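(* For every $\epsilon>0$ there is a polynomial-time algorithm with the following guarantee. Given an instance of School Bus Routing on a tree with regret bound $R\ge 0$, and a positive integer $k$ such that there exists a collection of $k$ paths, each starting at the depot and of regret at most $R$, that together cover all clients, the algorithm finds a collection of $k$ paths, each starting at the depot and of regret at most $(1+\epsilon)R$, that together cover all clients.
   Context: School Bus Routing on a tree: the input is a tree $T=(V,E)$ rooted at a depot $r$, nonnegative edge lengths $\ell(u,v)$, a set of clients located at vertices of $T$, and a regret bound $R\ge0$; the goal is to find the minimum number of paths (walks in $T$) each starting at $r$ and each of regret at most $R$, such that every client lies on at least one path. The length $\ell(P)$ of a walk $P$ is the total length of the edges it traverses (with multiplicity), and the regret of a walk $P$ from $u$ to $v$ is $\ell(P)-d_T(u,v)$, where $d_T$ denotes shortest-path distance in $T$. The running time may depend arbitrarily on $\epsilon$ but is polynomial in the input size for each fixed $\epsilon$. *)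

theory Defs
  imports
    "Graph_Theory.Graph_Theory"
    "HOL-Computational_Algebra.Polynomial"
begin

section \<open>Trees, walks and regret\<close>

text \<open>
  Undirected graphs are symmetric digraphs without loops and parallel arcs (\<^locale>\<open>pair_graph\<close>).
  The library predicate \<^const>\<open>tree\<close> is not usable for them: it forbids every directed cycle, and
  traversing an edge back and forth is a directed cycle of length 2. Cycles of length at least 3
  of a symmetric digraph are exactly the cycles of the undirected graph.
\<close>

definition undirected_tree :: "'a pair_pre_digraph \<Rightarrow> bool" where
  "undirected_tree G \<longleftrightarrow>
     pair_graph G \<and> Digraph_Component.connected (with_proj G) \<and>
     \<not> (\<exists>p. pre_digraph.cycle (with_proj G) p \<and> 3 \<le> length p)"

text \<open>
  Walks are non-empty vertex lists (\<^const>\<open>vwalk\<close>); they may repeat vertices and edges.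
\<close>

definition walk_length :: "('a \<times> 'a) weight_fun \<Rightarrow> 'a vwalk \<Rightarrow> real" where
  "walk_length w P = wf_digraph.awalk_cost w (vwalk_arcs P)"

definition tree_dist :: "'a pair_pre_digraph \<Rightarrow> ('a \<times> 'a) weight_fun \<Rightarrow> 'a \<Rightarrow> 'a \<Rightarrow> real" where
  "tree_dist G w u v = real_of_ereal (wf_digraph.\<mu> (with_proj G) w u v)"

definition regret :: "'a pair_pre_digraph \<Rightarrow> ('a \<times> 'a) weight_fun \<Rightarrow> 'a vwalk \<Rightarrow> real" where
  "regret G w P = walk_length w P - tree_dist G w (hd P) (last P)"

text \<open>
  A collection of paths is a list, so that a path may be used more than once.
\<close>

definition bus_routes ::
    "'a pair_pre_digraph \<Rightarrow> ('a \<times> 'a) weight_fun \<Rightarrow> 'a \<Rightarrow> 'a set \<Rightarrow> real \<Rightarrow> 'a vwalk list \<Rightarrow> bool"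
  where
  "bus_routes G w r C B Ps \<longleftrightarrow>
     (\<forall>P\<in>set Ps. vwalk P (with_proj G) \<and> hd P = r \<and> regret G w P \<le> B) \<and>
     (\<forall>c\<in>C. \<exists>P\<in>set Ps. c \<in> set P)"


section \<open>Instances\<close>

text \<open>
  Vertices are named by natural numbers. Each undirected edge occurs once in the edge list, in
  either orientation, together with its length.
\<close>

record sbr =
  vertex_list :: "nat list"
  edge_list :: "(nat \<times> nat \<times> rat) list"
  depot :: nat
  client_list :: "nat list"
  regret_bound :: rat

definition sbr_tree :: "sbr \<Rightarrow> nat pair_pre_digraph" where
  "sbr_tree I =
     \<lparr> pverts = set (vertex_list I),
       parcs = {(u, v). \<exists>l. (u, v, l) \<in> set (edge_list I) \<or> (v, u, l) \<in> set (edge_list I)} \<rparr>"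

definition edge_length :: "sbr \<Rightarrow> (nat \<times> nat) weight_fun" where
  "edge_length I =
     (\<lambda>(u, v). of_rat (THE l. (u, v, l) \<in> set (edge_list I) \<or> (v, u, l) \<in> set (edge_list I)))"

definition valid_sbr :: "sbr \<Rightarrow> bool" where
  "valid_sbr I \<longleftrightarrow>
     distinct (vertex_list I) \<and>
     distinct (map (\<lambda>(u, v, l). {u, v}) (edge_list I)) \<and>
     undirected_tree (sbr_tree I) \<and>
     (\<forall>(u, v, l)\<in>set (edge_list I). 0 \<le> l) \<and>
     depot I \<in> set (vertex_list I) \<and>
     set (client_list I) \<subseteq> set (vertex_list I) \<and>
     0 \<le> regret_bound I"

definition sbr_routes :: "sbr \<Rightarrow> real \<Rightarrow> nat vwalk list \<Rightarrow> bool" where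
  "sbr_routes I B Ps \<longleftrightarrow>
     bus_routes (sbr_tree I) (edge_length I) (depot I) (set (client_list I)) B Ps"


section \<open>Computation model\<close>

text \<open>
  Programs compute on binary trees (S-expressions with a single atom). They are the closure of
  the elementary tree operations under Backus' combining forms: composition, construction,
  condition and iteration. Each evaluation step costs one plus the size of the argument it is
  applied to (and of the constant it writes); see \<open>exec_size_le\<close> for the consequence that every
  value occurring in a computation is no larger than the time it takes. A Turing machine
  therefore simulates a program with polynomial overhead, and conversely, so that polynomial time
  has its usual meaning.
\<close>

datatype btree = Leaf | Node btree btree

datatype program =
    Ident
  | Const btree
  | Left
  | Right
  | Comp program program
  | Construct program program
  | Cond program program program
  | While program program

fun left :: "btree \<Rightarrow> btree" where
  "left Leaf = Leaf"
| "left (Node a b) = a"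

fun right :: "btree \<Rightarrow> btree" where
  "right Leaf = Leaf"
| "right (Node a b) = b"

text \<open>
  \<open>exec p x y t\<close>: on input \<open>x\<close> the program \<open>p\<close> halts with output \<open>y\<close> at cost \<open>t\<close>. As a truth
  value, \<^term>\<open>Leaf\<close> is false and everything else is true.
\<close>

inductive exec :: "program \<Rightarrow> btree \<Rightarrow> btree \<Rightarrow> nat \<Rightarrow> bool" where
  Ident: "exec Ident x x (Suc (size x))"
| Const: "exec (Const d) x d (Suc (size x + size d))"
| Left: "exec Left x (left x) (Suc (size x))"
| Right: "exec Right x (right x) (Suc (size x))"
| Comp: "exec g x y t \<Longrightarrow> exec f y z t' \<Longrightarrow> exec (Comp f g) x z (Suc (size x) + t + t')"
| Construct: "exec f x y t \<Longrightarrow> exec g x z t' \<Longrightarrow>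
    exec (Construct f g) x (Node y z) (Suc (size x) + t + t')"
| Cond_true: "exec c x b t \<Longrightarrow> b \<noteq> Leaf \<Longrightarrow> exec f x y t' \<Longrightarrow>
    exec (Cond c f g) x y (Suc (size x) + t + t')"
| Cond_false: "exec c x Leaf t \<Longrightarrow> exec g x y t' \<Longrightarrow>
    exec (Cond c f g) x y (Suc (size x) + t + t')"
| While_true: "exec c x b t \<Longrightarrow> b \<noteq> Leaf \<Longrightarrow> exec f x y t' \<Longrightarrow> exec (While c f) y z t'' \<Longrightarrow>
    exec (While c f) x z (Suc (size x) + t + t' + t'')"
| While_false: "exec c x Leaf t \<Longrightarrow> exec (While c f) x x (Suc (size x) + t)"

inductive_cases exec_elims:
  "exec Ident x y t" "exec (Const d) x y t" "exec Left x y t" "exec Right x y t"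
  "exec (Comp f g) x y t" "exec (Construct f g) x y t" "exec (Cond c f g) x y t"
  "exec (While c f) x y t"

lemma exec_deterministic:
  assumes "exec p x y t" and "exec p x y' t'"
  shows "y = y' \<and> t = t'"
  using assms
proof (induction arbitrary: y' t' rule: exec.induct)
  case Ident from Ident.prems show ?case by (rule exec_elims(1)) (auto)
next
  case Const from Const.prems show ?case by (rule exec_elims(2)) (auto)
next
  case Left from Left.prems show ?case by (rule exec_elims(3)) (auto)
next
  case Right from Right.prems show ?case by (rule exec_elims(4)) (auto)
next
  case Comp from Comp.prems show ?case by (rule exec_elims(5)) (auto dest!: Comp.IH)
next
  case Construct from Construct.prems show ?case by (rule exec_elims(6)) (auto dest!: Construct.IH)
next
  case Cond_true from Cond_true.prems show ?case by (rule exec_elims(7)) (auto dest!: Cond_true.IH simp: Cond_true.hyps)+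
next
  case Cond_false from Cond_false.prems show ?case by (rule exec_elims(7)) (auto dest!: Cond_false.IH simp: Cond_false.hyps)+
next
  case While_true from While_true.prems show ?case by (rule exec_elims(8)) (auto dest!: While_true.IH simp: While_true.hyps)+
next
  case While_false from While_false.prems show ?case by (rule exec_elims(8)) (auto dest!: While_false.IH simp: While_false.hyps)+
qed

lemma exec_size_le: "exec p x y t \<Longrightarrow> size x \<le> t \<and> size y \<le> t"
proof (induction rule: exec.induct)
  case (Left x) show ?case by (cases x) auto
next
  case (Right x) show ?case by (cases x) auto
qed auto

definition polynomial_time_on :: "program \<Rightarrow> btree set \<Rightarrow> bool" where
  "polynomial_time_on p X \<longleftrightarrow>
     (\<exists>q :: nat poly. \<forall>x\<in>X. \<exists>y t. exec p x y t \<and> t \<le> poly q (size x))"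

definition outputs :: "program \<Rightarrow> btree \<Rightarrow> btree \<Rightarrow> bool" where
  "outputs p x y \<longleftrightarrow> (\<exists>t. exec p x y t)"


section \<open>Encoding of inputs and outputs\<close>

text \<open>
  Numbers are written in binary, least significant bit first, rationals as numerator and
  denominator in lowest terms (only nonnegative rationals occur in valid instances).
\<close>

fun enc_nat :: "nat \<Rightarrow> btree" where
  "enc_nat n =
     (if n = 0 then Leaf
      else Node (if odd n then Node Leaf Leaf else Leaf) (enc_nat (n div 2)))"

declare enc_nat.simps [simp del]

definition enc_list :: "('a \<Rightarrow> btree) \<Rightarrow> 'a list \<Rightarrow> btree" where
  "enc_list f xs = foldr (\<lambda>x. Node (f x)) xs Leaf"

definition enc_rat :: "rat \<Rightarrow> btree" where
  "enc_rat q = (case quotient_of q of (a, b) \<Rightarrow> Node (enc_nat (nat a)) (enc_nat (nat b)))"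

definition enc_edge :: "nat \<times> nat \<times> rat \<Rightarrow> btree" where
  "enc_edge = (\<lambda>(u, v, l). Node (enc_nat u) (Node (enc_nat v) (enc_rat l)))"

definition enc_sbr :: "sbr \<Rightarrow> btree" where
  "enc_sbr I =
     Node (enc_list enc_nat (vertex_list I))
    (Node (enc_list enc_edge (edge_list I))
    (Node (enc_nat (depot I))
    (Node (enc_list enc_nat (client_list I))
          (enc_rat (regret_bound I)))))"

text \<open>
  The number \<open>k\<close> of paths is part of the input in unary: the output lists \<open>k\<close> paths explicitly,
  which takes time at least \<open>k\<close>.
\<close>

definition enc_input :: "sbr \<Rightarrow> nat \<Rightarrow> btree" where
  "enc_input I k = Node (enc_sbr I) (enc_list (\<lambda>_. Leaf) [0..<k])"

definition enc_routes :: "nat vwalk list \<Rightarrow> btree" where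
  "enc_routes = enc_list (enc_list enc_nat)"

lemma inj_enc_list: "inj f \<Longrightarrow> inj (enc_list f)"
proof (rule injI)
  fix xs ys assume "inj f" "enc_list f xs = enc_list f ys"
  then show "xs = ys"
  proof (induction xs arbitrary: ys)
    case Nil then show ?case by (cases ys) (auto simp: enc_list_def)
  next
    case (Cons x xs) then show ?case by (cases ys) (auto simp: enc_list_def dest: injD)
  qed
qed

lemma enc_nat_0: "enc_nat 0 = Leaf"
  by (subst enc_nat.simps) simp

lemma enc_nat_pos:
  "n > 0 \<Longrightarrow> enc_nat n = Node (if odd n then Node Leaf Leaf else Leaf) (enc_nat (n div 2))"
  by (subst enc_nat.simps) simp

lemma inj_enc_nat: "inj enc_nat"
proof (rule injI)
  fix m n assume "enc_nat m = enc_nat n"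
  then show "m = n"
  proof (induction m arbitrary: n rule: less_induct)
    case (less m)
    show ?case
    proof (cases "m = 0 \<or> n = 0")
      case True
      with less.prems show ?thesis
        using enc_nat_0 enc_nat_pos[of m] enc_nat_pos[of n] by (cases "m = 0"; cases "n = 0") auto
    next
      case False
      with less.prems have "odd m = odd n" and half: "enc_nat (m div 2) = enc_nat (n div 2)"
        using enc_nat_pos[of m] enc_nat_pos[of n] by (auto split: if_splits)
      moreover have "m div 2 = n div 2"
        using False half by (intro less.IH) auto
      ultimately show ?thesis
        by (metis dvd_mult_div_cancel odd_two_times_div_two_succ)
    qed
  qed
qed

lemma inj_enc_routes: "inj enc_routes"
  by (simp add: enc_routes_def inj_enc_list inj_enc_nat)

end

theory Submission
  imports Defs "HOL-Library.Multiset" "HOL-Library.FuncSet"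
begin

text \<open>
  Call the edges visited by a route, except those on the path from the depot to its last vertex, its
  detour. A walk from the root that visits the edge set \<open>S\<close> and ends at \<open>v\<close> has length at least twice
  the length of \<open>S\<close> minus the depth of \<open>v\<close>; hence a route of regret at most \<open>R\<close> has a detour of length
  at most \<open>R/2\<close>, and conversely a detour of that length suffices. Edge lengths are rounded up to units of
  \<open>R/(2nK)\<close>, where \<open>n\<close> exceeds the number of vertices and \<open>K\<close> depends only on \<open>\<epsilon>\<close>.

  A dynamic program sweeps the tree from the leaves to the depot. Its states are multisets of tokens, i.e.
  of fragments of routes inside a subtree together with the length of their detour. Fragments are merged
  where they meet, and all but six sizes are kept on a lattice of \<open>O(K)\<close> points, so that there are
  polynomially many states. For closed fragments, which pay for the edge to the parent, the lattice is
  shifted by the depth of the vertex; so moving upwards causes no rounding error.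

  An optimal solution survives this restriction at the cost of an \<open>O(\<epsilon>)\<close> fraction of \<open>R\<close>. A bus
  has a token of its own at a vertex only if it ends below or its detour below is at least a small
  constant fraction of \<open>R\<close>; therefore each bus merges tokens of its own only \<open>O(1)\<close> times, and it can pay
  for a bounded number of roundings each time. The detours of the other buses are pooled regardless of
  their owners, and a pool that has become heavy enough is closed and has to be carried by one
  of the buses that own a part of it. Who carries which pool is decided at the root by
  rounding the fractional assignment given by the ownership, which overloads a bus by at most one pool.
\<close>

text \<open>Five scales, each \<open>m\<close> times the one before, with \<open>m\<close> about
  \<open>100 / \<epsilon>\<close>, keep the errors apart. A rounding costs up to \<open>n\<close>. A
  closed pool weighs at least \<open>sg = n m\<close>, so the roundings it causes are an O(1/m) part
  of it. A bus gets a token of its own after a detour of \<open>gam = n m^2\<close>; hence it has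
  about \<open>m^2\<close> leaves, and the \<open>sg\<close> paid per forced closing add up to
  O(\<open>n m^3\<close>). A pool is normally closed at weight \<open>tau = n m^3\<close>. The
  reserve \<open>gam\<close> for lifting it until its carrier has a token is a 1/m part of it, and
  one pool too many per bus is a 1/m part of the budget \<open>n m^4\<close>. The carrier of a pool
  cannot be fixed when the pool is closed, because a fair choice depends on all pools of the tree.
  The induction therefore proves derivability for every choice among the owners at once. This also
  explains why the group must be closed, however light it is, before two trunks meet: its carrier is
  arbitrary in the united trunk, but the tokens already derived tie it to one side.\<close>

type_synonym tok = "bool \<times> nat"

section \<open>Token multisets\<close>

text \<open>A token \<open>(p, a)\<close> at a vertex \<open>v\<close> stands for a fragment of a route inside the subtree of \<open>v\<close> that starts at \<open>v\<close>
  with a detour of at most \<open>a\<close> units. It ends the route if \<open>p\<close> holds, and returns to \<open>v\<close> otherwise.\<close>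

datatype dp_term = Base nat | Start dp_term | Up nat nat dp_term | Join dp_term dp_term

primrec troot :: "dp_term \<Rightarrow> nat" where
  "troot (Base v) = v"
| "troot (Start t) = troot t"
| "troot (Up u l t) = u"
| "troot (Join t t') = troot t"

locale dp =
  fixes n Nm Hm :: nat and dep :: "nat \<Rightarrow> nat" and Cl :: "nat set"
  assumes n_pos: "n > 0" and Nm_pos: "Nm > 0"
begin

definition on_lattice :: "nat \<Rightarrow> tok \<Rightarrow> bool" where
  "on_lattice d t \<longleftrightarrow> (snd t + (if fst t then 0 else d)) mod n = 0"

definition off_lattice :: "nat \<Rightarrow> tok multiset \<Rightarrow> nat" where
  "off_lattice d M = size (filter_mset (\<lambda>t. \<not> on_lattice d t) M)"

text \<open>At a join up to four tokens can be off the lattice: an open pool and a group carrier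
  from each side. The bound 6 leaves room for the token that is being merged or rounded.\<close>

definition adm :: "nat \<Rightarrow> tok multiset \<Rightarrow> bool" where
  "adm d M \<longleftrightarrow> size M \<le> Nm \<and> (\<forall>t\<in>#M. snd t \<le> Hm) \<and> off_lattice d M \<le> 6"

text \<open>The least size of a closed token on the lattice at depth \<open>d\<close>. A fragment
  that merely waits at the vertex is started with this size rather than 0, so that it does not leave
  the lattice.\<close>

definition idl :: "nat \<Rightarrow> nat" where
  "idl d = (n - d mod n) mod n"

definition lift :: "nat \<Rightarrow> tok \<Rightarrow> tok" where
  "lift l t = (fst t, if fst t then snd t else snd t + l)"

text \<open>Every rule except \<open>Base\<close> demands admissibility of its result, even after a
  single merge or unit increase. So the algorithm may discard inadmissible states at once, and the
  lemmas below have to keep all intermediate multisets within the bounds.\<close>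

inductive der :: "dp_term \<Rightarrow> tok multiset \<Rightarrow> bool" where
  Base: "der (Base v) (if v \<in> Cl then {#(False, 0)#} else {#})"
| Start: "der t M \<Longrightarrow> adm (dep (troot t)) (M + replicate_mset p (True, 0) + replicate_mset q (False, idl (dep (troot t)))) \<Longrightarrow>
    der (Start t) (M + replicate_mset p (True, 0) + replicate_mset q (False, idl (dep (troot t))))"
| Up: "der t M \<Longrightarrow> adm (dep u) (image_mset (lift l) M) \<Longrightarrow> der (Up u l t) (image_mset (lift l) M)"
| Join: "der t M \<Longrightarrow> der t' M' \<Longrightarrow> adm (dep (troot t)) (M + M') \<Longrightarrow> der (Join t t') (M + M')"
| merge: "der t (add_mset x (add_mset y M)) \<Longrightarrow> \<not> fst y \<Longrightarrow>
    adm (dep (troot t)) (add_mset (fst x, snd x + snd y) M) \<Longrightarrow> der t (add_mset (fst x, snd x + snd y) M)"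
| inc: "der t (add_mset x M) \<Longrightarrow> adm (dep (troot t)) (add_mset (fst x, Suc (snd x)) M) \<Longrightarrow>
    der t (add_mset (fst x, Suc (snd x)) M)"

lemma off_lattice_union [simp]: "off_lattice d (A + B) = off_lattice d A + off_lattice d B"
  by (simp add: off_lattice_def)

lemma off_lattice_empty [simp]: "off_lattice d {#} = 0"
  by (simp add: off_lattice_def)

lemma off_lattice_add_mset: "off_lattice d (add_mset x M) = (if on_lattice d x then 0 else 1) + off_lattice d M"
  by (simp add: off_lattice_def)

lemma off_lattice_sum: "off_lattice d (\<Sum>i<(k::nat). W i) = (\<Sum>i<k. off_lattice d (W i))"
  by (induction k) auto

lemma size_sum_mset: "size (\<Sum>i<(k::nat). W i) = (\<Sum>i<k. size (W i :: tok multiset))"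
  by (induction k) auto

lemma der_adm: "der t M \<Longrightarrow> adm (dep (troot t)) M"
proof (induction rule: der.induct)
  case (Base v)
  have "off_lattice d {#(False, 0)#} \<le> 6" for d by (simp add: off_lattice_add_mset)
  then show ?case using Nm_pos by (simp add: adm_def)
qed simp_all

lemma on_lattice_idl: "on_lattice d (False, idl d)"
proof -
  have "(idl d + d) mod n = ((n - d mod n) + d mod n) mod n"
    by (simp add: idl_def mod_simps)
  also have "\<dots> = 0" using n_pos by (simp add: less_imp_le)
  finally show ?thesis by (simp add: on_lattice_def)
qed

lemma idl_less: "idl d < n"
  using n_pos by (simp add: idl_def)

lemma ex_round: "\<exists>a'\<ge>a. a' < a + n \<and> on_lattice d (p, a')"
proof -
  let ?o = "a + (if p then 0 else d)"
  have "(a + idl ?o + (if p then 0 else d)) mod n = (idl ?o + ?o) mod n"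
    by (cases p) (simp_all add: ac_simps)
  also have "\<dots> = 0" using on_lattice_idl[of ?o] by (simp add: on_lattice_def)
  finally show ?thesis using idl_less by (intro exI[of _ "a + idl ?o"]) (auto simp: on_lattice_def)
qed

text \<open>The growing token can be off the lattice after each merge, which is why the others are
  restricted to 5 instead of 6.\<close>

lemma merge_all:
  assumes "der t (add_mset x (Y + R))" and "\<forall>y\<in>#Y. \<not> fst y"
    and "snd x + (\<Sum>y\<in>#Y. snd y) \<le> Hm" and "off_lattice (dep (troot t)) (Y + R) \<le> 5"
  shows "der t (add_mset (fst x, snd x + (\<Sum>y\<in>#Y. snd y)) R)"
  using assms
proof (induction Y arbitrary: x)
  case empty
  then show ?case by simp
next
  case (add y Y)
  let ?x = "(fst x, snd x + snd y)"
  have a: "adm (dep (troot t)) (add_mset x (add_mset y (Y + R)))"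
    using der_adm[OF add.prems(1)] by simp
  have "off_lattice (dep (troot t)) (Y + R) \<le> 5" using add.prems(4) by (simp add: off_lattice_add_mset)
  then have "adm (dep (troot t)) (add_mset ?x (Y + R))"
    using a add.prems(3) by (auto simp: adm_def off_lattice_add_mset)
  then have "der t (add_mset ?x (Y + R))"
    using add.prems by (intro der.merge) (auto simp: add_mset_commute)
  from add.IH[OF this] add.prems show ?case by (auto simp: off_lattice_add_mset add.assoc split: if_splits)
qed

lemma raise_size:
  assumes "der t (add_mset (p, a) R)" and "a \<le> a'" and "a' \<le> Hm" and "off_lattice (dep (troot t)) R \<le> 5"
  shows "der t (add_mset (p, a') R)"
  using assms(2,3)
proof (induction a' rule: dec_induct)
  case base
  then show ?case using assms(1) by simp
next
  case (step m)
  then have d: "der t (add_mset (p, m) R)" by simp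
  have "adm (dep (troot t)) (add_mset (p, Suc m) R)"
    using der_adm[OF d] assms(4) step by (auto simp: adm_def off_lattice_add_mset)
  then show ?case using der.inc[OF d] by simp
qed

lemma round_up:
  assumes "der t (add_mset (p, a) R)" and "a + n \<le> Hm" and "off_lattice (dep (troot t)) R \<le> 5"
  shows "\<exists>a'. der t (add_mset (p, a') R) \<and> on_lattice (dep (troot t)) (p, a') \<and> a' < a + n"
proof -
  obtain a' where "a' \<ge> a" "a' < a + n" "on_lattice (dep (troot t)) (p, a')" using ex_round by blast
  then show ?thesis using raise_size[OF assms(1), of a'] assms by auto
qed

text \<open>The second partner of a merge must be closed; so an ending token, if there is one, has
  to absorb the others.\<close>

lemma pick_absorber:
  assumes "Y \<noteq> {#}" and "size (filter_mset fst Y) \<le> 1"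
  shows "\<exists>x Y'. Y = add_mset x Y' \<and> (\<forall>y\<in>#Y'. \<not> fst y) \<and> (fst x \<longleftrightarrow> (\<exists>y\<in>#Y. fst y))"
proof (cases "\<exists>y\<in>#Y. fst y")
  case True
  then obtain x Y' where x: "Y = add_mset x Y'" "fst x" by (metis mset_add)
  then have "set_mset (filter_mset fst Y') = {}" using assms by simp
  then have "\<forall>y\<in>#Y'. \<not> fst y" by auto
  moreover have "fst x \<longleftrightarrow> (\<exists>y\<in>#Y. fst y)" using x(2) True by simp
  ultimately show ?thesis using x(1) by (intro exI conjI) assumption+
next
  case False
  obtain x Y' where "Y = add_mset x Y'" using assms(1) by (metis multiset_cases)
  moreover have "\<forall>y\<in>#Y'. \<not> fst y" "\<not> fst x" using False calculation by auto
  ultimately show ?thesis using False by (intro exI[of _ x] exI[of _ Y']) simp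
qed

lemma merge_set:
  assumes "der t (Y + R)" and "Y \<noteq> {#}" and "size (filter_mset fst Y) \<le> 1"
    and "(\<Sum>y\<in>#Y. snd y) \<le> Hm" and "off_lattice (dep (troot t)) (Y + R) \<le> 5"
  shows "der t (add_mset (\<exists>y\<in>#Y. fst y, \<Sum>y\<in>#Y. snd y) R)"
proof -
  obtain x Y' where x: "Y = add_mset x Y'" "\<forall>y\<in>#Y'. \<not> fst y" and p: "(\<exists>y\<in>#Y. fst y) = fst x"
    using pick_absorber[OF assms(2,3)] by metis
  have d: "der t (add_mset x (Y' + R))" using assms(1) x by simp
  have "off_lattice (dep (troot t)) (Y' + R) \<le> 5" using assms(5) x(1) by (simp add: off_lattice_add_mset)
  moreover have "snd x + (\<Sum>y\<in>#Y'. snd y) = (\<Sum>y\<in>#Y. snd y)" using x(1) by simp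
  ultimately show ?thesis using merge_all[OF d x(2)] assms(4) p by simp
qed

text \<open>The buses are treated one after another, each time with the tokens of all others as the
  untouched rest. As no treatment raises the number of tokens off the lattice, the bound
  \<open>N\<close> is available for every bus.\<close>

lemma der_family:
  assumes "der t ((\<Sum>i<k. Y i) + R)"
    and "\<And>i R'. i < (k::nat) \<Longrightarrow> der t (Y i + R') \<Longrightarrow> off_lattice d (Y i + R') \<le> N \<Longrightarrow>
       \<exists>W. Q i W \<and> der t (W + R') \<and> off_lattice d W \<le> off_lattice d (Y i)"
    and "off_lattice d ((\<Sum>i<k. Y i) + R) \<le> N"
  shows "\<exists>W. (\<forall>i<k. Q i (W i)) \<and> der t ((\<Sum>i<k. W i) + R) \<and> off_lattice d (\<Sum>i<k. W i) \<le> off_lattice d (\<Sum>i<k. Y i)"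
  using assms
proof (induction k arbitrary: R)
  case 0
  then show ?case by simp
next
  case (Suc k)
  have "\<exists>W. (\<forall>i<k. Q i (W i)) \<and> der t ((\<Sum>i<k. W i) + (Y k + R)) \<and> off_lattice d (\<Sum>i<k. W i) \<le> off_lattice d (\<Sum>i<k. Y i)"
    using Suc.prems by (intro Suc.IH) (auto simp: add.assoc)
  then obtain W where W: "\<forall>i<k. Q i (W i)" "der t ((\<Sum>i<k. W i) + (Y k + R))"
    "off_lattice d (\<Sum>i<k. W i) \<le> off_lattice d (\<Sum>i<k. Y i)" by blast
  have "\<exists>V. Q k V \<and> der t (V + ((\<Sum>i<k. W i) + R)) \<and> off_lattice d V \<le> off_lattice d (Y k)"
    using Suc.prems(3) W by (intro Suc.prems(2)) (auto simp: ac_simps)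
  then obtain V where V: "Q k V" "der t (V + ((\<Sum>i<k. W i) + R))" "off_lattice d V \<le> off_lattice d (Y k)" by blast
  have s: "(\<Sum>i<k. (W(k := V)) i) = (\<Sum>i<k. W i)" by (intro sum.cong) auto
  have "der t ((\<Sum>i<Suc k. (W(k := V)) i) + R)"
    using V(2) s by (simp add: ac_simps)
  moreover have "\<forall>i<Suc k. Q i ((W(k := V)) i)" using W(1) V(1) by (simp add: less_Suc_eq)
  moreover have "off_lattice d (\<Sum>i<Suc k. (W(k := V)) i) \<le> off_lattice d (\<Sum>i<Suc k. Y i)"
    using s V(3) W(3) by simp
  ultimately show ?case by blast
qed

end

section \<open>Skeletons of a solution\<close>

text \<open>A skeleton describes what the buses of an optimal solution do inside a subtree. The \<open>trunk\<close> buses have a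
  token of their own; the \<open>pending\<close> ones have been there, but with a detour less than \<open>gam\<close>. The buses in
  \<open>ending\<close> end in the subtree, \<open>spent\<close> is the detour of a bus, and \<open>own\<close> is the part of it paid by its own token.
  An item \<open>(w, o)\<close> is a pool of weight \<open>w\<close>, of which bus \<open>i\<close> owns \<open>o i\<close>. At most one pool is open (\<open>has_open\<close>,
  \<open>open_size\<close>, \<open>open_share\<close>), and a further one, the group, is carried by an arbitrary trunk bus (\<open>group_size\<close>,
  \<open>group_share\<close>). Each of the \<open>leaves\<close> of the trunk of a bus entitles it to two units of \<open>credit\<close>, and a unit pays
  for an increase of \<open>sg\<close>.\<close>

record skeleton =
  trunk :: "nat set"
  pending :: "nat set"
  ending :: "nat set"
  spent :: "nat \<Rightarrow> nat"
  own :: "nat \<Rightarrow> nat"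
  leaves :: "nat \<Rightarrow> nat"
  credit :: "nat \<Rightarrow> nat"
  items :: "(nat \<times> (nat \<Rightarrow> nat)) list"
  has_open :: bool
  open_size :: nat
  open_share :: "nat \<Rightarrow> nat"
  group_size :: nat
  group_share :: "nat \<Rightarrow> nat"

definition load :: "(nat \<times> (nat \<Rightarrow> nat)) list \<Rightarrow> nat list \<Rightarrow> nat \<Rightarrow> nat" where
  "load I hs i = (\<Sum>z\<leftarrow>zip I hs. if snd z = i then fst (fst z) else 0)"

definition osum :: "(nat \<times> (nat \<Rightarrow> nat)) list \<Rightarrow> nat \<Rightarrow> nat" where
  "osum I i = (\<Sum>it\<leftarrow>I. snd it i)"

text \<open>A carrier owns a part of its item. It is therefore a bus that has been in the subtree
  where the item was collected.\<close>

definition hosts :: "(nat \<times> (nat \<Rightarrow> nat)) list \<Rightarrow> nat list \<Rightarrow> bool" where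
  "hosts I hs \<longleftrightarrow> length hs = length I \<and> (\<forall>z\<in>set (zip I hs). snd (fst z) (snd z) > 0)"

lemma load_append: "length hs = length I \<Longrightarrow> load (I @ I') (hs @ hs') i = load I hs i + load I' hs' i"
  by (simp add: load_def)

lemma load_single: "load [it] [h] i = (if h = i then fst it else 0)"
  by (simp add: load_def)

lemma osum_append [simp]: "osum (I @ I') i = osum I i + osum I' i"
  by (simp add: osum_def)

lemma osum_single [simp]: "osum [it] i = snd it i"
  by (simp add: osum_def)

lemma hosts_append:
  assumes "hosts (I @ I') hs"
  obtains hs1 hs2 where "hs = hs1 @ hs2" "hosts I hs1" "hosts I' hs2"
proof (rule that)
  show "hs = take (length I) hs @ drop (length I) hs" by simp
  have l: "length hs = length I + length I'" using assms by (simp add: hosts_def)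
  have "zip (I @ I') (take (length I) hs @ drop (length I) hs)
      = zip I (take (length I) hs) @ zip I' (drop (length I) hs)"
    using l by (subst zip_append) auto
  then have z: "zip (I @ I') hs = zip I (take (length I) hs) @ zip I' (drop (length I) hs)" by simp
  have a: "\<forall>z\<in>set (zip I (take (length I) hs)) \<union> set (zip I' (drop (length I) hs)). snd (fst z) (snd z) > 0"
    using assms unfolding hosts_def z by simp
  show "hosts I (take (length I) hs)" "hosts I' (drop (length I) hs)"
    unfolding hosts_def using a l by (simp_all add: ball_Un)
qed

lemma hosts_snoc:
  assumes "hosts (I @ [it]) hs"
  obtains hs0 h0 where "hs = hs0 @ [h0]" "hosts I hs0" "snd it h0 > 0"
proof -
  obtain hs1 hs2 where h: "hs = hs1 @ hs2" "hosts I hs1" "hosts [it] hs2"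
    using hosts_append[OF assms] by blast
  then obtain h0 where "hs2 = [h0]" by (auto simp: hosts_def length_Suc_conv)
  then show thesis using h that[of hs1 h0] by (simp add: hosts_def)
qed

lemma hosts_count:
  assumes "hosts I hs" and "\<forall>it\<in>set I. snd it i = 0"
  shows "count_list hs i = 0"
proof -
  have "i \<notin> set hs"
  proof
    assume "i \<in> set hs"
    then obtain p where "p < length hs" "hs ! p = i" by (metis in_set_conv_nth)
    then have "(I ! p, i) \<in> set (zip I hs)" "I ! p \<in> set I"
      using assms(1) by (auto simp: hosts_def in_set_zip)
    then show False using assms by (force simp: hosts_def)
  qed
  then show ?thesis by (simp add: count_list_0_iff)
qed

lemma sum_count_list: "(\<Sum>i<(k::nat). count_list hs i) \<le> length hs"
proof (induction hs)
  case (Cons h hs)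
  have "(\<Sum>i<k. count_list (h # hs) i) = (\<Sum>i<k. (if h = i then 1 else 0) + count_list hs i)"
    by (intro sum.cong) auto
  also have "\<dots> = (\<Sum>i<k. if h = i then 1 else 0) + (\<Sum>i<k. count_list hs i)"
    by (rule sum.distrib)
  also have "(\<Sum>i<k. if h = i then 1 else 0) \<le> (1::nat)" by (simp add: sum.delta)
  finally show ?case using Cons by simp
qed simp

lemma sum_insert_at:
  fixes W :: "nat \<Rightarrow> 'a multiset"
  assumes "h < (k::nat)"
  obtains R0 where "\<And>V. (\<Sum>i<k. (W(h := V)) i) = V + R0"
proof (rule that)
  fix V
  have "(\<Sum>i<k. (W(h := V)) i) = (W(h := V)) h + (\<Sum>i\<in>{..<k} - {h}. (W(h := V)) i)"
    using assms by (subst sum.remove[of _ h]) auto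
  also have "(\<Sum>i\<in>{..<k} - {h}. (W(h := V)) i) = (\<Sum>i\<in>{..<k} - {h}. W i)"
    by (intro sum.cong) auto
  finally show "(\<Sum>i<k. (W(h := V)) i) = V + (\<Sum>i\<in>{..<k} - {h}. W i)" by simp
qed

locale skeletons = dp +
  fixes k tau gam sg :: nat
  assumes gam_tau: "gam \<le> tau" and sg_tau: "sg \<le> tau" and tau_pos: "tau > 0"
begin

text \<open>Beyond its own detour and its items, the token of a bus is granted \<open>2 * n\<close>
  per trunk leaf and \<open>3 * n\<close> per carried item for roundings.\<close>

definition bnd :: "skeleton \<Rightarrow> nat list \<Rightarrow> nat \<Rightarrow> nat" where
  "bnd S hs i = own S i + load (items S) hs i + n * (2 * leaves S i + 3 * count_list hs i)"

text \<open>The margin covers what a token may hold beyond \<open>bnd\<close> for a while: the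
  group, an open pool and unfinished roundings. The last condition makes room for the multisets
  before merging at a join or a release, with two tokens per bus, one per item, and the open
  pools.\<close>

definition good :: "skeleton \<Rightarrow> nat list \<Rightarrow> bool" where
  "good S hs \<longleftrightarrow> (\<forall>i<k. bnd S hs i + (4 * tau + 4 * n) \<le> Hm) \<and> 4 * tau + 4 * n \<le> Hm \<and>
    3 * k + length hs + 4 \<le> Nm"

text \<open>A trunk token stays \<open>n\<close> below its allowance. When the tokens of a bus from
  two subtrees meet, two such reserves come together; one pays for the rounding, the other is kept.
  A pending bus has only the tokens of its items. The weight of each of these items includes a
  reserve \<open>gam\<close>. At most \<open>min (spent S i) gam\<close> of it has been used for
  climbing, because the token and the detour of the bus grow by the same edges.\<close>

definition busok :: "nat \<Rightarrow> skeleton \<Rightarrow> nat list \<Rightarrow> nat \<Rightarrow> nat \<Rightarrow> tok multiset \<Rightarrow> bool" where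
  "busok d S hs h i W \<longleftrightarrow>
    (if i \<in> trunk S then \<exists>a. W = {#(i \<in> ending S, a)#} \<and> a + n \<le> bnd S hs i + (if i = h then group_size S else 0) \<and>
        (i \<noteq> h \<or> group_size S = 0 \<longrightarrow> on_lattice d (i \<in> ending S, a))
     else if i \<in> pending S then (\<forall>y\<in>#W. \<not> fst y \<and> on_lattice d y) \<and> size W \<le> count_list hs i \<and>
        (\<Sum>y\<in>#W. snd y) + gam * count_list hs i \<le> load (items S) hs i + (min (spent S i) gam + n) * count_list hs i
     else W = {#})"

text \<open>The carriers \<open>hs\<close> of the items and the carrier \<open>h\<close> of the group are fixed only at the root; until then all
  choices must be derivable.\<close>

definition plan :: "dp_term \<Rightarrow> skeleton \<Rightarrow> bool" where
  "plan t S \<longleftrightarrow> (\<forall>hs h. hosts (items S) hs \<longrightarrow> good S hs \<longrightarrow> (trunk S \<noteq> {} \<longrightarrow> h \<in> trunk S) \<longrightarrow>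
    (\<exists>W vx. der t ((\<Sum>i<k. W i) + (if has_open S then {#(False, vx)#} else {#})) \<and> vx \<le> open_size S \<and>
      (\<forall>i<k. busok (dep (troot t)) S hs h i (W i))))"

text \<open>The weight of an item exceeds what its owners have paid by a factor of at most
  \<open>1 + gam / tau\<close>. The account of a bus balances its own token and all its shares
  against the detour it really makes, plus \<open>sg\<close> for each used unit of credit.\<close>

definition Inv0 :: "skeleton \<Rightarrow> bool" where
  "Inv0 S \<longleftrightarrow> trunk S \<union> pending S \<subseteq> {..<k} \<and> trunk S \<inter> pending S = {} \<and> ending S \<subseteq> trunk S \<and>
    (\<forall>i. i \<notin> trunk S \<longrightarrow> own S i = 0 \<and> leaves S i = 0 \<and> credit S i = 0 \<and> group_share S i = 0) \<and>
    (\<forall>i. i \<notin> trunk S \<union> pending S \<longrightarrow> open_share S i = 0) \<and>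
    (\<forall>it\<in>set (items S). (\<forall>i. i \<notin> trunk S \<union> pending S \<longrightarrow> snd it i = 0) \<and> sg \<le> fst it \<and> fst it \<le> 3 * tau + gam + sg \<and>
        fst it * tau \<le> (tau + gam) * (\<Sum>i<k. snd it i)) \<and>
    open_size S \<le> (\<Sum>i<k. open_share S i) \<and> open_size S < 2 * tau \<and> (\<not> has_open S \<longrightarrow> open_size S = 0) \<and>
    group_size S \<le> (\<Sum>i<k. group_share S i) \<and> group_size S < tau \<and>
    (\<forall>i<k. own S i + osum (items S) i + open_share S i + group_share S i \<le> spent S i + sg * credit S i) \<and>
    (\<forall>i. credit S i \<le> 2 * leaves S i)"

definition Inv :: "dp_term \<Rightarrow> skeleton \<Rightarrow> bool" where
  "Inv t S \<longleftrightarrow> Inv0 S \<and> plan t S"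

lemma off_lattice_busok:
  assumes "busok d S hs h i W"
  shows "off_lattice d W \<le> (if i = h \<and> group_size S > 0 then 1 else 0)"
proof -
  have "off_lattice d W = 0" if "\<forall>y\<in>#W. on_lattice d y"
    using that by (simp add: off_lattice_def filter_mset_eq_conv)
  then show ?thesis using assms by (auto simp: busok_def off_lattice_add_mset split: if_splits)
qed

lemma off_lattice_sum_busok:
  assumes "\<forall>i<k. busok d S hs h i (W i)"
  shows "off_lattice d (\<Sum>i<k. W i) \<le> (if group_size S > 0 then 1 else 0)"
proof -
  have "off_lattice d (\<Sum>i<k. W i) \<le> (\<Sum>i<k. if i = h \<and> group_size S > 0 then 1 else 0)"
    unfolding off_lattice_sum
  proof (rule sum_mono)
    fix i assume "i \<in> {..<k}"
    then show "off_lattice d (W i) \<le> (if i = h \<and> group_size S > 0 then 1 else 0)"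
      using off_lattice_busok assms by blast
  qed
  also have "\<dots> \<le> (\<Sum>i<k. if i = h then (if group_size S > 0 then 1 else 0) else 0)"
    by (intro sum_mono) auto
  also have "\<dots> \<le> (if group_size S > 0 then 1 else 0)" by (simp add: sum.delta)
  finally show ?thesis .
qed

lemma size_busok: "busok d S hs h i W \<Longrightarrow> size W \<le> 1 + count_list hs i"
  by (auto simp: busok_def split: if_splits)

lemma size_sum_busok:
  assumes "\<forall>i<k. busok d S hs h i (W i)"
  shows "size (\<Sum>i<k. W i) \<le> k + length hs"
proof -
  have "size (\<Sum>i<k. W i) \<le> (\<Sum>i<k. 1 + count_list hs i)"
    unfolding size_sum_mset
  proof (rule sum_mono)
    fix i assume "i \<in> {..<k}"
    then show "size (W i) \<le> 1 + count_list hs i" using size_busok assms by blast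
  qed
  also have "\<dots> = k + (\<Sum>i<k. count_list hs i)" by (simp add: sum_Suc)
  finally show ?thesis using sum_count_list[of hs k] by linarith
qed

lemma pend_sum:
  assumes "busok d S hs h i W" "i \<notin> trunk S"
  shows "(\<Sum>y\<in>#W. snd y) \<le> load (items S) hs i + n * count_list hs i" "\<forall>y\<in>#W. \<not> fst y \<and> on_lattice d y"
    "count_list hs i = 0 \<Longrightarrow> W = {#}"
proof -
  have m: "(min (spent S i) gam + n) * count_list hs i \<le> gam * count_list hs i + n * count_list hs i"
    by (simp add: add_mult_distrib)
  show "(\<Sum>y\<in>#W. snd y) \<le> load (items S) hs i + n * count_list hs i"
  proof (cases "i \<in> pending S")
    case True
    then have "(\<Sum>y\<in>#W. snd y) + gam * count_list hs i \<le> load (items S) hs i + (min (spent S i) gam + n) * count_list hs i"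
      using assms unfolding busok_def by simp
    then show ?thesis using m by linarith
  next
    case False
    then have "W = {#}" using assms unfolding busok_def by simp
    then show ?thesis by simp
  qed
  show "\<forall>y\<in>#W. \<not> fst y \<and> on_lattice d y" "count_list hs i = 0 \<Longrightarrow> W = {#}"
    using assms by (simp_all add: busok_def split: if_splits)
qed

lemma snd_le_sum: "y \<in># (W::tok multiset) \<Longrightarrow> snd y \<le> (\<Sum>y\<in>#W. snd y)"
  by (auto dest!: multi_member_split)

lemma busok_le:
  assumes "busok d S hs h i W" "good S hs" "group_size S < tau" "i < k" "y \<in># W"
  shows "snd y \<le> Hm"
proof (cases "i \<in> trunk S")
  case True
  have "bnd S hs i + (4 * tau + 4 * n) \<le> Hm" using assms by (simp add: good_def)
  then show ?thesis using True assms by (auto simp: busok_def split: if_splits)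
next
  case False
  have "snd y \<le> load (items S) hs i + n * count_list hs i"
    using snd_le_sum[OF assms(5)] pend_sum(1)[OF assms(1) False] by simp
  moreover have "bnd S hs i + (4 * tau + 4 * n) \<le> Hm" using assms by (simp add: good_def)
  ultimately show ?thesis by (simp add: bnd_def algebra_simps)
qed

lemma busok_TrD:
  assumes "busok d S hs h i W" "i \<in> trunk S"
  shows "\<exists>a. W = {#(i \<in> ending S, a)#} \<and> a + n \<le> bnd S hs i + (if i = h then group_size S else 0) \<and>
        (i \<noteq> h \<or> group_size S = 0 \<longrightarrow> on_lattice d (i \<in> ending S, a))"
  using assms unfolding busok_def by simp

lemma busok_TrI:
  assumes "i \<in> trunk S" "a + n \<le> bnd S hs i + (if i = h then group_size S else 0)"
    "i \<noteq> h \<or> group_size S = 0 \<Longrightarrow> on_lattice d (i \<in> ending S, a)"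
  shows "busok d S hs h i {#(i \<in> ending S, a)#}"
  using assms unfolding busok_def by simp

lemma planD:
  assumes "plan t S" "hosts (items S) hs" "good S hs" "trunk S \<noteq> {} \<Longrightarrow> h \<in> trunk S"
  obtains W vx where "der t ((\<Sum>i<k. W i) + (if has_open S then {#(False, vx)#} else {#}))" "vx \<le> open_size S"
      "\<forall>i<k. busok (dep (troot t)) S hs h i (W i)"
  using assms unfolding plan_def by blast

text \<open>For the buses that a step does not touch. Their token may be off the lattice before only
  if it may be so afterwards; this is what the last hypothesis ensures.\<close>

lemma busok_mono:
  assumes "busok d S hs h i W"
    and "i \<in> trunk S' \<longleftrightarrow> i \<in> trunk S" "i \<in> pending S' \<longleftrightarrow> i \<in> pending S" "i \<in> ending S' \<longleftrightarrow> i \<in> ending S"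
    and "bnd S hs i + (if i = h then group_size S else 0) \<le> bnd S' hs' i + (if i = h' then group_size S' else 0)"
    and "i \<in> pending S \<Longrightarrow> load (items S') hs' i = load (items S) hs i"
    and "i \<in> pending S \<Longrightarrow> count_list hs' i = count_list hs i"
    and "i \<in> pending S \<Longrightarrow> spent S i \<le> spent S' i"
    and "i = h \<Longrightarrow> group_size S > 0 \<Longrightarrow> i = h' \<and> group_size S' > 0"
  shows "busok d S' hs' h' i W"
proof (cases "i \<in> trunk S")
  case True
  then obtain a where a: "W = {#(i \<in> ending S, a)#}" "a + n \<le> bnd S hs i + (if i = h then group_size S else 0)"
    "i \<noteq> h \<or> group_size S = 0 \<longrightarrow> on_lattice d (i \<in> ending S, a)" using assms(1) unfolding busok_def by auto
  have "a + n \<le> bnd S' hs' i + (if i = h' then group_size S' else 0)" using a(2) assms(5) by linarith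
  moreover have "i \<noteq> h' \<or> group_size S' = 0 \<longrightarrow> on_lattice d (i \<in> ending S', a)" using a(3) assms(4,9) by (cases "group_size S = 0"; cases "i = h") auto
  ultimately show ?thesis using True assms(2,4) a(1) unfolding busok_def by simp
next
  case False
  show ?thesis
  proof (cases "i \<in> pending S")
    case True
    have "(min (spent S i) gam + n) * count_list hs i \<le> (min (spent S' i) gam + n) * count_list hs i"
      using assms(8)[OF True] by (intro mult_right_mono) auto
    moreover have "(\<forall>y\<in>#W. \<not> fst y \<and> on_lattice d y) \<and> size W \<le> count_list hs i \<and>
        (\<Sum>y\<in>#W. snd y) + gam * count_list hs i \<le> load (items S) hs i + (min (spent S i) gam + n) * count_list hs i"
      using assms(1) True False unfolding busok_def by simp
    ultimately have "(\<forall>y\<in>#W. \<not> fst y \<and> on_lattice d y) \<and> size W \<le> count_list hs i \<and>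
        (\<Sum>y\<in>#W. snd y) + gam * count_list hs i \<le> load (items S) hs i + (min (spent S' i) gam + n) * count_list hs i"
      by linarith
    then show ?thesis using assms(2,3) assms(6,7)[OF True] True False unfolding busok_def by simp
  next
    case f: False
    then show ?thesis using assms(1-3) False unfolding busok_def by simp
  qed
qed

lemma good_mono:
  assumes "good S' hs'" and "\<And>i. bnd S hs i \<le> bnd S' hs' i" and "length hs \<le> length hs'"
  shows "good S hs"
proof -
  have "bnd S hs i + (4 * tau + 4 * n) \<le> Hm" if "i < k" for i
  proof -
    have "bnd S' hs' i + (4 * tau + 4 * n) \<le> Hm" using assms(1) that by (simp only: good_def)
    then show ?thesis using assms(2)[of i] by linarith
  qed
  then show ?thesis using assms by (simp add: good_def)
qed

lemma goodD: "good S hs \<Longrightarrow> i < k \<Longrightarrow> bnd S hs i + (4 * tau + 4 * n) \<le> Hm"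
  by (simp only: good_def)

lemma bnd_snoc:
  assumes "length hs0 = length (items S)" "items S' = items S @ [(w, q)]" "own S' i = own S i" "leaves S' i = leaves S i"
  shows "bnd S' (hs0 @ [h0]) i = bnd S hs0 i + (if i = h0 then w + 3 * n else 0)"
  using assms by (simp add: bnd_def load_append load_single algebra_simps)

section \<open>Closing and absorbing pools\<close>

lemma Inv0_trunk: "Inv0 S \<Longrightarrow> i \<in> trunk S \<Longrightarrow> i < k" by (auto simp: Inv0_def)

text \<open>The group may be arbitrarily light, and a light item could not justify the
  \<open>3 * n\<close> of roundings granted to its carrier. Therefore bus \<open>j\<close> adds
  \<open>sg\<close> to its weight, paid by a unit of credit. From now on the carrier is fixed, so
  its token can be rounded.\<close>

lemma close_group:
  assumes I: "Inv t S" and j: "j \<in> trunk S" "credit S j < 2 * leaves S j"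
  shows "Inv t (S\<lparr>items := items S @ [(group_size S + sg, (group_share S)(j := group_share S j + sg))], group_size := 0, group_share := (\<lambda>_. 0),
    credit := (credit S)(j := Suc (credit S j))\<rparr>)" (is "Inv t ?S")
proof -
  let ?d = "dep (troot t)"
  have I0: "Inv0 S" and P: "plan t S" using I by (auto simp: Inv_def)
  have jk: "j < k" using I0 j Inv0_trunk by blast
  have so: "(\<Sum>i<k. ((group_share S)(j := group_share S j + sg)) i) = (\<Sum>i<k. group_share S i) + sg"
  proof -
    have "(\<Sum>i<k. ((group_share S)(j := group_share S j + sg)) i) = (\<Sum>i<k. group_share S i + (if i = j then sg else 0))"
      by (intro sum.cong) auto
    then show ?thesis using jk by (simp add: sum.distrib)
  qed
  have "(group_size S + sg) * tau \<le> (tau + gam) * ((\<Sum>i<k. group_share S i) + sg)"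
  proof -
    have "(group_size S + sg) * tau \<le> ((\<Sum>i<k. group_share S i) + sg) * (tau + gam)"
      using I0 by (intro mult_mono) (auto simp: Inv0_def)
    then show ?thesis by (simp add: mult.commute)
  qed
  then have "Inv0 ?S"
    using I0 j so jk by (auto simp: Inv0_def)
  moreover have "plan t ?S"
    unfolding plan_def
  proof (intro allI impI)
    fix hs h assume hs: "hosts (items ?S) hs" and g: "good ?S hs" and h: "trunk ?S \<noteq> {} \<longrightarrow> h \<in> trunk ?S"
    let ?w = "group_size S + sg" and ?o = "(group_share S)(j := group_share S j + sg)"
    obtain hs0 h0 where hh: "hs = hs0 @ [h0]" "hosts (items S) hs0" "?o h0 > 0"
      using hs hosts_snoc[of "items S" "(?w, ?o)" hs] by auto
    have h0: "h0 \<in> trunk S" using hh(3) I0 j by (auto simp: Inv0_def split: if_splits)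
    have ll: "length hs0 = length (items S)" using hh(2) by (simp add: hosts_def)
    have b: "bnd ?S hs i = bnd S hs0 i + (if i = h0 then ?w + 3 * n else 0)" for i
      unfolding hh(1) by (rule bnd_snoc[OF ll]) simp_all
    have "good S hs0"
      by (rule good_mono[OF g]) (use b hh(1) in auto)
    \<comment> \<open>The old plan is used with \<open>h0\<close>, the prescribed carrier of the new
      item, as the carrier of the group.\<close>
    then obtain W vx where W: "der t ((\<Sum>i<k. W i) + (if has_open S then {#(False, vx)#} else {#}))" "vx \<le> open_size S"
      "\<forall>i<k. busok ?d S hs0 h0 i (W i)"
      using P hh(2) h0 unfolding plan_def by blast
    let ?X = "if has_open S then {#(False, vx)#} else {#}"
    have nX: "off_lattice ?d ?X \<le> 1" by (simp add: off_lattice_add_mset)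
    have n5: "off_lattice ?d ((\<Sum>i<k. W i) + ?X) \<le> 5" using off_lattice_sum_busok[OF W(3)] nX by (auto split: if_splits)
    have step: "\<exists>V. busok ?d ?S hs h i V \<and> der t (V + R') \<and> off_lattice ?d V \<le> off_lattice ?d (W i)"
      if i: "i < k" and d: "der t (W i + R')" and n: "off_lattice ?d (W i + R') \<le> 5" for i R'
    proof (cases "i = h0")
      case False
      have "busok ?d S hs0 h0 i (W i)" using W(3) i by blast
      moreover have "bnd ?S hs i = bnd S hs0 i" using b[of i] False by simp
      moreover have "load (items ?S) hs i = load (items S) hs0 i" "count_list hs i = count_list hs0 i"
        using hh(1) ll False by (simp_all add: load_append load_single)
      ultimately have "busok ?d ?S hs h i (W i)"
        using False by (elim busok_mono) simp_all
      then show ?thesis using d by blast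
    next
      case True
      obtain a where a: "W i = {#(i \<in> ending S, a)#}" "a + n \<le> bnd S hs0 i + group_size S"
        using busok_TrD[of ?d S hs0 h0 h0 "W h0"] W(3) i h0 True by auto
      have "bnd ?S hs i + (4 * tau + 4 * n) \<le> Hm" using g i by (simp only: good_def)
      then have le: "a + n \<le> Hm" using a b[of i] True by simp
      obtain a' where a': "der t (add_mset (i \<in> ending S, a') R')" "on_lattice ?d (i \<in> ending S, a')" "a' < a + n"
        using round_up[of t "i \<in> ending S" a R'] d n a(1) le by (auto simp: off_lattice_add_mset split: if_splits)
      have "a' + n \<le> bnd ?S hs i" using a' a b[of i] True by simp
      then have "busok ?d ?S hs h i {#(i \<in> ending S, a')#}" using a'(2) True h0 by (auto simp: busok_def)
      then show ?thesis using a' by (intro exI[of _ "{#(i \<in> ending S, a')#}"]) (auto simp: off_lattice_add_mset)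
    qed
    obtain V where V: "\<forall>i<k. busok ?d ?S hs h i (V i)" "der t ((\<Sum>i<k. V i) + ?X)"
      using der_family[OF W(1), of ?d 5 "busok ?d ?S hs h"] step n5 by blast
    then show "\<exists>W vx. der t ((\<Sum>i<k. W i) + (if has_open ?S then {#(False, vx)#} else {#})) \<and> vx \<le> open_size ?S \<and>
      (\<forall>i<k. busok ?d ?S hs h i (W i))"
      using W(2) by (intro exI[of _ V] exI[of _ vx]) auto
  qed
  ultimately show ?thesis by (simp add: Inv_def)
qed

text \<open>Without a pending bus nobody could be charged for moving the open pool upwards. As long
  as it is light, it is put on a trunk token as part of the group, which costs no rounding because
  that token may be off the lattice.\<close>

lemma absorb_open:
  assumes I: "Inv t S" and x: "has_open S" "pending S = {}" "trunk S \<noteq> {}" "group_size S + open_size S < tau"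
  shows "Inv t (S\<lparr>has_open := False, open_size := 0, open_share := (\<lambda>_. 0), group_size := group_size S + open_size S, group_share := (\<lambda>i. group_share S i + open_share S i)\<rparr>)"
    (is "Inv t ?S")
proof -
  let ?d = "dep (troot t)"
  have I0: "Inv0 S" and P: "plan t S" using I by (auto simp: Inv_def)
  have "Inv0 ?S" using I0 x by (auto simp: Inv0_def sum.distrib add.assoc add.commute add.left_commute)
  moreover have "plan t ?S"
    unfolding plan_def
  proof (intro allI impI)
    fix hs h assume hs: "hosts (items ?S) hs" and g: "good ?S hs" and h: "trunk ?S \<noteq> {} \<longrightarrow> h \<in> trunk ?S"
    have h: "h \<in> trunk S" using h x(3) by simp
    have b: "bnd ?S hs i = bnd S hs i" for i by (simp add: bnd_def)
    have g': "good S hs" by (rule good_mono[OF g]) (use b in auto)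
    have hk: "h < k" using h I0 Inv0_trunk by blast
    obtain W vx where W: "der t ((\<Sum>i<k. W i) + (if has_open S then {#(False, vx)#} else {#}))" "vx \<le> open_size S"
      "\<forall>i<k. busok ?d S hs h i (W i)"
      by (rule planD[OF P _ g']) (use hs h in auto)
    obtain a where a: "W h = {#(h \<in> ending S, a)#}" "a + n \<le> bnd S hs h + group_size S"
        "group_size S = 0 \<longrightarrow> on_lattice ?d (h \<in> ending S, a)"
      using busok_TrD[of ?d S hs h h "W h"] W(3) hk h by auto
    obtain R0 where R0: "\<And>V. (\<Sum>i<k. (W(h := V)) i) = V + R0" using sum_insert_at[OF hk] by blast
    have WR: "(\<Sum>i<k. W i) = {#(h \<in> ending S, a)#} + R0" using R0[of "W h"] unfolding a(1) fun_upd_triv[of W h, unfolded a(1)] .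
    have d: "der t (add_mset (h \<in> ending S, a) ({#(False, vx)#} + R0))" using W(1) x(1) WR by (simp add: ac_simps)
    have n5: "off_lattice ?d ({#(False, vx)#} + R0) \<le> 5"
      using off_lattice_sum_busok[OF W(3)] WR by (auto simp: off_lattice_add_mset split: if_splits)
    have le: "a + vx \<le> Hm" using a(2) W(2) goodD[OF g' hk] x(4) by linarith
    have "der t (add_mset (h \<in> ending S, a + vx) R0)"
      using merge_all[OF d _ _ n5] le by simp
    then have "der t (\<Sum>i<k. (W(h := {#(h \<in> ending S, a + vx)#})) i)" unfolding R0 by simp
    moreover have "busok ?d ?S hs h i ((W(h := {#(h \<in> ending S, a + vx)#})) i)" if i: "i < k" for i
    proof (cases "i = h")
      case True
      \<comment> \<open>For an empty group \<open>busok\<close> demands a token on the lattice even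
        of \<open>h\<close>. If group and pool are both empty, then \<open>vx\<close> is 0 and the
        token is the old one.\<close>
      have l: "on_lattice ?d (h \<in> ending S, a + vx)" if "group_size S + open_size S = 0"
        using a(3) W(2) that by simp
      have "busok ?d ?S hs h h {#(h \<in> ending ?S, a + vx)#}"
        by (rule busok_TrI) (use h a(2) W(2) b[of h] l in auto)
      then show ?thesis using True by simp
    next
      case False
      have "busok ?d S hs h i (W i)" using W(3) i by blast
      then have "busok ?d ?S hs h i (W i)"
        by (rule busok_mono) (use False b[of i] in simp_all)
      then show ?thesis using False by simp
    qed
    ultimately show "\<exists>W vx. der t ((\<Sum>i<k. W i) + (if has_open ?S then {#(False, vx)#} else {#})) \<and> vx \<le> open_size ?S \<and>
      (\<forall>i<k. busok ?d ?S hs h i (W i))" by (intro exI[of _ "W(h := {#(h \<in> ending S, a + vx)#})"] exI[of _ 0]) simp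
  qed
  ultimately show ?thesis by (simp add: Inv_def)
qed

text \<open>The reserve \<open>gam\<close> is at most the part \<open>gam / tau\<close> of a pool
  whose size is at least \<open>tau\<close>.\<close>

lemma item_weight:
  assumes "tau \<le> s" "s \<le> (u::nat)"
  shows "(s + gam) * tau \<le> (tau + gam) * u"
proof -
  have "(s + gam) * tau \<le> s * tau + gam * s" using assms by (simp add: algebra_simps)
  also have "\<dots> = (tau + gam) * s" by (simp add: algebra_simps)
  also have "\<dots> \<le> (tau + gam) * u" using assms by simp
  finally show ?thesis .
qed

text \<open>Together, group and pool are heavy enough for an item without any credit. All buses
  present are trunk buses, so the prescribed carrier has a token that can absorb the pool and is
  rounded at once.\<close>

lemma close_open_group:
  assumes I: "Inv t S" and x: "has_open S" "pending S = {}" "trunk S \<noteq> {}" "tau \<le> group_size S + open_size S"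
  shows "Inv t (S\<lparr>has_open := False, open_size := 0, open_share := (\<lambda>_. 0), group_size := 0, group_share := (\<lambda>_. 0),
    items := items S @ [(group_size S + open_size S + gam, \<lambda>i. group_share S i + open_share S i)]\<rparr>)"
    (is "Inv t ?S")
proof -
  let ?d = "dep (troot t)"
  have I0: "Inv0 S" and P: "plan t S" using I by (auto simp: Inv_def)
  have "(group_size S + open_size S + gam) * tau \<le> (tau + gam) * (\<Sum>i<k. group_share S i + open_share S i)"
    using I0 x(4) by (intro item_weight) (auto simp: Inv0_def sum.distrib)
  then have "Inv0 ?S" using I0 x sg_tau tau_pos by (auto simp: Inv0_def add.assoc add.commute add.left_commute)
  moreover have "plan t ?S"
    unfolding plan_def
  proof (intro allI impI)
    fix hs h assume hs: "hosts (items ?S) hs" and g: "good ?S hs" and "trunk ?S \<noteq> {} \<longrightarrow> h \<in> trunk ?S"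
    let ?w = "group_size S + open_size S + gam" and ?o = "\<lambda>i. group_share S i + open_share S i"
    obtain hs0 h0 where hh: "hs = hs0 @ [h0]" "hosts (items S) hs0" "?o h0 > 0"
      using hs hosts_snoc[of "items S" "(?w, ?o)" hs] by auto
    have h0: "h0 \<in> trunk S" using hh(3) I0 x(2) unfolding Inv0_def by auto
    have ll: "length hs0 = length (items S)" using hh(2) by (simp add: hosts_def)
    have b: "bnd ?S hs i = bnd S hs0 i + (if i = h0 then ?w + 3 * n else 0)" for i
      unfolding hh(1) by (rule bnd_snoc[OF ll]) simp_all
    have g': "good S hs0" by (rule good_mono[OF g]) (use b hh(1) in auto)
    have hk: "h0 < k" using h0 I0 Inv0_trunk by blast
    obtain W vx where W: "der t ((\<Sum>i<k. W i) + (if has_open S then {#(False, vx)#} else {#}))" "vx \<le> open_size S"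
      "\<forall>i<k. busok ?d S hs0 h0 i (W i)"
      by (rule planD[OF P hh(2) g']) (use h0 in auto)
    obtain a where a: "W h0 = {#(h0 \<in> ending S, a)#}" "a + n \<le> bnd S hs0 h0 + group_size S"
      using busok_TrD[of ?d S hs0 h0 h0 "W h0"] W(3) hk h0 by auto
    obtain R0 where R0: "\<And>V. (\<Sum>i<k. (W(h0 := V)) i) = V + R0" using sum_insert_at[OF hk] by blast
    have WR: "(\<Sum>i<k. W i) = {#(h0 \<in> ending S, a)#} + R0" using R0[of "W h0"] unfolding a(1) fun_upd_triv[of W h0, unfolded a(1)] .
    have d: "der t (add_mset (h0 \<in> ending S, a) ({#(False, vx)#} + R0))" using W(1) x(1) WR by (simp add: ac_simps)
    have n5: "off_lattice ?d ({#(False, vx)#} + R0) \<le> 5"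
      using off_lattice_sum_busok[OF W(3)] WR by (auto simp: off_lattice_add_mset split: if_splits)
    have le: "a + vx + n \<le> Hm" using a(2) W(2) goodD[OF g hk] b[of h0] by simp
    have "der t (add_mset (h0 \<in> ending S, a + vx) R0)"
      using merge_all[OF d _ _ n5] le by simp
    then obtain a' where a': "der t (add_mset (h0 \<in> ending S, a') R0)" "on_lattice ?d (h0 \<in> ending S, a')" "a' < a + vx + n"
      using round_up[of t "h0 \<in> ending S" "a + vx" R0] le n5 by (auto simp: off_lattice_add_mset split: if_splits)
    then have "der t (\<Sum>i<k. (W(h0 := {#(h0 \<in> ending S, a')#})) i)" unfolding R0 by simp
    moreover have "busok ?d ?S hs h i ((W(h0 := {#(h0 \<in> ending S, a')#})) i)" if i: "i < k" for i
    proof (cases "i = h0")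
      case True
      have "busok ?d ?S hs h h0 {#(h0 \<in> ending ?S, a')#}"
        by (rule busok_TrI) (use h0 a(2) a' W(2) b[of h0] in auto)
      then show ?thesis using True by simp
    next
      case False
      have "busok ?d S hs0 h0 i (W i)" using W(3) i by blast
      then have "busok ?d ?S hs h i (W i)"
        by (rule busok_mono) (use False b[of i] hh(1) ll in \<open>simp_all add: load_append load_single\<close>)
      then show ?thesis using False by simp
    qed
    ultimately show "\<exists>W vx. der t ((\<Sum>i<k. W i) + (if has_open ?S then {#(False, vx)#} else {#})) \<and> vx \<le> open_size ?S \<and>
      (\<forall>i<k. busok ?d ?S hs h i (W i))" by (intro exI[of _ "W(h0 := {#(h0 \<in> ending S, a')#})"] exI[of _ 0]) simp
  qed
  ultimately show ?thesis by (simp add: Inv_def)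
qed

text \<open>A trunk carrier absorbs the pool immediately. A pending carrier has no token for that:
  the pool becomes a separate token on the lattice and waits until the carrier is released, with
  \<open>gam\<close> as its fare for the edges in between.\<close>

lemma close_open:
  assumes I: "Inv t S" and x: "has_open S" "tau \<le> open_size S"
  shows "Inv t (S\<lparr>has_open := False, open_size := 0, open_share := (\<lambda>_. 0), items := items S @ [(open_size S + gam, open_share S)]\<rparr>)"
    (is "Inv t ?S")
proof -
  let ?d = "dep (troot t)"
  have I0: "Inv0 S" and P: "plan t S" using I by (auto simp: Inv_def)
  have "(open_size S + gam) * tau \<le> (tau + gam) * (\<Sum>i<k. open_share S i)"
    using I0 x(2) by (intro item_weight) (auto simp: Inv0_def)
  then have "Inv0 ?S" using I0 x sg_tau tau_pos by (auto simp: Inv0_def add.assoc add.commute add.left_commute)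
  moreover have "plan t ?S"
    unfolding plan_def
  proof (intro allI impI)
    fix hs h assume hs: "hosts (items ?S) hs" and g: "good ?S hs" and h: "trunk ?S \<noteq> {} \<longrightarrow> h \<in> trunk ?S"
    let ?w = "open_size S + gam"
    obtain hs0 h0 where hh: "hs = hs0 @ [h0]" "hosts (items S) hs0" "open_share S h0 > 0"
      using hs hosts_snoc[of "items S" "(?w, open_share S)" hs] by auto
    have h0: "h0 \<in> trunk S \<union> pending S" using hh(3) I0 unfolding Inv0_def by auto
    have ll: "length hs0 = length (items S)" using hh(2) by (simp add: hosts_def)
    have b: "bnd ?S hs i = bnd S hs0 i + (if i = h0 then ?w + 3 * n else 0)" for i
      unfolding hh(1) by (rule bnd_snoc[OF ll]) simp_all
    have g': "good S hs0" by (rule good_mono[OF g]) (use b hh(1) in auto)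
    have hk: "h0 < k" using h0 I0 by (auto simp: Inv0_def)
    obtain W vx where W: "der t ((\<Sum>i<k. W i) + (if has_open S then {#(False, vx)#} else {#}))" "vx \<le> open_size S"
      "\<forall>i<k. busok ?d S hs0 h i (W i)"
      by (rule planD[OF P hh(2) g', of h]) (use h in auto)
    obtain R0 where R0: "\<And>V. (\<Sum>i<k. (W(h0 := V)) i) = V + R0" using sum_insert_at[OF hk] by blast
    have WR: "(\<Sum>i<k. W i) = W h0 + R0" using R0[of "W h0"] unfolding fun_upd_triv .
    have d: "der t (add_mset (False, vx) (W h0 + R0))" using W(1) x(1) WR by (simp add: ac_simps)
    have n1: "off_lattice ?d (W h0 + R0) \<le> 1"
      using off_lattice_sum_busok[OF W(3)] WR by (auto split: if_splits)
    have vx: "vx + n \<le> Hm" using W(2) goodD[OF g hk] b[of h0] by simp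
    have oth: "busok ?d ?S hs h i (W i)" if i: "i < k" "i \<noteq> h0" for i
    proof -
      have "busok ?d S hs0 h i (W i)" using W(3) i by blast
      then show ?thesis
        by (rule busok_mono) (use i b[of i] hh(1) ll in \<open>simp_all add: load_append load_single\<close>)
    qed
    have "\<exists>V. der t (V + R0) \<and> busok ?d ?S hs h h0 V"
    proof (cases "h0 \<in> trunk S")
      case True
      obtain a where a: "W h0 = {#(h0 \<in> ending S, a)#}" "a + n \<le> bnd S hs0 h0 + (if h0 = h then group_size S else 0)"
        using busok_TrD[of ?d S hs0 h h0 "W h0"] W(3) hk True by auto
      have d: "der t (add_mset (h0 \<in> ending S, a) ({#(False, vx)#} + R0))" using d a(1) by (simp add: add_mset_commute)
      have n5: "off_lattice ?d ({#(False, vx)#} + R0) \<le> 5" using n1 a(1) by (auto simp: off_lattice_add_mset split: if_splits)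
      have le: "a + vx + n \<le> Hm"
        using a(2) W(2) goodD[OF g hk] b[of h0] I0 by (auto simp: Inv0_def split: if_splits)
      have d2: "der t (add_mset (h0 \<in> ending S, a + vx) R0)"
        using merge_all[OF d _ _ n5] le by simp
      show ?thesis
      proof (cases "h0 = h \<and> group_size S > 0")
        \<comment> \<open>The token also carries the group and may stay off the lattice; its
          rounding is left to the closing of the group.\<close>
        case ex: True
        have "busok ?d ?S hs h h0 {#(h0 \<in> ending ?S, a + vx)#}"
          by (rule busok_TrI) (use True ex a(2) W(2) b[of h0] in auto)
        then show ?thesis using d2 by (intro exI[of _ "{#(h0 \<in> ending S, a + vx)#}"]) simp
      next
        case ex: False
        obtain a' where a': "der t (add_mset (h0 \<in> ending S, a') R0)" "on_lattice ?d (h0 \<in> ending S, a')" "a' < a + vx + n"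
          using round_up[OF d2 le] n5 by (auto simp: off_lattice_add_mset split: if_splits)
        have "busok ?d ?S hs h h0 {#(h0 \<in> ending ?S, a')#}"
          by (rule busok_TrI) (use True ex a(2) a' W(2) b[of h0] in \<open>auto split: if_splits\<close>)
        then show ?thesis using a'(1) by (intro exI[of _ "{#(h0 \<in> ending S, a')#}"]) simp
      qed
    next
      case False
      then have hP: "h0 \<in> pending S" using h0 by simp
      have bk: "busok ?d S hs0 h h0 (W h0)" using W(3) hk by blast
      obtain v' where v': "der t (add_mset (False, v') (W h0 + R0))" "on_lattice ?d (False, v')" "v' < vx + n"
        using round_up[OF d vx] n1 by auto
      have "busok ?d ?S hs h h0 (add_mset (False, v') (W h0))"
        using bk False hP v' W(2) hh(1) ll
        by (auto simp: busok_def load_append load_single add_mult_distrib)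
      then show ?thesis using v'(1) by (intro exI[of _ "add_mset (False, v') (W h0)"]) simp
    qed
    then obtain V where V: "der t (V + R0)" "busok ?d ?S hs h h0 V" by blast
    have "der t (\<Sum>i<k. (W(h0 := V)) i)" unfolding R0 by (rule V(1))
    moreover have "\<forall>i<k. busok ?d ?S hs h i ((W(h0 := V)) i)" using V(2) oth by auto
    ultimately show "\<exists>W vx. der t ((\<Sum>i<k. W i) + (if has_open ?S then {#(False, vx)#} else {#})) \<and> vx \<le> open_size ?S \<and>
      (\<forall>i<k. busok ?d ?S hs h i (W i))" by (intro exI[of _ "W(h0 := V)"] exI[of _ 0]) simp
  qed
  ultimately show ?thesis by (simp add: Inv_def)
qed

section \<open>New trunk buses, and the step along an edge\<close>

lemma sum_replicate:
  assumes "Q \<subseteq> {..<k}"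
  shows "(\<Sum>i<k. if i \<in> Q then {#z#} else {#}) = replicate_mset (card Q) z"
proof -
  have "(\<Sum>i<k. if i \<in> Q then {#z#} else {#}) = (\<Sum>i\<in>{..<k} \<inter> Q. {#z#})"
    by (rule sum.inter_restrict[symmetric]) simp
  also have "{..<k} \<inter> Q = Q" using assms by blast
  also have "(\<Sum>i\<in>Q. {#z#}) = replicate_mset (card Q) z"
    using finite_subset[OF assms finite_lessThan] by (induction Q rule: finite_induct) auto
  finally show ?thesis .
qed

lemma no_trunk_no_group:
  assumes "Inv0 S" "trunk S = {}"
  shows "group_size S = 0"
proof -
  have "\<forall>i. i \<notin> trunk S \<longrightarrow> own S i = 0 \<and> leaves S i = 0 \<and> credit S i = 0 \<and> group_share S i = 0"
    and le: "group_size S \<le> (\<Sum>i<k. group_share S i)" using assms(1) by (simp_all add: Inv0_def)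
  then have "group_share S i = 0" for i using assms(2) by simp
  then have "(\<Sum>i<k. group_share S i) = 0" by simp
  then show ?thesis using le by simp
qed

lemma sum_values_less:
  assumes "\<forall>i<k. busok d S hs h i (W i)" "good S hs" "group_size S < tau" "y \<in># (\<Sum>i<k. W i)"
  shows "snd y \<le> Hm"
proof -
  have "\<exists>i<m. y \<in># W i" if "y \<in># (\<Sum>i<m. W i)" for m
    using that by (induction m) (auto simp: less_Suc_eq)
  then obtain i where "i < k" "y \<in># W i" using assms(4) by blast
  then show ?thesis using busok_le[OF _ assms(2,3), of d h i "W i" y] assms(1) by simp
qed

text \<open>A new trunk bus gets an idle token at the vertex, which absorbs the waiting tokens of
  its items. The group has to be empty if there was a trunk before: it sits on an old trunk bus,
  whereas the new plan must also work for a carrier among the new ones.\<close>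

lemma release:
  assumes I: "Inv t S" and Q: "Q \<subseteq> pending S" and g0: "Q \<noteq> {} \<Longrightarrow> trunk S \<noteq> {} \<Longrightarrow> group_size S = 0"
  shows "Inv (Start t) (S\<lparr>trunk := trunk S \<union> Q, pending := pending S - Q, leaves := (\<lambda>i. if i \<in> Q then 1 else leaves S i)\<rparr>)"
    (is "Inv _ ?S")
proof -
  let ?d = "dep (troot t)" and ?z = "(False, idl (dep (troot t)))"
  have I0: "Inv0 S" and P: "plan t S" using I by (auto simp: Inv_def)
  have Qk: "Q \<subseteq> {..<k}" using I0 Q by (auto simp: Inv0_def)
  have QT: "Q \<inter> trunk S = {}" using I0 Q by (auto simp: Inv0_def)
  have "Inv0 ?S" using I0 Q QT by (auto simp: Inv0_def)
  moreover have "plan (Start t) ?S"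
    unfolding plan_def
  proof (intro allI impI)
    fix hs h assume hs: "hosts (items ?S) hs" and g: "good ?S hs" and h: "trunk ?S \<noteq> {} \<longrightarrow> h \<in> trunk ?S"
    \<comment> \<open>If \<open>h\<close> is a new trunk bus, any old one can replace it, since the
      group is empty then.\<close>
    define h1 where "h1 = (if h \<in> trunk S then h else (SOME i. i \<in> trunk S))"
    have h1: "h1 \<in> trunk S" if "trunk S \<noteq> {}"
      using that some_in_eq[of "trunk S"] by (auto simp: h1_def)
    have gQ: "group_size S = 0" if "Q \<noteq> {}" using g0 that no_trunk_no_group[OF I0] by blast
    have b: "bnd ?S hs i = bnd S hs i + (if i \<in> Q then 2 * n else 0)" for i
    proof (cases "i \<in> Q")
      case True
      then have "leaves S i = 0" using I0 QT by (auto simp: Inv0_def)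
      then show ?thesis using True by (simp add: bnd_def algebra_simps)
    qed (simp add: bnd_def)
    have g': "good S hs" by (rule good_mono[OF g]) (use b in auto)
    have hs': "hosts (items S) hs" using hs by simp
    obtain W vx where W: "der t ((\<Sum>i<k. W i) + (if has_open S then {#(False, vx)#} else {#}))" "vx \<le> open_size S"
      "\<forall>i<k. busok ?d S hs h1 i (W i)"
      by (rule planD[OF P hs' g' h1]) auto
    let ?X = "if has_open S then {#(False, vx)#} else {#}"
    let ?Y = "\<lambda>i. W i + (if i \<in> Q then {#?z#} else {#})"
    have lz: "on_lattice ?d ?z" by (rule on_lattice_idl)
    have nlz: "off_lattice ?d (replicate_mset m ?z) = 0" for m by (induction m) (use lz in \<open>auto simp: off_lattice_add_mset\<close>)
    have n2: "off_lattice ?d ((\<Sum>i<k. W i) + ?X) \<le> 2"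
      using off_lattice_sum_busok[OF W(3)] by (auto simp: off_lattice_add_mset split: if_splits)
    have cQ: "card Q \<le> k" using card_mono[OF _ Qk] by simp
    have "size ((\<Sum>i<k. W i) + ?X + replicate_mset (card Q) ?z) \<le> Nm"
      using size_sum_busok[OF W(3)] cQ g by (auto simp: good_def)
    moreover have "n \<le> Hm" using g by (simp add: good_def)
    then have "idl ?d \<le> Hm" using idl_less[of ?d] by linarith
    ultimately have ad: "adm ?d ((\<Sum>i<k. W i) + ?X + replicate_mset 0 (True, 0) + replicate_mset (card Q) ?z)"
      using der_adm[OF W(1)] n2 nlz by (auto simp: adm_def in_replicate_mset)
    have "der (Start t) ((\<Sum>i<k. W i) + ?X + replicate_mset 0 (True, 0) + replicate_mset (card Q) ?z)"
      by (rule der.Start[OF W(1) ad])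
    moreover have e: "(\<Sum>i<k. ?Y i) = (\<Sum>i<k. W i) + replicate_mset (card Q) ?z"
      unfolding sum.distrib using sum_replicate[OF Qk] by simp
    ultimately have D: "der (Start t) ((\<Sum>i<k. ?Y i) + ?X)" by (simp add: ac_simps)
    have n5: "off_lattice ?d ((\<Sum>i<k. ?Y i) + ?X) \<le> 5" using n2 nlz by (simp add: e)
    have step: "\<exists>V. busok ?d ?S hs h i V \<and> der (Start t) (V + R') \<and> off_lattice ?d V \<le> off_lattice ?d (?Y i)"
      if i: "i < k" and d: "der (Start t) (?Y i + R')" and nn: "off_lattice ?d (?Y i + R') \<le> 5" for i R'
    proof (cases "i \<in> Q")
      case False
      have "busok ?d S hs h1 i (W i)" using W(3) i by blast
      then have "busok ?d ?S hs h i (W i)"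
        by (rule busok_mono) (use False b[of i] gQ h no_trunk_no_group[OF I0] in \<open>auto simp: h1_def split: if_splits\<close>)
      then show ?thesis using False d by auto
    next
      case True
      have iT: "i \<notin> trunk S" and iB: "i \<notin> ending S" using True QT I0 by (auto simp: Inv0_def)
      have bk: "busok ?d S hs h1 i (W i)" using W(3) i by blast
      note pp = pend_sum[OF bk iT]
      have gvS: "group_size ?S = 0" using gQ True by auto
      show ?thesis
      proof (cases "count_list hs i = 0")
        case c0: True
        then have "W i = {#}" using pp(3) by simp
        moreover have "busok ?d ?S hs h i {#(i \<in> ending ?S, idl ?d)#}"
          by (rule busok_TrI) (use True lz iB b[of i] idl_less[of ?d] in auto)
        ultimately show ?thesis using d True iB by (intro exI[of _ "{#?z#}"]) (auto simp: off_lattice_add_mset)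
      next
        case c1: False
        have m: "n \<le> n * count_list hs i" using c1 by (cases "count_list hs i") auto
        have sm: "(\<Sum>y\<in>#?Y i. snd y) = (\<Sum>y\<in>#W i. snd y) + idl ?d" using True by simp
        have bb: "load (items S) hs i + 3 * (n * count_list hs i) + 2 * n \<le> bnd ?S hs i"
          using b[of i] True by (simp add: bnd_def algebra_simps)
        \<comment> \<open>Above \<open>load\<close> the sum takes \<open>n\<close> per item and less
          than \<open>n\<close> for \<open>idl\<close>; another \<open>2 * n\<close> are for
          rounding and reserve. The grant is \<open>3 * n\<close> per item and \<open>2 * n\<close>
          for the leaf, which suffices because there is at least one item.\<close>
        have le: "(\<Sum>y\<in>#?Y i. snd y) + 2 * n \<le> bnd ?S hs i"
          using pp(1) sm bb m idl_less[of ?d] by linarith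
        have noP: "\<forall>y\<in>#?Y i. \<not> fst y" using pp(2) by auto
        then have f0: "filter_mset fst (?Y i) = {#}" by (auto simp: filter_mset_eq_conv)
        have ne: "(\<exists>y\<in>#?Y i. fst y) = (i \<in> ending S)" using noP iB by blast
        have f1: "size (filter_mset fst (?Y i)) \<le> 1" by (simp only: f0 size_empty)
        have "der (Start t) (add_mset (\<exists>y\<in>#?Y i. fst y, \<Sum>y\<in>#?Y i. snd y) R')"
          by (rule merge_set[OF d _ f1]) (use True le goodD[OF g i] nn in auto)
        then have d2: "der (Start t) (add_mset (i \<in> ending S, \<Sum>y\<in>#?Y i. snd y) R')" unfolding ne .
        obtain a' where a': "der (Start t) (add_mset (i \<in> ending S, a') R')" "on_lattice ?d (i \<in> ending S, a')"
          "a' < (\<Sum>y\<in>#?Y i. snd y) + n"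
          using round_up[OF d2] le goodD[OF g i] nn by auto
        have "busok ?d ?S hs h i {#(i \<in> ending ?S, a')#}"
          by (rule busok_TrI) (use True a' le in auto)
        then show ?thesis using a' by (intro exI[of _ "{#(i \<in> ending S, a')#}"]) (auto simp: off_lattice_add_mset)
      qed
    qed
    obtain V where V: "\<forall>i<k. busok ?d ?S hs h i (V i)" "der (Start t) ((\<Sum>i<k. V i) + ?X)"
      using der_family[OF D, of ?d 5 "busok ?d ?S hs h"] step n5 by blast
    then show "\<exists>W vx. der (Start t) ((\<Sum>i<k. W i) + (if has_open ?S then {#(False, vx)#} else {#})) \<and> vx \<le> open_size ?S \<and>
      (\<forall>i<k. busok (dep (troot (Start t))) ?S hs h i (W i))"
      using W(2) by (intro exI[of _ V] exI[of _ vx]) auto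
  qed
  ultimately show ?thesis by (simp add: Inv_def)
qed

lemma on_lattice_lift: "on_lattice d (lift l y) = on_lattice (d + l) y"
  by (simp add: on_lattice_def lift_def ac_simps)

lemma off_lattice_lift: "off_lattice d (image_mset (lift l) M) = off_lattice (d + l) M"
  by (induction M) (auto simp: off_lattice_add_mset on_lattice_lift)

lemma sum_lift:
  "\<forall>y\<in>#W. \<not> fst y \<Longrightarrow> (\<Sum>y\<in>#image_mset (lift l) W. snd y) = (\<Sum>y\<in>#W. snd y) + l * size W"
  by (induction W) (auto simp: lift_def)

lemma image_mset_sum: "image_mset f (\<Sum>i<(m::nat). W i) = (\<Sum>i<m. image_mset f (W i))"
  by (induction m) auto

text \<open>A trunk bus pays for the edge with its token unless it has ended below. The open pool is
  one token, and its passage is charged to one pending bus \<open>j\<close>: the detour of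
  \<open>j\<close> grows by \<open>l\<close> as well, and \<open>j\<close> has no token of its own
  to pay for. The waiting tokens of pending buses draw on their reserves.\<close>

lemma up:
  assumes I: "Inv t S" and du: "dep (troot t) = dep u + l"
    and pe: "\<forall>i\<in>pending S. spent S i + l < gam" and j: "has_open S \<Longrightarrow> j \<in> pending S" and xt: "open_size S < tau"
  shows "Inv (Up u l t) (S\<lparr>spent := (\<lambda>i. if i \<in> trunk S \<union> pending S \<and> i \<notin> ending S then spent S i + l else spent S i),
    own := (\<lambda>i. if i \<in> trunk S \<and> i \<notin> ending S then own S i + l else own S i),
    open_size := (if has_open S then open_size S + l else open_size S), open_share := (if has_open S then (open_share S)(j := open_share S j + l) else open_share S)\<rparr>)"
    (is "Inv _ ?S")
proof -
  have I0: "Inv0 S" and P: "plan t S" using I by (auto simp: Inv_def)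
  define S' where "S' = ?S"
  have sel: "trunk S' = trunk S" "pending S' = pending S" "ending S' = ending S" "leaves S' = leaves S" "items S' = items S" "has_open S' = has_open S"
    "group_size S' = group_size S" "group_share S' = group_share S" "credit S' = credit S"
    "\<And>i. spent S' i = (if i \<in> trunk S \<union> pending S \<and> i \<notin> ending S then spent S i + l else spent S i)"
    "\<And>i. own S' i = (if i \<in> trunk S \<and> i \<notin> ending S then own S i + l else own S i)"
    "open_size S' = (if has_open S then open_size S + l else open_size S)" "open_share S' = (if has_open S then (open_share S)(j := open_share S j + l) else open_share S)"
    by (simp_all add: S'_def)
  have so: "(\<Sum>i<k. open_share S' i) = (\<Sum>i<k. open_share S i) + (if has_open S then l else 0)"
  proof (cases "has_open S")
    case True
    then have jk: "j < k" using j I0 by (auto simp: Inv0_def)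
    have "(\<Sum>i<k. open_share S' i) = (\<Sum>i<k. open_share S i + (if i = j then l else 0))"
      using True by (intro sum.cong) (auto simp: sel)
    then show ?thesis using jk True by (simp add: sum.distrib)
  qed (simp add: sel)
  \<comment> \<open>An open pool comes with a pending bus, and a pending bus stays below
    \<open>gam\<close> on this edge.\<close>
  have ll: "l < gam" if "has_open S" using j[OF that] pe by fastforce
  have x2: "open_size S' < 2 * tau" using xt ll gam_tau by (cases "has_open S") (auto simp: sel)
  have acc: "own S' i + osum (items S') i + open_share S' i + group_share S' i \<le> spent S' i + sg * credit S' i" if "i < k" for i
  proof -
    have "own S i + osum (items S) i + open_share S i + group_share S i \<le> spent S i + sg * credit S i"
      using I0 that by (simp add: Inv0_def)
    moreover have "trunk S \<inter> pending S = {}" "ending S \<subseteq> trunk S" using I0 by (auto simp: Inv0_def)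
    ultimately show ?thesis using j by (auto simp: sel)
  qed
  have "Inv0 S'"
    unfolding Inv0_def
  proof (intro conjI)
    show "open_size S' \<le> (\<Sum>i<k. open_share S' i)" unfolding so using I0 by (auto simp: Inv0_def sel)
    show "\<forall>i. i \<notin> trunk S' \<union> pending S' \<longrightarrow> open_share S' i = 0" using I0 j by (auto simp: Inv0_def sel)
    show "\<forall>i<k. own S' i + osum (items S') i + open_share S' i + group_share S' i \<le> spent S' i + sg * credit S' i" using acc by blast
  qed (use I0 x2 in \<open>auto simp: Inv0_def sel\<close>)
  moreover have "plan (Up u l t) S'"
    unfolding plan_def
  proof (intro allI impI)
    fix hs h assume hs: "hosts (items S') hs" and g: "good S' hs" and h: "trunk S' \<noteq> {} \<longrightarrow> h \<in> trunk S'"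
    have b: "bnd S' hs i = bnd S hs i + (if i \<in> trunk S \<and> i \<notin> ending S then l else 0)" for i
      by (simp add: bnd_def sel)
    have g': "good S hs" by (rule good_mono[OF g]) (use b in auto)
    have hs': "hosts (items S) hs" using hs by (simp add: sel)
    obtain W vx where W: "der t ((\<Sum>i<k. W i) + (if has_open S then {#(False, vx)#} else {#}))" "vx \<le> open_size S"
      "\<forall>i<k. busok (dep (troot t)) S hs h i (W i)"
      by (rule planD[OF P hs' g', of h]) (use h in \<open>simp add: sel\<close>)
    let ?X = "if has_open S then {#(False, vx)#} else {#}"
    let ?W = "\<lambda>i. image_mset (lift l) (W i)"
    let ?X' = "if has_open S then {#(False, vx + l)#} else {#}"
    have im: "image_mset (lift l) ((\<Sum>i<k. W i) + ?X) = (\<Sum>i<k. ?W i) + ?X'"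
      by (simp add: image_mset_sum lift_def)
    have bk: "busok (dep u) S' hs h i (?W i)" if i: "i < k" for i
    proof -
      have bi: "busok (dep (troot t)) S hs h i (W i)" using W(3) i by blast
      show ?thesis
      proof (cases "i \<in> trunk S")
        case True
        from busok_TrD[OF bi True]
        obtain a where a0: "W i = {#(i \<in> ending S, a)#} \<and> a + n \<le> bnd S hs i + (if i = h then group_size S else 0) \<and>
          (i \<noteq> h \<or> group_size S = 0 \<longrightarrow> on_lattice (dep (troot t)) (i \<in> ending S, a))" by (rule exE)
        note a = conjunct1[OF a0] conjunct1[OF conjunct2[OF a0]] conjunct2[OF conjunct2[OF a0]]
        define a' where "a' = (if i \<in> ending S then a else a + l)"
        have lt: "lift l (i \<in> ending S, a) = (i \<in> ending S, a')" by (simp add: lift_def a'_def)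
        have ll: "on_lattice (dep u) (i \<in> ending S, a') = on_lattice (dep (troot t)) (i \<in> ending S, a)"
          using on_lattice_lift[of "dep u" l "(i \<in> ending S, a)"] unfolding lt du .
        have aa: "a' + n \<le> bnd S' hs i + (if i = h then group_size S else 0)"
          using a(2) b[of i] True by (cases "i \<in> ending S"; cases "i = h") (simp_all add: a'_def)
        have "busok (dep u) S' hs h i {#(i \<in> ending S', a')#}"
        proof (rule busok_TrI)
          show "i \<in> trunk S'" using True by (simp add: sel)
          show "a' + n \<le> bnd S' hs i + (if i = h then group_size S' else 0)" using aa by (simp only: sel)
          show "on_lattice (dep u) (i \<in> ending S', a')" if "i \<noteq> h \<or> group_size S' = 0" using that a(3) ll by (simp add: sel)
        qed
        moreover have "{#(i \<in> ending S', a')#} = ?W i" using a(1) lt by (simp add: sel)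
        ultimately show ?thesis by (rule subst[rotated])
      next
        case False
        note pp = pend_sum[OF bi False]
        show ?thesis
        proof (cases "i \<in> pending S")
          case iP: True
          have s: "(\<Sum>y\<in>#?W i. snd y) = (\<Sum>y\<in>#W i. snd y) + l * size (W i)"
            using pp(2) by (intro sum_lift) simp
          have w: "size (W i) \<le> count_list hs i"
            "(\<Sum>y\<in>#W i. snd y) + gam * count_list hs i \<le> load (items S) hs i + (min (spent S i) gam + n) * count_list hs i"
            using bi iP False unfolding busok_def by simp_all
          \<comment> \<open>The pending bus does not reach \<open>gam\<close> on the edge, so the
            minimum does not cut off the increase and the reserve covers \<open>l\<close> for each
            waiting token.\<close>
          have "min (spent S i) gam + l \<le> min (spent S i + l) gam" using pe iP by force
          then have "(min (spent S i) gam + l + n) * count_list hs i \<le> (min (spent S i + l) gam + n) * count_list hs i"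
            by (intro mult_right_mono) auto
          then have "(min (spent S i) gam + n) * count_list hs i + l * count_list hs i
              \<le> (min (spent S i + l) gam + n) * count_list hs i"
            by (simp add: algebra_simps)
          moreover have "l * size (W i) \<le> l * count_list hs i" using w(1) by simp
          ultimately have "(\<Sum>y\<in>#?W i. snd y) + gam * count_list hs i
              \<le> load (items S) hs i + (min (spent S i + l) gam + n) * count_list hs i"
            using s w(2) by linarith
          moreover have "i \<notin> ending S" using False I0 by (auto simp: Inv0_def)
          moreover have "\<forall>y\<in>#?W i. \<not> fst y \<and> on_lattice (dep u) y"
            using pp(2) du by (simp add: on_lattice_lift) (simp add: lift_def)
          ultimately show ?thesis using w(1) iP False unfolding busok_def by (simp add: sel)
        next
          case iP: False
          then have "W i = {#}" using bi False unfolding busok_def by simp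
          then show ?thesis using iP False unfolding busok_def by (simp add: sel)
        qed
      qed
    qed
    have gt: "group_size S' < tau" using I0 by (simp add: Inv0_def sel)
    have tH: "4 * tau \<le> Hm" using g by (simp add: good_def)
    have vH: "vx + l \<le> Hm" if "has_open S" using W(2) xt ll[OF that] gam_tau tH by linarith
    have "snd y \<le> Hm" if "y \<in># (\<Sum>i<k. ?W i) + ?X'" for y
      using that sum_values_less[of "dep u" S' hs h ?W y] bk g gt vH by (auto split: if_splits)
    moreover have ad: "adm (dep (troot t)) ((\<Sum>i<k. W i) + ?X)" by (rule der_adm[OF W(1)])
    moreover have "size (image_mset (lift l) ((\<Sum>i<k. W i) + ?X)) \<le> Nm" using ad unfolding adm_def by simp
    moreover have "off_lattice (dep u) (image_mset (lift l) ((\<Sum>i<k. W i) + ?X)) \<le> 6"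
      unfolding off_lattice_lift using ad du unfolding adm_def by simp
    ultimately have "adm (dep u) (image_mset (lift l) ((\<Sum>i<k. W i) + ?X))"
      unfolding adm_def im by blast
    then have D: "der (Up u l t) ((\<Sum>i<k. ?W i) + ?X')" using der.Up[OF W(1), of u l] unfolding im by blast
    define v where "v = (if has_open S then vx + l else vx)"
    have X: "?X' = (if has_open S' then {#(False, v)#} else {#})" unfolding sel v_def by simp
    have D': "der (Up u l t) ((\<Sum>i<k. ?W i) + (if has_open S' then {#(False, v)#} else {#}))"
      using D unfolding X .
    have v: "v \<le> open_size S'" using W(2) by (simp add: sel v_def)
    have bk': "\<forall>i<k. busok (dep (troot (Up u l t))) S' hs h i (?W i)" unfolding troot.simps using bk by blast
    show "\<exists>W vx. der (Up u l t) ((\<Sum>i<k. W i) + (if has_open S' then {#(False, vx)#} else {#})) \<and> vx \<le> open_size S' \<and>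
      (\<forall>i<k. busok (dep (troot (Up u l t))) S' hs h i (W i))"
      by (rule exI[of _ ?W], rule exI[of _ v], rule conjI[OF D' conjI[OF v bk']])
  qed
  ultimately show ?thesis unfolding S'_def[symmetric] by (simp add: Inv_def)
qed

end

section \<open>Joining two subtrees\<close>

context skeletons begin

lemma Inv0D:
  assumes "Inv0 S"
  shows "trunk S \<union> pending S \<subseteq> {..<k}" "trunk S \<inter> pending S = {}" "ending S \<subseteq> trunk S"
    "\<And>i. i \<notin> trunk S \<Longrightarrow> own S i = 0 \<and> leaves S i = 0 \<and> credit S i = 0 \<and> group_share S i = 0"
    "\<And>i. i \<notin> trunk S \<union> pending S \<Longrightarrow> open_share S i = 0"
    "\<And>it. it \<in> set (items S) \<Longrightarrow> (\<forall>i. i \<notin> trunk S \<union> pending S \<longrightarrow> snd it i = 0) \<and> sg \<le> fst it \<and>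
        fst it \<le> 3 * tau + gam + sg \<and> fst it * tau \<le> (tau + gam) * (\<Sum>i<k. snd it i)"
    "open_size S \<le> (\<Sum>i<k. open_share S i)" "open_size S < 2 * tau" "\<not> has_open S \<Longrightarrow> open_size S = 0"
    "group_size S \<le> (\<Sum>i<k. group_share S i)" "group_size S < tau"
    "\<And>i. i < k \<Longrightarrow> own S i + osum (items S) i + open_share S i + group_share S i \<le> spent S i + sg * credit S i"
    "\<And>i. credit S i \<le> 2 * leaves S i"
  using assms by (simp_all add: Inv0_def)

text \<open>A bus that is in the trunk on one side only is a trunk bus of the join; the waiting
  tokens of its items on the other side are merged into its token.\<close>

definition join_skeleton :: "skeleton \<Rightarrow> skeleton \<Rightarrow> skeleton" where
  "join_skeleton S1 S2 = \<lparr>trunk = trunk S1 \<union> trunk S2, pending = (pending S1 \<union> pending S2) - (trunk S1 \<union> trunk S2), ending = ending S1 \<union> ending S2,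
     spent = (\<lambda>i. spent S1 i + spent S2 i), own = (\<lambda>i. own S1 i + own S2 i), leaves = (\<lambda>i. leaves S1 i + leaves S2 i),
     credit = (\<lambda>i. credit S1 i + credit S2 i), items = items S1 @ items S2, has_open = (has_open S1 \<or> has_open S2), open_size = open_size S1 + open_size S2,
     open_share = (\<lambda>i. open_share S1 i + open_share S2 i), group_size = group_size S1 + group_size S2, group_share = (\<lambda>i. group_share S1 i + group_share S2 i)\<rparr>"

lemma join_skeleton_sel [simp]:
  "trunk (join_skeleton S1 S2) = trunk S1 \<union> trunk S2"
  "pending (join_skeleton S1 S2) = (pending S1 \<union> pending S2) - (trunk S1 \<union> trunk S2)"
  "ending (join_skeleton S1 S2) = ending S1 \<union> ending S2"
  "spent (join_skeleton S1 S2) i = spent S1 i + spent S2 i" "own (join_skeleton S1 S2) i = own S1 i + own S2 i"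
  "leaves (join_skeleton S1 S2) i = leaves S1 i + leaves S2 i" "credit (join_skeleton S1 S2) i = credit S1 i + credit S2 i"
  "items (join_skeleton S1 S2) = items S1 @ items S2" "has_open (join_skeleton S1 S2) = (has_open S1 \<or> has_open S2)"
  "open_size (join_skeleton S1 S2) = open_size S1 + open_size S2" "open_share (join_skeleton S1 S2) i = open_share S1 i + open_share S2 i"
  "group_size (join_skeleton S1 S2) = group_size S1 + group_size S2" "group_share (join_skeleton S1 S2) i = group_share S1 i + group_share S2 i"
  by (simp_all add: join_skeleton_def)

text \<open>Trunk and pending buses are treated alike: a side that brings any token also brings a
  reserve \<open>n\<close>.\<close>

lemma side_bound:
  assumes "busok d S hs h i W"
  shows "(\<Sum>y\<in>#W. snd y) + (if W = {#} then 0 else n) \<le> bnd S hs i + (if i = h then group_size S else 0)"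
proof (cases "i \<in> trunk S")
  case True
  from busok_TrD[OF assms True] show ?thesis by auto
next
  case False
  note pp = pend_sum[OF assms False]
  show ?thesis
  proof (cases "W = {#}")
    case nonempty: False
    then have "count_list hs i \<noteq> 0" using pp(3) by blast
    then have "n \<le> n * count_list hs i" by simp
    moreover have "bnd S hs i = own S i + load (items S) hs i + (2 * (n * leaves S i) + 3 * (n * count_list hs i))"
      by (simp add: bnd_def algebra_simps)
    ultimately have "(\<Sum>y\<in>#W. snd y) + n \<le> bnd S hs i" using pp(1) by linarith
    then show ?thesis using nonempty by simp
  qed simp
qed

lemma side_fst:
  assumes "busok d S hs h i W" "ending S \<subseteq> trunk S"
  shows "size (filter_mset fst W) = (if i \<in> ending S then 1 else 0)" "(\<exists>y\<in>#W. fst y) \<longleftrightarrow> i \<in> ending S"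
proof -
  have *: "size (filter_mset fst W) = (if i \<in> ending S then 1 else 0) \<and> ((\<exists>y\<in>#W. fst y) \<longleftrightarrow> i \<in> ending S)"
  proof (cases "i \<in> trunk S")
    case True
    from busok_TrD[OF assms(1) True] show ?thesis by auto
  next
    case False
    then have n: "\<forall>y\<in>#W. \<not> fst y" using pend_sum(2)[OF assms(1) False] by blast
    then have "filter_mset fst W = {#}" by (simp add: filter_mset_eq_conv)
    moreover have "i \<notin> ending S" using False assms(2) by blast
    ultimately show ?thesis using n by simp
  qed
  then show "size (filter_mset fst W) = (if i \<in> ending S then 1 else 0)" "(\<exists>y\<in>#W. fst y) \<longleftrightarrow> i \<in> ending S"
    by blast+
qed

lemma side_on_lattice:
  assumes "busok d S hs h i W" "\<not> (i = h \<and> group_size S > 0)"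
  shows "\<forall>y\<in>#W. on_lattice d y"
proof (cases "i \<in> trunk S")
  case True
  from busok_TrD[OF assms(1) True] show ?thesis using assms(2) by auto
next
  case False
  then show ?thesis using pend_sum(2)[OF assms(1) False] by blast
qed

lemma off_lattice_0D: "off_lattice d W = 0 \<Longrightarrow> \<forall>y\<in>#W. on_lattice d y"
  by (induction W) (auto simp: off_lattice_add_mset split: if_splits)

text \<open>Two closed sizes that are both congruent to \<open>-d\<close> add up to a size congruent
  to \<open>-2 * d\<close>, in general off the lattice. If both sides bring tokens there are two
  reserves \<open>n\<close>, and one of them pays for rounding the sum. If some token was off the
  lattice already, the bus carries the group; then the sum is left as it is, and the number of
  tokens off the lattice does not grow.\<close>

lemma merge_bus:
  assumes bk1: "busok d S1 hs1 h1 i W1" and bk2: "busok d S2 hs2 h2 i W2"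
    and PT: "ending S1 \<subseteq> trunk S1" "ending S2 \<subseteq> trunk S2" and iT: "i \<in> trunk S1 \<union> trunk S2"
    and PP: "\<not> (i \<in> ending S1 \<and> i \<in> ending S2)"
    and b: "bnd S hs i = bnd S1 hs1 i + bnd S2 hs2 i" and g: "group_size S = group_size S1 + group_size S2"
    and h1: "i = h1 \<Longrightarrow> group_size S1 > 0 \<Longrightarrow> i = h" and h2: "i = h2 \<Longrightarrow> group_size S2 > 0 \<Longrightarrow> i = h"
    and T: "trunk S = trunk S1 \<union> trunk S2" and P: "ending S = ending S1 \<union> ending S2"
    and d: "der t (W1 + W2 + R')" "d = dep (troot t)" "off_lattice d (W1 + W2 + R') \<le> 5"
    and le: "bnd S hs i + group_size S \<le> Hm"
  shows "\<exists>V. busok d S hs h i V \<and> der t (V + R') \<and> off_lattice d V \<le> off_lattice d (W1 + W2)"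
proof -
  let ?W = "W1 + W2" and ?G = "if i = h then group_size S else 0"
  let ?s = "\<Sum>y\<in>#?W. snd y"
  have G: "(if i = h1 then group_size S1 else 0) + (if i = h2 then group_size S2 else 0) \<le> ?G"
  proof -
    have "group_size S1 = 0 \<or> i \<noteq> h1 \<or> i = h" "group_size S2 = 0 \<or> i \<noteq> h2 \<or> i = h" using h1 h2 by blast+
    then have "(if i = h1 then group_size S1 else 0) \<le> (if i = h then group_size S1 else 0)"
      "(if i = h2 then group_size S2 else 0) \<le> (if i = h then group_size S2 else 0)" by (elim disjE; simp)+
    then show ?thesis unfolding g by (cases "i = h") simp_all
  qed
  have s: "?s + (if W1 = {#} then 0 else n) + (if W2 = {#} then 0 else n) \<le> bnd S hs i + ?G"
    using side_bound[OF bk1] side_bound[OF bk2] G b by simp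
  have f: "size (filter_mset fst ?W) \<le> 1" "(\<exists>y\<in>#?W. fst y) = (i \<in> ending S)"
    using side_fst[OF bk1 PT(1)] side_fst[OF bk2 PT(2)] PP P by auto
  have l: "\<forall>y\<in>#?W. on_lattice d y" if "\<not> (i = h \<and> group_size S > 0)"
    using side_on_lattice[OF bk1] side_on_lattice[OF bk2] that h1 h2 g by auto
  have iTS: "i \<in> trunk S" using iT T by simp
  have ne: "W1 \<noteq> {#} \<or> W2 \<noteq> {#}"
    using iT busok_TrD[OF bk1] busok_TrD[OF bk2] by fastforce
  show ?thesis
  proof (cases "W1 = {#} \<or> W2 = {#}")
    case True
    have "\<exists>p a. ?W = {#(p, a)#}"
      using True iT busok_TrD[OF bk1] busok_TrD[OF bk2] ne by auto
    then obtain p a where pa: "?W = {#(p, a)#}" by blast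
    have "p = (i \<in> ending S)" using f(2) unfolding pa by simp
    then have w: "?W = {#(i \<in> ending S, a)#}" using pa by simp
    have "busok d S hs h i {#(i \<in> ending S, a)#}"
    proof (rule busok_TrI[OF iTS])
      show "a + n \<le> bnd S hs i + ?G" using s ne unfolding w by (auto split: if_splits)
      show "on_lattice d (i \<in> ending S, a)" if "i \<noteq> h \<or> group_size S = 0" using l that unfolding w by auto
    qed
    then show ?thesis using d(1) w by (intro exI[of _ ?W]) auto
  next
    case False
    then have s2: "?s + n + n \<le> bnd S hs i + ?G" using s by simp
    have sH: "?s + n \<le> Hm" using s2 le by (auto split: if_splits)
    have d2: "der t (add_mset (i \<in> ending S, ?s) R')"
      using merge_set[OF d(1) _ f(1)] ne sH d(2,3) unfolding f(2) by auto
    show ?thesis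
    proof (cases "\<forall>y\<in>#?W. on_lattice d y")
      case True
      have n5: "off_lattice (dep (troot t)) R' \<le> 5" using d(2,3) by simp
      obtain a' where a': "der t (add_mset (i \<in> ending S, a') R')" "on_lattice d (i \<in> ending S, a')" "a' < ?s + n"
        using round_up[OF d2 sH n5] d(2) by auto
      have "busok d S hs h i {#(i \<in> ending S, a')#}"
        by (rule busok_TrI[OF iTS]) (use a' s2 in auto)
      then show ?thesis using a'(1,2) by (intro exI[of _ "{#(i \<in> ending S, a')#}"]) (simp add: off_lattice_add_mset)
    next
      case nlat: False
      then have E: "i = h \<and> group_size S > 0" using l by blast
      have "busok d S hs h i {#(i \<in> ending S, ?s)#}"
        by (rule busok_TrI[OF iTS]) (use E s2 in auto)
      moreover have "off_lattice d ?W \<noteq> 0" using nlat off_lattice_0D by blast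
      moreover have "off_lattice d {#(i \<in> ending S, ?s)#} \<le> 1" by (simp add: off_lattice_add_mset)
      moreover have "der t ({#(i \<in> ending S, ?s)#} + R')" using d2 by simp
      ultimately show ?thesis by (metis One_nat_def Suc_leI bot_nat_0.not_eq_extremum le_trans)
    qed
  qed
qed

lemma pend_full:
  assumes "busok d S hs h i W" "i \<notin> trunk S" "i \<notin> pending S \<Longrightarrow> count_list hs i = 0"
  shows "size W \<le> count_list hs i"
    "(\<Sum>y\<in>#W. snd y) + gam * count_list hs i \<le> load (items S) hs i + (min (spent S i) gam + n) * count_list hs i"
proof -
  have "size W \<le> count_list hs i \<and>
    (\<Sum>y\<in>#W. snd y) + gam * count_list hs i \<le> load (items S) hs i + (min (spent S i) gam + n) * count_list hs i"
  proof (cases "i \<in> pending S")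
    case True
    then show ?thesis using assms(1,2) unfolding busok_def by simp
  next
    case False
    then have "W = {#}" using assms(1,2) unfolding busok_def by simp
    then show ?thesis using assms(3)[OF False] by simp
  qed
  then show "size W \<le> count_list hs i"
    "(\<Sum>y\<in>#W. snd y) + gam * count_list hs i \<le> load (items S) hs i + (min (spent S i) gam + n) * count_list hs i"
    by blast+
qed

text \<open>Without a trunk token there is nothing to merge into, and the tokens are only collected.
  Crediting \<open>spent\<close> of both sides to all of them can only weaken the estimate.\<close>

lemma merge_pend:
  assumes bk1: "busok d S1 hs1 h1 i W1" and bk2: "busok d S2 hs2 h2 i W2"
    and c1: "i \<notin> trunk S1" "i \<notin> pending S1 \<Longrightarrow> count_list hs1 i = 0"
    and c2: "i \<notin> trunk S2" "i \<notin> pending S2 \<Longrightarrow> count_list hs2 i = 0"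
    and len: "length hs1 = length (items S1)"
  shows "busok d (join_skeleton S1 S2) (hs1 @ hs2) h i (W1 + W2)"
proof (cases "i \<in> pending S1 \<union> pending S2")
  case True
  let ?n1 = "count_list hs1 i" and ?n2 = "count_list hs2 i"
  have p1: "size W1 \<le> ?n1"
      "(\<Sum>y\<in>#W1. snd y) + gam * ?n1 \<le> load (items S1) hs1 i + (min (spent S1 i) gam + n) * ?n1"
    by (rule pend_full[OF bk1 c1(1)], use c1(2) in blast)+
  have p2: "size W2 \<le> ?n2"
      "(\<Sum>y\<in>#W2. snd y) + gam * ?n2 \<le> load (items S2) hs2 i + (min (spent S2 i) gam + n) * ?n2"
    by (rule pend_full[OF bk2 c2(1)], use c2(2) in blast)+
  have "(min (spent S1 i) gam + n) * ?n1 \<le> (min (spent S1 i + spent S2 i) gam + n) * ?n1"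
    "(min (spent S2 i) gam + n) * ?n2 \<le> (min (spent S1 i + spent S2 i) gam + n) * ?n2"
    by (intro mult_right_mono; simp)+
  then have "(\<Sum>y\<in>#W1 + W2. snd y) + gam * (?n1 + ?n2) \<le> load (items S1 @ items S2) (hs1 @ hs2) i +
      (min (spent S1 i + spent S2 i) gam + n) * (?n1 + ?n2)"
    using p1(2) p2(2) load_append[OF len, of "items S2" hs2 i]
    by (simp only: image_mset_union sum_mset.union add_mult_distrib2; linarith)
  moreover have "size (W1 + W2) \<le> ?n1 + ?n2" using p1(1) p2(1) by simp
  moreover have "\<forall>y\<in>#W1 + W2. \<not> fst y \<and> on_lattice d y"
    using pend_sum(2)[OF bk1 c1(1)] pend_sum(2)[OF bk2 c2(1)] by auto
  ultimately show ?thesis using True c1(1) c2(1) unfolding busok_def by simp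
next
  case False
  then have "W1 = {#}" "W2 = {#}" using bk1 bk2 c1(1) c2(1) unfolding busok_def by simp_all
  then show ?thesis using False c1(1) c2(1) unfolding busok_def by simp
qed

lemma join_Inv0:
  assumes I1: "Inv0 S1" and I2: "Inv0 S2" and G: "group_size S1 = 0 \<or> group_size S2 = 0"
    and x: "open_size S1 < tau" "open_size S2 < tau"
  shows "Inv0 (join_skeleton S1 S2)"
  unfolding Inv0_def
proof (intro conjI)
  let ?S = "join_skeleton S1 S2"
  note D1 = Inv0D[OF I1] and D2 = Inv0D[OF I2]
  show "trunk ?S \<union> pending ?S \<subseteq> {..<k}" "trunk ?S \<inter> pending ?S = {}" "ending ?S \<subseteq> trunk ?S"
    using D1(1-3) D2(1-3) by auto
  show "\<forall>i. i \<notin> trunk ?S \<longrightarrow> own ?S i = 0 \<and> leaves ?S i = 0 \<and> credit ?S i = 0 \<and> group_share ?S i = 0"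
    using D1(4) D2(4) by simp
  show "\<forall>i. i \<notin> trunk ?S \<union> pending ?S \<longrightarrow> open_share ?S i = 0" using D1(5) D2(5) by simp
  show "\<forall>it\<in>set (items ?S). (\<forall>i. i \<notin> trunk ?S \<union> pending ?S \<longrightarrow> snd it i = 0) \<and> sg \<le> fst it \<and>
        fst it \<le> 3 * tau + gam + sg \<and> fst it * tau \<le> (tau + gam) * (\<Sum>i<k. snd it i)"
    using D1(6) D2(6) by simp blast
  show "open_size ?S \<le> (\<Sum>i<k. open_share ?S i)" using D1(7) D2(7) by (simp add: sum.distrib)
  show "open_size ?S < 2 * tau" using x by simp
  show "\<not> has_open ?S \<longrightarrow> open_size ?S = 0" using D1(9) D2(9) by simp
  show "group_size ?S \<le> (\<Sum>i<k. group_share ?S i)" using D1(10) D2(10) by (simp add: sum.distrib)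
  show "group_size ?S < tau" using D1(11) D2(11) G by auto
  show "\<forall>i<k. own ?S i + osum (items ?S) i + open_share ?S i + group_share ?S i \<le> spent ?S i + sg * credit ?S i"
  proof (intro allI impI)
    fix i assume "i < k"
    then show "own ?S i + osum (items ?S) i + open_share ?S i + group_share ?S i \<le> spent ?S i + sg * credit ?S i"
      using D1(12)[of i] D2(12)[of i] by (simp add: algebra_simps)
  qed
  show "\<forall>i. credit ?S i \<le> 2 * leaves ?S i" using D1(13) D2(13) by (simp add: add_mono)
qed

lemma absent_count:
  assumes "Inv0 S" "hosts (items S) hs" "i \<notin> trunk S \<union> pending S"
  shows "count_list hs i = 0"
  using hosts_count[OF assms(2)] Inv0D(6)[OF assms(1)] assms(3) by blast

lemma adm_union:
  "adm d A \<Longrightarrow> adm d B \<Longrightarrow> size (A + B) \<le> Nm \<Longrightarrow> off_lattice d (A + B) \<le> 6 \<Longrightarrow> adm d (A + B)"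
  by (auto simp: adm_def)

text \<open>If only one side has a trunk, \<open>h\<close> belongs to it and may go on carrying its
  group. If both have one, the groups are empty and \<open>h1\<close>, \<open>h2\<close> may differ
  from \<open>h\<close>. The two open pools become one of size less than \<open>2 * tau\<close>,
  which \<open>normalise\<close> deals with afterwards.\<close>

lemma join:
  assumes I1: "Inv t S1" and I2: "Inv t' S2" and rt: "troot t' = troot t"
    and PP: "ending S1 \<inter> ending S2 = {}"
    and G: "trunk S1 \<noteq> {} \<Longrightarrow> trunk S2 \<noteq> {} \<Longrightarrow> group_size S1 = 0 \<and> group_size S2 = 0"
    and x: "open_size S1 < tau" "open_size S2 < tau"
  shows "Inv (Join t t') (join_skeleton S1 S2)"
proof -
  let ?S = "join_skeleton S1 S2" and ?d = "dep (troot t)"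
  have I01: "Inv0 S1" and P1: "plan t S1" and I02: "Inv0 S2" and P2: "plan t' S2"
    using I1 I2 by (simp_all add: Inv_def)
  have G': "group_size S1 = 0 \<or> group_size S2 = 0"
    using G no_trunk_no_group[OF I01] no_trunk_no_group[OF I02]
    by (cases "trunk S1 = {}"; cases "trunk S2 = {}") simp_all
  note D1 = Inv0D[OF I01] and D2 = Inv0D[OF I02]
  have I0: "Inv0 ?S" by (rule join_Inv0[OF I01 I02 G' x])
  moreover have "plan (Join t t') ?S"
    unfolding plan_def
  proof (intro allI impI)
    fix hs h assume hs: "hosts (items ?S) hs" and g: "good ?S hs" and h: "trunk ?S \<noteq> {} \<longrightarrow> h \<in> trunk ?S"
    have "hosts (items S1 @ items S2) hs" using hs by simp
    then obtain hs1 hs2 where hh: "hs = hs1 @ hs2" "hosts (items S1) hs1" "hosts (items S2) hs2"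
      by (rule hosts_append)
    have len: "length hs1 = length (items S1)" using hh(2) by (simp add: hosts_def)
    have b: "bnd ?S hs i = bnd S1 hs1 i + bnd S2 hs2 i" for i
      using hh(1) len by (simp add: bnd_def load_append algebra_simps)
    have g1: "good S1 hs1" by (rule good_mono[OF g]) (use b hh(1) in auto)
    have g2: "good S2 hs2" by (rule good_mono[OF g]) (use b hh(1) in auto)
    define h1 where "h1 = (if h \<in> trunk S1 then h else (SOME i. i \<in> trunk S1))"
    define h2 where "h2 = (if h \<in> trunk S2 then h else (SOME i. i \<in> trunk S2))"
    have h1T: "h1 \<in> trunk S1" if "trunk S1 \<noteq> {}" using that some_in_eq[of "trunk S1"] by (simp add: h1_def)
    have h2T: "h2 \<in> trunk S2" if "trunk S2 \<noteq> {}" using that some_in_eq[of "trunk S2"] by (simp add: h2_def)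
    have hU: "h \<in> trunk S1 \<union> trunk S2" if "trunk S1 \<union> trunk S2 \<noteq> {}" using h that by simp
    have h1h: "h1 = h" if "group_size S1 > 0"
    proof -
      have "trunk S1 \<noteq> {}" using that no_trunk_no_group[OF I01] by auto
      moreover from this have "trunk S2 = {}" using G that by auto
      ultimately show ?thesis using hU by (simp add: h1_def)
    qed
    have h2h: "h2 = h" if "group_size S2 > 0"
    proof -
      have "trunk S2 \<noteq> {}" using that no_trunk_no_group[OF I02] by auto
      moreover from this have "trunk S1 = {}" using G that by auto
      ultimately show ?thesis using hU by (simp add: h2_def)
    qed
    obtain W1 v1 where W1: "der t ((\<Sum>i<k. W1 i) + (if has_open S1 then {#(False, v1)#} else {#}))" "v1 \<le> open_size S1"
      "\<forall>i<k. busok ?d S1 hs1 h1 i (W1 i)"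
      by (rule planD[OF P1 hh(2) g1 h1T])
    obtain W2 v2 where W2: "der t' ((\<Sum>i<k. W2 i) + (if has_open S2 then {#(False, v2)#} else {#}))" "v2 \<le> open_size S2"
      "\<forall>i<k. busok ?d S2 hs2 h2 i (W2 i)"
      by (rule planD[OF P2 hh(3) g2 h2T, unfolded rt])
    let ?X1 = "if has_open S1 then {#(False, v1)#} else {#}" and ?X2 = "if has_open S2 then {#(False, v2)#} else {#}"
    have nX: "off_lattice ?d ?X1 \<le> 1" "off_lattice ?d ?X2 \<le> 1" by (simp_all add: off_lattice_add_mset)
    have nW: "off_lattice ?d (\<Sum>i<k. W1 i) \<le> 1" "off_lattice ?d (\<Sum>i<k. W2 i) \<le> 1"
      using off_lattice_sum_busok[OF W1(3)] off_lattice_sum_busok[OF W2(3)] by (auto split: if_splits)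
    have sz: "size (\<Sum>i<k. W1 i) \<le> k + length hs1" "size (\<Sum>i<k. W2 i) \<le> k + length hs2"
      using size_sum_busok[OF W1(3)] size_sum_busok[OF W2(3)] by auto
    have Nm: "3 * k + length hs + 4 \<le> Nm" using g by (simp add: good_def)
    have a1: "adm ?d ((\<Sum>i<k. W1 i) + ?X1)" by (rule der_adm[OF W1(1)])
    have a2: "adm ?d ((\<Sum>i<k. W2 i) + ?X2)" using der_adm[OF W2(1)] unfolding rt .
    have sX: "size ?X1 \<le> 1" "size ?X2 \<le> 1" by simp_all
    have "size ((\<Sum>i<k. W1 i) + ?X1 + ((\<Sum>i<k. W2 i) + ?X2)) \<le> Nm"
      unfolding size_union using sz sX Nm hh(1) by simp
    moreover have "off_lattice ?d ((\<Sum>i<k. W1 i) + ?X1 + ((\<Sum>i<k. W2 i) + ?X2)) \<le> 4"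
      unfolding off_lattice_union using nX nW by linarith
    ultimately have ad: "adm ?d ((\<Sum>i<k. W1 i) + ?X1 + ((\<Sum>i<k. W2 i) + ?X2))"
      by (intro adm_union[OF a1 a2]) linarith+
    have D0: "der (Join t t') ((\<Sum>i<k. W1 i) + ?X1 + ((\<Sum>i<k. W2 i) + ?X2))"
      by (rule der.Join[OF W1(1) W2(1) ad])
    have tH: "4 * tau \<le> Hm" using g by (simp add: good_def)
    define v where "v = (if has_open S1 then v1 else 0) + (if has_open S2 then v2 else 0)"
    let ?X = "if has_open ?S then {#(False, v)#} else {#}"
    let ?Y = "\<lambda>i. W1 i + W2 i"
    have vle: "v \<le> open_size ?S" using W1(2) W2(2) D1(9) D2(9) by (simp add: v_def)
    have D: "der (Join t t') ((\<Sum>i<k. ?Y i) + ?X)"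
    proof (cases "has_open S1 \<and> has_open S2")
      case True
      have eq: "(\<Sum>i<k. W1 i) + ?X1 + ((\<Sum>i<k. W2 i) + ?X2) = add_mset (False, v1) ({#(False, v2)#} + (\<Sum>i<k. ?Y i))"
        using True by (simp add: sum.distrib)
      have "der (Join t t') (add_mset (fst (False, v1), snd (False, v1) + (\<Sum>y\<in>#{#(False, v2)#}. snd y)) (\<Sum>i<k. ?Y i))"
      proof (rule merge_all)
        show "der (Join t t') (add_mset (False, v1) ({#(False, v2)#} + (\<Sum>i<k. ?Y i)))" using D0 unfolding eq .
        show "snd (False, v1) + (\<Sum>y\<in>#{#(False, v2)#}. snd y) \<le> Hm"
          using W1(2) W2(2) x tH by simp
        show "off_lattice (dep (troot (Join t t'))) ({#(False, v2)#} + (\<Sum>i<k. ?Y i)) \<le> 5"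
          using nW by (simp add: off_lattice_add_mset sum.distrib)
      qed simp
      then show ?thesis using True by (simp add: v_def)
    next
      case False
      then have "(\<Sum>i<k. W1 i) + ?X1 + ((\<Sum>i<k. W2 i) + ?X2) = (\<Sum>i<k. ?Y i) + ?X"
        by (auto simp: v_def sum.distrib)
      then show ?thesis using D0 by simp
    qed
    have nX': "off_lattice ?d ?X \<le> 1" by (simp add: off_lattice_add_mset)
    have n5: "off_lattice ?d ((\<Sum>i<k. ?Y i) + ?X) \<le> 5"
      unfolding sum.distrib off_lattice_union using nW nX' by linarith
    have step: "\<exists>V. busok ?d ?S hs h i V \<and> der (Join t t') (V + R') \<and> off_lattice ?d V \<le> off_lattice ?d (?Y i)"
      if i: "i < k" and d: "der (Join t t') (?Y i + R')" and nn: "off_lattice ?d (?Y i + R') \<le> 5" for i R'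
    proof -
      have bk1: "busok ?d S1 hs1 h1 i (W1 i)" and bk2: "busok ?d S2 hs2 h2 i (W2 i)"
        using W1(3) W2(3) i by blast+
      show ?thesis
      proof (cases "i \<in> trunk S1 \<union> trunk S2")
        case True
        show ?thesis
        proof (rule merge_bus[OF bk1 bk2 D1(3) D2(3) True])
          show "\<not> (i \<in> ending S1 \<and> i \<in> ending S2)" using PP by blast
          show "bnd ?S hs i = bnd S1 hs1 i + bnd S2 hs2 i" by (rule b)
          show "bnd ?S hs i + group_size ?S \<le> Hm"
            using goodD[OF g i] Inv0D(11)[OF I0] by linarith
        qed (use h1h h2h d nn in auto)
      next
        case False
        then have "busok ?d ?S hs h i (?Y i)"
          unfolding hh(1) using absent_count[OF I01 hh(2)] absent_count[OF I02 hh(3)]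
          by (intro merge_pend[OF bk1 bk2 _ _ _ _ len]) auto
        then show ?thesis using d by blast
      qed
    qed
    obtain V where V: "\<forall>i<k. busok ?d ?S hs h i (V i)" "der (Join t t') ((\<Sum>i<k. V i) + ?X)"
      using der_family[OF D, of ?d 5 "busok ?d ?S hs h"] step n5 by blast
    show "\<exists>W vx. der (Join t t') ((\<Sum>i<k. W i) + (if has_open ?S then {#(False, vx)#} else {#})) \<and> vx \<le> open_size ?S \<and>
      (\<forall>i<k. busok (dep (troot (Join t t'))) ?S hs h i (W i))"
      unfolding troot.simps by (rule exI[of _ V], rule exI[of _ v], rule conjI[OF V(2) conjI[OF vle V(1)]])
  qed
  ultimately show ?thesis by (simp add: Inv_def)
qed

end

section \<open>Rounding a fractional assignment\<close>

text \<open>There are more unknowns than equations; the proof is Gaussian elimination, one unknown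
  per equation.\<close>

lemma homogeneous_solution:
  fixes c :: "'j \<Rightarrow> 'e \<Rightarrow> real"
  assumes "finite J" "finite E" "card J < card E"
  shows "\<exists>d. (\<exists>e\<in>E. d e \<noteq> 0) \<and> (\<forall>j\<in>J. (\<Sum>e\<in>E. c j e * d e) = 0)"
  using assms
proof (induction J arbitrary: E c rule: finite_induct)
  case empty
  then obtain e where "e \<in> E" by fastforce
  then show ?case by (intro exI[of _ "\<lambda>_. 1"]) auto
next
  case (insert j J)
  show ?case
  proof (cases "\<forall>e\<in>E. c j e = 0")
    case True
    have "card J < card E" using insert.hyps insert.prems by simp
    then obtain d where "\<exists>e\<in>E. d e \<noteq> 0" "\<forall>l\<in>J. (\<Sum>e\<in>E. c l e * d e) = 0"
      using insert.IH[OF insert.prems(1)] by blast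
    moreover have "(\<Sum>e\<in>E. c j e * d e) = 0" using True by (intro sum.neutral) auto
    ultimately show ?thesis by blast
  next
    case False
    then obtain e0 where e0: "e0 \<in> E" "c j e0 \<noteq> 0" by blast
    let ?E = "E - {e0}"
    have "card J < card ?E" using insert e0 by simp
    then obtain d where d: "\<exists>e\<in>?E. d e \<noteq> 0"
      "\<forall>l\<in>J. (\<Sum>e\<in>?E. (c l e - c l e0 * c j e / c j e0) * d e) = 0"
      using insert.IH[of ?E "\<lambda>l e. c l e - c l e0 * c j e / c j e0"] insert.prems by auto
    \<comment> \<open>Equation \<open>j\<close> is solved for the unknown \<open>e0\<close>;
      \<open>d\<close> solves the other equations after this substitution.\<close>
    define d' where "d' = d(e0 := - (\<Sum>e\<in>?E. c j e * d e) / c j e0)"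
    have s: "(\<Sum>e\<in>E. c l e * d' e) = c l e0 * d' e0 + (\<Sum>e\<in>?E. c l e * d e)" for l
      using e0 insert.prems by (subst sum.remove[of _ e0]) (auto simp: d'_def intro!: sum.cong)
    have d0: "d' e0 = - (\<Sum>e\<in>?E. c j e * d e) / c j e0" by (simp add: d'_def)
    have "(\<Sum>e\<in>E. c l e * d' e) = 0" if l: "l \<in> insert j J" for l
    proof (cases "l = j")
      case True
      show ?thesis unfolding s True d0 using e0 by simp
    next
      case False
      then have "(\<Sum>e\<in>?E. (c l e - c l e0 * c j e / c j e0) * d e) = 0" using d l by blast
      moreover have "(\<Sum>e\<in>?E. (c l e - c l e0 * c j e / c j e0) * d e)
        = (\<Sum>e\<in>?E. c l e * d e) - c l e0 / c j e0 * (\<Sum>e\<in>?E. c j e * d e)"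
        by (simp add: sum_subtractf sum_distrib_left algebra_simps)
      ultimately show ?thesis unfolding s d0 by simp
    qed
    moreover have "\<exists>e\<in>E. d' e \<noteq> 0" using d(1) by (auto simp: d'_def)
    ultimately show ?thesis by blast
  qed
qed

lemma card_ge_2:
  assumes "finite A" "a \<in> A" "\<not> (\<forall>x\<in>A. x = a)"
  shows "card A \<ge> 2"
proof -
  obtain x where x: "x \<in> A" "x \<noteq> a" using assms(3) by blast
  then have "card {a, x} \<le> card A" using assms by (intro card_mono) auto
  then show ?thesis using x by simp
qed

text \<open>Induction on the size of the support. If no item has a unique bus and no bus has a unique item,
  there are at most as many items and used buses as entries of the support. The sum over the items equals the sum
  over the buses, so one bus constraint is redundant; there is a nonzero direction that keeps all the sums,
  and one can move along it until an entry vanishes.\<close>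

lemma generalized_assignment:
  fixes y :: "'p \<Rightarrow> 'b \<Rightarrow> real" and S :: real
  assumes "finite P" "finite B" "S \<ge> 0"
    and "\<And>p b. p \<in> P \<Longrightarrow> b \<in> B \<Longrightarrow> 0 \<le> y p b"
    and "\<And>p. p \<in> P \<Longrightarrow> s p > 0 \<and> s p \<le> S \<and> (\<Sum>b\<in>B. y p b) = s p"
  shows "\<exists>f. (\<forall>p\<in>P. f p \<in> B \<and> y p (f p) > 0) \<and>
    (\<forall>b\<in>B. (\<Sum>p\<in>{p\<in>P. f p = b}. s p) \<le> (\<Sum>p\<in>P. y p b) + S)"
  using assms
proof (induction "card {(p, b). p \<in> P \<and> b \<in> B \<and> y p b > 0}" arbitrary: P y rule: less_induct)
  case less
  let ?supp = "\<lambda>P (y :: 'p \<Rightarrow> 'b \<Rightarrow> real). {(p, b). p \<in> P \<and> b \<in> B \<and> y p b > 0}"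
  have fin: "finite (?supp P' y)" if "finite P'" for P' and y :: "'p \<Rightarrow> 'b \<Rightarrow> real"
    by (rule finite_subset[of _ "P' \<times> B"]) (use that less.prems in auto)
  have smaller: "card (?supp (P - {p}) y) < card (?supp P y)" if "p \<in> P" "b \<in> B" "y p b > 0" for p b
  proof (rule psubset_card_mono[OF fin[OF less.prems(1)]])
    have "(p, b) \<in> ?supp P y" "(p, b) \<notin> ?supp (P - {p}) y" using that by simp_all
    moreover have "?supp (P - {p}) y \<subseteq> ?supp P y" by blast
    ultimately show "?supp (P - {p}) y \<subset> ?supp P y" by blast
  qed
  show ?case
  proof (cases "P = {}")
    case True
    then show ?thesis using less.prems by auto
  next
    case False
    have deg: "\<exists>b\<in>B. y p b > 0" if p: "p \<in> P" for p
    proof (rule ccontr)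
      assume "\<not> ?thesis"
      then have "(\<Sum>b\<in>B. y p b) \<le> 0" by (intro sum_nonpos) auto
      then show False using less.prems(5)[OF p] by simp
    qed
    consider (bus) b p where "b \<in> B" "p \<in> P" "y p b > 0" "\<forall>q\<in>P. y q b > 0 \<longrightarrow> q = p"
      | (item) p b where "p \<in> P" "b \<in> B" "y p b > 0" "\<forall>c\<in>B. y p c > 0 \<longrightarrow> c = b"
      | (cyc) "\<And>p. p \<in> P \<Longrightarrow> card {b\<in>B. y p b > 0} \<ge> 2"
          "\<And>b. b \<in> B \<Longrightarrow> (\<exists>p\<in>P. y p b > 0) \<Longrightarrow> card {p\<in>P. y p b > 0} \<ge> 2"
    proof -
      show ?thesis
      proof (cases "(\<exists>b\<in>B. \<exists>p\<in>P. y p b > 0 \<and> (\<forall>q\<in>P. y q b > 0 \<longrightarrow> q = p)) \<or>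
          (\<exists>p\<in>P. \<exists>b\<in>B. y p b > 0 \<and> (\<forall>c\<in>B. y p c > 0 \<longrightarrow> c = b))")
        case True
        then show ?thesis using bus item by blast
      next
        case False
        show ?thesis
        proof (rule cyc)
          fix p assume p: "p \<in> P"
          then obtain b where "b \<in> B" "y p b > 0" using deg by blast
          then have "\<not> (\<forall>c\<in>B. y p c > 0 \<longrightarrow> c = b)" using False p by blast
          then show "card {b\<in>B. y p b > 0} \<ge> 2"
            using \<open>b \<in> B\<close> \<open>y p b > 0\<close> less.prems(2) by (intro card_ge_2[of _ b]) auto
        next
          fix b assume b: "b \<in> B" "\<exists>p\<in>P. y p b > 0"
          then obtain p where p: "p \<in> P" "y p b > 0" by blast
          then have "\<not> (\<forall>q\<in>P. y q b > 0 \<longrightarrow> q = p)" using False b(1) by blast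
          then show "card {p\<in>P. y p b > 0} \<ge> 2"
            using p less.prems(1) by (intro card_ge_2[of _ p]) auto
        qed
      qed
    qed
    then show ?thesis
    proof cases
      case bus
      have lt: "card (?supp (P - {p}) y) < card (?supp P y)"
        by (rule smaller[OF bus(2,1,3)])
      have "\<exists>f. (\<forall>q\<in>P - {p}. f q \<in> B \<and> y q (f q) > 0) \<and>
          (\<forall>c\<in>B. (\<Sum>q\<in>{q\<in>P - {p}. f q = c}. s q) \<le> (\<Sum>q\<in>P - {p}. y q c) + S)"
        by (rule less.hyps[OF lt]) (use less.prems in simp_all)
      then obtain f where f: "\<forall>q\<in>P - {p}. f q \<in> B \<and> y q (f q) > 0"
        "\<forall>c\<in>B. (\<Sum>q\<in>{q\<in>P - {p}. f q = c}. s q) \<le> (\<Sum>q\<in>P - {p}. y q c) + S" by (elim exE conjE)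
      \<comment> \<open>Only \<open>p\<close> has a share on \<open>b\<close>, and assignments
        follow positive shares. So \<open>b\<close> gets nothing but \<open>p\<close>, a load of at
        most \<open>S\<close>.\<close>
      have fb: "f q \<noteq> b" if "q \<in> P - {p}" for q using f(1) bus(4) that by (metis DiffE singletonI)
      show ?thesis
      proof (intro exI[of _ "f(p := b)"] conjI ballI)
        fix q assume "q \<in> P"
        then show "(f(p := b)) q \<in> B" "y q ((f(p := b)) q) > 0" using f(1) bus(1-3) by (cases "q = p"; simp)+
      next
        fix c assume c: "c \<in> B"
        have m: "(\<Sum>q\<in>P - {p}. y q c) \<le> (\<Sum>q\<in>P. y q c)"
          using less.prems c by (intro sum_mono2) auto
        show "(\<Sum>q\<in>{q\<in>P. (f(p := b)) q = c}. s q) \<le> (\<Sum>q\<in>P. y q c) + S"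
        proof (cases "c = b")
          case True
          then have "{q\<in>P. (f(p := b)) q = c} = {p}" using fb bus(2) by auto
          moreover have "(\<Sum>q\<in>P. y q c) \<ge> 0" using less.prems c by (intro sum_nonneg) auto
          ultimately show ?thesis using less.prems(5)[OF bus(2)] by simp
        next
          case False
          then have "{q\<in>P. (f(p := b)) q = c} = {q\<in>P - {p}. f q = c}" by auto
          then show ?thesis using f(2) c m by fastforce
        qed
      qed
    next
      case item
      have lt: "card (?supp (P - {p}) y) < card (?supp P y)"
        by (rule smaller[OF item(1-3)])
      have "\<exists>f. (\<forall>q\<in>P - {p}. f q \<in> B \<and> y q (f q) > 0) \<and>
          (\<forall>c\<in>B. (\<Sum>q\<in>{q\<in>P - {p}. f q = c}. s q) \<le> (\<Sum>q\<in>P - {p}. y q c) + S)"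
        by (rule less.hyps[OF lt]) (use less.prems in simp_all)
      then obtain f where f: "\<forall>q\<in>P - {p}. f q \<in> B \<and> y q (f q) > 0"
        "\<forall>c\<in>B. (\<Sum>q\<in>{q\<in>P - {p}. f q = c}. s q) \<le> (\<Sum>q\<in>P - {p}. y q c) + S" by (elim exE conjE)
      have "y p c = 0" if "c \<in> B - {b}" for c
      proof -
        have "c \<in> B" "c \<noteq> b" using that by simp_all
        then have "\<not> y p c > 0" "y p c \<ge> 0" using item(4) less.prems(4)[OF item(1)] by blast+
        then show ?thesis by simp
      qed
      then have "(\<Sum>c\<in>B. y p c) = (\<Sum>c\<in>{b}. y p c)"
        using item(2) less.prems(2) by (intro sum.mono_neutral_right) simp_all
      \<comment> \<open>Item \<open>p\<close> lies entirely on \<open>b\<close>; assigning it there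
        adds exactly its fractional load, and the excess \<open>S\<close> remains available for the
        other items.\<close>
      then have yp: "y p b = s p" using less.prems(5)[OF item(1)] by simp
      show ?thesis
      proof (intro exI[of _ "f(p := b)"] conjI ballI)
        fix q assume "q \<in> P"
        then show "(f(p := b)) q \<in> B" "y q ((f(p := b)) q) > 0" using f(1) item(1-3) by (cases "q = p"; simp)+
      next
        fix c assume c: "c \<in> B"
        have r: "(\<Sum>q\<in>P. y q c) = y p c + (\<Sum>q\<in>P - {p}. y q c)"
          using less.prems item by (subst sum.remove[of _ p]) auto
        show "(\<Sum>q\<in>{q\<in>P. (f(p := b)) q = c}. s q) \<le> (\<Sum>q\<in>P. y q c) + S"
        proof (cases "c = b")
          case True
          then have "{q\<in>P. (f(p := b)) q = c} = insert p {q\<in>P - {p}. f q = c}" using item(1) by auto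
          then show ?thesis using f(2) c r yp True less.prems(1) by fastforce
        next
          case False
          then have "{q\<in>P. (f(p := b)) q = c} = {q\<in>P - {p}. f q = c}" by auto
          then show ?thesis using f(2) c r less.prems(4)[OF item(1) c] by fastforce
        qed
      qed
    next
      case cyc
      let ?E = "?supp P y"
      define B' where "B' = {b\<in>B. \<exists>p\<in>P. y p b > 0}"
      have fE: "finite ?E" using fin less.prems by blast
      have fB': "finite B'" using less.prems by (simp add: B'_def)
      have "?E = (SIGMA p:P. {b\<in>B. y p b > 0})" by auto
      then have "card ?E = (\<Sum>p\<in>P. card {b\<in>B. y p b > 0})"
        using less.prems by (simp add: card_SigmaI)
      also have "\<dots> \<ge> (\<Sum>p\<in>P. 2)" using cyc(1) by (intro sum_mono)
      finally have c1: "2 * card P \<le> card ?E" by simp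
      have "card ?E = card (prod.swap ` ?E)" by (rule card_image[symmetric]) (auto simp: inj_on_def)
      also have "prod.swap ` ?E = (SIGMA b:B'. {p\<in>P. y p b > 0})" by (auto simp: B'_def)
      also have "card \<dots> = (\<Sum>b\<in>B'. card {p\<in>P. y p b > 0})"
        using less.prems fB' by (simp add: card_SigmaI)
      finally have "card ?E = (\<Sum>b\<in>B'. card {p\<in>P. y p b > 0})" .
      also have "\<dots> \<ge> (\<Sum>b\<in>B'. 2)" using cyc(2) by (intro sum_mono) (auto simp: B'_def)
      finally have c2: "2 * card B' \<le> card ?E" by simp
      obtain p0 b0 where p0: "p0 \<in> P" "b0 \<in> B" "y p0 b0 > 0" using False deg by blast
      then have b0: "b0 \<in> B'" by (auto simp: B'_def)
      let ?J = "Inl ` P \<union> Inr ` (B' - {b0})"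
      let ?c = "\<lambda>j (e :: 'p \<times> 'b). case j of Inl p \<Rightarrow> (if fst e = p then 1 else 0) | Inr b \<Rightarrow> (if snd e = b then 1 else (0::real))"
      have "card ?J = card P + card (B' - {b0})"
        using less.prems fB' by (subst card_Un_disjoint) (auto simp: card_image)
      also have "\<dots> < card P + card B'" using card_Diff1_less[OF fB' b0] by linarith
      finally have "card ?J < card ?E" using c1 c2 by simp
      then obtain d where d: "\<exists>e\<in>?E. d e \<noteq> 0" "\<forall>j\<in>?J. (\<Sum>e\<in>?E. ?c j e * d e) = 0"
        using homogeneous_solution[of ?J ?E ?c] fE fB' less.prems(1) by blast
      define D where "D p b = (if (p, b) \<in> ?E then d (p, b) else 0)" for p b
      have tot: "(\<Sum>e\<in>?E. g e * d e) = (\<Sum>p\<in>P. \<Sum>b\<in>B. g (p, b) * D p b)" for g :: "'p \<times> 'b \<Rightarrow> real"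
      proof -
        have "(\<Sum>e\<in>?E. g e * d e) = (\<Sum>e\<in>P \<times> B. g e * (if e \<in> ?E then d e else 0))"
          using less.prems by (intro sum.mono_neutral_cong_left) auto
        also have "\<dots> = (\<Sum>p\<in>P. \<Sum>b\<in>B. g (p, b) * D p b)"
          unfolding sum.cartesian_product by (intro sum.cong) (auto simp: D_def split: if_splits)
        finally show ?thesis .
      qed
      have row: "(\<Sum>b\<in>B. D p b) = 0" if p: "p \<in> P" for p
      proof -
        have "(\<Sum>e\<in>?E. ?c (Inl p) e * d e) = 0" using d(2) p by blast
        then have "(\<Sum>q\<in>P. \<Sum>b\<in>B. ?c (Inl p) (q, b) * D q b) = 0" unfolding tot .
        also have "(\<Sum>q\<in>P. \<Sum>b\<in>B. ?c (Inl p) (q, b) * D q b) = (\<Sum>q\<in>P. if q = p then (\<Sum>b\<in>B. D p b) else 0)"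
          by (intro sum.cong) auto
        finally show ?thesis using p less.prems by simp
      qed
      have col': "(\<Sum>p\<in>P. D p b) = 0" if b: "b \<in> B" "b \<noteq> b0" for b
      proof (cases "b \<in> B'")
        case True
        then have "(\<Sum>e\<in>?E. ?c (Inr b) e * d e) = 0" using d(2) b by blast
        then have "(\<Sum>q\<in>P. \<Sum>c\<in>B. ?c (Inr b) (q, c) * D q c) = 0" unfolding tot .
        also have "(\<Sum>q\<in>P. \<Sum>c\<in>B. ?c (Inr b) (q, c) * D q c) = (\<Sum>q\<in>P. \<Sum>c\<in>B. if c = b then D q b else 0)"
          by (intro sum.cong) auto
        finally show ?thesis using b less.prems by simp
      next
        case False
        then show ?thesis using b by (intro sum.neutral) (auto simp: D_def B'_def)
      qed
      have "(\<Sum>p\<in>P. D p b0) = (\<Sum>b\<in>B. \<Sum>p\<in>P. D p b)"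
        using col' p0 less.prems by (subst sum.remove[of B b0]) auto
      also have "\<dots> = (\<Sum>p\<in>P. \<Sum>b\<in>B. D p b)" by (rule sum.swap)
      also have "\<dots> = 0" using row by simp
      finally have col: "(\<Sum>p\<in>P. D p b) = 0" if "b \<in> B" for b using col' that by (cases "b = b0") auto
      \<comment> \<open>Each row of \<open>D\<close> sums to 0 and some entry is nonzero, so
        positive and negative entries occur together.\<close>
      have "\<exists>p\<in>P. \<exists>b\<in>B. D p b < 0"
      proof (rule ccontr)
        assume n: "\<not> ?thesis"
        obtain p b where pb: "(p, b) \<in> ?E" "d (p, b) \<noteq> 0" using d(1) by auto
        then have "\<not> D p b < 0" "D p b \<noteq> 0" using n by (simp add: not_less) (use pb in \<open>simp add: D_def\<close>)
        then have "D p b > 0" by linarith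
        moreover have "D p b \<le> (\<Sum>b\<in>B. D p b)"
          using n pb less.prems by (intro member_le_sum) (auto simp: not_less)
        ultimately show False using row pb by auto
      qed
      define N where "N = {(p, b). p \<in> P \<and> b \<in> B \<and> D p b < 0}"
      have fN: "finite N" by (rule finite_subset[of _ "P \<times> B"]) (use less.prems in \<open>auto simp: N_def\<close>)
      have nN: "N \<noteq> {}" using \<open>\<exists>p\<in>P. \<exists>b\<in>B. D p b < 0\<close> by (auto simp: N_def)
      \<comment> \<open>The largest step along \<open>D\<close> that keeps all shares nonnegative;
        where the minimum is attained, a share vanishes.\<close>
      define t where "t = Min ((\<lambda>(p, b). y p b / (- D p b)) ` N)"
      have tle: "t \<le> y p b / (- D p b)" if "(p, b) \<in> N" for p b
        unfolding t_def using that fN by (intro Min_le) force+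
      have "t \<in> (\<lambda>(p, b). y p b / (- D p b)) ` N" unfolding t_def using fN nN by (intro Min_in) auto
      then obtain p1 b1 where e1: "(p1, b1) \<in> N" "t = y p1 b1 / (- D p1 b1)" by auto
      have t0: "t \<ge> 0"
        unfolding e1(2) by (rule divide_nonneg_pos) (use e1(1) less.prems(4) in \<open>auto simp: N_def\<close>)
      define z where "z p b = y p b + t * D p b" for p b
      have z0: "z p b \<ge> 0" if "p \<in> P" "b \<in> B" for p b
      proof (cases "D p b < 0")
        case True
        then have "t \<le> y p b / (- D p b)" using that tle by (auto simp: N_def)
        then have "t * (- D p b) \<le> y p b" by (subst (asm) pos_le_divide_eq) (use True in simp_all)
        then show ?thesis by (simp add: z_def)
      next
        case False
        then show ?thesis using t0 less.prems(4)[OF that] by (simp add: z_def)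
      qed
      have zy: "y p b > 0" if "p \<in> P" "b \<in> B" "z p b > 0" for p b
        using that less.prems(4)[OF that(1,2)] by (auto simp: z_def D_def split: if_splits)
      have "z p1 b1 = 0" using e1 by (simp add: z_def N_def)
      moreover have "y p1 b1 > 0" using e1 by (auto simp: N_def D_def split: if_splits)
      ultimately have "(p1, b1) \<in> ?E" "(p1, b1) \<notin> ?supp P z" using e1(1) by (auto simp: N_def)
      moreover have "?supp P z \<subseteq> ?E" using zy by blast
      ultimately have "?supp P z \<subset> ?E" by blast
      then have lt: "card (?supp P z) < card ?E" using fE by (intro psubset_card_mono)
      have "(\<Sum>b\<in>B. z p b) = s p" if "p \<in> P" for p
        using row[OF that] less.prems(5)[OF that] by (simp add: z_def sum.distrib sum_distrib_left[symmetric])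
      then have "\<exists>f. (\<forall>p\<in>P. f p \<in> B \<and> z p (f p) > 0) \<and>
          (\<forall>b\<in>B. (\<Sum>p\<in>{p\<in>P. f p = b}. s p) \<le> (\<Sum>p\<in>P. z p b) + S)"
        by (intro less.hyps[OF lt]) (use less.prems z0 in simp_all)
      then obtain f where f: "\<forall>p\<in>P. f p \<in> B \<and> z p (f p) > 0"
        "\<forall>b\<in>B. (\<Sum>p\<in>{p\<in>P. f p = b}. s p) \<le> (\<Sum>p\<in>P. z p b) + S" by (elim exE conjE)
      have "(\<Sum>p\<in>P. z p b) = (\<Sum>p\<in>P. y p b)" if "b \<in> B" for b
        using col[OF that] by (simp add: z_def sum.distrib sum_distrib_left[symmetric])
      then show ?thesis using f zy by (intro exI[of _ f]) auto
    qed
  qed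
qed

text \<open>The shares of an item may sum to more than its weight. Scaling them down makes them a
  fractional assignment and only lowers the resulting bound.\<close>

lemma generalized_assignment_nat:
  fixes z :: "'p \<Rightarrow> 'b \<Rightarrow> nat" and S :: nat
  assumes "finite P" "finite B" and "\<And>p. p \<in> P \<Longrightarrow> s p > 0 \<and> s p \<le> S \<and> s p \<le> (\<Sum>b\<in>B. z p b)"
  shows "\<exists>f. (\<forall>p\<in>P. f p \<in> B \<and> z p (f p) > 0) \<and>
    (\<forall>b\<in>B. (\<Sum>p\<in>{p\<in>P. f p = b}. s p) \<le> (\<Sum>p\<in>P. z p b) + S)"
proof -
  define y where "y p b = real (z p b) * (real (s p) / real (\<Sum>b\<in>B. z p b))" for p b
  have pos: "(\<Sum>b\<in>B. z p b) > 0" if "p \<in> P" for p using assms(3)[OF that] by linarith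
  have "(\<Sum>b\<in>B. y p b) = real (s p)" if "p \<in> P" for p
    unfolding y_def sum_distrib_right[symmetric] of_nat_sum[symmetric] using pos[OF that] by (simp del: of_nat_sum)
  moreover have y0: "0 \<le> y p b" for p b by (simp add: y_def sum_nonneg)
  ultimately obtain f where f: "\<forall>p\<in>P. f p \<in> B \<and> y p (f p) > 0"
    "\<forall>b\<in>B. (\<Sum>p\<in>{p\<in>P. f p = b}. real (s p)) \<le> (\<Sum>p\<in>P. y p b) + real S"
    using generalized_assignment[OF assms(1,2), of "real S" y "\<lambda>p. real (s p)"] assms(3) y0
    by auto
  have le: "y p b \<le> real (z p b)" if "p \<in> P" for p b
  proof -
    have "real (s p) / real (\<Sum>b\<in>B. z p b) \<le> 1"
      using assms(3)[OF that] pos[OF that] by (subst divide_le_eq_1) (auto simp del: of_nat_sum)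
    then show ?thesis unfolding y_def by (rule mult_left_le) simp
  qed
  show ?thesis
  proof (intro exI[of _ f] conjI ballI)
    fix p assume "p \<in> P"
    then have "f p \<in> B" "y p (f p) > 0" using f(1) by blast+
    then show "f p \<in> B" "z p (f p) > 0" by (auto simp: y_def intro!: gr0I)
  next
    fix b assume b: "b \<in> B"
    have "(\<Sum>p\<in>P. y p b) \<le> (\<Sum>p\<in>P. real (z p b))" using le by (intro sum_mono)
    then have "real (\<Sum>p\<in>{p\<in>P. f p = b}. s p) \<le> real ((\<Sum>p\<in>P. z p b) + S)" using f(2) b by fastforce
    then show "(\<Sum>p\<in>{p\<in>P. f p = b}. s p) \<le> (\<Sum>p\<in>P. z p b) + S" by (simp only: of_nat_le_iff)
  qed
qed

section \<open>Completeness of the derivations\<close>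

primrec bases :: "dp_term \<Rightarrow> nat set" where
  "bases (Base v) = {v}"
| "bases (Start t) = bases t"
| "bases (Up u l t) = bases t"
| "bases (Join t t') = bases t \<union> bases t'"

text \<open>The detour of a route that visits \<open>V\<close> and ends at \<open>e\<close>: an edge
  counts if \<open>V\<close> meets the part below it while \<open>e\<close> lies outside that
  part.\<close>

primrec tcost :: "nat set \<Rightarrow> nat \<Rightarrow> dp_term \<Rightarrow> nat" where
  "tcost V e (Base v) = 0"
| "tcost V e (Start t) = tcost V e t"
| "tcost V e (Up u l t) = tcost V e t + (if V \<inter> bases t \<noteq> {} \<and> e \<notin> bases t then l else 0)"
| "tcost V e (Join t t') = tcost V e t + tcost V e t'"

context skeletons begin

text \<open>Restores what \<open>up\<close> and \<open>join\<close> require: an open pool is lighter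
  than \<open>tau\<close>, and it exists only together with a pending bus that can be charged for
  it.\<close>

lemma normalise:
  assumes "Inv t S" "has_open S \<longrightarrow> trunk S \<union> pending S \<noteq> {}"
  shows "\<exists>S'. Inv t S' \<and> trunk S' = trunk S \<and> pending S' = pending S \<and> ending S' = ending S \<and> spent S' = spent S \<and> leaves S' = leaves S \<and>
    credit S' = credit S \<and> open_size S' < tau \<and> (pending S = {} \<longrightarrow> \<not> has_open S') \<and> (has_open S' \<longrightarrow> has_open S)"
proof -
  have I0: "Inv0 S" using assms(1) by (simp add: Inv_def)
  consider (a) "\<not> has_open S" | (b) "has_open S" "pending S = {}" "group_size S + open_size S < tau" | (c) "has_open S" "pending S = {}" "tau \<le> group_size S + open_size S"
    | (d) "has_open S" "pending S \<noteq> {}" "open_size S < tau" | (e) "has_open S" "pending S \<noteq> {}" "tau \<le> open_size S"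
    by linarith
  then show ?thesis
  proof cases
    case a
    then show ?thesis using assms(1) Inv0D(9)[OF I0] tau_pos by (intro exI[of _ S]) simp
  next
    case b
    then have "trunk S \<noteq> {}" using assms(2) by simp
    note A = absorb_open[OF assms(1) b(1,2) this b(3)]
    show ?thesis by (rule exI, rule conjI, rule A) (use tau_pos b in simp)
  next
    case c
    then have "trunk S \<noteq> {}" using assms(2) by simp
    note A = close_open_group[OF assms(1) c(1,2) this c(3)]
    show ?thesis by (rule exI, rule conjI, rule A) (use tau_pos c in simp)
  next
    case d
    then show ?thesis using assms(1) by (intro exI[of _ S]) simp
  next
    case e
    note A = close_open[OF assms(1) e(1,3)]
    show ?thesis by (rule exI, rule conjI, rule A) (use tau_pos e in simp)
  qed
qed

text \<open>If credit is left in total, some trunk bus has some of it. That bus may pay for closing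
  the group, whether it owns a part of the group or not.\<close>

lemma close_all:
  assumes "Inv t S" "(\<Sum>i<k. credit S i) < (\<Sum>i<k. 2 * leaves S i)"
  shows "\<exists>S'. Inv t S' \<and> trunk S' = trunk S \<and> pending S' = pending S \<and> ending S' = ending S \<and> spent S' = spent S \<and> leaves S' = leaves S \<and>
    has_open S' = has_open S \<and> open_size S' = open_size S \<and> group_size S' = 0 \<and> (\<Sum>i<k. credit S' i) = (\<Sum>i<k. credit S i) + 1"
proof -
  have I0: "Inv0 S" using assms(1) by (simp add: Inv_def)
  obtain j where j: "j < k" "credit S j < 2 * leaves S j"
  proof (rule ccontr)
    assume "\<not> thesis"
    then have "\<forall>j<k. 2 * leaves S j \<le> credit S j" using that not_less by blast
    then have "(\<Sum>i<k. 2 * leaves S i) \<le> (\<Sum>i<k. credit S i)" by (intro sum_mono) simp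
    then show False using assms(2) by simp
  qed
  have jT: "j \<in> trunk S"
  proof (rule ccontr)
    assume "j \<notin> trunk S"
    then have "leaves S j = 0" using Inv0D(4)[OF I0] by blast
    then show False using j by simp
  qed
  have "(\<Sum>i<k. ((credit S)(j := Suc (credit S j))) i) = (\<Sum>i<k. credit S i + (if i = j then 1 else 0))"
    by (intro sum.cong) auto
  also have "\<dots> = (\<Sum>i<k. credit S i) + 1" using j(1) by (simp only: sum.distrib) simp
  finally have s: "(\<Sum>i<k. ((credit S)(j := Suc (credit S j))) i) = (\<Sum>i<k. credit S i) + 1" .
  note A = close_group[OF assms(1) jT j(2)]
  show ?thesis by (rule exI, rule conjI, rule A) (use s in simp)
qed

end

locale covering = skeletons +
  fixes Sv :: "nat \<Rightarrow> nat set" and ev :: "nat \<Rightarrow> nat"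
  assumes ev_in: "\<And>i. i < k \<Longrightarrow> ev i \<in> Sv i" and cover: "\<And>v. v \<in> Cl \<Longrightarrow> \<exists>i<k. v \<in> Sv i"
begin

definition Rel0 :: "dp_term \<Rightarrow> skeleton \<Rightarrow> bool" where
  "Rel0 t S \<longleftrightarrow> trunk S \<union> pending S = {i. i < k \<and> Sv i \<inter> bases t \<noteq> {}} \<and> ending S = {i. i < k \<and> ev i \<in> bases t} \<and>
    (\<forall>i<k. spent S i = tcost (Sv i) (ev i) t) \<and>
    (\<forall>i\<in>trunk S. gam * (leaves S i - (if i \<in> ending S then 1 else 0)) \<le> spent S i) \<and>
    (trunk S \<noteq> {} \<longrightarrow> (\<Sum>i<k. credit S i) + 2 \<le> (\<Sum>i<k. 2 * leaves S i)) \<and>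
    (has_open S \<longrightarrow> trunk S \<union> pending S \<noteq> {})"

lemma Rel0D:
  assumes "Rel0 t S"
  shows "trunk S \<union> pending S = {i. i < k \<and> Sv i \<inter> bases t \<noteq> {}}" "ending S = {i. i < k \<and> ev i \<in> bases t}"
    "\<forall>i<k. spent S i = tcost (Sv i) (ev i) t"
    "\<forall>i\<in>trunk S. gam * (leaves S i - (if i \<in> ending S then 1 else 0)) \<le> spent S i"
    "trunk S \<noteq> {} \<longrightarrow> (\<Sum>i<k. credit S i) + 2 \<le> (\<Sum>i<k. 2 * leaves S i)"
    "has_open S \<longrightarrow> trunk S \<union> pending S \<noteq> {}"
  using assms unfolding Rel0_def by - (elim conjE, assumption)+

definition Ok :: "dp_term \<Rightarrow> bool" where
  "Ok t \<longleftrightarrow> (\<exists>S. Inv t S \<and> Rel0 t S \<and> open_size S < tau \<and> (pending S = {} \<longrightarrow> \<not> has_open S))"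

lemma OkI:
  assumes "Inv t S" "Rel0 t S"
  shows "Ok t"
proof -
  have "has_open S \<longrightarrow> trunk S \<union> pending S \<noteq> {}" using assms(2) unfolding Rel0_def by blast
  from normalise[OF assms(1) this] obtain S' where S': "Inv t S'" "trunk S' = trunk S" "pending S' = pending S" "ending S' = ending S"
    "spent S' = spent S" "leaves S' = leaves S" "credit S' = credit S" "open_size S' < tau" "pending S = {} \<longrightarrow> \<not> has_open S'" "has_open S' \<longrightarrow> has_open S"
    by (elim exE conjE)
  have "Rel0 t S'" using assms(2) S'(10) unfolding Rel0_def S'(2-7) by blast
  then show ?thesis unfolding Ok_def using S' by (intro exI[of _ S']) simp
qed

text \<open>At a client the open pool starts as a token of size 0. It weighs nothing but must
  eventually be merged into some route, since it is the visit to the client.\<close>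

lemma Ok_base: "Ok (Start (Base v))"
proof -
  let ?T = "{i. i < k \<and> ev i = v}"
  let ?P = "{i. i < k \<and> v \<in> Sv i} - ?T"
  define S where "S = \<lparr>trunk = ?T, pending = ?P, ending = ?T, spent = (\<lambda>_. 0), own = (\<lambda>_. 0),
    leaves = (\<lambda>i. if i \<in> ?T then 1 else 0), credit = (\<lambda>_. 0), items = [], has_open = (v \<in> Cl), open_size = 0, open_share = (\<lambda>_. 0),
    group_size = 0, group_share = (\<lambda>_. 0)\<rparr>"
  have sel: "trunk S = ?T" "pending S = ?P" "ending S = ?T" "\<And>i. spent S i = 0" "\<And>i. own S i = 0"
    "\<And>i. leaves S i = (if i \<in> ?T then 1 else 0)" "\<And>i. credit S i = 0" "items S = []" "has_open S = (v \<in> Cl)" "open_size S = 0"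
    "\<And>i. open_share S i = 0" "group_size S = 0" "\<And>i. group_share S i = 0" by (simp_all add: S_def)
  have "Inv0 S" unfolding Inv0_def sel using tau_pos by (auto simp: osum_def)
  moreover have "plan (Start (Base v)) S"
    unfolding plan_def
  proof (intro allI impI)
    fix hs h assume hs: "hosts (items S) hs" and g: "good S hs"
    have h0: "hs = []" using hs by (simp add: hosts_def sel)
    let ?W = "\<lambda>i. if i \<in> ?T then {#(True, 0::nat)#} else {#}"
    let ?X = "if v \<in> Cl then {#(False, 0::nat)#} else {#}"
    have cT: "card ?T \<le> k" using card_mono[of "{..<k}" ?T] by auto
    have W: "(\<Sum>i<k. ?W i) = replicate_mset (card ?T) (True, 0)" by (rule sum_replicate) auto
    have lt: "on_lattice d (True, 0)" for d by (simp add: on_lattice_def)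
    have nlr: "off_lattice d (replicate_mset m (True, 0)) = 0" for d m by (induction m) (use lt in \<open>auto simp: off_lattice_add_mset\<close>)
    have nX: "off_lattice d ?X \<le> 1" for d by (simp add: off_lattice_add_mset)
    have Nm: "3 * k + 4 \<le> Nm" using g by (simp add: good_def h0)
    have "adm (dep v) (?X + replicate_mset (card ?T) (True, 0) + replicate_mset 0 (False, idl (dep v)))"
      using cT Nm nX[of "dep v"] nlr[of "dep v" "card ?T"] by (auto simp: adm_def in_replicate_mset)
    then have "der (Start (Base v)) (?X + replicate_mset (card ?T) (True, 0) + replicate_mset 0 (False, idl (dep v)))"
      using der.Start[OF der.Base[of v], of "card ?T" 0] by simp
    then have D: "der (Start (Base v)) ((\<Sum>i<k. ?W i) + (if has_open S then {#(False, 0)#} else {#}))"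
      unfolding W sel by (simp add: ac_simps)
    have "busok (dep v) S hs h i (?W i)" for i
    proof (cases "i \<in> ?T")
      case True
      have "busok (dep v) S hs h i {#(i \<in> ending S, 0)#}"
        by (rule busok_TrI) (use True lt in \<open>auto simp: sel bnd_def\<close>)
      then show ?thesis using True by (simp add: sel)
    next
      case False
      have "count_list hs i = 0" "load (items S) hs i = 0" by (simp_all add: h0 load_def sel)
      then show ?thesis using False unfolding busok_def sel by auto
    qed
    then have bk: "\<forall>i<k. busok (dep (troot (Start (Base v)))) S hs h i (?W i)" unfolding troot.simps by blast
    show "\<exists>W vx. der (Start (Base v)) ((\<Sum>i<k. W i) + (if has_open S then {#(False, vx)#} else {#})) \<and> vx \<le> open_size S \<and>
      (\<forall>i<k. busok (dep (troot (Start (Base v)))) S hs h i (W i))"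
      by (rule exI[of _ ?W], rule exI[of _ 0], rule conjI[OF D conjI[OF _ bk]]) simp
  qed
  ultimately have I: "Inv (Start (Base v)) S" by (simp add: Inv_def)
  have "(\<Sum>i<k. 2 * leaves S i) \<ge> 2" if ne: "trunk S \<noteq> {}"
  proof -
    obtain i where i: "i < k" "i \<in> ?T" using ne by (auto simp: sel)
    then have "2 * leaves S i \<le> (\<Sum>i<k. 2 * leaves S i)" by (intro member_le_sum) auto
    then show ?thesis using i by (simp add: sel)
  qed
  moreover have "(\<Sum>i<k. credit S i) = 0" by (simp add: sel(7))
  ultimately have c: "trunk S \<noteq> {} \<longrightarrow> (\<Sum>i<k. credit S i) + 2 \<le> (\<Sum>i<k. 2 * leaves S i)" by linarith
  have "Rel0 (Start (Base v)) S"
    unfolding Rel0_def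
  proof (intro conjI c)
    show "trunk S \<union> pending S = {i. i < k \<and> Sv i \<inter> bases (Start (Base v)) \<noteq> {}}"
      using ev_in by (auto simp: sel)
    show "has_open S \<longrightarrow> trunk S \<union> pending S \<noteq> {}" using cover[of v] by (auto simp: sel)
  qed (simp_all add: sel)
  then show ?thesis using OkI I by blast
qed

text \<open>The bases are disjoint, so no bus ends on both sides; in particular two ending tokens
  never have to be merged, and at most one leaf of a bus is exempt from paying
  \<open>gam\<close>.\<close>

lemma Ok_join:
  assumes "Ok t" "Ok t'" and rt: "troot t' = troot t" and dis: "bases t \<inter> bases t' = {}"
  shows "Ok (Join t t')"
proof -
  obtain S1 where S1: "Inv t S1" "Rel0 t S1" "open_size S1 < tau" using assms(1) by (auto simp: Ok_def)
  obtain S2 where S2: "Inv t' S2" "Rel0 t' S2" "open_size S2 < tau" using assms(2) by (auto simp: Ok_def)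
  define both where "both \<longleftrightarrow> trunk S1 \<noteq> {} \<and> trunk S2 \<noteq> {}"
  have "\<exists>S'. Inv t S' \<and> trunk S' = trunk S1 \<and> pending S' = pending S1 \<and> ending S' = ending S1 \<and> spent S' = spent S1 \<and> leaves S' = leaves S1 \<and>
    has_open S' = has_open S1 \<and> open_size S' = open_size S1 \<and> (both \<longrightarrow> group_size S' = 0) \<and>
    (\<Sum>i<k. credit S' i) = (\<Sum>i<k. credit S1 i) + (if both then 1 else 0)"
  proof (cases both)
    case True
    then have "(\<Sum>i<k. credit S1 i) < (\<Sum>i<k. 2 * leaves S1 i)" using S1(2) by (auto simp: Rel0_def both_def)
    from close_all[OF S1(1) this] show ?thesis using True by simp
  qed (use S1 in auto)
  then obtain U1 where U1: "Inv t U1" "trunk U1 = trunk S1" "pending U1 = pending S1" "ending U1 = ending S1" "spent U1 = spent S1" "leaves U1 = leaves S1"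
    "has_open U1 = has_open S1" "open_size U1 = open_size S1" "both \<longrightarrow> group_size U1 = 0" "(\<Sum>i<k. credit U1 i) = (\<Sum>i<k. credit S1 i) + (if both then 1 else 0)"
    by (elim exE conjE)
  have "\<exists>S'. Inv t' S' \<and> trunk S' = trunk S2 \<and> pending S' = pending S2 \<and> ending S' = ending S2 \<and> spent S' = spent S2 \<and> leaves S' = leaves S2 \<and>
    has_open S' = has_open S2 \<and> open_size S' = open_size S2 \<and> (both \<longrightarrow> group_size S' = 0) \<and>
    (\<Sum>i<k. credit S' i) = (\<Sum>i<k. credit S2 i) + (if both then 1 else 0)"
  proof (cases both)
    case True
    then have "(\<Sum>i<k. credit S2 i) < (\<Sum>i<k. 2 * leaves S2 i)" using S2(2) by (auto simp: Rel0_def both_def)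
    from close_all[OF S2(1) this] show ?thesis using True by simp
  qed (use S2 in auto)
  then obtain U2 where U2: "Inv t' U2" "trunk U2 = trunk S2" "pending U2 = pending S2" "ending U2 = ending S2" "spent U2 = spent S2" "leaves U2 = leaves S2"
    "has_open U2 = has_open S2" "open_size U2 = open_size S2" "both \<longrightarrow> group_size U2 = 0" "(\<Sum>i<k. credit U2 i) = (\<Sum>i<k. credit S2 i) + (if both then 1 else 0)"
    by (elim exE conjE)
  let ?S = "join_skeleton U1 U2"
  have I01: "Inv0 U1" and I02: "Inv0 U2" using U1(1) U2(1) by (simp_all add: Inv_def)
  have PP: "ending U1 \<inter> ending U2 = {}" using Rel0D(2)[OF S1(2)] Rel0D(2)[OF S2(2)] dis U1(4) U2(4) by auto
  have I: "Inv (Join t t') ?S"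
    by (rule join[OF U1(1) U2(1) rt PP]) (use U1 U2 S1(3) S2(3) in \<open>auto simp: both_def\<close>)
  have z: "(\<Sum>i<k. f i) = 0" if "\<And>i. f i = (0::nat)" for f using that by simp
  have credit: "(\<Sum>i<k. credit U1 i + credit U2 i) + 2 \<le> (\<Sum>i<k. 2 * (leaves U1 i + leaves U2 i))" if ne: "trunk U1 \<union> trunk U2 \<noteq> {}"
  proof -
    have c1: "(\<Sum>i<k. credit S1 i) + 2 \<le> (\<Sum>i<k. 2 * leaves S1 i)" if "trunk S1 \<noteq> {}" using S1(2) that by (simp add: Rel0_def)
    have c2: "(\<Sum>i<k. credit S2 i) + 2 \<le> (\<Sum>i<k. 2 * leaves S2 i)" if "trunk S2 \<noteq> {}" using S2(2) that by (simp add: Rel0_def)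
    have d: "(\<Sum>i<k. credit U1 i + credit U2 i) = (\<Sum>i<k. credit U1 i) + (\<Sum>i<k. credit U2 i)"
      "(\<Sum>i<k. 2 * (leaves U1 i + leaves U2 i)) = (\<Sum>i<k. 2 * leaves S1 i) + (\<Sum>i<k. 2 * leaves S2 i)"
      by (simp_all add: sum.distrib U1 U2 add_mult_distrib2)
    consider "both" | "trunk S1 = {}" "trunk S2 \<noteq> {}" "\<not> both" | "trunk S2 = {}" "trunk S1 \<noteq> {}" "\<not> both"
      using ne U1(2) U2(2) by (auto simp: both_def)
    then show ?thesis
    proof cases
      case 1
      then show ?thesis using c1 c2 d U1(10) U2(10) by (auto simp: both_def)
    next
      case 2
      then have "(\<Sum>i<k. credit U1 i) = 0" using Inv0D(4)[OF I01] U1(2) by simp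
      then show ?thesis using c2[OF 2(2)] d U2(10) 2(3) by simp
    next
      case 3
      then have "(\<Sum>i<k. credit U2 i) = 0" using Inv0D(4)[OF I02] U2(2) by simp
      then show ?thesis using c1[OF 3(2)] d U1(10) 3(3) by simp
    qed
  qed
  have leaves: "gam * (leaves U1 i + leaves U2 i - (if i \<in> ending U1 \<union> ending U2 then 1 else 0)) \<le> spent U1 i + spent U2 i"
    if i: "i \<in> trunk U1 \<union> trunk U2" for i
  proof -
    have a: "gam * (leaves U1 i - (if i \<in> ending U1 then 1 else 0)) \<le> spent U1 i"
    proof (cases "i \<in> trunk U1")
      case True
      then have "gam * (leaves S1 i - (if i \<in> ending S1 then 1 else 0)) \<le> spent S1 i"
        using S1(2) U1(2) unfolding Rel0_def by blast
      then show ?thesis unfolding U1(4-6) .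
    next
      case False
      then have "leaves U1 i = 0" using Inv0D(4)[OF I01] by blast
      then show ?thesis by simp
    qed
    have b: "gam * (leaves U2 i - (if i \<in> ending U2 then 1 else 0)) \<le> spent U2 i"
    proof (cases "i \<in> trunk U2")
      case True
      then have "gam * (leaves S2 i - (if i \<in> ending S2 then 1 else 0)) \<le> spent S2 i"
        using S2(2) U2(2) unfolding Rel0_def by blast
      then show ?thesis unfolding U2(4-6) .
    next
      case False
      then have "leaves U2 i = 0" using Inv0D(4)[OF I02] by blast
      then show ?thesis by simp
    qed
    have "leaves U1 i + leaves U2 i - (if i \<in> ending U1 \<union> ending U2 then 1 else 0)
        \<le> (leaves U1 i - (if i \<in> ending U1 then 1 else 0)) + (leaves U2 i - (if i \<in> ending U2 then 1 else 0))"
      using PP by auto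
    then have "gam * (leaves U1 i + leaves U2 i - (if i \<in> ending U1 \<union> ending U2 then 1 else 0))
        \<le> gam * ((leaves U1 i - (if i \<in> ending U1 then 1 else 0)) + (leaves U2 i - (if i \<in> ending U2 then 1 else 0)))"
      by (rule mult_le_mono2)
    then show ?thesis using a b unfolding add_mult_distrib2 by linarith
  qed
  have "Rel0 (Join t t') ?S"
    unfolding Rel0_def
  proof (intro conjI)
    note R1 = Rel0D[OF S1(2)] and R2 = Rel0D[OF S2(2)]
    have e: "trunk ?S \<union> pending ?S = (trunk S1 \<union> pending S1) \<union> (trunk S2 \<union> pending S2)" using U1(2,3) U2(2,3) by auto
    show "trunk ?S \<union> pending ?S = {i. i < k \<and> Sv i \<inter> bases (Join t t') \<noteq> {}}" unfolding e R1(1) R2(1) by auto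
    show "ending ?S = {i. i < k \<and> ev i \<in> bases (Join t t')}" unfolding join_skeleton_sel U1(4) U2(4) R1(2) R2(2) by auto
    show "\<forall>i<k. spent ?S i = tcost (Sv i) (ev i) (Join t t')" using R1(3) R2(3) U1(5) U2(5) by simp
    show "has_open ?S \<longrightarrow> trunk ?S \<union> pending ?S \<noteq> {}"
    proof
      assume "has_open ?S"
      then have "has_open S1 \<or> has_open S2" unfolding join_skeleton_sel U1(7) U2(7) .
      then have "trunk S1 \<union> pending S1 \<noteq> {} \<or> trunk S2 \<union> pending S2 \<noteq> {}" using R1(6) R2(6) by (elim disjE) simp_all
      then show "trunk ?S \<union> pending ?S \<noteq> {}" unfolding e by auto
    qed
    show "\<forall>i\<in>trunk ?S. gam * (leaves ?S i - (if i \<in> ending ?S then 1 else 0)) \<le> spent ?S i" using leaves by simp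
    show "trunk ?S \<noteq> {} \<longrightarrow> (\<Sum>i<k. credit ?S i) + 2 \<le> (\<Sum>i<k. 2 * leaves ?S i)" using credit by simp
  qed
  then show ?thesis using OkI I by blast
qed

text \<open>Pending buses whose detour would reach \<open>gam\<close> on the edge are released below
  it. The reserves of the remaining ones then suffice for the edge, and above it the new leaves have
  made the detour that \<open>Rel0\<close> asks for.\<close>

lemma Ok_up:
  assumes "Ok t" and du: "dep (troot t) = dep u + l"
  shows "Ok (Up u l (Start t))"
proof -
  obtain S where S: "Inv t S" "Rel0 t S" "open_size S < tau" "pending S = {} \<longrightarrow> \<not> has_open S" using assms(1) by (auto simp: Ok_def)
  define Q where "Q = {i \<in> pending S. spent S i + l \<ge> gam}"
  define cl where "cl \<longleftrightarrow> trunk S \<noteq> {} \<and> Q \<noteq> {}"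
  have "\<exists>S'. Inv t S' \<and> trunk S' = trunk S \<and> pending S' = pending S \<and> ending S' = ending S \<and> spent S' = spent S \<and> leaves S' = leaves S \<and>
    has_open S' = has_open S \<and> open_size S' = open_size S \<and> (cl \<longrightarrow> group_size S' = 0) \<and>
    (\<Sum>i<k. credit S' i) = (\<Sum>i<k. credit S i) + (if cl then 1 else 0)"
  proof (cases cl)
    case True
    then have "(\<Sum>i<k. credit S i) < (\<Sum>i<k. 2 * leaves S i)" using S(2) by (auto simp: Rel0_def cl_def)
    from close_all[OF S(1) this] show ?thesis using True by simp
  qed (use S in auto)
  then obtain U where U: "Inv t U" "trunk U = trunk S" "pending U = pending S" "ending U = ending S" "spent U = spent S" "leaves U = leaves S"
    "has_open U = has_open S" "open_size U = open_size S" "cl \<longrightarrow> group_size U = 0" "(\<Sum>i<k. credit U i) = (\<Sum>i<k. credit S i) + (if cl then 1 else 0)"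
    by (elim exE conjE)
  have I0U: "Inv0 U" using U(1) by (simp add: Inv_def)
  have QU: "Q \<subseteq> pending U" using U(3) by (auto simp: Q_def)
  define R where "R = U\<lparr>trunk := trunk U \<union> Q, pending := pending U - Q, leaves := (\<lambda>i. if i \<in> Q then 1 else leaves U i)\<rparr>"
  have R: "Inv (Start t) R"
    unfolding R_def by (rule release[OF U(1) QU]) (use U(2,9) in \<open>simp add: cl_def\<close>)
  have Rs: "trunk R = trunk S \<union> Q" "pending R = pending S - Q" "ending R = ending S" "spent R = spent S"
    "\<And>i. leaves R i = (if i \<in> Q then 1 else leaves S i)" "credit R = credit U" "has_open R = has_open S" "open_size R = open_size S"
    using U by (simp_all add: R_def)
  have TP: "trunk R \<union> pending R = trunk S \<union> pending S" using QU U(3) by (auto simp: Rs)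
  have "has_open R \<longrightarrow> trunk R \<union> pending R \<noteq> {}" using S(2) unfolding TP Rs Rel0_def by blast
  from normalise[OF R this] obtain N where N: "Inv (Start t) N" "trunk N = trunk R" "pending N = pending R" "ending N = ending R"
    "spent N = spent R" "leaves N = leaves R" "credit N = credit R" "open_size N < tau" "pending R = {} \<longrightarrow> \<not> has_open N" "has_open N \<longrightarrow> has_open R"
    by (elim exE conjE)
  have I0N: "Inv0 N" using N(1) by (simp add: Inv_def)
  define j where "j = (SOME i. i \<in> pending N)"
  have j: "j \<in> pending N" if "has_open N" using that N(3,9) some_in_eq[of "pending N"] by (auto simp: j_def)
  have pe: "\<forall>i\<in>pending N. spent N i + l < gam" by (auto simp: N(3,5) Rs Q_def)
  define F where "F = N\<lparr>spent := (\<lambda>i. if i \<in> trunk N \<union> pending N \<and> i \<notin> ending N then spent N i + l else spent N i),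
    own := (\<lambda>i. if i \<in> trunk N \<and> i \<notin> ending N then own N i + l else own N i),
    open_size := (if has_open N then open_size N + l else open_size N), open_share := (if has_open N then (open_share N)(j := open_share N j + l) else open_share N)\<rparr>"
  have I: "Inv (Up u l (Start t)) F"
    unfolding F_def by (rule up[OF N(1) _ pe j N(8)]) (use du in simp_all)
  have Fs: "trunk F = trunk S \<union> Q" "pending F = pending S - Q" "ending F = ending S"
    "\<And>i. spent F i = (if i \<in> trunk S \<union> pending S \<and> i \<notin> ending S then spent S i + l else spent S i)"
    "\<And>i. leaves F i = (if i \<in> Q then 1 else leaves S i)" "credit F = credit U" "has_open F \<longrightarrow> has_open S"
    using N Rs TP by (simp_all add: F_def)
  have TPF: "trunk F \<union> pending F = trunk S \<union> pending S" using QU U(3) by (auto simp: Fs)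
  have Qk: "Q \<subseteq> {..<k}" using QU Inv0D(1)[OF I0U] by blast
  have credit: "(\<Sum>i<k. credit F i) + 2 \<le> (\<Sum>i<k. 2 * leaves F i)" if ne: "trunk F \<noteq> {}"
  proof -
    have "2 * leaves S i + (if i \<in> Q then 2 else 0) = 2 * leaves F i" for i
    proof (cases "i \<in> Q")
      case True
      then have "i \<notin> trunk U" using QU Inv0D(2)[OF I0U] by blast
      then have "leaves U i = 0" using Inv0D(4)[OF I0U] by blast
      then show ?thesis using True U(6) by (simp add: Fs)
    qed (simp add: Fs)
    then have "(\<Sum>i<k. 2 * leaves F i) = (\<Sum>i<k. 2 * leaves S i + (if i \<in> Q then 2 else 0))" by simp
    also have "\<dots> = (\<Sum>i<k. 2 * leaves S i) + (\<Sum>i<k. if i \<in> Q then 2 else 0)" by (rule sum.distrib)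
    finally have l: "(\<Sum>i<k. 2 * leaves F i) = (\<Sum>i<k. 2 * leaves S i) + (\<Sum>i<k. if i \<in> Q then 2 else 0)" .
    have q2: "(\<Sum>i<k. if i \<in> Q then 2 else 0) \<ge> (2::nat)" if ne: "Q \<noteq> {}"
    proof -
      obtain i where i: "i \<in> Q" "i < k" using ne Qk by blast
      have "(if i \<in> Q then 2 else 0) \<le> (\<Sum>i<k. if i \<in> Q then 2 else (0::nat))"
        by (rule member_le_sum) (use i in auto)
      then show ?thesis using i by simp
    qed
    have c: "(\<Sum>i<k. credit S i) + 2 \<le> (\<Sum>i<k. 2 * leaves S i)" if "trunk S \<noteq> {}" using S(2) that by (simp add: Rel0_def)
    show ?thesis
    proof (cases "trunk S = {}")
      case True
      then have "Q \<noteq> {}" using ne by (auto simp: Fs)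
      moreover have "(\<Sum>i<k. credit U i) = 0" using Inv0D(4)[OF I0U] U(2) True by simp
      ultimately show ?thesis using q2 l by (simp add: Fs)
    next
      case False
      then show ?thesis using c[OF False] q2 l U(10) by (cases "Q = {}") (auto simp: Fs cl_def)
    qed
  qed
  have lvF: "gam * (leaves F i - (if i \<in> ending F then 1 else 0)) \<le> spent F i" if i: "i \<in> trunk F" for i
  proof (cases "i \<in> Q")
    case True
    then have iP: "i \<in> pending S" and g: "gam \<le> spent S i + l" by (auto simp: Q_def)
    have "i \<notin> ending S" using True QU Inv0D(2,3)[OF I0U] U(4) by blast
    then show ?thesis using True g iP by (simp add: Fs)
  next
    case False
    then have "i \<in> trunk S" using i by (simp add: Fs)
    then have "gam * (leaves S i - (if i \<in> ending S then 1 else 0)) \<le> spent S i" using S(2) unfolding Rel0_def by blast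
    then show ?thesis using False by (auto simp: Fs)
  qed
  have "Rel0 (Up u l (Start t)) F"
    unfolding Rel0_def
  proof (intro conjI)
    note R = Rel0D[OF S(2)]
    show "trunk F \<union> pending F = {i. i < k \<and> Sv i \<inter> bases (Up u l (Start t)) \<noteq> {}}" unfolding TPF R(1) by simp
    show "ending F = {i. i < k \<and> ev i \<in> bases (Up u l (Start t))}" unfolding Fs R(2) by simp
    show "\<forall>i<k. spent F i = tcost (Sv i) (ev i) (Up u l (Start t))"
      unfolding Fs R(1,2) using R(3) by simp
    show "\<forall>i\<in>trunk F. gam * (leaves F i - (if i \<in> ending F then 1 else 0)) \<le> spent F i" using lvF by blast
    show "trunk F \<noteq> {} \<longrightarrow> (\<Sum>i<k. credit F i) + 2 \<le> (\<Sum>i<k. 2 * leaves F i)" using credit by blast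
    show "has_open F \<longrightarrow> trunk F \<union> pending F \<noteq> {}" unfolding TPF using Fs(7) R(6) by simp
  qed
  then show ?thesis using OkI I by blast
qed

lemma load_map:
  "load I (map f [0..<length I]) i = (\<Sum>p\<in>{p\<in>{..<length I}. f p = i}. fst (I ! p))"
proof -
  have z: "zip I (map f [0..<length I]) = map (\<lambda>p. (I ! p, f p)) [0..<length I]"
    by (rule nth_equalityI) auto
  have "load I (map f [0..<length I]) i = (\<Sum>p\<leftarrow>[0..<length I]. if f p = i then fst (I ! p) else 0)"
    unfolding load_def z by (simp add: comp_def cong: if_cong)
  also have "\<dots> = (\<Sum>p\<in>{..<length I}. if f p = i then fst (I ! p) else 0)"
    by (simp add: interv_sum_list_conv_sum_set_nat atLeast0LessThan)
  also have "\<dots> = (\<Sum>p\<in>{p\<in>{..<length I}. f p = i}. fst (I ! p))"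
    by (rule sum.inter_filter[symmetric]) simp
  finally show ?thesis .
qed

lemma osum_nth: "osum I i = (\<Sum>p<length I. snd (I ! p) i)"
  unfolding osum_def by (simp add: sum_list_sum_nth atLeast0LessThan)

lemma count_load: "length hs = length I \<Longrightarrow> (\<And>it. it \<in> set I \<Longrightarrow> c \<le> fst it) \<Longrightarrow> count_list hs i * c \<le> load I hs i"
proof (induction hs arbitrary: I)
  case (Cons h hs)
  then obtain it I' where I: "I = it # I'" by (cases I) auto
  have "count_list hs i * c \<le> load I' hs i" using Cons I by simp
  moreover have "c \<le> fst it" using Cons.prems(2) I by simp
  ultimately show ?case unfolding I load_def by simp
qed (simp add: load_def)

lemma length_count:
  assumes "set hs \<subseteq> {..<(k::nat)}"
  shows "length hs = (\<Sum>i<k. count_list hs i)"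
proof -
  have "(\<Sum>i<k. count_list hs i) = (\<Sum>i\<in>set hs. count_list hs i)"
    using assms by (intro sum.mono_neutral_right) (auto simp: count_list_0_iff)
  then show ?thesis by (simp add: sum_count_set)
qed

text \<open>With \<open>gam = n m\<^sup>2\<close> a detour has at most about \<open>m\<^sup>2\<close> trunk leaves, and items weigh at
  least \<open>sg = n m\<close>; all rounding errors therefore add up to \<open>O(n m\<^sup>3)\<close> units, compared with a
  budget of about \<open>n m\<^sup>4\<close>.\<close>

lemma complete:
  assumes ok: "Ok t" and k0: "k > 0" and ends: "\<And>i. i < k \<Longrightarrow> ev i \<in> bases t"
    and cost: "\<And>i. i < k \<Longrightarrow> tcost (Sv i) (ev i) t \<le> n * (m ^ 4 + 1)"
    and m: "m > 0" and par: "sg = n * m" "gam = n * m ^ 2" "tau = n * m ^ 3"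
    and Hm: "n * (m ^ 4 + 100 * m ^ 3) \<le> Hm" and Nm: "k * (21 * m ^ 3 + 10) \<le> Nm"
  shows "\<exists>M. der t M \<and> size M = k \<and> (\<forall>y\<in>#M. fst y)"
proof -
  obtain S where S: "Inv t S" "Rel0 t S" "open_size S < tau" "pending S = {} \<longrightarrow> \<not> has_open S" using ok by (auto simp: Ok_def)
  have I0: "Inv0 S" using S(1) by (simp add: Inv_def)
  have PBk: "ending S = {..<k}" using S(2) ends by (auto simp: Rel0_def)
  have TrS: "trunk S = {..<k}" using PBk Inv0D(1,3)[OF I0] by blast
  have PeS: "pending S = {}" using TrS Inv0D(1,2)[OF I0] by blast
  have "(\<Sum>i<k. credit S i) + 2 \<le> (\<Sum>i<k. 2 * leaves S i)" using Rel0D(5)[OF S(2)] k0 unfolding TrS by auto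
  then have "(\<Sum>i<k. credit S i) < (\<Sum>i<k. 2 * leaves S i)" by simp
  from close_all[OF S(1) this] obtain U where U: "Inv t U" "trunk U = trunk S" "pending U = pending S" "ending U = ending S" "spent U = spent S"
    "leaves U = leaves S" "has_open U = has_open S" "open_size U = open_size S" "group_size U = 0" by (elim exE conjE)
  have IU: "Inv0 U" and P: "plan t U" using U(1) by (simp_all add: Inv_def)
  have xeU: "\<not> has_open U" using S(4) PeS U(7) by simp
  have n0: "n > 0" by (rule n_pos)
  define K where "K = m ^ 4"
  have m34: "m ^ 3 \<le> K" "1 \<le> m ^ 3" "m \<le> m ^ 3" "m ^ 2 \<le> m ^ 3" "1 \<le> m ^ 2" "K = m ^ 3 * m" "K = m ^ 2 * m ^ 2"
      "m ^ 3 = m ^ 2 * m"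
    using m by (auto simp: K_def power_eq_if numeral_eq_Suc)
  define q2 where "q2 = m ^ 2"
  define q3 where "q3 = m ^ 3"
  note q = par[folded q2_def q3_def] and mm = m34[folded q2_def q3_def]
    and Hmq = Hm[folded q3_def K_def] and Nmq = Nm[folded q3_def]
  \<comment> \<open>All leaves but one have each used \<open>gam = n * q2\<close> of a detour of at
    most \<open>n * (K + 1)\<close>.\<close>
  have leaves: "leaves U i \<le> q2 + 2" if i: "i < k" for i
  proof (rule ccontr)
    assume "\<not> ?thesis"
    then have "q2 + 2 \<le> leaves U i - 1" by simp
    then have "gam * (q2 + 2) \<le> gam * (leaves U i - 1)" by (rule mult_le_mono2)
    also have "\<dots> \<le> spent S i"
      using Rel0D(4)[OF S(2), rule_format, of i] i unfolding TrS PBk U(6) by simp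
    also have "\<dots> \<le> n * (K + 1)"
      using Rel0D(3)[OF S(2), rule_format, OF i] cost[OF i] unfolding K_def by simp
    finally have "n * (q2 * (q2 + 2)) \<le> n * (K + 1)" unfolding q mult.assoc .
    then have "q2 * (q2 + 2) \<le> K + 1" using n0 by (rule mult_left_le_imp_le)
    then have "2 * q2 \<le> 1" unfolding mm(7) by (simp add: add_mult_distrib2 )
    then show False using mm(5) by linarith
  qed
  let ?I = "items U"
  let ?z = "\<lambda>p i. (tau + gam) * snd (?I ! p) i"
  have it: "sg \<le> fst (?I ! p)" "fst (?I ! p) \<le> 3 * tau + gam + sg" "fst (?I ! p) * tau \<le> (tau + gam) * (\<Sum>i<k. snd (?I ! p) i)"
    if "p < length ?I" for p using Inv0D(6)[OF IU, of "?I ! p"] that by auto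
  have sg0: "sg > 0" using q m n0 by simp
  \<comment> \<open>To stay within natural numbers, weights are scaled by \<open>tau\<close> and
    shares by \<open>tau + gam\<close>; the invariant compares just these quantities.\<close>
  have "\<exists>f. (\<forall>p\<in>{..<length ?I}. f p \<in> {..<k} \<and> ?z p (f p) > 0) \<and>
    (\<forall>b\<in>{..<k}. (\<Sum>p\<in>{p\<in>{..<length ?I}. f p = b}. fst (?I ! p) * tau) \<le>
        (\<Sum>p\<in>{..<length ?I}. ?z p b) + (3 * tau + gam + sg) * tau)"
  proof (rule generalized_assignment_nat)
    fix p assume p: "p \<in> {..<length ?I}"
    have "fst (?I ! p) * tau > 0" using it(1)[of p] p sg0 tau_pos by simp
    moreover have "fst (?I ! p) * tau \<le> (3 * tau + gam + sg) * tau" using it(2)[of p] p by simp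
    moreover have "fst (?I ! p) * tau \<le> (\<Sum>b<k. ?z p b)" using it(3)[of p] p by (simp add: sum_distrib_left)
    ultimately show "0 < fst (?I ! p) * tau \<and> fst (?I ! p) * tau \<le> (3 * tau + gam + sg) * tau \<and>
      fst (?I ! p) * tau \<le> (\<Sum>b<k. ?z p b)" by blast
  qed auto
  then obtain f where f: "\<And>p. p < length ?I \<Longrightarrow> f p < k \<and> snd (?I ! p) (f p) > 0"
    "\<And>b. b < k \<Longrightarrow> (\<Sum>p\<in>{p\<in>{..<length ?I}. f p = b}. fst (?I ! p) * tau) \<le>
        (\<Sum>p<length ?I. ?z p b) + (3 * tau + gam + sg) * tau" by fastforce
  define hs where "hs = map f [0..<length ?I]"
  have len: "length hs = length ?I" by (simp add: hs_def)
  have H: "hosts ?I hs" unfolding hosts_def using f(1) by (auto simp: hs_def set_zip) (metis snd_conv)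
  \<comment> \<open>The factor is \<open>1 + gam / tau = 1 + 1 / m\<close>, and the single surplus
    item weighs at most \<open>3 * tau + gam + sg\<close>.\<close>
  have load: "load ?I hs i * m \<le> (m + 1) * osum ?I i + 5 * (n * q3) * m" if i: "i < k" for i
  proof -
    have "load ?I hs i * tau = (\<Sum>p\<in>{p\<in>{..<length ?I}. f p = i}. fst (?I ! p) * tau)"
      unfolding hs_def load_map by (simp add: sum_distrib_right)
    also have "\<dots> \<le> (tau + gam) * osum ?I i + (3 * tau + gam + sg) * tau"
      using f(2)[OF i] by (simp add: osum_nth sum_distrib_left)
    finally have a: "load ?I hs i * tau \<le> (tau + gam) * osum ?I i + (3 * tau + gam + sg) * tau" .
    have t: "tau = gam * m" "tau + gam = gam * (m + 1)" using mm q by simp_all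
    have "gam * (load ?I hs i * m) \<le> gam * ((m + 1) * osum ?I i + (3 * tau + gam + sg) * m)"
      using a unfolding t(2) unfolding t(1) by (simp add: algebra_simps)
    then have b: "load ?I hs i * m \<le> (m + 1) * osum ?I i + (3 * tau + gam + sg) * m"
      using q n0 m mm(5) by simp
    have "gam \<le> n * q3" "sg \<le> n * q3" using q mm by simp_all
    then have "3 * tau + gam + sg \<le> 5 * (n * q3)" using q(3) by linarith
    then have "(3 * tau + gam + sg) * m \<le> 5 * (n * q3) * m" by (rule mult_le_mono1)
    then show ?thesis using b by linarith
  qed
  \<comment> \<open>Own detour and shares, credit included, are at most
    \<open>n * (K + 7 * q3)\<close>. The factor \<open>1 + 1 / m\<close> adds at most
    \<open>8 * n * q3\<close> and the surplus item \<open>5 * n * q3\<close>. As every item weighs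
    at least \<open>sg = n * m\<close>, no more than \<open>21 * q3\<close> of them fit.\<close>
  have total: "own U i + load ?I hs i \<le> n * (K + 20 * q3)" "count_list hs i \<le> 21 * q3" if i: "i < k" for i
  proof -
    have "own U i + osum ?I i \<le> spent U i + sg * credit U i" using Inv0D(12)[OF IU i] by linarith
    moreover have "spent U i \<le> n * (K + 1)" 
      using Rel0D(3)[OF S(2), rule_format, OF i] cost[OF i] unfolding U(5) K_def by simp
    moreover have "sg * credit U i \<le> sg * (2 * (q2 + 2))"
    proof (rule mult_le_mono2)
      have "2 * leaves U i \<le> 2 * (q2 + 2)" using leaves[OF i] by (rule mult_le_mono2)
      then show "credit U i \<le> 2 * (q2 + 2)" using Inv0D(13)[OF IU, of i] by linarith
    qed
    moreover have "sg * (2 * (q2 + 2)) \<le> n * (6 * q3)"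
    proof -
      have "m * (2 * (q2 + 2)) \<le> 6 * q3" using mm(3) unfolding mm(8) by (simp add: algebra_simps)
      then have "n * (m * (2 * (q2 + 2))) \<le> n * (6 * q3)" by (rule mult_le_mono2)
      then show ?thesis unfolding q mult.assoc .
    qed
    moreover have "n * (K + 1) + n * (6 * q3) \<le> n * (K + 7 * q3)"
      unfolding add_mult_distrib2[symmetric] using mm(2) by (intro mult_le_mono2) linarith
    ultimately have A: "own U i + osum ?I i \<le> n * (K + 7 * q3)" by linarith
    have "n * (K + 7 * q3) \<le> n * (8 * q3 * m)"
    proof (intro mult_le_mono2)
      show "K + 7 * q3 \<le> 8 * q3 * m" using mm(1) unfolding mm(6) by simp
    qed
    then have o: "osum ?I i \<le> 8 * (n * q3) * m" using A by (simp add: algebra_simps)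
    have "load ?I hs i * m \<le> (osum ?I i + 13 * (n * q3)) * m"
      using load[OF i] o by (simp add: algebra_simps)
    then have "load ?I hs i \<le> osum ?I i + 13 * (n * q3)" using m by simp
    then have B: "own U i + load ?I hs i \<le> n * (K + 7 * q3) + 13 * (n * q3)" using A by linarith
    then show C: "own U i + load ?I hs i \<le> n * (K + 20 * q3)" by (simp add: algebra_simps)
    have "count_list hs i * sg \<le> load ?I hs i"
      by (rule count_load[OF len]) (use Inv0D(6)[OF IU] in blast)
    also have "\<dots> \<le> n * (K + 20 * q3)" using C by linarith
    also have "\<dots> \<le> n * (21 * q3 * m)" using mm(1) unfolding mm(6) by (intro mult_le_mono2) simp
    finally have "count_list hs i * (n * m) \<le> 21 * q3 * (n * m)" by (simp add: q algebra_simps)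
    then show "count_list hs i \<le> 21 * q3" using n0 m by simp
  qed
  have setk: "set hs \<subseteq> {..<k}" using f(1) by (auto simp: hs_def)
  have "length hs \<le> (\<Sum>i<k. 21 * q3)"
    unfolding length_count[OF setk] using total(2) by (intro sum_mono) simp
  then have lh: "length hs \<le> k * (21 * q3)" by simp
  \<comment> \<open>The coefficient 100 in \<open>Hm\<close> has to cover \<open>20 * q3\<close>
    from the load, \<open>69 * q3\<close> from the roundings and \<open>8 * q3\<close> from the
    margin.\<close>
  have g: "good U hs"
    unfolding good_def
  proof (intro conjI allI impI)
    fix i assume i: "i < k"
    have "2 * leaves U i + 3 * count_list hs i \<le> 69 * q3" using leaves[OF i] total(2)[OF i] mm by linarith
    then have "n * (2 * leaves U i + 3 * count_list hs i) \<le> n * (69 * q3)" by (rule mult_le_mono2)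
    moreover have "4 * tau + 4 * n \<le> n * (8 * q3)" using mult_le_mono2[OF mm(2), of n] unfolding q(3) by simp
    moreover have "n * (K + 20 * q3) + n * (69 * q3) + n * (8 * q3) \<le> n * (K + 100 * q3)"
      unfolding add_mult_distrib2[symmetric] by (intro mult_le_mono2) simp
    ultimately show "bnd U hs i + (4 * tau + 4 * n) \<le> Hm"
      unfolding bnd_def using total(1)[OF i] Hmq by linarith
  next
    have "4 * tau + 4 * n \<le> n * (8 * q3)" using mult_le_mono2[OF mm(2), of n] unfolding q(3) by simp
    also have "\<dots> \<le> n * (K + 100 * q3)" by (intro mult_le_mono2) simp
    finally show "4 * tau + 4 * n \<le> Hm" using Hmq by linarith
    have "3 * k + length hs + 4 \<le> k * (21 * q3) + k * 10" using lh k0 by linarith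
    then show "3 * k + length hs + 4 \<le> Nm" using Nmq by (simp add: add_mult_distrib2)
  qed
  obtain W vx where W: "der t ((\<Sum>i<k. W i) + (if has_open U then {#(False, vx)#} else {#}))"
      "\<forall>i<k. busok (dep (troot t)) U hs 0 i (W i)"
    by (rule planD[OF P H g, of 0]) (use k0 TrS U(2) in auto)
  have Wi: "\<exists>a. W i = {#(True, a)#}" if "i < k" for i
    using busok_TrD[of _ U hs 0 i "W i"] W(2) that TrS PBk U(2,4) by fastforce
  have L: "size (\<Sum>i<j. W i) = j \<and> (\<forall>y\<in>#(\<Sum>i<j. W i). fst y)" if "j \<le> k" for j
    using that
  proof (induction j)
    case (Suc j)
    then obtain a where "W j = {#(True, a)#}" using Wi[of j] by auto
    then show ?case using Suc by simp
  qed simp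
  show ?thesis using L[of k] W(1) xeU by (intro exI[of _ "\<Sum>i<k. W i"]) simp
qed

end

section \<open>Walks in rooted trees\<close>

lemma vwalk_arcs_snoc: "p \<noteq> [] \<Longrightarrow> vwalk_arcs (p @ [x]) = vwalk_arcs p @ [(last p, x)]"
  by (induction p rule: vwalk_arcs.induct) auto

lemma vwalk_arcs_glue: "q \<noteq> [] \<Longrightarrow> p \<noteq> [] \<Longrightarrow> last q = hd p \<Longrightarrow> vwalk_arcs (q @ tl p) = vwalk_arcs q @ vwalk_arcs p"
proof (induction q rule: vwalk_arcs.induct)
  case (2 x)
  then show ?case by (cases p) auto
qed auto

text \<open>\<open>awalk_cost\<close> does not refer to the graph, so its equation can be taken from
  any well-formed digraph; the empty one serves.\<close>

lemma awalk_cost_eq: "wf_digraph.awalk_cost w p = sum_list (map w p)"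
proof -
  have "wf_digraph \<lparr>verts = {}, arcs = {}, tail = \<lambda>_. (), head = \<lambda>_. ()\<rparr>" by unfold_locales auto
  then show ?thesis by (rule wf_digraph.awalk_cost_def)
qed

lemma walk_length_simps:
  "walk_length w [x] = 0" "p \<noteq> [] \<Longrightarrow> walk_length w (p @ [x]) = walk_length w p + w (last p, x)"
  "p \<noteq> [] \<Longrightarrow> walk_length w (u # p) = w (u, hd p) + walk_length w p"
  "q \<noteq> [] \<Longrightarrow> p \<noteq> [] \<Longrightarrow> last q = hd p \<Longrightarrow> walk_length w (q @ tl p) = walk_length w q + walk_length w p"
  by (simp_all add: walk_length_def awalk_cost_eq vwalk_arcs_snoc vwalk_arcs_Cons vwalk_arcs_glue)

text \<open>\<open>par\<close> gives parents and \<open>D\<close> distances from the root.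
  \<open>P y\<close> is the path from \<open>r\<close> to \<open>y\<close>, with every edge
  represented by its lower end; hence it contains \<open>y\<close> but never \<open>r\<close>. The
  assumption \<open>tree\<close> makes each arc join a vertex and its parent.\<close>

locale rtree =
  fixes G :: "nat pair_pre_digraph" and w :: "nat \<times> nat \<Rightarrow> real" and r :: nat and par :: "nat \<Rightarrow> nat"
    and D :: "nat \<Rightarrow> real" and P :: "nat \<Rightarrow> nat set"
  assumes pg: "pair_graph G" and r: "r \<in> pverts G"
    and par: "\<And>y. y \<in> pverts G \<Longrightarrow> y \<noteq> r \<Longrightarrow> (par y, y) \<in> parcs G"
    and Dr: "D r = 0" and D: "\<And>y. y \<in> pverts G \<Longrightarrow> y \<noteq> r \<Longrightarrow> D y = D (par y) + w (par y, y)"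
    and w_nonneg: "\<And>a. a \<in> parcs G \<Longrightarrow> 0 \<le> w a" and w_sym: "\<And>u v. w (u, v) = w (v, u)"
    and tree: "\<And>u v. (u, v) \<in> parcs G \<Longrightarrow> v \<noteq> r \<and> par v = u \<or> u \<noteq> r \<and> par u = v"
    and Pr: "P r = {}" and P: "\<And>y. y \<in> pverts G \<Longrightarrow> y \<noteq> r \<Longrightarrow> P y = insert y (P (par y)) \<and> y \<notin> P (par y)"
    and PV: "\<And>y. y \<in> pverts G \<Longrightarrow> P y \<subseteq> pverts G - {r}"
begin

lemma arc_verts: "(u, v) \<in> parcs G \<Longrightarrow> u \<in> pverts G \<and> v \<in> pverts G"
proof -
  interpret pair_graph G by (rule pg)
  show "(u, v) \<in> parcs G \<Longrightarrow> u \<in> pverts G \<and> v \<in> pverts G" by (auto dest: in_arcsD1 in_arcsD2)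
qed

lemma fin: "finite (pverts G)"
proof -
  interpret pair_graph G by (rule pg)
  show ?thesis by (rule pair_finite_verts)
qed

lemma sym: "(u, v) \<in> parcs G \<Longrightarrow> (v, u) \<in> parcs G"
proof -
  interpret pair_graph G by (rule pg)
  show "(u, v) \<in> parcs G \<Longrightarrow> (v, u) \<in> parcs G" by (rule arcs_symmetric)
qed

lemma vw: "vwalk p (with_proj G) \<longleftrightarrow> p \<noteq> [] \<and> set p \<subseteq> pverts G \<and> set (vwalk_arcs p) \<subseteq> parcs G"
  by (auto simp: vwalk_def arcs_ends_def arc_to_ends_def)

lemma finP: "y \<in> pverts G \<Longrightarrow> finite (P y)"
  using PV fin finite_subset by blast

lemma up_induct [consumes 1, case_names root step]:
  assumes "y \<in> pverts G" "Q r" "\<And>y. y \<in> pverts G \<Longrightarrow> y \<noteq> r \<Longrightarrow> Q (par y) \<Longrightarrow> Q y"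
  shows "Q y"
  using assms(1)
proof (induction "card (P y)" arbitrary: y rule: less_induct)
  case less
  show ?case
  proof (cases "y = r")
    case False
    have p: "par y \<in> pverts G" using par[OF less.prems False] arc_verts by blast
    have "P y = insert y (P (par y))" "y \<notin> P (par y)" using P[OF less.prems False] by auto
    then have "card (P (par y)) < card (P y)" using finP[OF p] by simp
    then show ?thesis using assms(3)[OF less.prems False less.hyps[OF _ p]] by blast
  qed (simp add: assms(2))
qed

lemma D_sum: "y \<in> pverts G \<Longrightarrow> D y = (\<Sum>z\<in>P y. w (par z, z))"
proof (induction rule: up_induct)
  case (step y)
  have "par y \<in> pverts G" using par[OF step(1,2)] arc_verts by blast
  then show ?case using P[OF step(1,2)] D[OF step(1,2)] finP step(3) by simp
qed (simp add: Pr Dr)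

lemma P_closed:
  assumes "\<forall>y\<in>S - {r}. par y \<in> S" "S \<subseteq> pverts G" "y \<in> S"
  shows "P y \<subseteq> S"
proof -
  have "y \<in> pverts G" using assms by blast
  then have "y \<in> S \<longrightarrow> P y \<subseteq> S"
  proof (induction rule: up_induct)
    case (step y)
    then show ?case using P[OF step(1,2)] assms(1) by auto
  qed (simp add: Pr)
  then show ?thesis using assms(3) by simp
qed

lemma vwalk_snoc: "p \<noteq> [] \<Longrightarrow> vwalk (p @ [x]) (with_proj G) \<longleftrightarrow> vwalk p (with_proj G) \<and> (last p, x) \<in> parcs G"
  unfolding vw by (auto simp: vwalk_arcs_snoc dest: arc_verts)

text \<open>Inductively along the walk: an edge towards a new vertex pays for itself and for the way back.\<close>

lemma walk_bound:
  assumes "vwalk p (with_proj G)" "hd p = r"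
  shows "(\<forall>y\<in>set p - {r}. par y \<in> set p) \<and>
    2 * (\<Sum>y\<in>set p - {r}. w (par y, y)) - D (last p) \<le> walk_length w p"
  using assms
proof (induction p rule: rev_induct)
  case Nil
  then show ?case by (simp add: vw)
next
  case (snoc x p)
  show ?case
  proof (cases "p = []")
    case True
    then show ?thesis using snoc.prems by (simp add: walk_length_simps Dr)
  next
    case False
    define v where "v = last p"
    have v: "v \<in> set p" using False by (simp add: v_def)
    have p: "vwalk p (with_proj G)" "hd p = r" and a: "(v, x) \<in> parcs G"
      using snoc.prems vwalk_snoc[OF False] False by (auto simp: v_def)
    have I: "\<forall>y\<in>set p - {r}. par y \<in> set p"
      "2 * (\<Sum>y\<in>set p - {r}. w (par y, y)) - D v \<le> walk_length w p"
      using snoc.IH[OF p] by (auto simp: v_def)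
    have rp: "r \<in> set p" using p(2) False by (metis list.set_sel(1))
    have wl: "walk_length w (p @ [x]) = walk_length w p + w (v, x)" using False by (simp add: walk_length_simps v_def)
    have xv: "x \<in> pverts G" "v \<in> pverts G" using arc_verts[OF a] by auto
    have w0: "w (v, x) \<ge> 0" by (rule w_nonneg[OF a])
    from tree[OF a] consider (new) "x \<noteq> r" "par x = v" "x \<notin> set p" | (old) "x \<noteq> r" "par x = v" "x \<in> set p"
      | (up) "v \<noteq> r" "par v = x" by blast
    then show ?thesis
    proof cases
      case new
      then have "set (p @ [x]) - {r} = insert x (set p - {r})" by auto
      then have "(\<Sum>y\<in>set (p @ [x]) - {r}. w (par y, y)) = w (v, x) + (\<Sum>y\<in>set p - {r}. w (par y, y))"
        using new by simp
      moreover have "D x = D v + w (v, x)" using D[OF xv(1) new(1)] new by simp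
      ultimately show ?thesis using I new v wl by auto
    next
      case old
      then have "set (p @ [x]) = set p" by auto
      moreover have "D x = D v + w (v, x)" using D[OF xv(1) old(1)] old by simp
      ultimately show ?thesis using I wl w0 by simp
    next
      case up
      then have "x \<in> set p" using I(1) v by blast
      then have "set (p @ [x]) = set p" by auto
      moreover have "D v = D x + w (v, x)" using D[OF xv(2) up(1)] up w_sym by simp
      ultimately show ?thesis using I wl by simp
    qed
  qed
qed

lemma arc_D: "(u, v) \<in> parcs G \<Longrightarrow> D v - D u \<le> w (u, v)"
proof -
  assume a: "(u, v) \<in> parcs G"
  have uv: "u \<in> pverts G" "v \<in> pverts G" using arc_verts[OF a] by auto
  from tree[OF a] show ?thesis
    using D[OF uv(1)] D[OF uv(2)] w_nonneg[OF a] w_sym[of u v] by auto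
qed

text \<open>\<open>D\<close> is a potential that rises along an arc by at most its length, which
  bounds every walk from below; the path through the parents attains the bound.\<close>

lemma dist:
  assumes "v \<in> pverts G"
  shows "tree_dist G w r v = D v"
proof -
  interpret pair_graph G by (rule pg)
  have lb: "D v - D u \<le> awalk_cost w p" if "awalk u p v" for u p v
    using that
  proof (induction p arbitrary: u)
    case (Cons a p)
    obtain x y where a: "a = (x, y)" by (cases a)
    have "(x, y) \<in> parcs G" "u = x" "awalk y p v" using Cons.prems by (auto simp: awalk_Cons_iff a)
    then show ?case using Cons.IH[of y] arc_D[of x y] a by (simp add: awalk_cost_Cons)
  qed (simp add: awalk_Nil_iff)
  have ub: "\<exists>p. awalk r p v \<and> awalk_cost w p = D v"
    using assms
  proof (induction rule: up_induct)
    case root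
    show ?case using r by (intro exI[of _ "[]"]) (simp add: awalk_Nil_iff Dr)
  next
    case (step y)
    then obtain p where p: "awalk r p (par y)" "awalk_cost w p = D (par y)" by blast
    have "awalk (par y) [(par y, y)] y" using par[OF step(1,2)] arc_verts by (auto simp: awalk_Cons_iff awalk_Nil_iff)
    then have "awalk r (p @ [(par y, y)]) y" using p(1) by (rule awalk_appendI[rotated])
    moreover have "awalk_cost w (p @ [(par y, y)]) = D y" using p(2) D[OF step(1,2)] by simp
    ultimately show ?case by blast
  qed
  have "\<mu> w r v = ereal (D v)"
    unfolding \<mu>_def
  proof (rule antisym)
    obtain p where "awalk r p v" "awalk_cost w p = D v" using ub by blast
    then show "(INF p\<in>{p. awalk r p v}. ereal (awalk_cost w p)) \<le> ereal (D v)"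
      by (intro INF_lower2[of p]) auto
    show "ereal (D v) \<le> (INF p\<in>{p. awalk r p v}. ereal (awalk_cost w p))"
      by (rule INF_greatest) (use lb[of r _ v] Dr in auto)
  qed
  then show ?thesis by (simp add: tree_dist_def)
qed

lemma regret_D: "vwalk p (with_proj G) \<Longrightarrow> hd p = r \<Longrightarrow> regret G w p = walk_length w p - D (last p)"
proof -
  assume p: "vwalk p (with_proj G)" "hd p = r"
  have "last p \<in> pverts G" using p(1) last_in_set[of p] unfolding vw by blast
  then show ?thesis using dist[of "last p"] p(2) by (simp add: regret_def)
qed

text \<open>The visited set is closed under parents and contains the path to the last vertex. In
  \<open>walk_bound\<close> that path contributes twice the depth of the last vertex; once it is
  already subtracted there, and once more by the definition of regret.\<close>

lemma detour_bound:
  assumes "vwalk p (with_proj G)" "hd p = r" "regret G w p \<le> B"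
  shows "2 * (\<Sum>y\<in>set p - {r} - P (last p). w (par y, y)) \<le> B"
    and "\<forall>y\<in>set p - {r}. par y \<in> set p" and "last p \<in> set p" and "r \<in> set p" and "set p \<subseteq> pverts G"
proof -
  have b: "\<forall>y\<in>set p - {r}. par y \<in> set p" "2 * (\<Sum>y\<in>set p - {r}. w (par y, y)) - D (last p) \<le> walk_length w p"
    using walk_bound[OF assms(1,2)] by auto
  have s: "set p \<subseteq> pverts G" "p \<noteq> []" using assms(1) by (auto simp: vw)
  then have l: "last p \<in> set p" "last p \<in> pverts G" by auto
  have "P (last p) \<subseteq> set p" by (rule P_closed[OF b(1) s(1) l(1)])
  then have sub: "P (last p) \<subseteq> set p - {r}" using PV[OF l(2)] by blast
  have "(\<Sum>y\<in>set p - {r}. w (par y, y)) = (\<Sum>y\<in>set p - {r} - P (last p). w (par y, y)) + D (last p)"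
    unfolding D_sum[OF l(2)] by (rule sum.subset_diff[OF sub]) simp
  then show "2 * (\<Sum>y\<in>set p - {r} - P (last p). w (par y, y)) \<le> B"
    using b(2) assms(3) regret_D[OF assms(1,2)] by linarith
  show "\<forall>y\<in>set p - {r}. par y \<in> set p" "last p \<in> set p" "r \<in> set p" "set p \<subseteq> pverts G"
    using b l s assms(2) by (auto intro: list.set_sel(1))
qed

end

section \<open>Polynomial time for functions on encoded data\<close>

text \<open>The base \<open>size + 2\<close> makes the bounds increasing in \<open>d\<close>, so that they are closed under sums and products.\<close>

definition ptf :: "('a \<Rightarrow> btree) \<Rightarrow> ('b \<Rightarrow> btree) \<Rightarrow> ('a \<Rightarrow> 'b) \<Rightarrow> bool" where
  "ptf E F f \<longleftrightarrow> (\<exists>p d. \<forall>x. \<exists>t. exec p (E x) (F (f x)) t \<and> t \<le> (size (E x) + 2) ^ d)"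

definition pbd :: "('a \<Rightarrow> btree) \<Rightarrow> ('a \<Rightarrow> nat) \<Rightarrow> bool" where
  "pbd E f \<longleftrightarrow> (\<exists>d. \<forall>x. f x \<le> (size (E x) + 2) ^ d)"

lemma pow_mono2: "a \<le> b \<Longrightarrow> (s + 2) ^ a \<le> (s + 2) ^ (b :: nat)" for s :: nat
  by (rule power_increasing) auto

lemma pow_add2: "(s + 2) ^ a + (s + 2) ^ b \<le> (s + 2) ^ (max a b + 1)" for s :: nat
proof -
  have "(s + 2) ^ a + (s + 2) ^ b \<le> (s + 2) ^ max a b + (s + 2) ^ max a b"
    by (intro add_mono pow_mono2) auto
  also have "\<dots> = 2 * (s + 2) ^ max a b" by simp
  also have "\<dots> \<le> (s + 2) * (s + 2) ^ max a b" by (intro mult_right_mono) auto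
  finally show ?thesis by simp
qed

lemma pbd_const [intro]: "pbd E (\<lambda>_. c)"
  unfolding pbd_def
proof (intro exI allI)
  fix x
  have "c \<le> 2 ^ c" by (simp add: less_imp_le)
  also have "\<dots> \<le> (size (E x) + 2) ^ c" by (rule power_mono) auto
  finally show "c \<le> (size (E x) + 2) ^ c" .
qed

lemma pbd_mono: "pbd E g \<Longrightarrow> (\<And>x. f x \<le> g x) \<Longrightarrow> pbd E f"
  unfolding pbd_def by (meson le_trans)

lemma pbd_add [intro]:
  assumes "pbd E f" "pbd E g"
  shows "pbd E (\<lambda>x. f x + g x)"
proof -
  obtain a b where ab: "\<forall>x. f x \<le> (size (E x) + 2) ^ a" "\<forall>x. g x \<le> (size (E x) + 2) ^ b"
    using assms unfolding pbd_def by blast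
  have "f x + g x \<le> (size (E x) + 2) ^ (max a b + 1)" for x
    using ab(1)[rule_format, of x] ab(2)[rule_format, of x] pow_add2[of "size (E x)" a b] by linarith
  then show ?thesis unfolding pbd_def by blast
qed

lemma pbd_mult [intro]:
  assumes "pbd E f" "pbd E g"
  shows "pbd E (\<lambda>x. f x * g x)"
proof -
  obtain a b where ab: "\<forall>x. f x \<le> (size (E x) + 2) ^ a" "\<forall>x. g x \<le> (size (E x) + 2) ^ b"
    using assms unfolding pbd_def by blast
  have "f x * g x \<le> (size (E x) + 2) ^ (a + b)" for x
    unfolding power_add using ab by (intro mult_mono) auto
  then show ?thesis unfolding pbd_def by blast
qed

lemma pbd_power [intro]: "pbd E f \<Longrightarrow> pbd E (\<lambda>x. f x ^ c)"
  by (induction c) auto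

lemma pbd_Suc [intro]: "pbd E f \<Longrightarrow> pbd E (\<lambda>x. Suc (f x))"
  using pbd_add[OF _ pbd_const, of E f 1] by simp

lemma pbd_size [intro]: "pbd E (\<lambda>x. size (E x))"
  unfolding pbd_def by (intro exI[of _ 1]) auto

lemma ptf_size:
  assumes "ptf E F f"
  shows "pbd E (\<lambda>x. size (F (f x)))"
  using assms exec_size_le unfolding ptf_def pbd_def by (meson le_trans)

lemma pbd_comp:
  assumes "pbd F g" "pbd E (\<lambda>x. size (F (f x)))"
  shows "pbd E (\<lambda>x. g (f x))"
proof -
  obtain a where a: "\<forall>x. g x \<le> (size (F x) + 2) ^ a" using assms(1) unfolding pbd_def by blast
  have "pbd E (\<lambda>x. (size (F (f x)) + 2) ^ a)"
    by (intro pbd_power pbd_add pbd_const assms(2))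
  then show ?thesis by (rule pbd_mono) (use a in blast)
qed

lemma ptfI:
  assumes "\<And>x. exec p (E x) (F (f x)) (t x)" "pbd E t"
  shows "ptf E F f"
  using assms unfolding ptf_def pbd_def by blast

lemma ptfE:
  assumes "ptf E F f"
  obtains p t where "\<And>x. exec p (E x) (F (f x)) (t x)" "pbd E t"
proof -
  obtain p d where "\<forall>x. \<exists>t. exec p (E x) (F (f x)) t \<and> t \<le> (size (E x) + 2) ^ d"
    using assms unfolding ptf_def by blast
  then obtain t where "\<forall>x. exec p (E x) (F (f x)) (t x) \<and> t x \<le> (size (E x) + 2) ^ d" by metis
  then show thesis using that[of p t] unfolding pbd_def by blast
qed

definition ePair :: "('a \<Rightarrow> btree) \<Rightarrow> ('b \<Rightarrow> btree) \<Rightarrow> 'a \<times> 'b \<Rightarrow> btree" where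
  "ePair E F z = Node (E (fst z)) (F (snd z))"

definition eBool :: "bool \<Rightarrow> btree" where
  "eBool b = (if b then Node Leaf Leaf else Leaf)"

definition un :: "nat \<Rightarrow> btree" where
  "un n = enc_list (\<lambda>_. Leaf) [0..<n]"

abbreviation eList :: "('a \<Rightarrow> btree) \<Rightarrow> 'a list \<Rightarrow> btree" where "eList \<equiv> enc_list"

lemma enc_list_simps [simp]: "enc_list f [] = Leaf" "enc_list f (x # xs) = Node (f x) (enc_list f xs)"
  by (simp_all add: enc_list_def)

lemma ptf_id: "ptf E E (\<lambda>x. x)"
  by (rule ptfI[of Ident _ _ _ "\<lambda>x. Suc (size (E x))"]) (auto intro: exec.intros)

lemma ptf_const: "ptf E F (\<lambda>_. c)"
proof (rule ptfI)
  show "exec (Const (F c)) (E x) (F c) (Suc (size (E x) + size (F c)))" for x by (rule exec.Const)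
  show "pbd E (\<lambda>x. Suc (size (E x) + size (F c)))" by (intro pbd_Suc pbd_add pbd_size pbd_const)
qed

lemma ptf_compose:
  assumes "ptf E F f" "ptf F G g"
  shows "ptf E G (\<lambda>x. g (f x))"
proof -
  obtain p t where p: "\<And>x. exec p (E x) (F (f x)) (t x)" "pbd E t" using ptfE[OF assms(1)] by blast
  obtain q s where q: "\<And>x. exec q (F x) (G (g x)) (s x)" "pbd F s" using ptfE[OF assms(2)] by blast
  show ?thesis
  proof (rule ptfI)
    show "exec (Comp q p) (E x) (G (g (f x))) (Suc (size (E x)) + t x + s (f x))" for x
      by (rule exec.Comp[OF p(1) q(1)])
    show "pbd E (\<lambda>x. Suc (size (E x)) + t x + s (f x))"
      using p(2) pbd_comp[OF q(2) ptf_size[OF assms(1)]] by (intro pbd_add pbd_Suc pbd_size)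
  qed
qed

lemma ptf_enc:
  assumes "ptf E F f" "\<And>x. F' (f' x) = F (f x)" 
  shows "ptf E F' f'"
  using assms by (simp add: ptf_def)

lemma ptf_pair:
  assumes "ptf E F f" "ptf E G g"
  shows "ptf E (ePair F G) (\<lambda>x. (f x, g x))"
proof -
  obtain p t where p: "\<And>x. exec p (E x) (F (f x)) (t x)" "pbd E t" using ptfE[OF assms(1)] by blast
  obtain q s where q: "\<And>x. exec q (E x) (G (g x)) (s x)" "pbd E s" using ptfE[OF assms(2)] by blast
  show ?thesis
  proof (rule ptfI)
    show "exec (Construct p q) (E x) (ePair F G (f x, g x)) (Suc (size (E x)) + t x + s x)" for x
      unfolding ePair_def using exec.Construct[OF p(1) q(1)] by simp
    show "pbd E (\<lambda>x. Suc (size (E x)) + t x + s x)" using p(2) q(2) by (intro pbd_add pbd_Suc pbd_size)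
  qed
qed

lemma ptf_fst: "ptf E (ePair F G) f \<Longrightarrow> ptf E F (\<lambda>x. fst (f x))"
proof (rule ptf_compose[of E "ePair F G" f])
  show "ptf (ePair F G) F fst"
  proof (rule ptfI)
    show "exec Left (ePair F G x) (F (fst x)) (Suc (size (ePair F G x)))" for x
      using exec.Left[of "ePair F G x"] by (simp add: ePair_def)
  qed auto
qed

lemma ptf_snd: "ptf E (ePair F G) f \<Longrightarrow> ptf E G (\<lambda>x. snd (f x))"
proof (rule ptf_compose[of E "ePair F G" f])
  show "ptf (ePair F G) G snd"
  proof (rule ptfI)
    show "exec Right (ePair F G x) (G (snd x)) (Suc (size (ePair F G x)))" for x
      using exec.Right[of "ePair F G x"] by (simp add: ePair_def)
  qed auto
qed

lemma ptf_if:
  assumes "ptf E eBool b" "ptf E F f" "ptf E F g"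
  shows "ptf E F (\<lambda>x. if b x then f x else g x)"
proof -
  obtain r u where r: "\<And>x. exec r (E x) (eBool (b x)) (u x)" "pbd E u" using ptfE[OF assms(1)] by blast
  obtain p t where p: "\<And>x. exec p (E x) (F (f x)) (t x)" "pbd E t" using ptfE[OF assms(2)] by blast
  obtain q s where q: "\<And>x. exec q (E x) (F (g x)) (s x)" "pbd E s" using ptfE[OF assms(3)] by blast
  show ?thesis
  proof (rule ptfI)
    show "exec (Cond r p q) (E x) (F (if b x then f x else g x)) (Suc (size (E x)) + u x + (if b x then t x else s x))" for x
    proof (cases "b x")
      case True
      then have "exec r (E x) (Node Leaf Leaf) (u x)" using r(1)[of x] by (simp add: eBool_def)
      then show ?thesis using exec.Cond_true[of r "E x" _ _ p] p(1) True by simp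
    next
      case False
      then have "exec r (E x) Leaf (u x)" using r(1)[of x] by (simp add: eBool_def)
      then show ?thesis using exec.Cond_false[of r "E x" _ q _ _ p] q(1) False by simp
    qed
    have "pbd E (\<lambda>x. Suc (size (E x)) + u x + (t x + s x))"
      using p(2) q(2) r(2) by (intro pbd_add pbd_Suc pbd_size)
    then show "pbd E (\<lambda>x. Suc (size (E x)) + u x + (if b x then t x else s x))" by (rule pbd_mono) auto
  qed
qed

text \<open>The list is evaluated twice, first as the condition and then to be paired with the
  argument. A nonempty list is encoded exactly like the pair of its head and tail, so the pair is
  what the program for \<open>g\<close> expects.\<close>

lemma ptf_case_list:
  assumes "ptf E (eList G) xs" "ptf E F f"
    "ptf (ePair E (ePair G (eList G))) F (\<lambda>z. g (fst z) (fst (snd z)) (snd (snd z)))"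
  shows "ptf E F (\<lambda>x. case xs x of [] \<Rightarrow> f x | y # ys \<Rightarrow> g x y ys)"
proof -
  obtain r u where r: "\<And>x. exec r (E x) (eList G (xs x)) (u x)" "pbd E u" using ptfE[OF assms(1)] by blast
  obtain p t where p: "\<And>x. exec p (E x) (F (f x)) (t x)" "pbd E t" using ptfE[OF assms(2)] by blast
  obtain q s where q: "\<And>z. exec q (ePair E (ePair G (eList G)) z) (F (g (fst z) (fst (snd z)) (snd (snd z)))) (s z)"
      "pbd (ePair E (ePair G (eList G))) s" using ptfE[OF assms(3)] by blast
  let ?z = "\<lambda>x. (x, hd (xs x), tl (xs x))"
  let ?c = "\<lambda>x. Suc (size (E x)) + (Suc (size (E x)) + Suc (size (E x)) + u x) + s (?z x)"
  have ex: "exec (Cond r (Comp q (Construct Ident r)) p) (E x) (F (case xs x of [] \<Rightarrow> f x | y # ys \<Rightarrow> g x y ys))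
      (Suc (size (E x)) + u x + (if xs x = [] then t x else ?c x))" for x
  proof (cases "xs x")
    case Nil
    then have "exec r (E x) Leaf (u x)" using r(1)[of x] by simp
    then show ?thesis using exec.Cond_false[of r "E x" _ p] p(1) Nil by simp
  next
    case (Cons y ys)
    then have e: "exec r (E x) (Node (G y) (eList G ys)) (u x)" using r(1)[of x] by simp
    have "exec (Construct Ident r) (E x) (Node (E x) (Node (G y) (eList G ys))) (Suc (size (E x)) + Suc (size (E x)) + u x)"
      by (rule exec.Construct[OF exec.Ident e])
    moreover have "exec q (Node (E x) (Node (G y) (eList G ys))) (F (g x y ys)) (s (?z x))"
      using q(1)[of "?z x"] Cons by (simp add: ePair_def)
    ultimately have "exec (Comp q (Construct Ident r)) (E x) (F (g x y ys)) (?c x)" by (rule exec.Comp)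
    then have "exec (Cond r (Comp q (Construct Ident r)) p) (E x) (F (g x y ys)) (Suc (size (E x)) + u x + ?c x)"
      by (intro exec.Cond_true[OF e]) simp
    then show ?thesis using Cons by simp
  qed
  \<comment> \<open>For an empty list the components of \<open>?z x\<close> are the unspecified
    \<open>hd []\<close> and \<open>tl []\<close>, whose encodings have constant size.\<close>
  have sz': "size (ePair E (ePair G (eList G)) (?z x)) \<le> size (E x) + 2 + size (eList G (xs x)) + size (G (hd [])) + size (eList G (tl []))" for x
    by (cases "xs x") (auto simp: ePair_def)
  have "pbd E (\<lambda>x. size (E x) + 2 + size (eList G (xs x)) + size (G (hd [])) + size (eList G (tl [])))"
    using ptf_size[OF assms(1)] by (intro pbd_add pbd_size pbd_const)
  then have "pbd E (\<lambda>x. size (ePair E (ePair G (eList G)) (?z x)))" by (rule pbd_mono) (rule sz')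
  then have ps: "pbd E (\<lambda>x. s (?z x))" by (rule pbd_comp[OF q(2)])
  have "pbd E (\<lambda>x. Suc (size (E x)) + u x + (t x + ?c x))"
    using p(2) r(2) ps by (intro pbd_add pbd_Suc pbd_size)
  then have "pbd E (\<lambda>x. Suc (size (E x)) + u x + (if xs x = [] then t x else ?c x))" by (rule pbd_mono) auto
  then show ?thesis using ex by (intro ptfI)
qed

text \<open>The loop state consists of the argument, the accumulator and the rest of the list. A
  bound on all intermediate accumulators is a hypothesis, because iterating a step of polynomial
  cost may otherwise lead to exponential size.\<close>

lemma ptf_foldl:
  assumes xs: "ptf E (eList G) xs" and i: "ptf E A i"
    and g: "ptf (ePair (ePair E A) G) A (\<lambda>z. g (fst (fst z)) (snd (fst z)) (snd z))"
    and sz: "\<And>x j. j \<le> length (xs x) \<Longrightarrow> size (A (foldl (g x) (i x) (take j (xs x)))) \<le> B x" and B: "pbd E B"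
  shows "ptf E A (\<lambda>x. foldl (g x) (i x) (xs x))"
proof -
  let ?S = "ePair E (ePair A (eList G))"
  obtain r u where r: "\<And>x. exec r (E x) (ePair E (ePair A (eList G)) (x, i x, xs x)) (u x)" "pbd E u"
    using ptfE[OF ptf_pair[OF ptf_id ptf_pair[OF i xs]]] by blast
  define step where "step s = (case snd (snd s) of [] \<Rightarrow> s | y # ys \<Rightarrow> (fst s, g (fst s) (fst (snd s)) y, ys))" for s
  have "ptf ?S ?S step"
    unfolding step_def
  proof (rule ptf_case_list)
    show "ptf ?S (eList G) (\<lambda>s. snd (snd s))" by (rule ptf_snd[where F = A], rule ptf_snd[where F = E], rule ptf_id)
    show "ptf ?S ?S (\<lambda>s. s)" by (rule ptf_id)
    let ?Z = "ePair ?S (ePair G (eList G))"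
    have "ptf ?Z (ePair (ePair E A) G) (\<lambda>z. ((fst (fst z), fst (snd (fst z))), fst (snd z)))"
      by (intro ptf_pair ptf_fst[where G = "ePair A (eList G)"] ptf_fst[where G = "eList G"]
          ptf_fst[where G = "ePair G (eList G)"] ptf_snd[where F = E] ptf_snd[where F = ?S] ptf_id)
    from ptf_compose[OF this g]
    have "ptf ?Z A (\<lambda>z. g (fst (fst z)) (fst (snd (fst z))) (fst (snd z)))" by simp
    then show "ptf ?Z ?S (\<lambda>z. (fst (fst z), g (fst (fst z)) (fst (snd (fst z))) (fst (snd z)), snd (snd z)))"
      by (intro ptf_pair ptf_fst[where G = "ePair A (eList G)"] ptf_fst[where G = "ePair G (eList G)"]
          ptf_snd[where F = G] ptf_snd[where F = ?S] ptf_id)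
  qed
  then obtain p t where p: "\<And>s. exec p (?S s) (?S (step s)) (t s)" "pbd ?S t" using ptfE by blast
  have "ptf ?S eBool (\<lambda>s. case snd (snd s) of [] \<Rightarrow> False | y # ys \<Rightarrow> True)"
  proof (rule ptf_case_list)
    show "ptf ?S (eList G) (\<lambda>s. snd (snd s))" by (rule ptf_snd[where F = A], rule ptf_snd[where F = E], rule ptf_id)
  qed (rule ptf_const)+
  then obtain q v where q: "\<And>s. exec q (?S s) (eBool (case snd (snd s) of [] \<Rightarrow> False | y # ys \<Rightarrow> True)) (v s)" "pbd ?S v"
    using ptfE by blast
  obtain a where a: "\<forall>s. t s + v s \<le> (size (?S s) + 2) ^ a"
    using pbd_add[OF p(2) q(2)] unfolding pbd_def by blast
  let ?st = "\<lambda>x j. (x, foldl (g x) (i x) (take j (xs x)), drop j (xs x))"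
  let ?L = "\<lambda>x. size (E x) + 2 + B x + size (eList G (xs x))"
  have dl: "size (eList G (drop j ys)) \<le> size (eList G ys)" for j ys
  proof (induction ys arbitrary: j)
    case (Cons y ys)
    have "size (eList G (drop i ys)) \<le> Suc (size (G y) + size (eList G ys))" for i using Cons[of i] by simp
    then show ?case by (cases j) auto
  qed simp
  have sS: "size (?S (?st x j)) \<le> ?L x" if "j \<le> length (xs x)" for x j
    using sz[OF that] dl[of j "xs x"] by (simp add: ePair_def)
  have main: "\<exists>tt. exec (While q p) (?S (?st x (length (xs x) - m))) (?S (?st x (length (xs x)))) tt \<and>
      tt \<le> Suc m * (Suc (?L x) + (?L x + 2) ^ a)" if "m \<le> length (xs x)" for m x
    using that
  proof (induction m)
    case 0
    let ?s = "?st x (length (xs x))"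
    have e: "exec q (?S ?s) Leaf (v ?s)" using q(1)[of ?s] by (simp add: eBool_def)
    have b: "size (?S ?s) \<le> ?L x" by (rule sS) simp
    then have "(size (?S ?s) + 2) ^ a \<le> (?L x + 2) ^ a" by (intro power_mono) auto
    then have "v ?s \<le> (?L x + 2) ^ a" using a[rule_format, of ?s] by linarith
    then have "Suc (size (?S ?s)) + v ?s \<le> Suc 0 * (Suc (?L x) + (?L x + 2) ^ a)" using b by simp
    then show ?case using exec.While_false[OF e, of p] by auto
  next
    case (Suc m)
    let ?j = "length (xs x) - Suc m"
    let ?s = "?st x ?j"
    have j: "Suc ?j = length (xs x) - m" "?j < length (xs x)" using Suc.prems by auto
    have d: "drop ?j (xs x) = xs x ! ?j # drop (Suc ?j) (xs x)" using j(2) by (simp add: Cons_nth_drop_Suc)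
    have tk: "take (Suc ?j) (xs x) = take ?j (xs x) @ [xs x ! ?j]" using j(2) by (simp add: take_Suc_conv_app_nth)
    have st: "step ?s = ?st x (length (xs x) - m)"
      unfolding step_def j(1)[symmetric] tk by (simp add: d)
    obtain tt where tt: "exec (While q p) (?S (step ?s)) (?S (?st x (length (xs x)))) tt"
      "tt \<le> Suc m * (Suc (?L x) + (?L x + 2) ^ a)" using Suc unfolding st by auto
    have e: "exec q (?S ?s) (Node Leaf Leaf) (v ?s)" using q(1)[of ?s] by (simp add: eBool_def d)
    have b: "size (?S ?s) \<le> ?L x" by (rule sS) simp
    then have "(size (?S ?s) + 2) ^ a \<le> (?L x + 2) ^ a" by (intro power_mono) auto
    then have tv: "t ?s + v ?s \<le> (?L x + 2) ^ a" using a[rule_format, of ?s] by linarith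
    have ex: "exec (While q p) (?S ?s) (?S (?st x (length (xs x)))) (Suc (size (?S ?s)) + v ?s + t ?s + tt)"
      by (rule exec.While_true[OF e _ p(1) tt(1)]) simp
    have "Suc (size (?S ?s)) + v ?s + t ?s + tt \<le> Suc (Suc m) * (Suc (?L x) + (?L x + 2) ^ a)"
      using tt(2) b tv by simp
    then show ?case using ex by blast
  qed
  have "\<exists>tt. exec (While q p) (?S (?st x 0)) (?S (?st x (length (xs x)))) tt \<and>
      tt \<le> Suc (length (xs x)) * (Suc (?L x) + (?L x + 2) ^ a)" for x
    using main[of "length (xs x)" x] by simp
  then obtain tt where tt: "\<And>x. exec (While q p) (?S (?st x 0)) (?S (?st x (length (xs x)))) (tt x)"
    "\<And>x. tt x \<le> Suc (length (xs x)) * (Suc (?L x) + (?L x + 2) ^ a)" by metis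
  have lx: "length ys \<le> size (eList G ys)" for ys by (induction ys) auto
  have pl: "pbd E (\<lambda>x. length (xs x))" by (rule pbd_mono[OF ptf_size[OF xs]]) (rule lx)
  have pL: "pbd E ?L" using B ptf_size[OF xs] by (intro pbd_add pbd_size pbd_const)
  have pT: "pbd E (\<lambda>x. Suc (length (xs x)) * (Suc (?L x) + (?L x + 2) ^ a))"
    by (rule pbd_mult[OF pbd_Suc[OF pl] pbd_add[OF pbd_Suc[OF pL] pbd_power[OF pbd_add[OF pL pbd_const]]]])
  have "pbd E tt" by (rule pbd_mono[OF pT]) (rule tt(2))
  have fin: "exec (Comp (Comp Left Right) (Comp (While q p) r)) (E x) (A (foldl (g x) (i x) (xs x)))
      (Suc (size (E x)) + (Suc (size (E x)) + u x + tt x)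
        + (Suc (size (?S (?st x (length (xs x))))) + Suc (size (?S (?st x (length (xs x)))))
          + Suc (size (ePair A (eList G) (snd (?st x (length (xs x))))))))" for x
  proof (rule exec.Comp)
    show "exec (Comp (While q p) r) (E x) (?S (?st x (length (xs x)))) (Suc (size (E x)) + u x + tt x)"
      using exec.Comp[OF r(1)[of x] tt(1)[of x, unfolded take_0 drop_0 foldl_Nil]] by simp
    let ?f = "?st x (length (xs x))"
    have "exec Right (?S ?f) (ePair A (eList G) (snd ?f)) (Suc (size (?S ?f)))"
      using exec.Right[of "?S ?f"] by (simp add: ePair_def)
    moreover have "exec Left (ePair A (eList G) (snd ?f)) (A (foldl (g x) (i x) (xs x)))
        (Suc (size (ePair A (eList G) (snd ?f))))"
      using exec.Left[of "ePair A (eList G) (snd ?f)"] by (simp add: ePair_def)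
    ultimately show "exec (Comp Left Right) (?S ?f) (A (foldl (g x) (i x) (xs x)))
      (Suc (size (?S ?f)) + Suc (size (?S ?f)) + Suc (size (ePair A (eList G) (snd ?f))))" by (rule exec.Comp)
  qed
  have "pbd E (\<lambda>x. Suc (size (E x)) + (Suc (size (E x)) + u x + tt x)
        + (Suc (?L x) + Suc (?L x) + Suc (?L x)))"
    by (rule pbd_add[OF pbd_add[OF pbd_Suc[OF pbd_size] pbd_add[OF pbd_add[OF pbd_Suc[OF pbd_size] r(2)] \<open>pbd E tt\<close>]]
      pbd_add[OF pbd_add[OF pbd_Suc[OF pL] pbd_Suc[OF pL]] pbd_Suc[OF pL]]])
  then have "pbd E (\<lambda>x. Suc (size (E x)) + (Suc (size (E x)) + u x + tt x)
        + (Suc (size (?S (?st x (length (xs x))))) + Suc (size (?S (?st x (length (xs x)))))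
          + Suc (size (ePair A (eList G) (snd (?st x (length (xs x))))))))"
  proof (rule pbd_mono)
    fix x
    have a: "size (?S (?st x (length (xs x)))) \<le> ?L x" by (rule sS) simp
    then have "size (ePair A (eList G) (snd (?st x (length (xs x))))) \<le> ?L x" by (simp add: ePair_def)
    then show "Suc (size (E x)) + (Suc (size (E x)) + u x + tt x)
        + (Suc (size (?S (?st x (length (xs x))))) + Suc (size (?S (?st x (length (xs x)))))
          + Suc (size (ePair A (eList G) (snd (?st x (length (xs x)))))))
      \<le> Suc (size (E x)) + (Suc (size (E x)) + u x + tt x) + (Suc (?L x) + Suc (?L x) + Suc (?L x))"
      using a by linarith
  qed
  then show ?thesis using fin by (intro ptfI)
qed

section \<open>Lists and truth values\<close>

lemmas ptf_basic = ptf_const ptf_id ptf_fst ptf_snd ptf_pair ptf_if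

lemma ptf_Cons:
  assumes "ptf E G a" "ptf E (eList G) l"
  shows "ptf E (eList G) (\<lambda>x. a x # l x)"
  by (rule ptf_enc[OF ptf_pair[OF assms]]) (simp add: ePair_def)

lemma eList_mono_take: "size (eList G (take j xs)) \<le> size (eList G xs)"
proof (induction xs arbitrary: j)
  case (Cons x xs)
  have "size (eList G (take i xs)) \<le> size (eList G xs)" for i by (rule Cons)
  then show ?case by (cases j) auto
qed simp

lemma size_eList_append: "size (eList G (xs @ ys)) = size (eList G xs) + size (eList G ys)"
  by (induction xs) auto

lemma size_eList_rev: "size (eList G (rev xs)) = size (eList G xs)"
  by (induction xs) (auto simp: size_eList_append)

lemma length_eList: "length xs \<le> size (eList G xs)"
  by (induction xs) auto

lemma size_eList_bound: "(\<And>y. y \<in> set xs \<Longrightarrow> size (G y) \<le> b) \<Longrightarrow> size (eList G xs) \<le> length xs * (b + 1)"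
proof (induction xs)
  case (Cons a xs)
  then have "size (eList G xs) \<le> length xs * (b + 1)" "size (G a) \<le> b" by auto
  then show ?case by simp
qed simp

lemma size_eList_mem: "y \<in> set xs \<Longrightarrow> size (G y) < size (eList G xs)"
  by (induction xs) auto

lemma foldl_Cons_rev: "foldl (\<lambda>acc y. f y # acc) a xs = rev (map f xs) @ a"
  by (induction xs arbitrary: a) auto

lemma ptf_rev_append:
  assumes xs: "ptf E (eList G) xs" and ys: "ptf E (eList G) ys"
  shows "ptf E (eList G) (\<lambda>x. rev (xs x) @ ys x)"
proof -
  have "ptf E (eList G) (\<lambda>x. foldl (\<lambda>acc y. y # acc) (ys x) (xs x))"
  proof (rule ptf_foldl[OF xs ys])
    show "ptf (ePair (ePair E (eList G)) G) (eList G) (\<lambda>z. snd z # snd (fst z))"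
      by (rule ptf_Cons ptf_basic)+
    show "size (eList G (foldl (\<lambda>acc y. y # acc) (ys x) (take j (xs x))))
        \<le> size (eList G (xs x)) + size (eList G (ys x))" for x j
      using eList_mono_take[of G j "xs x"] foldl_Cons_rev[of id "ys x" "take j (xs x)"]
      by (simp add: size_eList_append size_eList_rev)
    show "pbd E (\<lambda>x. size (eList G (xs x)) + size (eList G (ys x)))"
      by (rule pbd_add[OF ptf_size[OF xs] ptf_size[OF ys]])
  qed
  then show ?thesis by (simp add: foldl_Cons_rev[of id, simplified])
qed

lemma ptf_rev: "ptf E (eList G) xs \<Longrightarrow> ptf E (eList G) (\<lambda>x. rev (xs x))"
  using ptf_rev_append[OF _ ptf_const[of E "eList G" "[]"]] by simp

lemma ptf_append: "ptf E (eList G) xs \<Longrightarrow> ptf E (eList G) ys \<Longrightarrow> ptf E (eList G) (\<lambda>x. xs x @ ys x)"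
  using ptf_rev_append[OF ptf_rev] by simp

lemma pbd_pair_bound:
  assumes "pbd (ePair E G) h" "ptf E (eList G) xs"
  shows "\<exists>B. pbd E B \<and> (\<forall>x. \<forall>y\<in>set (xs x). h (x, y) \<le> B x)"
proof -
  obtain d where d: "\<forall>z. h z \<le> (size (ePair E G z) + 2) ^ d" using assms(1) unfolding pbd_def by blast
  have "h (x, y) \<le> (size (E x) + size (eList G (xs x)) + 3) ^ d" if "y \<in> set (xs x)" for x y
  proof -
    have "h (x, y) \<le> (size (E x) + size (G y) + 3) ^ d" using d[rule_format, of "(x, y)"] by (simp add: ePair_def eval_nat_numeral)
    also have "\<dots> \<le> (size (E x) + size (eList G (xs x)) + 3) ^ d"
      using size_eList_mem[OF that, of G] by (intro power_mono) auto
    finally show ?thesis .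
  qed
  moreover have "pbd E (\<lambda>x. (size (E x) + size (eList G (xs x)) + 3) ^ d)"
    by (rule pbd_power[OF pbd_add[OF pbd_add[OF pbd_size ptf_size[OF assms(2)]] pbd_const]])
  ultimately show ?thesis by blast
qed

lemma pbd_length: "ptf E (eList G) xs \<Longrightarrow> pbd E (\<lambda>x. length (xs x))"
  by (rule pbd_mono[OF ptf_size]) (auto intro: length_eList)

lemma ptf_map:
  assumes xs: "ptf E (eList G) xs" and f: "ptf (ePair E G) F (\<lambda>z. f (fst z) (snd z))"
  shows "ptf E (eList F) (\<lambda>x. map (\<lambda>y. f x y) (xs x))"
proof -
  obtain B where B: "pbd E B" "\<forall>x. \<forall>y\<in>set (xs x). size (F (f x y)) \<le> B x"
    using pbd_pair_bound[OF ptf_size[OF f] xs] by auto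
  have "ptf E (eList F) (\<lambda>x. foldl (\<lambda>acc y. f x y # acc) [] (xs x))"
  proof (rule ptf_foldl[OF xs ptf_const])
    have "ptf (ePair (ePair E (eList F)) G) (ePair E G) (\<lambda>z. (fst (fst z), snd z))"
      by (rule ptf_basic)+
    from ptf_compose[OF this f]
    have "ptf (ePair (ePair E (eList F)) G) F (\<lambda>z. f (fst (fst z)) (snd z))" by simp
    then show "ptf (ePair (ePair E (eList F)) G) (eList F) (\<lambda>z. f (fst (fst z)) (snd z) # snd (fst z))"
      by (rule ptf_Cons) (rule ptf_basic)+
    show "size (eList F (foldl (\<lambda>acc y. f x y # acc) [] (take j (xs x)))) \<le> length (xs x) * (B x + 1)" for x j
    proof -
      have "size (eList F (map (f x) (take j (xs x)))) \<le> length (map (f x) (take j (xs x))) * (B x + 1)"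
        using B(2) by (intro size_eList_bound) (auto dest!: in_set_takeD)
      also have "\<dots> \<le> length (xs x) * (B x + 1)" by (intro mult_le_mono1) simp
      finally show ?thesis by (simp add: foldl_Cons_rev size_eList_rev)
    qed
    show "pbd E (\<lambda>x. length (xs x) * (B x + 1))"
      by (rule pbd_mult[OF pbd_length[OF xs] pbd_add[OF B(1) pbd_const]])
  qed
  from ptf_rev[OF this] show ?thesis by (simp add: foldl_Cons_rev)
qed

lemma foldl_filter: "foldl (\<lambda>acc y. if P y then y # acc else acc) a xs = rev (filter P xs) @ a"
  by (induction xs arbitrary: a) auto

lemma size_filter: "size (eList G (filter P xs)) \<le> size (eList G xs)"
  by (induction xs) auto

lemma ptf_filter:
  assumes xs: "ptf E (eList G) xs" and P: "ptf (ePair E G) eBool (\<lambda>z. P (fst z) (snd z))"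
  shows "ptf E (eList G) (\<lambda>x. filter (\<lambda>y. P x y) (xs x))"
proof -
  have "ptf E (eList G) (\<lambda>x. foldl (\<lambda>acc y. if P x y then y # acc else acc) [] (xs x))"
  proof (rule ptf_foldl[OF xs ptf_const])
    have "ptf (ePair (ePair E (eList G)) G) (ePair E G) (\<lambda>z. (fst (fst z), snd z))"
      by (rule ptf_basic)+
    from ptf_compose[OF this P]
    have "ptf (ePair (ePair E (eList G)) G) eBool (\<lambda>z. P (fst (fst z)) (snd z))" by simp
    then show "ptf (ePair (ePair E (eList G)) G) (eList G)
        (\<lambda>z. if P (fst (fst z)) (snd z) then snd z # snd (fst z) else snd (fst z))"
      by (rule ptf_if) (rule ptf_Cons ptf_basic)+
    show "size (eList G (foldl (\<lambda>acc y. if P x y then y # acc else acc) [] (take j (xs x)))) \<le> size (eList G (xs x))" for x j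
      using size_filter[of G "P x" "take j (xs x)"] eList_mono_take[of G j "xs x"]
      by (simp add: foldl_filter size_eList_rev)
    show "pbd E (\<lambda>x. size (eList G (xs x)))" by (rule ptf_size[OF xs])
  qed
  from ptf_rev[OF this] show ?thesis by (simp add: foldl_filter)
qed

lemma foldl_append_concat: "foldl (\<lambda>acc y. acc @ y) a xs = a @ concat xs"
  by (induction xs arbitrary: a) auto

lemma size_concat: "size (eList G (concat xs)) \<le> size (eList (eList G) xs)"
  by (induction xs) (auto simp: size_eList_append)

lemma ptf_concat:
  assumes xs: "ptf E (eList (eList G)) xs"
  shows "ptf E (eList G) (\<lambda>x. concat (xs x))"
proof -
  have "ptf E (eList G) (\<lambda>x. foldl (\<lambda>acc y. acc @ y) [] (xs x))"
  proof (rule ptf_foldl[OF xs ptf_const])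
    show "ptf (ePair (ePair E (eList G)) (eList G)) (eList G) (\<lambda>z. snd (fst z) @ snd z)"
      by (rule ptf_append ptf_basic)+
    show "size (eList G (foldl (\<lambda>acc y. acc @ y) [] (take j (xs x)))) \<le> size (eList (eList G) (xs x))" for x j
      using size_concat[of G "take j (xs x)"] eList_mono_take[of "eList G" j "xs x"]
      by (simp add: foldl_append_concat)
    show "pbd E (\<lambda>x. size (eList (eList G) (xs x)))" by (rule ptf_size[OF xs])
  qed
  then show ?thesis by (simp add: foldl_append_concat)
qed

lemma size_eBool: "size (eBool b) \<le> 1" by (simp add: eBool_def)

lemma ptf_not: "ptf E eBool b \<Longrightarrow> ptf E eBool (\<lambda>x. \<not> b x)"
  using ptf_if[OF _ ptf_const[of E eBool False] ptf_const[of E eBool True], of b] by (simp add: if_bool_eq_disj cong: if_cong)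

lemma ptf_conj: "ptf E eBool b \<Longrightarrow> ptf E eBool c \<Longrightarrow> ptf E eBool (\<lambda>x. b x \<and> c x)"
  using ptf_if[OF _ _ ptf_const[of E eBool False], of b c] by (simp add: if_bool_eq_disj conj_commute cong: if_cong)

lemma ptf_disj: "ptf E eBool b \<Longrightarrow> ptf E eBool c \<Longrightarrow> ptf E eBool (\<lambda>x. b x \<or> c x)"
  using ptf_not[OF ptf_conj[OF ptf_not ptf_not], of E b c] by simp

lemma foldl_ex: "foldl (\<lambda>b y. b \<or> P y) a xs \<longleftrightarrow> a \<or> (\<exists>y\<in>set xs. P y)"
  by (induction xs arbitrary: a) auto

lemma ptf_ex:
  assumes xs: "ptf E (eList G) xs" and P: "ptf (ePair E G) eBool (\<lambda>z. P (fst z) (snd z))"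
  shows "ptf E eBool (\<lambda>x. \<exists>y\<in>set (xs x). P x y)"
proof -
  have "ptf E eBool (\<lambda>x. foldl (\<lambda>b y. b \<or> P x y) False (xs x))"
  proof (rule ptf_foldl[OF xs ptf_const])
    have "ptf (ePair (ePair E eBool) G) (ePair E G) (\<lambda>z. (fst (fst z), snd z))"
      by (rule ptf_basic)+
    from ptf_compose[OF this P]
    have "ptf (ePair (ePair E eBool) G) eBool (\<lambda>z. P (fst (fst z)) (snd z))" by simp
    then show "ptf (ePair (ePair E eBool) G) eBool (\<lambda>z. snd (fst z) \<or> P (fst (fst z)) (snd z))"
      by (intro ptf_disj) (rule ptf_basic)+
    show "size (eBool (foldl (\<lambda>b y. b \<or> P x y) False (take j (xs x)))) \<le> 1" for x j by (rule size_eBool)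
  qed (rule pbd_const)
  then show ?thesis by (simp add: foldl_ex)
qed

lemma ptf_all:
  assumes xs: "ptf E (eList G) xs" and P: "ptf (ePair E G) eBool (\<lambda>z. P (fst z) (snd z))"
  shows "ptf E eBool (\<lambda>x. \<forall>y\<in>set (xs x). P x y)"
  using ptf_not[OF ptf_ex[OF xs ptf_not[OF P]]] by simp

section \<open>Unary numbers\<close>

lemma un_0 [simp]: "un 0 = Leaf" by (simp add: un_def)

lemma un_Suc [simp]: "un (Suc n) = Node Leaf (un n)"
proof -
  have h: "enc_list (\<lambda>_. Leaf) xs = enc_list (\<lambda>_. Leaf) ys" if "length xs = length ys" for xs ys :: "nat list"
    using that by (induction xs ys rule: list_induct2) auto
  have "enc_list (\<lambda>_. Leaf) [1..<Suc n] = enc_list (\<lambda>_. Leaf) [0..<n]" by (rule h) simp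
  then show ?thesis by (simp add: un_def upt_conv_Cons del: upt_Suc)
qed

lemma size_un [simp]: "size (un n) = n" by (induction n) auto

lemma un_replicate: "un n = eList (\<lambda>_::unit. Leaf) (replicate n ())"
  by (induction n) auto

text \<open>A unary number is a list of trivial elements, so arithmetic reduces to list operations,
  such as subtraction to \<open>drop\<close>.\<close>

lemma ptf_un_list: "ptf E un f \<longleftrightarrow> ptf E (eList (\<lambda>_::unit. Leaf)) (\<lambda>x. replicate (f x) ())"
  by (simp add: ptf_def un_replicate)

lemma ptf_Suc: "ptf E un f \<Longrightarrow> ptf E un (\<lambda>x. Suc (f x))"
  by (rule ptf_enc[OF ptf_pair[OF ptf_const[of E id Leaf]], of un f]) (simp_all add: ePair_def)

lemma foldl_const_funpow: "foldl (\<lambda>a _. g a) a (xs :: unit list) = (g ^^ length xs) a"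
  by (induction xs arbitrary: a) (auto simp: funpow_swap1)

lemma ptf_iter:
  assumes n: "ptf E un n" and i: "ptf E A i" and g: "ptf (ePair E A) A (\<lambda>z. g (fst z) (snd z))"
    and sz: "\<And>x j. j \<le> n x \<Longrightarrow> size (A ((g x ^^ j) (i x))) \<le> B x" and B: "pbd E B"
  shows "ptf E A (\<lambda>x. (g x ^^ n x) (i x))"
proof -
  have "ptf E A (\<lambda>x. foldl (\<lambda>a _. g x a) (i x) (replicate (n x) ()))"
  proof (rule ptf_foldl[OF n[unfolded ptf_un_list] i])
    let ?Z = "ePair (ePair E A) (\<lambda>_::unit. Leaf)"
    have "ptf ?Z (ePair E A) (\<lambda>z. (fst (fst z), snd (fst z)))" by (rule ptf_basic)+
    from ptf_compose[OF this g]
    show "ptf ?Z A (\<lambda>z. g (fst (fst z)) (snd (fst z)))" by simp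
    show "size (A (foldl (\<lambda>a _. g x a) (i x) (take j (replicate (n x) ())))) \<le> B x" for x j
      using sz[of "min j (n x)" x] by (simp add: foldl_const_funpow min.commute)
  qed (rule B)
  then show ?thesis by (simp add: foldl_const_funpow)
qed

lemma pbd_un: "ptf E un f \<Longrightarrow> pbd E f"
  using ptf_size[of E un f] by simp

lemma ptf_add:
  assumes f: "ptf E un f" and g: "ptf E un g"
  shows "ptf E un (\<lambda>x. f x + g x)"
proof -
  have s: "(Suc ^^ j) a = a + j" for j a by (induction j) auto
  have "ptf E un (\<lambda>x. (Suc ^^ g x) (f x))"
    by (rule ptf_iter[OF g f ptf_Suc[OF ptf_snd[OF ptf_id]]])
      (auto simp: s intro: pbd_add[OF pbd_un[OF f] pbd_un[OF g]])
  then show ?thesis by (simp add: s add.commute)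
qed

lemma ptf_length: "ptf E (eList G) xs \<Longrightarrow> ptf E un (\<lambda>x. length (xs x))"
proof -
  assume "ptf E (eList G) xs"
  from ptf_map[OF this ptf_const[of _ "\<lambda>_::unit. Leaf" "()"]]
  show ?thesis unfolding ptf_un_list by (simp add: map_replicate_const)
qed

lemma ptf_tl: "ptf E (eList G) xs \<Longrightarrow> ptf E (eList G) (\<lambda>x. tl (xs x))"
proof -
  assume "ptf E (eList G) xs"
  then have "ptf E (eList G) (\<lambda>x. case xs x of [] \<Rightarrow> [] | y # ys \<Rightarrow> ys)"
    by (rule ptf_case_list[OF _ ptf_const]) (rule ptf_basic)+
  moreover have "(case xs x of [] \<Rightarrow> [] | y # ys \<Rightarrow> ys) = tl (xs x)" for x by (cases "xs x") auto
  ultimately show ?thesis by simp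
qed

lemma size_drop: "size (eList G (drop j xs)) \<le> size (eList G xs)"
  using size_eList_append[of G "take j xs" "drop j xs"] by simp

lemma ptf_drop:
  assumes n: "ptf E un n" and xs: "ptf E (eList G) xs"
  shows "ptf E (eList G) (\<lambda>x. drop (n x) (xs x))"
proof -
  have t: "(tl ^^ j) l = drop j l" for j and l :: "'b list" by (induction j) (auto simp: tl_drop drop_Suc)
  have "ptf E (eList G) (\<lambda>x. (tl ^^ n x) (xs x))"
    by (rule ptf_iter[OF n xs ptf_tl[OF ptf_snd[OF ptf_id]]])
      (auto simp: t size_drop intro: ptf_size[OF xs])
  then show ?thesis by (simp add: t)
qed

lemma ptf_diff:
  assumes f: "ptf E un f" and g: "ptf E un g"
  shows "ptf E un (\<lambda>x. f x - g x)"
  using ptf_drop[OF g f[unfolded ptf_un_list]] unfolding ptf_un_list by simp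

lemma ptf_take:
  assumes n: "ptf E un n" and xs: "ptf E (eList G) xs"
  shows "ptf E (eList G) (\<lambda>x. take (n x) (xs x))"
proof -
  have "take (length l - (length l - j)) l = take j l" for j and l :: "'b list" by (cases "j \<le> length l") auto
  then show ?thesis
    using ptf_rev[OF ptf_drop[OF ptf_diff[OF ptf_length[OF xs] n] ptf_rev[OF xs]]] by (simp add: rev_drop)
qed

lemma ptf_times:
  assumes f: "ptf E un f" and g: "ptf E un g"
  shows "ptf E un (\<lambda>x. f x * g x)"
proof -
  have s: "((\<lambda>a. a + c) ^^ j) 0 = j * c" for j c :: nat by (induction j) auto
  have "ptf E un (\<lambda>x. ((\<lambda>a. a + g x) ^^ f x) 0)"
  proof (rule ptf_iter[OF f ptf_const])
    have "ptf (ePair E un) un (\<lambda>z. g (fst z))" by (rule ptf_compose[OF ptf_fst[OF ptf_id] g])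
    then show "ptf (ePair E un) un (\<lambda>z. snd z + g (fst z))" by (intro ptf_add ptf_snd[OF ptf_id])
    show "size (un (((\<lambda>a. a + g x) ^^ j) 0)) \<le> f x * g x" if "j \<le> f x" for x j
      using that by (simp add: s)
    show "pbd E (\<lambda>x. f x * g x)" by (rule pbd_mult[OF pbd_un[OF f] pbd_un[OF g]])
  qed
  then show ?thesis by (simp add: s)
qed

lemma ptf_null: "ptf E (eList G) xs \<Longrightarrow> ptf E eBool (\<lambda>x. xs x = [])"
proof -
  assume "ptf E (eList G) xs"
  then have "ptf E eBool (\<lambda>x. case xs x of [] \<Rightarrow> True | y # ys \<Rightarrow> False)"
    by (rule ptf_case_list[OF _ ptf_const ptf_const])
  moreover have "(case xs x of [] \<Rightarrow> True | y # ys \<Rightarrow> False) = (xs x = [])" for x by (cases "xs x") auto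
  ultimately show ?thesis by simp
qed

lemma ptf_le:
  assumes f: "ptf E un f" and g: "ptf E un g"
  shows "ptf E eBool (\<lambda>x. f x \<le> g x)"
  using ptf_null[OF ptf_diff[OF f g, unfolded ptf_un_list]] by simp

lemma ptf_eq_un:
  assumes f: "ptf E un f" and g: "ptf E un g"
  shows "ptf E eBool (\<lambda>x. f x = g x)"
  using ptf_conj[OF ptf_le[OF f g] ptf_le[OF g f]] by (simp add: eq_iff)

text \<open>A counter that is reset at \<open>m\<close>. For \<open>m = 0\<close> the reset never
  happens, in accordance with \<open>j mod 0 = j\<close>.\<close>

lemma mod_funpow: "((\<lambda>r. if Suc r = m then 0 else Suc r) ^^ j) 0 = j mod m"
  by (induction j) (auto simp: mod_Suc)

lemma ptf_mod:
  assumes f: "ptf E un f" and g: "ptf E un g"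
  shows "ptf E un (\<lambda>x. f x mod g x)"
proof -
  have "ptf E un (\<lambda>x. ((\<lambda>r. if Suc r = g x then 0 else Suc r) ^^ f x) 0)"
  proof (rule ptf_iter[OF f ptf_const])
    have "ptf (ePair E un) un (\<lambda>z. g (fst z))" by (rule ptf_compose[OF ptf_fst[OF ptf_id] g])
    then show "ptf (ePair E un) un (\<lambda>z. if Suc (snd z) = g (fst z) then 0 else Suc (snd z))"
      by (intro ptf_if ptf_eq_un ptf_const ptf_Suc ptf_snd[OF ptf_id])
    show "size (un (((\<lambda>r. if Suc r = g x then 0 else Suc r) ^^ j) 0)) \<le> f x" if "j \<le> f x" for x j
      using that by (simp add: mod_funpow) (meson le_trans mod_less_eq_dividend)
  qed (rule pbd_un[OF f])
  then show ?thesis by (simp add: mod_funpow)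
qed

lemma ptf_upt: 
  assumes n: "ptf E un n"
  shows "ptf E (eList un) (\<lambda>x. [0..<n x])"
proof -
  have s: "((\<lambda>l. length l # l) ^^ j) [] = rev [0..<j]" for j by (induction j) auto
  have "ptf E (eList un) (\<lambda>x. ((\<lambda>l. length l # l) ^^ n x) [])"
  proof (rule ptf_iter[OF n ptf_const])
    show "ptf (ePair E (eList un)) (eList un) (\<lambda>z. length (snd z) # snd z)"
      by (rule ptf_Cons[OF ptf_length[OF ptf_snd[OF ptf_id]] ptf_snd[OF ptf_id]])
    show "size (eList un (((\<lambda>l. length l # l) ^^ j) [])) \<le> n x * (n x + 1)" if "j \<le> n x" for x j
    proof -
      have "size (eList un [0..<j]) \<le> length [0..<j] * (n x + 1)"
        using that by (intro size_eList_bound) auto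
      also have "\<dots> \<le> n x * (n x + 1)" using that by (intro mult_le_mono1) simp
      finally show ?thesis by (simp add: s size_eList_rev)
    qed
    show "pbd E (\<lambda>x. n x * (n x + 1))" by (rule pbd_mult[OF pbd_un[OF n] pbd_add[OF pbd_un[OF n] pbd_const]])
  qed
  from ptf_rev[OF this] show ?thesis by (simp add: s)
qed

lemma ptf_replicate:
  assumes n: "ptf E un n" and a: "ptf E G a"
  shows "ptf E (eList G) (\<lambda>x. replicate (n x) (a x))"
proof -
  have "ptf E (eList G) (\<lambda>x. map (\<lambda>_. a x) (replicate (n x) ()))"
    by (rule ptf_map[OF n[unfolded ptf_un_list] ptf_compose[OF ptf_fst[OF ptf_id] a]])
  then show ?thesis by simp
qed

lemma ptf2:
  assumes "ptf (ePair A B) F (\<lambda>z. f (fst z) (snd z))" "ptf E A a" "ptf E B b"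
  shows "ptf E F (\<lambda>x. f (a x) (b x))"
  using ptf_compose[OF ptf_pair[OF assms(2,3)] assms(1)] by simp

lemma ptf3:
  assumes "ptf (ePair A (ePair B C)) F (\<lambda>z. f (fst z) (fst (snd z)) (snd (snd z)))" "ptf E A a" "ptf E B b" "ptf E C c"
  shows "ptf E F (\<lambda>x. f (a x) (b x) (c x))"
  using ptf_compose[OF ptf_pair[OF assms(2) ptf_pair[OF assms(3,4)]] assms(1)] by simp

lemma ptf4:
  assumes "ptf (ePair A (ePair B (ePair C D))) F (\<lambda>z. f (fst z) (fst (snd z)) (fst (snd (snd z))) (snd (snd (snd z))))"
    "ptf E A a" "ptf E B b" "ptf E C c" "ptf E D d"
  shows "ptf E F (\<lambda>x. f (a x) (b x) (c x) (d x))"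
  using ptf_compose[OF ptf_pair[OF assms(2) ptf_pair[OF assms(3) ptf_pair[OF assms(4,5)]]] assms(1)] by simp

lemmas ptf_rules = ptf_const ptf_id ptf_fst ptf_snd ptf_pair ptf_if ptf_Cons ptf_append ptf_map ptf_filter ptf_concat
  ptf_rev ptf_tl ptf_take ptf_drop ptf_length ptf_upt ptf_replicate ptf_not ptf_conj ptf_disj ptf_ex ptf_all
  ptf_Suc ptf_add ptf_diff ptf_times ptf_mod ptf_le ptf_null

section \<open>Binary numbers\<close>

abbreviation eBits :: "bool list \<Rightarrow> btree" where "eBits \<equiv> eList eBool"

fun bits :: "nat \<Rightarrow> bool list" where
  "bits n = (if n = 0 then [] else odd n # bits (n div 2))"

declare bits.simps [simp del]

text \<open>The most significant end of a list may consist of zeros, as in results of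
  \<open>badd\<close>; numbers are compared through \<open>val\<close> only.\<close>

primrec val :: "bool list \<Rightarrow> nat" where
  "val [] = 0"
| "val (b # bs) = of_bool b + 2 * val bs"

lemma val_bits [simp]: "val (bits n) = n"
proof (induction n rule: less_induct)
  case (less n)
  show ?case
  proof (cases "n = 0")
    case False
    then have "val (bits (n div 2)) = n div 2" using less by simp
    then show ?thesis using False by (subst bits.simps) (simp add: mod_2_eq_odd[symmetric] del: mod_2_eq_odd)
  qed (simp add: bits.simps)
qed

lemma enc_nat_bits: "enc_nat n = eBits (bits n)"
proof (induction n rule: less_induct)
  case (less n)
  show ?case
  proof (cases "n = 0")
    case False
    then have "enc_nat (n div 2) = eBits (bits (n div 2))" using less by simp
    then show ?thesis using False enc_nat_pos[of n] by (subst bits.simps) (simp add: eBool_def)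
  qed (simp add: bits.simps enc_nat_0)
qed

lemma ptf_bits: "ptf E enc_nat f \<Longrightarrow> ptf E eBits (\<lambda>x. bits (f x))"
  by (rule ptf_enc[where F = enc_nat and f = f and F' = eBits and f' = "\<lambda>x. bits (f x)"]) (simp_all add: enc_nat_bits)

text \<open>The default \<open>False\<close> pads the shorter of two numbers with zeros.\<close>

definition low :: "bool list \<Rightarrow> bool" where
  "low bs = (case bs of [] \<Rightarrow> False | b # _ \<Rightarrow> b)"

lemma ptf_low: "ptf E eBits f \<Longrightarrow> ptf E eBool (\<lambda>x. low (f x))"
  unfolding low_def by (rule ptf_case_list[OF _ ptf_const]) (assumption | rule ptf_rules)+

lemma val_tl: "val bs = of_bool (low bs) + 2 * val (tl bs)"
  by (cases bs) (auto simp: low_def)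

definition carry :: "bool \<Rightarrow> bool \<Rightarrow> bool \<Rightarrow> bool" where
  "carry a b c \<longleftrightarrow> a \<and> b \<or> a \<and> c \<or> b \<and> c"

definition sbit :: "bool \<Rightarrow> bool \<Rightarrow> bool \<Rightarrow> bool" where
  "sbit a b c \<longleftrightarrow> (if a then (if b then c else \<not> c) else (if b then \<not> c else c))"

definition add_step :: "(bool \<times> bool list) \<times> bool list \<times> bool list \<Rightarrow> (bool \<times> bool list) \<times> bool list \<times> bool list" where
  "add_step s = ((carry (fst (fst s)) (low (fst (snd s))) (low (snd (snd s))),
      sbit (fst (fst s)) (low (fst (snd s))) (low (snd (snd s))) # snd (fst s)), tl (fst (snd s)), tl (snd (snd s)))"

text \<open>After \<open>length a + length b\<close> steps both inputs are used up, and only the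
  carry remains to be appended.\<close>

definition badd :: "bool list \<Rightarrow> bool list \<Rightarrow> bool list" where
  "badd a b = (let s = (add_step ^^ (length a + length b)) ((False, []), a, b) in rev (snd (fst s)) @ [fst (fst s)])"

abbreviation eAdd where "eAdd \<equiv> ePair (ePair eBool eBits) (ePair eBits eBits)"

lemma ptf_add_step: "ptf eAdd eAdd add_step"
  unfolding add_step_def carry_def sbit_def by (rule ptf_rules ptf_low)+

lemma val_append: "val (a @ b) = val a + 2 ^ length a * val b"
  by (induction a) (auto simp: algebra_simps)

lemma add_step_inv: "let s = (add_step ^^ j) ((False, []), a, b) in
   val (rev (snd (fst s))) + 2 ^ j * (of_bool (fst (fst s)) + val (fst (snd s)) + val (snd (snd s))) = val a + val b \<and>
   length (snd (fst s)) = j \<and> fst (snd s) = drop j a \<and> snd (snd s) = drop j b"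
proof (induction j)
  case (Suc j)
  define s where "s = (add_step ^^ j) ((False, []), a, b)"
  have I: "val (rev (snd (fst s))) + 2 ^ j * (of_bool (fst (fst s)) + val (fst (snd s)) + val (snd (snd s))) = val a + val b"
    "length (snd (fst s)) = j" "fst (snd s) = drop j a" "snd (snd s) = drop j b"
    using Suc unfolding Let_def s_def[symmetric] by blast+
  have "val (rev (snd (fst (add_step s)))) + 2 ^ Suc j * (of_bool (fst (fst (add_step s))) + val (fst (snd (add_step s)))
      + val (snd (snd (add_step s))))
    = val (rev (snd (fst s))) + 2 ^ j * (of_bool (fst (fst s)) + val (fst (snd s)) + val (snd (snd s)))"
    using val_tl[of "fst (snd s)"] val_tl[of "snd (snd s)"] I(2)
    by (simp add: add_step_def val_append carry_def sbit_def algebra_simps)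
  then have "val (rev (snd (fst (add_step s)))) + 2 ^ Suc j * (of_bool (fst (fst (add_step s))) + val (fst (snd (add_step s)))
      + val (snd (snd (add_step s)))) = val a + val b" using I(1) by simp
  moreover have "(add_step ^^ Suc j) ((False, []), a, b) = add_step s" by (simp add: s_def)
  moreover have "length (snd (fst (add_step s))) = Suc j" "fst (snd (add_step s)) = drop (Suc j) a"
    "snd (snd (add_step s)) = drop (Suc j) b"
    using I by (simp_all add: add_step_def tl_drop drop_Suc)
  ultimately show ?case by (simp only: Let_def)
qed simp

lemma val_badd [simp]: "val (badd a b) = val a + val b"
  and length_badd: "length (badd a b) = length a + length b + 1"
proof -
  define s where "s = (add_step ^^ (length a + length b)) ((False, []), a, b)"
  have "val (rev (snd (fst s))) + 2 ^ (length a + length b) * (of_bool (fst (fst s)) + val (fst (snd s)) + val (snd (snd s))) = val a + val b"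
    "length (snd (fst s)) = length a + length b" "fst (snd s) = []" "snd (snd s) = []"
    using add_step_inv[of "length a + length b" a b] unfolding Let_def s_def[symmetric] by auto
  then show "val (badd a b) = val a + val b" "length (badd a b) = length a + length b + 1"
    unfolding badd_def Let_def s_def[symmetric] by (simp_all add: val_append)
qed

lemma size_bits: "size (eBits l) \<le> 2 * length l"
  using size_eList_bound[of l eBool 1] size_eBool by simp

lemma ptf_badd0: "ptf (ePair eBits eBits) eBits (\<lambda>z. badd (fst z) (snd z))"
  unfolding badd_def Let_def
proof -
  let ?E = "ePair eBits eBits"
  have "ptf ?E eAdd (\<lambda>z. (add_step ^^ (length (fst z) + length (snd z))) ((False, []), fst z, snd z))"
  proof (rule ptf_iter)
    show "ptf ?E un (\<lambda>z. length (fst z) + length (snd z))" by (rule ptf_rules)+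
    show "ptf ?E eAdd (\<lambda>z. ((False, []), fst z, snd z))" by (rule ptf_rules)+
    show "ptf (ePair ?E eAdd) eAdd (\<lambda>z. add_step (snd z))"
      by (rule ptf_compose[OF _ ptf_add_step]) (rule ptf_rules)+
    show "size (eAdd ((add_step ^^ j) ((False, []), fst z, snd z)))
        \<le> 10 + 4 * (length (fst z) + length (snd z))"
      if "j \<le> length (fst z) + length (snd z)" for z :: "bool list \<times> bool list" and j
    proof -
      define s where "s = (add_step ^^ j) ((False, []), fst z, snd z)"
      have s: "length (snd (fst s)) = j" "fst (snd s) = drop j (fst z)" "snd (snd s) = drop j (snd z)"
        using add_step_inv[of j "fst z" "snd z"] by (simp_all add: Let_def s_def)
      have "size (eBits (snd (fst s))) \<le> 2 * j" "size (eBits (fst (snd s))) \<le> 2 * length (fst z)"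
        "size (eBits (snd (snd s))) \<le> 2 * length (snd z)" 
        using size_bits[of "snd (fst s)"] size_bits[of "fst (snd s)"] size_bits[of "snd (snd s)"] s by simp_all
      then show ?thesis using that size_eBool[of "fst (fst s)"] unfolding s_def[symmetric] by (simp add: ePair_def)
    qed
    show "pbd ?E (\<lambda>z. 10 + 4 * (length (fst z) + length (snd z)))"
      by (intro pbd_add pbd_mult pbd_const pbd_length[where G = eBool] ptf_fst[OF ptf_id] ptf_snd[OF ptf_id])
  qed
  note s = this
  show "ptf ?E eBits (\<lambda>z. rev (snd (fst ((add_step ^^ (length (fst z) + length (snd z))) ((False, []), fst z, snd z)))) @
      [fst (fst ((add_step ^^ (length (fst z) + length (snd z))) ((False, []), fst z, snd z)))])"
    by (rule ptf_append ptf_rev ptf_Cons ptf_const[of _ _ "[]"] ptf_snd ptf_fst s)+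
qed

lemmas ptf_badd = ptf2[where f = badd, OF ptf_badd0]

text \<open>Digits are read from the least significant one. The flag compares the parts read so far,
  and a later digit overrides it where the two numbers differ.\<close>

definition le_step :: "bool \<times> bool list \<times> bool list \<Rightarrow> bool \<times> bool list \<times> bool list" where
  "le_step s = ((if low (fst (snd s)) then low (snd (snd s)) \<and> fst s else low (snd (snd s)) \<or> fst s),
     tl (fst (snd s)), tl (snd (snd s)))"

definition ble :: "bool list \<Rightarrow> bool list \<Rightarrow> bool" where
  "ble a b = fst ((le_step ^^ (length a + length b)) (True, a, b))"

lemma le_step_inv: "let s = (le_step ^^ j) (True, a, b) in
   (val a \<le> val b \<longleftrightarrow> (val (fst (snd s)) < val (snd (snd s)) \<or> val (fst (snd s)) = val (snd (snd s)) \<and> fst s)) \<and>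
   fst (snd s) = drop j a \<and> snd (snd s) = drop j b"
proof (induction j)
  case (Suc j)
  define s where "s = (le_step ^^ j) (True, a, b)"
  have I: "val a \<le> val b \<longleftrightarrow> (val (fst (snd s)) < val (snd (snd s)) \<or> val (fst (snd s)) = val (snd (snd s)) \<and> fst s)"
    "fst (snd s) = drop j a" "snd (snd s) = drop j b"
    using Suc unfolding Let_def s_def[symmetric] by blast+
  have "(val (fst (snd (le_step s))) < val (snd (snd (le_step s))) \<or> val (fst (snd (le_step s))) = val (snd (snd (le_step s))) \<and> fst (le_step s))
    = (val (fst (snd s)) < val (snd (snd s)) \<or> val (fst (snd s)) = val (snd (snd s)) \<and> fst s)"
    using val_tl[of "fst (snd s)"] val_tl[of "snd (snd s)"] by (simp add: le_step_def) linarith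
  moreover have "(le_step ^^ Suc j) (True, a, b) = le_step s" by (simp add: s_def)
  moreover have "fst (snd (le_step s)) = drop (Suc j) a" "snd (snd (le_step s)) = drop (Suc j) b"
    using I by (simp_all add: le_step_def tl_drop drop_Suc)
  ultimately show ?case using I(1) by (simp only: Let_def)
qed auto

lemma ble [simp]: "ble a b \<longleftrightarrow> val a \<le> val b"
  using le_step_inv[of "length a + length b" a b] by (simp add: Let_def ble_def)

lemma ptf_ble0: "ptf (ePair eBits eBits) eBool (\<lambda>z. ble (fst z) (snd z))"
  unfolding ble_def
proof (rule ptf_fst[where G = "ePair eBits eBits"], rule ptf_iter)
  let ?E = "ePair eBits eBits"
  show "ptf ?E un (\<lambda>z. length (fst z) + length (snd z))" by (rule ptf_rules)+
  show "ptf ?E (ePair eBool ?E) (\<lambda>z. (True, fst z, snd z))" by (rule ptf_rules)+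
  show "ptf (ePair ?E (ePair eBool ?E)) (ePair eBool ?E) (\<lambda>z. le_step (snd z))"
    unfolding le_step_def by (rule ptf_rules ptf_low)+
  show "size (ePair eBool ?E ((le_step ^^ j) (True, fst z, snd z)))
      \<le> 10 + 4 * (length (fst z) + length (snd z))" for z :: "bool list \<times> bool list" and j
  proof -
    define s where "s = (le_step ^^ j) (True, fst z, snd z)"
    have s: "fst (snd s) = drop j (fst z)" "snd (snd s) = drop j (snd z)"
      using le_step_inv[of j "fst z" "snd z"] by (simp_all add: Let_def s_def)
    have "size (eBits (fst (snd s))) \<le> 2 * length (fst z)" "size (eBits (snd (snd s))) \<le> 2 * length (snd z)" 
      using size_bits[of "fst (snd s)"] size_bits[of "snd (snd s)"] s by simp_all
    then show ?thesis using size_eBool[of "fst s"] unfolding s_def[symmetric] by (simp add: ePair_def)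
  qed
  show "pbd ?E (\<lambda>z. 10 + 4 * (length (fst z) + length (snd z)))"
    by (intro pbd_add pbd_mult pbd_const pbd_length[where G = eBool] ptf_fst[OF ptf_id] ptf_snd[OF ptf_id])
qed

lemma ptf_val_le: "ptf E eBits f \<Longrightarrow> ptf E eBits g \<Longrightarrow> ptf E eBool (\<lambda>x. val (f x) \<le> val (g x))"
  using ptf2[where f = ble, OF ptf_ble0] by simp

text \<open>Equality of vertex names as a constant of its own directs the rules to the binary
  comparison \<open>ptf_veq\<close>; elsewhere it is simplified away.\<close>

definition veq :: "nat \<Rightarrow> nat \<Rightarrow> bool" where [simp]: "veq a b \<longleftrightarrow> a = b"

lemma ptf_veq: "ptf E enc_nat f \<Longrightarrow> ptf E enc_nat g \<Longrightarrow> ptf E eBool (\<lambda>x. veq (f x) (g x))"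
  using ptf_conj[OF ptf_val_le[OF ptf_bits ptf_bits] ptf_val_le[OF ptf_bits ptf_bits], of E f g g f] by (simp add: eq_iff)

text \<open>Horner's scheme, starting with the most significant digit.\<close>

definition bmul :: "bool list \<Rightarrow> bool list \<Rightarrow> bool list" where
  "bmul a b = foldl (\<lambda>acc c. if c then badd b (False # acc) else False # acc) [] (rev a)"

lemma val_bmul [simp]: "val (bmul a b) = val a * val b"
  by (induction a) (auto simp: bmul_def algebra_simps)

lemma length_bmul: "length (foldl (\<lambda>acc c. if c then badd b (False # acc) else False # acc) s a)
   \<le> length s + length a * (length b + 2)"
proof (induction a arbitrary: s)
  case (Cons c a)
  let ?s = "if c then badd b (False # s) else False # s"
  have "length ?s \<le> length s + (length b + 2)" by (simp add: length_badd)
  then show ?case using Cons[of ?s] by simp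
qed simp

lemma ptf_bmul0: "ptf (ePair eBits eBits) eBits (\<lambda>z. bmul (fst z) (snd z))"
  unfolding bmul_def
proof (rule ptf_foldl)
  let ?E = "ePair eBits eBits"
  show "ptf ?E eBits (\<lambda>z. rev (fst z))" by (rule ptf_rules)+
  show "ptf ?E eBits (\<lambda>z. [])" by (rule ptf_rules)
  show "ptf (ePair (ePair ?E eBits) eBool) eBits (\<lambda>z. if snd z then badd (snd (fst (fst z))) (False # snd (fst z)) else False # snd (fst z))"
    by (rule ptf_rules ptf_badd)+
  show "size (eBits (foldl (\<lambda>acc c. if c then badd (snd z) (False # acc) else False # acc) [] (take j (rev (fst z)))))
    \<le> 2 * (length (fst z) * (length (snd z) + 2))" for z :: "bool list \<times> bool list" and j
  proof -
    have "length (take j (rev (fst z))) * (length (snd z) + 2) \<le> length (fst z) * (length (snd z) + 2)"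
      by (intro mult_le_mono1) simp
    then show ?thesis using length_bmul[of "snd z" "[]" "take j (rev (fst z))"]
      size_bits[of "foldl (\<lambda>acc c. if c then badd (snd z) (False # acc) else False # acc) [] (take j (rev (fst z)))"]
      by simp
  qed
  show "pbd ?E (\<lambda>z. 2 * (length (fst z) * (length (snd z) + 2)))"
    by (intro pbd_add pbd_mult pbd_const pbd_length[where G = eBool] ptf_fst[OF ptf_id] ptf_snd[OF ptf_id])
qed

lemmas ptf_bmul = ptf2[where f = bmul, OF ptf_bmul0]

definition bmulu :: "nat \<Rightarrow> bool list \<Rightarrow> bool list" where
  "bmulu j b = ((\<lambda>s. badd b s) ^^ j) []"

lemma val_bmulu [simp]: "val (bmulu j b) = j * val b" 
  by (induction j) (auto simp: bmulu_def)

lemma ptf_bmulu0: "ptf (ePair un eBits) eBits (\<lambda>z. bmulu (fst z) (snd z))"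
  unfolding bmulu_def
proof (rule ptf_iter)
  let ?E = "ePair un eBits"
  show "ptf ?E un fst" "ptf ?E eBits (\<lambda>z. [])" by (rule ptf_rules)+
  show "ptf (ePair ?E eBits) eBits (\<lambda>z. badd (snd (fst z)) (snd z))" by (rule ptf_rules ptf_badd)+
  show "size (eBits ((badd (snd z) ^^ j) [])) \<le> 2 * (fst z * (length (snd z) + 1))" if "j \<le> fst z" for z :: "nat \<times> bool list" and j
  proof -
    have "length ((badd (snd z) ^^ j) []) = j * (length (snd z) + 1)" by (induction j) (auto simp: length_badd)
    also have "\<dots> \<le> fst z * (length (snd z) + 1)" using that by (intro mult_le_mono1)
    finally show ?thesis using size_bits[of "(badd (snd z) ^^ j) []"] by simp
  qed
  show "pbd ?E (\<lambda>z. 2 * (fst z * (length (snd z) + 1)))"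
    by (intro pbd_add pbd_mult pbd_const pbd_length[where G = eBool] pbd_un ptf_fst[OF ptf_id] ptf_snd[OF ptf_id])
qed

lemmas ptf_bmulu = ptf2[where f = bmulu, OF ptf_bmulu0]

section \<open>Tables of token multisets\<close>

type_synonym token = "bool \<times> nat \<times> nat list"

abbreviation eVs :: "nat list \<Rightarrow> btree" where "eVs \<equiv> eList enc_nat"
abbreviation eTk :: "token \<Rightarrow> btree" where "eTk \<equiv> ePair eBool (ePair un eVs)"
abbreviation eSt :: "token list \<Rightarrow> btree" where "eSt \<equiv> eList eTk"
abbreviation eTab :: "token list list \<Rightarrow> btree" where "eTab \<equiv> eList eSt"
abbreviation eEnv :: "nat \<times> nat \<Rightarrow> btree" where "eEnv \<equiv> ePair un un"

text \<open>The third component of a token is a concrete walk. It is merely a witness: states that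
  agree in their keys are interchangeable, and a table keeps one of them.\<close>

definition key :: "token \<Rightarrow> bool \<times> nat" where "key t = (fst t, fst (snd t))"

definition keys :: "token list \<Rightarrow> (bool \<times> nat) multiset" where "keys S = mset (map key S)"

lemma keys_simps [simp]: "keys [] = {#}" "keys (t # S) = add_mset (key t) (keys S)" "keys (S @ S') = keys S + keys S'"
  by (simp_all add: keys_def)

text \<open>Equality is spelled out with connectives and comparisons that the rules for
  \<open>ptf\<close> cover; likewise \<open>same_keys\<close> expresses equality of multisets by
  counting.\<close>

definition same_key :: "token \<Rightarrow> token \<Rightarrow> bool" where
  "same_key s t \<longleftrightarrow> (fst s \<and> fst t \<or> \<not> fst s \<and> \<not> fst t) \<and> fst (snd s) \<le> fst (snd t) \<and> fst (snd t) \<le> fst (snd s)"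

lemma same_key: "same_key s t \<longleftrightarrow> key s = key t"
  by (auto simp: same_key_def key_def)

lemma ptf_keyq0: "ptf (ePair eTk eTk) eBool (\<lambda>z. same_key (fst z) (snd z))"
  unfolding same_key_def by (rule ptf_rules)+

lemmas ptf_same_key = ptf2[where f = same_key, OF ptf_keyq0]

definition same_keys :: "token list \<Rightarrow> token list \<Rightarrow> bool" where
  "same_keys A B \<longleftrightarrow> (\<forall>t\<in>set (A @ B). length (filter (\<lambda>s. same_key t s) A) \<le> length (filter (\<lambda>s. same_key t s) B)
     \<and> length (filter (\<lambda>s. same_key t s) B) \<le> length (filter (\<lambda>s. same_key t s) A))"

lemma count_keys: "length (filter (\<lambda>s. same_key t s) A) = count (keys A) (key t)"
  by (induction A) (auto simp: same_key)

lemma same_keys: "same_keys A B \<longleftrightarrow> keys A = keys B"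
proof
  assume k: "same_keys A B"
  show "keys A = keys B"
  proof (rule multiset_eqI)
    fix x
    show "count (keys A) x = count (keys B) x"
    proof (cases "x \<in> key ` set (A @ B)")
      case True
      then obtain t where t: "t \<in> set (A @ B)" "x = key t" by blast
      then show ?thesis using k unfolding same_keys_def count_keys by (simp add: eq_iff)
    next
      case False
      then have "x \<notin># keys A" "x \<notin># keys B" by (auto simp: keys_def)
      then show ?thesis by (simp add: not_in_iff)
    qed
  qed
qed (simp add: same_keys_def count_keys)

lemma ptf_keq0: "ptf (ePair eSt eSt) eBool (\<lambda>z. same_keys (fst z) (snd z))"
  unfolding same_keys_def by (rule ptf_same_key ptf_rules)+

lemmas ptf_same_keys = ptf2[where f = same_keys, OF ptf_keq0]

text \<open>The parameter \<open>e\<close> holds the number of vertices and the bound on the number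
  of tokens. The successor makes the lattice spacing positive and larger than the number of
  edges.\<close>

abbreviation grid :: "nat \<times> nat \<Rightarrow> nat" where "grid e \<equiv> Suc (fst e)"

definition hmax :: "nat \<Rightarrow> nat \<times> nat \<Rightarrow> nat" where "hmax h e = grid e * h"

definition lattice :: "nat \<times> nat \<Rightarrow> nat \<Rightarrow> token \<Rightarrow> bool" where
  "lattice e d t \<longleftrightarrow> (fst (snd t) + (if fst t then 0 else d)) mod grid e \<le> 0"

definition admissible :: "nat \<Rightarrow> nat \<times> nat \<Rightarrow> nat \<Rightarrow> token list \<Rightarrow> bool" where
  "admissible h e d S \<longleftrightarrow> length S \<le> snd e \<and> (\<forall>t\<in>set S. fst (snd t) \<le> hmax h e) \<and> length (filter (\<lambda>t. \<not> lattice e d t) S) \<le> 6"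

lemma ptf_hmax: "ptf E eEnv e \<Longrightarrow> ptf E un (\<lambda>x. hmax h (e x))"
  unfolding hmax_def by (assumption | rule ptf_rules)+

lemma ptf_latk0: "ptf (ePair eEnv (ePair un eTk)) eBool (\<lambda>z. lattice (fst z) (fst (snd z)) (snd (snd z)))"
  unfolding lattice_def by (rule ptf_rules)+

lemmas ptf_lattice = ptf3[where f = lattice, OF ptf_latk0]

lemma ptf_admk0: "ptf (ePair eEnv (ePair un eSt)) eBool (\<lambda>z. admissible h (fst z) (fst (snd z)) (snd (snd z)))"
  unfolding admissible_def by (rule ptf_lattice ptf_hmax ptf_rules)+

lemmas ptf_admissible = ptf3[where f = "admissible h" for h, OF ptf_admk0]

definition sel :: "token list \<Rightarrow> (token \<times> token list) list" where
  "sel S = concat (map (\<lambda>i. map (\<lambda>x. (x, take i S @ drop (Suc i) S)) (take 1 (drop i S))) [0..<length S])"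

lemma set_sel: "set (sel S) = {(S ! i, take i S @ drop (Suc i) S) | i. i < length S}"
proof -
  have "take 1 (drop i S) = [S ! i]" if "i < length S" for i using that by (simp add: take_Suc_conv_app_nth Cons_nth_drop_Suc[symmetric])
  then show ?thesis unfolding sel_def by (auto intro!: bexI)
qed

lemma sel_mset: "(x, R) \<in> set (sel S) \<Longrightarrow> mset S = add_mset x (mset R)"
proof -
  assume "(x, R) \<in> set (sel S)"
  then obtain i where i: "i < length S" "x = S ! i" "R = take i S @ drop (Suc i) S" unfolding set_sel by blast
  have "mset S = mset (take i S @ S ! i # drop (Suc i) S)" using id_take_nth_drop[OF i(1)] by simp
  then show ?thesis using i by simp
qed

lemma sel_ex: "x \<in> set S \<Longrightarrow> \<exists>R. (x, R) \<in> set (sel S)"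
  unfolding set_sel in_set_conv_nth by blast

lemma ptf_sel: "ptf E eSt f \<Longrightarrow> ptf E (eList (ePair eTk eSt)) (\<lambda>x. sel (f x))"
proof (erule ptf_compose)
  show "ptf eSt (eList (ePair eTk eSt)) sel" unfolding sel_def by (rule ptf_rules)+
qed

text \<open>The walk of the closed token \<open>y\<close> comes first, as it returns to the vertex
  where the walk of \<open>x\<close> starts; \<open>tl\<close> drops the repeated vertex.\<close>

definition mrg :: "token \<Rightarrow> token \<Rightarrow> token" where
  "mrg x y = (fst x, fst (snd x) + fst (snd y), snd (snd y) @ tl (snd (snd x)))"

definition grow :: "token \<Rightarrow> token" where "grow x = (fst x, Suc (fst (snd x)), snd (snd x))"

definition succs :: "token list \<Rightarrow> token list list" where
  "succs S = concat (map (\<lambda>p. map (\<lambda>p'. mrg (fst p) (fst p') # snd p') (filter (\<lambda>p'. \<not> fst (fst p')) (sel (snd p)))) (sel S))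
     @ map (\<lambda>p. grow (fst p) # snd p) (sel S)"

lemma ptf_succs: "ptf E eSt f \<Longrightarrow> ptf E eTab (\<lambda>x. succs (f x))"
proof (erule ptf_compose)
  show "ptf eSt eTab succs" unfolding succs_def mrg_def grow_def by (rule ptf_sel ptf_rules)+
qed

definition insert_state :: "nat \<Rightarrow> nat \<times> nat \<Rightarrow> nat \<Rightarrow> token list list \<Rightarrow> token list \<Rightarrow> token list list" where
  "insert_state h e d acc S = (if admissible h e d S \<and> \<not> (\<exists>S'\<in>set acc. same_keys S S') then S # acc else acc)"

text \<open>Discarding states with known keys is what keeps tables polynomial, since the walks could
  differ in exponentially many ways.\<close>

definition norm :: "nat \<Rightarrow> nat \<times> nat \<Rightarrow> nat \<Rightarrow> token list list \<Rightarrow> token list list" where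
  "norm h e d T = foldl (insert_state h e d) [] T"

lemma ptf_ins0: "ptf (ePair eEnv (ePair un (ePair eTab eSt))) eTab
    (\<lambda>z. insert_state h (fst z) (fst (snd z)) (fst (snd (snd z))) (snd (snd (snd z))))"
  unfolding insert_state_def by (rule ptf_admissible ptf_same_keys ptf_rules)+

lemmas ptf_insert_state = ptf4[where f = "insert_state h" for h, OF ptf_ins0]

lemma size_foldl_insert_state: "size (eTab (foldl (insert_state h e d) acc T)) \<le> size (eTab acc) + size (eTab T)"
proof (induction T arbitrary: acc)
  case (Cons S T)
  have "size (eTab (insert_state h e d acc S)) \<le> size (eTab acc) + size (eSt S) + 1" by (simp add: insert_state_def)
  then show ?case using Cons[of "insert_state h e d acc S"] by simp
qed simp

lemma ptf_norm0: "ptf (ePair eEnv (ePair un eTab)) eTab (\<lambda>z. norm h (fst z) (fst (snd z)) (snd (snd z)))"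
  unfolding norm_def
proof (rule ptf_foldl)
  let ?E = "ePair eEnv (ePair un eTab)"
  show "ptf ?E eTab (\<lambda>z. snd (snd z))" by (rule ptf_rules)+
  show "ptf ?E eTab (\<lambda>z. [])" by (rule ptf_rules)
  show "ptf (ePair (ePair ?E eTab) eSt) eTab
      (\<lambda>z. insert_state h (fst (fst (fst z))) (fst (snd (fst (fst z)))) (snd (fst z)) (snd z))"
    by (rule ptf_insert_state ptf_rules)+
  show "size (eTab (foldl (insert_state h (fst z) (fst (snd z))) [] (take j (snd (snd z))))) \<le> size (eTab (snd (snd z)))"
    for z :: "(nat \<times> nat) \<times> nat \<times> token list list" and j
    using size_foldl_insert_state[of h "fst z" "fst (snd z)" "[]" "take j (snd (snd z))"] eList_mono_take[of eSt j "snd (snd z)"]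
    by simp
  show "pbd ?E (\<lambda>z. size (eTab (snd (snd z))))" by (rule ptf_size) (rule ptf_rules)+
qed

lemmas ptf_norm = ptf3[where f = "norm h" for h, OF ptf_norm0]

definition good_table :: "nat \<Rightarrow> nat \<times> nat \<Rightarrow> nat \<Rightarrow> token list list \<Rightarrow> bool" where
  "good_table h e d T \<longleftrightarrow> (\<forall>S\<in>set T. admissible h e d S) \<and> distinct (map keys T)"

lemma good_table_foldl: "good_table h e d acc \<Longrightarrow> good_table h e d (foldl (insert_state h e d) acc T)"
proof (induction T arbitrary: acc)
  case (Cons S T)
  have "good_table h e d (insert_state h e d acc S)" using Cons.prems by (auto simp: good_table_def insert_state_def same_keys)
  then show ?case using Cons.IH by simp
qed simp

lemma good_table_norm: "good_table h e d (norm h e d T)"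
  unfolding norm_def by (rule good_table_foldl) (simp add: good_table_def)

lemma set_foldl_insert_state: "set (foldl (insert_state h e d) acc T) \<subseteq> set acc \<union> set T"
proof (induction T arbitrary: acc)
  case (Cons S T)
  have "set (insert_state h e d acc S) \<subseteq> insert S (set acc)" by (auto simp: insert_state_def)
  then show ?case using Cons[of "insert_state h e d acc S"] by auto
qed simp

lemma set_norm: "set (norm h e d T) \<subseteq> set T"
  unfolding norm_def using set_foldl_insert_state[of h e d "[]" T] by simp

lemma keys_foldl_insert_state: "(S \<in> set acc \<or> S \<in> set T \<and> admissible h e d S) \<Longrightarrow> keys S \<in> keys ` set (foldl (insert_state h e d) acc T)"
proof (induction T arbitrary: acc S)
  case (Cons U T)
  show ?case
  proof (cases "S \<in> set acc \<or> S \<in> set T \<and> admissible h e d S")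
    case True
    then have "S \<in> set (insert_state h e d acc U) \<or> S \<in> set T \<and> admissible h e d S" by (auto simp: insert_state_def)
    then show ?thesis using Cons.IH[of S "insert_state h e d acc U"] by simp
  next
    case False
    then have S: "S = U" "admissible h e d S" using Cons.prems by auto
    have "\<exists>S'. keys S' = keys S \<and> S' \<in> set (insert_state h e d acc U)" using S
      by (cases "\<exists>S'\<in>set acc. keys U = keys S'") (fastforce simp: insert_state_def same_keys)+
    then obtain S' where "keys S' = keys S" "S' \<in> set (insert_state h e d acc U)" by blast
    then show ?thesis using Cons.IH[of S' "insert_state h e d acc U"] by simp
  qed
qed auto

lemma keys_norm: "S \<in> set T \<Longrightarrow> admissible h e d S \<Longrightarrow> keys S \<in> keys ` set (norm h e d T)"
  unfolding norm_def by (rule keys_foldl_insert_state) simp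

definition step :: "nat \<Rightarrow> nat \<times> nat \<Rightarrow> nat \<Rightarrow> token list list \<Rightarrow> token list list" where
  "step h e d T = norm h e d (T @ concat (map (\<lambda>S. succs S) T))"

lemma ptf_step0: "ptf (ePair eEnv (ePair un eTab)) eTab (\<lambda>z. step h (fst z) (fst (snd z)) (snd (snd z)))"
  unfolding step_def by (rule ptf_norm ptf_succs ptf_rules)+

lemmas ptf_step = ptf3[where f = "step h" for h, OF ptf_step0]

text \<open>The number of rounds is the largest value of the potential \<open>mpot\<close> on
  admissible states; every merge or increase lowers it, so the result is closed under both.\<close>

definition saturate :: "nat \<Rightarrow> nat \<times> nat \<Rightarrow> nat \<Rightarrow> token list list \<Rightarrow> token list list" where
  "saturate h e d T = (step h e d ^^ (snd e * Suc (hmax h e))) (norm h e d T)"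

text \<open>Keys do not bound the stored walks. Their total length is followed separately, and
  neither merging nor growing increases it.\<close>

definition mass :: "token list \<Rightarrow> nat" where "mass S = (\<Sum>t\<leftarrow>S. size (eVs (snd (snd t))))"

lemma mass_simps [simp]: "mass [] = 0" "mass (t # S) = size (eVs (snd (snd t))) + mass S" "mass (S @ S') = mass S + mass S'"
  by (simp_all add: mass_def)

lemma mass_mset: "mset S = mset S' \<Longrightarrow> mass S = mass S'"
  unfolding mass_def by (simp flip: sum_mset_sum_list)

lemma mass_sel: "p \<in> set (sel S) \<Longrightarrow> mass S = size (eVs (snd (snd (fst p)))) + mass (snd p)"
  using mass_mset[of S "fst p # snd p"] sel_mset[of "fst p" "snd p" S] by simp

lemma size_tl: "size (eVs (tl xs)) \<le> size (eVs xs)"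
  by (cases xs) auto

lemma mass_succs: "S' \<in> set (succs S) \<Longrightarrow> mass S' \<le> mass S"
proof -
  assume "S' \<in> set (succs S)"
  then consider p p' where "p \<in> set (sel S)" "p' \<in> set (sel (snd p))" "S' = mrg (fst p) (fst p') # snd p'"
    | p where "p \<in> set (sel S)" "S' = grow (fst p) # snd p" unfolding succs_def by auto
  then show ?thesis
  proof cases
    case 1
    then show ?thesis using mass_sel[OF 1(1)] mass_sel[OF 1(2)] size_tl[of "snd (snd (fst p))"]
      by (simp add: mrg_def size_eList_append)
  next
    case 2
    then show ?thesis using mass_sel[OF 2(1)] by (simp add: grow_def)
  qed
qed

lemma mass_step: "\<forall>S\<in>set T. mass S \<le> W \<Longrightarrow> \<forall>S\<in>set (step h e d T). mass S \<le> W"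
proof
  fix S assume T: "\<forall>S\<in>set T. mass S \<le> W" and "S \<in> set (step h e d T)"
  then have "S \<in> set (T @ concat (map (\<lambda>S. succs S) T))" unfolding step_def using set_norm by blast
  then consider "S \<in> set T" | S0 where "S0 \<in> set T" "S \<in> set (succs S0)" by auto
  then show "mass S \<le> W" using T mass_succs by cases (auto intro: le_trans)
qed

lemma mass_saturate: "\<forall>S\<in>set T. mass S \<le> W \<Longrightarrow> \<forall>S\<in>set ((step h e d ^^ j) (norm h e d T)). mass S \<le> W"
proof (induction j)
  case 0
  then show ?case using set_norm[of h e d T] by auto
next
  case (Suc j)
  then show ?case using mass_step[of "(step h e d ^^ j) (norm h e d T)" W] by simp
qed

lemma good_table_saturate: "good_table h e d ((step h e d ^^ j) (norm h e d T))"
  by (induction j) (auto simp: good_table_norm step_def)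

text \<open>\<open>h\<close> occurs in the exponent. For each fixed \<open>h\<close> the bound is
  polynomial in \<open>e\<close>, which is enough because \<open>h\<close> will depend on \<epsilon>
  alone.\<close>

definition states_bound :: "nat \<Rightarrow> nat \<times> nat \<Rightarrow> nat" where
  "states_bound h e = Suc (snd e) ^ (2 * Suc h) * (\<Sum>i\<le>6. (2 * Suc (hmax h e)) ^ i)"

text \<open>Sizes on a shifted lattice can be counted by their quotients.\<close>

lemma div_mod_unique:
  assumes "(a + c) mod n = 0" "(b + c) mod n = 0" "a div n = b div (n::nat)"
  shows "a = b"
proof -
  have *: "a = b" if le: "a \<le> b" and ab: "(a + c) mod n = 0" "(b + c) mod n = 0" "a div n = b div n" for a b
  proof -
    have "n dvd (b + c) - (a + c)" using ab by (intro dvd_diff_nat) auto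
    then have "n dvd b - a" by simp
    then obtain q where q: "b = a + n * q" using le unfolding dvd_def by (metis le_add_diff_inverse)
    then show ?thesis using ab(3) by (cases "n = 0") (auto simp: div_add1_eq)
  qed
  show ?thesis using *[of a b] *[of b a] assms by (cases "a \<le> b") auto
qed

text \<open>At most \<open>2 (h + 1)\<close> keys lie on the lattice; a state is determined by their multiplicities and
  a list of at most six other keys.\<close>

lemma card_keys: "card (keys ` {S. admissible h e d S}) \<le> states_bound h e" "finite (keys ` {S. admissible h e d S})"
proof -
  define KK where "KK = (UNIV :: bool set) \<times> {..hmax h e}"
  define lt where "lt k \<longleftrightarrow> (snd k + (if fst k then 0 else d)) mod grid e = 0" for k :: "bool \<times> nat"
  define L where "L = {k \<in> KK. lt k}"
  have fK: "finite KK" "card KK = 2 * Suc (hmax h e)" by (simp_all add: KK_def card_cartesian_product)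
  have fL: "finite L" using fK by (simp add: L_def)
  have "inj_on (\<lambda>k. (fst k, snd k div grid e)) L"
  proof (rule inj_onI)
    fix k k' assume k: "k \<in> L" "k' \<in> L" "(fst k, snd k div grid e) = (fst k', snd k' div grid e)"
    have "snd k = snd k'"
      by (rule div_mod_unique[of _ "if fst k then 0 else d" "grid e"]) (use k in \<open>auto simp: L_def lt_def\<close>)
    then show "k = k'" using k(3) by (simp add: prod_eq_iff)
  qed
  moreover have dv: "a div grid e \<le> h" if "a \<le> hmax h e" for a
    using div_le_mono[OF that, of "grid e"] by (simp add: hmax_def del: mult_Suc)
  moreover have "(\<lambda>k. (fst k, snd k div grid e)) ` L \<subseteq> UNIV \<times> {..h}"
    using dv by (auto simp: L_def KK_def)
  ultimately have "card L \<le> card ((UNIV :: bool set) \<times> {..h})" by (intro card_inj_on_le) auto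
  then have cL: "card L \<le> 2 * Suc h" by (simp add: card_cartesian_product)
  let ?P = "(L \<rightarrow>\<^sub>E {..snd e}) \<times> {xs. set xs \<subseteq> KK \<and> length xs \<le> 6}"
  let ?g = "\<lambda>z. (\<Sum>k\<in>L. replicate_mset (fst z k) k) + mset (snd z)"
  have sub: "keys ` {S. admissible h e d S} \<subseteq> ?g ` ?P"
  proof
    fix M assume "M \<in> keys ` {S. admissible h e d S}"
    then obtain S where S: "M = keys S" "admissible h e d S" by blast
    let ?f = "restrict (count M) L" and ?xs = "map key (filter (\<lambda>t. \<not> lattice e d t) S)"
    have lk: "lattice e d t \<longleftrightarrow> lt (key t)" for t by (simp add: lattice_def lt_def key_def)
    have "M = ?g (?f, ?xs)"
    proof (rule multiset_eqI)
      fix x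
      have "count (\<Sum>k\<in>L. replicate_mset (?f k) k) x = (\<Sum>k\<in>L. if k = x then count M x else 0)"
        by (auto simp: count_sum intro!: sum.cong)
      then have a: "count (\<Sum>k\<in>L. replicate_mset (?f k) k) x = (if x \<in> L then count M x else 0)"
        using fL by simp
      have "mset ?xs = filter_mset (\<lambda>k. \<not> lt k) M"
        unfolding S keys_def by (simp add: filter_mset_image_mset lk flip: mset_filter)
      then have b: "count (mset ?xs) x = (if lt x then 0 else count M x)" by simp
      have c: "count M x = 0" if "x \<notin> KK"
      proof -
        have "x \<notin># M" using that S by (auto simp: keys_def admissible_def KK_def key_def)
        then show ?thesis by (simp add: not_in_iff)
      qed
      show "count M x = count (?g (?f, ?xs)) x" using a b c by (auto simp: L_def)
    qed
    moreover have "count M x \<le> snd e" for x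
      using S count_le_size[of M x] by (simp add: admissible_def keys_def)
    then have "(?f, ?xs) \<in> ?P" using S(2) by (auto simp: admissible_def KK_def key_def)
    ultimately show "M \<in> ?g ` ?P" by blast
  qed
  have fP: "finite ?P" using fL fK by (intro finite_cartesian_product finite_PiE finite_lists_length_le) auto
  then show "finite (keys ` {S. admissible h e d S})" using sub by (meson finite_imageI finite_subset)
  have "card (keys ` {S. admissible h e d S}) \<le> card (?g ` ?P)" using sub fP by (intro card_mono) auto
  also have "\<dots> \<le> card ?P" by (rule card_image_le[OF fP])
  also have "\<dots> = Suc (snd e) ^ card L * (\<Sum>i\<le>6. card KK ^ i)"
    using fL fK by (simp add: card_cartesian_product card_PiE card_lists_length_le)
  also have "\<dots> \<le> states_bound h e"
    unfolding states_bound_def fK(2) using cL by (intro mult_le_mono1 power_increasing) auto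
  finally show "card (keys ` {S. admissible h e d S}) \<le> states_bound h e" .
qed

lemma good_table_length: "good_table h e d T \<Longrightarrow> length T \<le> states_bound h e"
proof -
  assume g: "good_table h e d T"
  have "length T = card (set (map keys T))" using g unfolding good_table_def by (metis distinct_card length_map)
  also have "\<dots> \<le> card (keys ` {S. admissible h e d S})"
    using g card_keys(2) by (intro card_mono) (auto simp: good_table_def)
  also have "\<dots> \<le> states_bound h e" by (rule card_keys(1))
  finally show ?thesis .
qed

lemma size_eSt: "\<forall>t\<in>set S. fst (snd t) \<le> H \<Longrightarrow> size (eSt S) \<le> length S * (H + 4) + mass S"
proof (induction S)
  case (Cons t S)
  then have "size (eSt S) \<le> length S * (H + 4) + mass S" "fst (snd t) \<le> H" by auto
  moreover have "size (eTk t) = size (eBool (fst t)) + fst (snd t) + size (eVs (snd (snd t))) + 2"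
    by (simp add: ePair_def)
  ultimately show ?case using size_eBool[of "fst t"] by simp
qed simp

definition table_bound :: "nat \<Rightarrow> nat \<times> nat \<Rightarrow> nat \<Rightarrow> nat" where
  "table_bound h e W = states_bound h e * (snd e * (hmax h e + 4) + W + 1)"

lemma size_good_table:
  assumes "good_table h e d T" "\<forall>S\<in>set T. mass S \<le> W"
  shows "size (eTab T) \<le> table_bound h e W"
proof -
  have "size (eSt S) \<le> snd e * (hmax h e + 4) + W" if S: "S \<in> set T" for S
  proof -
    have a: "admissible h e d S" "mass S \<le> W" using assms S by (auto simp: good_table_def)
    have "size (eSt S) \<le> length S * (hmax h e + 4) + mass S" using a by (intro size_eSt) (simp add: admissible_def)
    moreover have "length S * (hmax h e + 4) \<le> snd e * (hmax h e + 4)" using a by (intro mult_le_mono1) (simp add: admissible_def)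
    ultimately show ?thesis using a(2) by linarith
  qed
  then have "size (eTab T) \<le> length T * (snd e * (hmax h e + 4) + W + 1)"
    by (rule size_eList_bound)
  also have "\<dots> \<le> table_bound h e W" unfolding table_bound_def using good_table_length[OF assms(1)] by (intro mult_le_mono1)
  finally show ?thesis .
qed

lemma pbd_table_bound:
  assumes e: "ptf E eEnv e" and W: "pbd E W"
  shows "pbd E (\<lambda>x. table_bound h (e x) (W x))"
proof -
  have hm: "pbd E (\<lambda>x. hmax h (e x))" by (rule pbd_un[OF ptf_hmax[OF e]])
  have nm: "pbd E (\<lambda>x. snd (e x))" by (rule pbd_un[OF ptf_snd[OF e]])
  have "(\<Sum>i\<le>6. c ^ i) = 1 + c + c ^ 2 + c ^ 3 + c ^ 4 + c ^ 5 + c ^ 6" for c :: nat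
    by (simp add: eval_nat_numeral)
  note s = this
  show ?thesis
    unfolding table_bound_def states_bound_def s
    by (rule pbd_mult pbd_add pbd_power pbd_Suc hm nm W pbd_const)+
qed

lemma mass_le_size: "S \<in> set T \<Longrightarrow> mass S \<le> size (eTab T)"
proof -
  assume "S \<in> set T"
  then have "size (eSt S) < size (eTab T)" by (rule size_eList_mem)
  moreover have "mass S \<le> size (eSt S)" by (induction S) (auto simp: ePair_def)
  ultimately show ?thesis by simp
qed

lemma ptf_cl0: "ptf (ePair eEnv (ePair un eTab)) eTab (\<lambda>z. saturate h (fst z) (fst (snd z)) (snd (snd z)))"
  unfolding saturate_def
proof (rule ptf_iter)
  let ?E = "ePair eEnv (ePair un eTab)"
  show "ptf ?E un (\<lambda>z. snd (fst z) * Suc (hmax h (fst z)))" by (rule ptf_hmax ptf_rules)+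
  show "ptf ?E eTab (\<lambda>z. norm h (fst z) (fst (snd z)) (snd (snd z)))" by (rule ptf_norm ptf_rules)+
  show "ptf (ePair ?E eTab) eTab (\<lambda>z. step h (fst (fst z)) (fst (snd (fst z))) (snd z))"
    by (rule ptf_step ptf_rules)+
  show "size (eTab ((step h (fst z) (fst (snd z)) ^^ j) (norm h (fst z) (fst (snd z)) (snd (snd z)))))
    \<le> table_bound h (fst z) (size (eTab (snd (snd z))))" for z :: "(nat \<times> nat) \<times> nat \<times> token list list" and j
    by (rule size_good_table[OF good_table_saturate mass_saturate]) (use mass_le_size in blast)
  show "pbd ?E (\<lambda>z. table_bound h (fst z) (size (eTab (snd (snd z)))))"
    by (intro pbd_table_bound ptf_size[of ?E eTab] ptf_fst[OF ptf_id] ptf_snd[OF ptf_snd[OF ptf_id]])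
qed

lemmas ptf_saturate = ptf3[where f = "saturate h" for h, OF ptf_cl0]

section \<open>Table operations for starting, moving up and joining\<close>

definition idle :: "nat \<times> nat \<Rightarrow> nat \<Rightarrow> nat" where
  "idle e d = (grid e - d mod grid e) mod grid e"

definition starts :: "nat \<times> nat \<Rightarrow> nat \<Rightarrow> nat \<Rightarrow> token list list \<Rightarrow> token list list" where
  "starts e d v T = concat (map (\<lambda>S. concat (map (\<lambda>p. map (\<lambda>q.
      S @ replicate p (True, 0, [v]) @ replicate q (False, idle e d, [v])) [0..<Suc (snd e)]) [0..<Suc (snd e)])) T)"

text \<open>Only a closed fragment returns over the edge and pays \<open>l\<close>. For an ending
  one the edge lies on the path from the depot to the last vertex and does not belong to the
  detour.\<close>

definition ups :: "nat \<Rightarrow> nat \<Rightarrow> token list list \<Rightarrow> token list list" where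
  "ups u l T = map (\<lambda>S. map (\<lambda>t. if fst t then (fst t, fst (snd t), u # snd (snd t))
      else (fst t, fst (snd t) + l, u # snd (snd t) @ [u])) S) T"

definition joins :: "token list list \<Rightarrow> token list list \<Rightarrow> token list list" where
  "joins A B = concat (map (\<lambda>S. map (\<lambda>S'. S @ S') B) A)"

lemma ptf_starts0: "ptf (ePair eEnv (ePair un (ePair enc_nat eTab))) eTab
    (\<lambda>z. starts (fst z) (fst (snd z)) (fst (snd (snd z))) (snd (snd (snd z))))"
  unfolding starts_def idle_def by (rule ptf_rules)+

lemmas ptf_starts = ptf4[where f = starts, OF ptf_starts0]

lemma ptf_ups0: "ptf (ePair enc_nat (ePair un eTab)) eTab (\<lambda>z. ups (fst z) (fst (snd z)) (snd (snd z)))"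
  unfolding ups_def by (rule ptf_rules)+

lemmas ptf_ups = ptf3[where f = ups, OF ptf_ups0]

lemma ptf_joins0: "ptf (ePair eTab eTab) eTab (\<lambda>z. joins (fst z) (snd z))"
  unfolding joins_def by (rule ptf_rules)+

lemmas ptf_joins = ptf2[where f = joins, OF ptf_joins0]

section \<open>The algorithm\<close>

text \<open>An edge consists of its ends and of its length as numerator and denominator; an arc of a
  vertex, its parent, the length of the edge between them and the depth, both in units; an entry of
  a vertex, its depth and its table.\<close>

type_synonym edge = "nat \<times> nat \<times> nat \<times> nat"
type_synonym arc = "nat \<times> nat \<times> nat \<times> nat"
type_synonym entry = "nat \<times> nat \<times> token list list"

abbreviation eEdge :: "edge \<Rightarrow> btree" where "eEdge \<equiv> ePair enc_nat (ePair enc_nat (ePair enc_nat enc_nat))"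
abbreviation eArc :: "arc \<Rightarrow> btree" where "eArc \<equiv> ePair enc_nat (ePair enc_nat (ePair un un))"
abbreviation eEntry :: "entry \<Rightarrow> btree" where "eEntry \<equiv> ePair enc_nat (ePair un eTab)"
abbreviation eQ :: "nat \<times> nat \<Rightarrow> btree" where "eQ \<equiv> ePair enc_nat enc_nat"

text \<open>The length \<open>q\<close> of an edge in units of \<open>R / (2 n K)\<close>, rounded up and cut off at \<open>Suc (hmax h e)\<close>, which no
  admissible closed fragment can pay for. Lengths and \<open>R\<close> are given as numerator and denominator.\<close>

definition ulen :: "nat \<Rightarrow> nat \<Rightarrow> nat \<times> nat \<Rightarrow> nat \<times> nat \<Rightarrow> nat \<times> nat \<Rightarrow> nat" where
  "ulen K h e R q = length (filter (\<lambda>j. \<not> val (bmulu (2 * (grid e * K)) (bmul (bits (fst q)) (bits (snd R))))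
     \<le> val (bmulu j (bmul (bits (fst R)) (bits (snd q))))) [0..<Suc (hmax h e)])"

lemma ptf_ulen0: "ptf (ePair eEnv (ePair eQ eQ)) un (\<lambda>z. ulen K h (fst z) (fst (snd z)) (snd (snd z)))"
  unfolding ulen_def by (rule ptf_length ptf_filter ptf_upt ptf_hmax ptf_not ptf_val_le ptf_bmulu ptf_bmul ptf_bits ptf_rules)+

lemmas ptf_ulen = ptf3[where f = "ulen K h" for K h, OF ptf_ulen0]

lemma ulen_le: "ulen K h e R q \<le> Suc (hmax h e)"
  unfolding ulen_def by (rule le_trans[OF length_filter_le]) simp

section \<open>A spanning tree by search\<close>

definition reached :: "arc list \<Rightarrow> nat \<Rightarrow> bool" where
  "reached rs v \<longleftrightarrow> (\<exists>t\<in>set rs. veq (fst t) v)"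

lemma ptf_reached0: "ptf (ePair (eList eArc) enc_nat) eBool (\<lambda>z. reached (fst z) (snd z))"
  unfolding reached_def by (rule ptf_veq ptf_rules)+

lemmas ptf_reached = ptf2[where f = reached, OF ptf_reached0]

definition cand :: "nat \<Rightarrow> nat \<Rightarrow> nat \<times> nat \<Rightarrow> nat \<times> nat \<Rightarrow> arc list \<Rightarrow> arc \<Rightarrow> nat \<Rightarrow> nat \<Rightarrow> nat \<times> nat \<Rightarrow> arc list" where
  "cand K h e R rs t u v q = (if veq (fst t) u \<and> \<not> reached rs v
     then [(v, u, ulen K h e R q, snd (snd (snd t)) + ulen K h e R q)] else [])"

definition cands :: "nat \<Rightarrow> nat \<Rightarrow> nat \<times> nat \<Rightarrow> nat \<times> nat \<Rightarrow> edge list \<Rightarrow> arc list \<Rightarrow> arc list" where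
  "cands K h e R es rs = concat (map (\<lambda>x. concat (map (\<lambda>t.
     cand K h e R rs t (fst x) (fst (snd x)) (snd (snd x)) @ cand K h e R rs t (fst (snd x)) (fst x) (snd (snd x))) rs)) es)"

text \<open>A single vertex is added per step, and in front. Thus every vertex precedes its parent
  in the result, and the list can be used from the front as an order of elimination.\<close>

definition bfs_step :: "nat \<Rightarrow> nat \<Rightarrow> nat \<times> nat \<Rightarrow> nat \<times> nat \<Rightarrow> edge list \<Rightarrow> arc list \<Rightarrow> arc list" where
  "bfs_step K h e R es rs = (case cands K h e R es rs of [] \<Rightarrow> rs | c # cs \<Rightarrow> c # rs)"

definition bfs :: "nat \<Rightarrow> nat \<Rightarrow> nat \<times> nat \<Rightarrow> nat \<times> nat \<Rightarrow> edge list \<Rightarrow> nat \<Rightarrow> arc list" where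
  "bfs K h e R es r = (bfs_step K h e R es ^^ fst e) [(r, r, 0, 0)]"

lemma ptf_cands0: "ptf (ePair eEnv (ePair eQ (ePair (eList eEdge) (eList eArc)))) (eList eArc)
    (\<lambda>z. cands K h (fst z) (fst (snd z)) (fst (snd (snd z))) (snd (snd (snd z))))"
  unfolding cands_def cand_def by (rule ptf_veq ptf_reached ptf_ulen ptf_rules)+

lemmas ptf_cands = ptf4[where f = "cands K h" for K h, OF ptf_cands0]

lemma ptf_bstep0: "ptf (ePair eEnv (ePair eQ (ePair (eList eEdge) (eList eArc)))) (eList eArc)
    (\<lambda>z. bfs_step K h (fst z) (fst (snd z)) (fst (snd (snd z))) (snd (snd (snd z))))"
  unfolding bfs_step_def by (rule ptf_case_list ptf_cands ptf_rules)+

lemmas ptf_bfs_step = ptf4[where f = "bfs_step K h" for K h, OF ptf_bstep0]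

lemma mem_cands: "t \<in> set (cands K h e R es rs) \<longleftrightarrow> (\<exists>u v q s. ((u, v, q) \<in> set es \<or> (v, u, q) \<in> set es) \<and> s \<in> set rs \<and>
    fst s = u \<and> \<not> reached rs v \<and> t = (v, u, ulen K h e R q, snd (snd (snd s)) + ulen K h e R q))"
  (is "?l \<longleftrightarrow> ?r")
proof -
  have m: "t \<in> set (cand K h e R rs s u v q) \<longleftrightarrow>
      fst s = u \<and> \<not> reached rs v \<and> t = (v, u, ulen K h e R q, snd (snd (snd s)) + ulen K h e R q)" for s u v q
    by (auto simp: cand_def)
  have "?l \<longleftrightarrow> (\<exists>x\<in>set es. \<exists>s\<in>set rs. t \<in> set (cand K h e R rs s (fst x) (fst (snd x)) (snd (snd x))) \<or>
      t \<in> set (cand K h e R rs s (fst (snd x)) (fst x) (snd (snd x))))"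
    by (simp add: cands_def)
  also have "\<dots> \<longleftrightarrow> (\<exists>u v q. (u, v, q) \<in> set es \<and> (\<exists>s\<in>set rs. t \<in> set (cand K h e R rs s u v q) \<or> t \<in> set (cand K h e R rs s v u q)))"
    by (simp only: Bex_def split_paired_Ex fst_conv snd_conv)
  also have "\<dots> \<longleftrightarrow> ?r" unfolding m by blast
  finally show ?thesis .
qed

definition name_bound :: "edge list \<Rightarrow> nat \<Rightarrow> nat" where
  "name_bound es r = size (eList eEdge es) + size (enc_nat r)"

lemma bfs_bound:
  "length ((bfs_step K h e R es ^^ j) [(r, r, 0, 0)]) \<le> Suc j \<and>
   (\<forall>t\<in>set ((bfs_step K h e R es ^^ j) [(r, r, 0, 0)]). size (enc_nat (fst t)) \<le> name_bound es r \<and>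
     size (enc_nat (fst (snd t))) \<le> name_bound es r \<and> fst (snd (snd t)) \<le> Suc (hmax h e) \<and>
     snd (snd (snd t)) \<le> j * Suc (hmax h e))"
proof (induction j)
  case (Suc j)
  define rs where "rs = (bfs_step K h e R es ^^ j) [(r, r, 0, 0)]"
  show ?case
  proof (cases "cands K h e R es rs")
    case Nil
    then have "bfs_step K h e R es rs = rs" by (simp add: bfs_step_def)
    then show ?thesis using Suc unfolding funpow.simps comp_def rs_def[symmetric] by fastforce
  next
    case (Cons c cs)
    then have e: "bfs_step K h e R es rs = c # rs" by (simp add: bfs_step_def)
    have "c \<in> set (cands K h e R es rs)" using Cons by simp
    then obtain u v q s where c: "(u, v, q) \<in> set es \<or> (v, u, q) \<in> set es" "s \<in> set rs"
      "c = (v, u, ulen K h e R q, snd (snd (snd s)) + ulen K h e R q)" unfolding mem_cands by blast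
    have "size (enc_nat u) \<le> name_bound es r" "size (enc_nat v) \<le> name_bound es r"
      using c(1) size_eList_mem[of "(u, v, q)" es eEdge] size_eList_mem[of "(v, u, q)" es eEdge]
      by (auto simp: name_bound_def ePair_def)
    moreover have "snd (snd (snd s)) \<le> j * Suc (hmax h e)" using Suc c(2) rs_def by blast
    ultimately show ?thesis using Suc ulen_le[of K h e R q]
      unfolding funpow.simps comp_def rs_def[symmetric] e by (fastforce simp: c(3))
  qed
qed (simp add: name_bound_def)

lemma ptf_bfs0: "ptf (ePair eEnv (ePair eQ (ePair (eList eEdge) enc_nat))) (eList eArc)
    (\<lambda>z. bfs K h (fst z) (fst (snd z)) (fst (snd (snd z))) (snd (snd (snd z))))"
  unfolding bfs_def
proof (rule ptf_iter)
  let ?E = "ePair eEnv (ePair eQ (ePair (eList eEdge) enc_nat))"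
  show "ptf ?E un (\<lambda>z. fst (fst z))" by (rule ptf_rules)+
  show "ptf ?E (eList eArc) (\<lambda>z. [(snd (snd (snd z)), snd (snd (snd z)), 0, 0)])" by (rule ptf_rules)+
  show "ptf (ePair ?E (eList eArc)) (eList eArc)
    (\<lambda>z. bfs_step K h (fst (fst z)) (fst (snd (fst z))) (fst (snd (snd (fst z)))) (snd z))"
    by (rule ptf_bfs_step ptf_rules)+
  let ?B = "\<lambda>z. Suc (fst (fst z)) * (2 * name_bound (fst (snd (snd z))) (snd (snd (snd z))) + Suc (hmax h (fst z))
      + fst (fst z) * Suc (hmax h (fst z)) + 3 + 1)"
  show "size (eList eArc ((bfs_step K h (fst z) (fst (snd z)) (fst (snd (snd z))) ^^ j) [(snd (snd (snd z)), snd (snd (snd z)), 0, 0)])) \<le> ?B z"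
    if j: "j \<le> fst (fst z)" for z :: "(nat \<times> nat) \<times> (nat \<times> nat) \<times> edge list \<times> nat" and j
  proof -
    obtain e R es r where z: "z = (e, R, es, r)" by (metis prod.collapse)
    define rs where "rs = (bfs_step K h e R es ^^ j) [(r, r, 0, 0)]"
    have b: "length rs \<le> Suc j" "\<And>t. t \<in> set rs \<Longrightarrow> size (enc_nat (fst t)) \<le> name_bound es r \<and>
       size (enc_nat (fst (snd t))) \<le> name_bound es r \<and> fst (snd (snd t)) \<le> Suc (hmax h e) \<and>
       snd (snd (snd t)) \<le> j * Suc (hmax h e)" using bfs_bound[of j K h e R es r] unfolding rs_def by blast+
    have jf: "j * Suc (hmax h e) \<le> fst e * Suc (hmax h e)" using j z by (intro mult_le_mono1) simp
    have "size (eList eArc rs) \<le> length rs * ((2 * name_bound es r + Suc (hmax h e) + fst e * Suc (hmax h e) + 3) + 1)"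
    proof (rule size_eList_bound)
      fix t assume "t \<in> set rs"
      then show "size (eArc t) \<le> 2 * name_bound es r + Suc (hmax h e) + fst e * Suc (hmax h e) + 3"
        using b(2)[of t] jf by (simp add: ePair_def)
    qed
    also have "\<dots> \<le> Suc (fst e) * ((2 * name_bound es r + Suc (hmax h e) + fst e * Suc (hmax h e) + 3) + 1)"
      using b(1) j z by (intro mult_le_mono1) simp
    finally show ?thesis by (simp add: z rs_def)
  qed
  have "pbd ?E (\<lambda>z. size (eList eEdge (fst (snd (snd z)))))" by (rule ptf_size) (rule ptf_rules)+
  moreover have "pbd ?E (\<lambda>z. size (enc_nat (snd (snd (snd z)))))" by (rule ptf_size) (rule ptf_rules)+
  moreover have "pbd ?E (\<lambda>z. hmax h (fst z))" by (rule pbd_un) (rule ptf_hmax ptf_rules)+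
  moreover have "pbd ?E (\<lambda>z. fst (fst z))" by (rule pbd_un) (rule ptf_rules)+
  ultimately show "pbd ?E ?B" unfolding name_bound_def by (intro pbd_mult pbd_add pbd_Suc pbd_const)
qed

lemmas ptf_bfs = ptf4[where f = "bfs K h" for K h, OF ptf_bfs0]

section \<open>The sweep towards the depot\<close>

definition base :: "nat list \<Rightarrow> nat \<Rightarrow> token list list" where
  "base cs v = (if \<exists>c\<in>set cs. veq c v then [[(False, 0, [v])]] else [[]])"

definition inits :: "nat \<Rightarrow> nat \<times> nat \<Rightarrow> nat list \<Rightarrow> arc list \<Rightarrow> entry list" where
  "inits h e cs rs = map (\<lambda>t. (fst t, snd (snd (snd t)),
     saturate h e (snd (snd (snd t))) (starts e (snd (snd (snd t))) (fst t) (saturate h e (snd (snd (snd t))) (base cs (fst t)))))) rs"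

text \<open>When \<open>t\<close> is processed, its vertex is a leaf of the remaining tree. Its
  table is taken over the edge and crossed with the table of its parent, and its own entry
  disappears. The cases without an entry only make the function total.\<close>

definition link :: "nat \<Rightarrow> nat \<times> nat \<Rightarrow> arc \<Rightarrow> entry list \<Rightarrow> entry list" where
  "link h e t st = (case filter (\<lambda>x. veq (fst x) (fst t)) st of [] \<Rightarrow> st | a # as \<Rightarrow>
     (case filter (\<lambda>x. veq (fst x) (fst (snd t)) \<and> \<not> veq (fst x) (fst t)) st of [] \<Rightarrow> st | b # bs \<Rightarrow>
      (fst b, fst (snd b), saturate h e (fst (snd b)) (joins (snd (snd b)) (saturate h e (fst (snd b)) (ups (fst (snd t)) (fst (snd (snd t)))
        (saturate h e (fst (snd a)) (starts e (fst (snd a)) (fst t) (snd (snd a)))))))) #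
      filter (\<lambda>x. \<not> veq (fst x) (fst t) \<and> \<not> veq (fst x) (fst (snd t))) st))"

text \<open>\<open>rev (tl (rev rs))\<close> is \<open>butlast rs\<close>, that is, all arcs except
  the one for the depot, in operations covered by the rules.\<close>

definition links :: "nat \<Rightarrow> nat \<times> nat \<Rightarrow> nat list \<Rightarrow> arc list \<Rightarrow> entry list" where
  "links h e cs rs = foldl (\<lambda>st t. link h e t st) (inits h e cs rs) (rev (tl (rev rs)))"

lemma ptf_inits0: "ptf (ePair eEnv (ePair eVs (eList eArc))) (eList eEntry) (\<lambda>z. inits h (fst z) (fst (snd z)) (snd (snd z)))"
  unfolding inits_def base_def by (rule ptf_veq ptf_saturate ptf_starts ptf_rules)+

lemma ptf_link0: "ptf (ePair eEnv (ePair eArc (eList eEntry))) (eList eEntry) (\<lambda>z. link h (fst z) (fst (snd z)) (snd (snd z)))"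
  unfolding link_def by (rule ptf_case_list ptf_veq ptf_saturate ptf_starts ptf_joins ptf_ups ptf_rules)+

lemmas ptf_link = ptf3[where f = "link h" for h, OF ptf_link0]

definition max_mass :: "token list list \<Rightarrow> nat" where "max_mass T = foldr (\<lambda>S a. max (mass S) a) T 0"

lemma max_mass: "max_mass T \<le> W \<longleftrightarrow> (\<forall>S\<in>set T. mass S \<le> W)"
  by (induction T) (auto simp: max_mass_def)

lemma mass_max_mass: "S \<in> set T \<Longrightarrow> mass S \<le> max_mass T"
  using max_mass[of T "max_mass T"] by blast

lemma max_mass_saturate: "max_mass (saturate h e d T) \<le> max_mass T"
  unfolding max_mass saturate_def by (rule mass_saturate) (simp add: mass_max_mass)

lemma mass_replicate: "mass (replicate p (b, a, w)) = p * size (eVs w)"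
  by (induction p) auto

lemma mem_starts: "S' \<in> set (starts e d v T) \<longleftrightarrow> (\<exists>S\<in>set T. \<exists>p\<le>snd e. \<exists>q\<le>snd e.
    S' = S @ replicate p (True, 0, [v]) @ replicate q (False, idle e d, [v]))"
  unfolding starts_def by (simp add: image_iff atLeast0LessThan lessThan_Suc_atMost del: upt_Suc) blast

lemma table_bound_mono: "W \<le> W' \<Longrightarrow> table_bound h e W \<le> table_bound h e W'"
  by (simp add: table_bound_def)

lemma max_mass_starts: "max_mass (starts e d v T) \<le> max_mass T + 2 * (snd e * (size (enc_nat v) + 1))"
  unfolding max_mass
proof
  fix S' assume "S' \<in> set (starts e d v T)"
  then obtain S p q where S: "S \<in> set T" "p \<le> snd e" "q \<le> snd e"
    "S' = S @ replicate p (True, 0, [v]) @ replicate q (False, idle e d, [v])"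
    unfolding mem_starts by blast
  have "p * (size (enc_nat v) + 1) \<le> snd e * (size (enc_nat v) + 1)" "q * (size (enc_nat v) + 1) \<le> snd e * (size (enc_nat v) + 1)"
    using S by (intro mult_le_mono1; simp)+
  then show "mass S' \<le> max_mass T + 2 * (snd e * (size (enc_nat v) + 1))"
    using mass_max_mass[OF S(1)] by (simp add: S(4) mass_replicate)
qed

lemma max_mass_ups:
  assumes "good_table h e d T"
  shows "max_mass (ups u l T) \<le> max_mass T + 2 * (snd e * (size (enc_nat u) + 1))"
  unfolding max_mass
proof
  fix S' assume "S' \<in> set (ups u l T)"
  then obtain S where S: "S \<in> set T" "S' = map (\<lambda>t. if fst t then (fst t, fst (snd t), u # snd (snd t))
      else (fst t, fst (snd t) + l, u # snd (snd t) @ [u])) S"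
    unfolding ups_def by auto
  have "mass (map (\<lambda>t. if fst t then (fst t, fst (snd t), u # snd (snd t))
      else (fst t, fst (snd t) + l, u # snd (snd t) @ [u])) S) \<le> mass S + 2 * (length S * (size (enc_nat u) + 1))" for S
    by (induction S) (auto simp: size_eList_append)
  then have "mass S' \<le> mass S + 2 * (length S * (size (enc_nat u) + 1))" unfolding S(2) .
  moreover have "length S * (size (enc_nat u) + 1) \<le> snd e * (size (enc_nat u) + 1)"
    using assms S(1) by (intro mult_le_mono1) (auto simp: good_table_def admissible_def)
  ultimately show "mass S' \<le> max_mass T + 2 * (snd e * (size (enc_nat u) + 1))"
    using mass_max_mass[OF S(1)] by linarith
qed

lemma max_mass_joins: "max_mass (joins A B) \<le> max_mass A + max_mass B"
  unfolding max_mass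
proof
  fix S assume "S \<in> set (joins A B)"
  then obtain S1 S2 where "S1 \<in> set A" "S2 \<in> set B" "S = S1 @ S2" unfolding joins_def by auto
  then show "mass S \<le> max_mass A + max_mass B" using mass_max_mass[of S1 A] mass_max_mass[of S2 B] by simp
qed

lemma max_mass_base: "max_mass (base cs v) \<le> size (enc_nat v) + 1"
  unfolding max_mass base_def by auto

definition total :: "entry list \<Rightarrow> nat" where "total st = (\<Sum>x\<leftarrow>st. max_mass (snd (snd x)))"

lemma total_simps [simp]: "total [] = 0" "total (x # st) = max_mass (snd (snd x)) + total st"
  by (simp_all add: total_def)

lemma total_filter2:
  assumes "\<And>x. \<not> (P x \<and> Q x)"
  shows "total (filter P st) + total (filter Q st) + total (filter (\<lambda>x. \<not> P x \<and> \<not> Q x) st) = total st"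
  using assms by (induction st) auto

definition wf_st :: "nat \<Rightarrow> nat \<times> nat \<Rightarrow> nat \<Rightarrow> nat \<Rightarrow> nat \<Rightarrow> entry list \<Rightarrow> bool" where
  "wf_st h e b L W st \<longleftrightarrow> length st \<le> L \<and> total st \<le> W \<and>
    (\<forall>x\<in>set st. size (enc_nat (fst x)) \<le> b \<and> fst (snd x) \<le> b \<and> good_table h e (fst (snd x)) (snd (snd x)))"

lemma good_table_cl': "good_table h e d (saturate h e d T)"
  unfolding saturate_def by (rule good_table_saturate)

text \<open>The walks at a vertex move to its parent and the old table disappears. Therefore the masses only add
  up, although tables are copied and crossed.\<close>

lemma wf_link:
  assumes st: "wf_st h e b L W st" and t: "size (enc_nat (fst t)) \<le> b" "size (enc_nat (fst (snd t))) \<le> b"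
  shows "wf_st h e b L (W + 4 * (snd e * (b + 1))) (link h e t st)"
proof -
  let ?P = "\<lambda>x. veq (fst x) (fst t)" and ?Q = "\<lambda>x. veq (fst x) (fst (snd t)) \<and> \<not> veq (fst x) (fst t)"
  have triv: "wf_st h e b L (W + 4 * (snd e * (b + 1))) st" using st by (simp add: wf_st_def)
  show ?thesis
  proof (cases "filter ?P st = [] \<or> filter ?Q st = []")
    case True
    then have "link h e t st = st" by (auto simp: link_def split: list.split)
    then show ?thesis using triv by simp
  next
    case False
    then obtain a as c bs where f: "filter ?P st = a # as" "filter ?Q st = c # bs" by (meson neq_Nil_conv)
    define rest where "rest = filter (\<lambda>x. \<not> ?P x \<and> \<not> ?Q x) st"
    have rest: "filter (\<lambda>x. \<not> veq (fst x) (fst t) \<and> \<not> veq (fst x) (fst (snd t))) st = rest"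
      unfolding rest_def by (rule filter_cong) auto
    define Ta where "Ta = saturate h e (fst (snd a)) (starts e (fst (snd a)) (fst t) (snd (snd a)))"
    define Tb where "Tb = saturate h e (fst (snd c)) (ups (fst (snd t)) (fst (snd (snd t))) Ta)"
    define Tc where "Tc = saturate h e (fst (snd c)) (joins (snd (snd c)) Tb)"
    have e: "link h e t st = (fst c, fst (snd c), Tc) # rest"
      unfolding link_def f list.case rest Ta_def Tb_def Tc_def ..
    have "total (filter ?P st) + total (filter ?Q st) + total rest = total st"
      unfolding rest_def by (rule total_filter2) auto
    then have tot: "max_mass (snd (snd a)) + max_mass (snd (snd c)) + total rest \<le> W"
      using st unfolding f wf_st_def by simp
    have b1: "snd e * (size (enc_nat (fst t)) + 1) \<le> snd e * (b + 1)"
        "snd e * (size (enc_nat (fst (snd t))) + 1) \<le> snd e * (b + 1)" using t by simp_all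
    have "max_mass Ta \<le> max_mass (snd (snd a)) + 2 * (snd e * (b + 1))"
      unfolding Ta_def using max_mass_saturate max_mass_starts b1(1) by (meson add_le_mono le_refl le_trans mult_le_mono2)
    moreover have "max_mass Tb \<le> max_mass Ta + 2 * (snd e * (b + 1))"
      unfolding Tb_def using max_mass_saturate max_mass_ups[OF good_table_cl'[of h e "fst (snd a)"]] b1(2) unfolding Ta_def
      by (meson add_le_mono le_refl le_trans mult_le_mono2)
    moreover have "max_mass Tc \<le> max_mass (snd (snd c)) + max_mass Tb"
      unfolding Tc_def using max_mass_saturate max_mass_joins by (meson le_trans)
    ultimately have w: "max_mass Tc + total rest \<le> W + 4 * (snd e * (b + 1))" using tot by linarith
    have "c \<in> set (filter ?Q st)" "a \<in> set (filter ?P st)" unfolding f by simp_all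
    then have c: "c \<in> set st" "a \<in> set st" "\<not> ?P c" "?P a" by auto
    have "length rest < length st"
      unfolding rest_def by (rule length_filter_less[OF c(2)]) (use c(4) in simp)
    then have "Suc (length rest) \<le> L" using st by (simp add: wf_st_def)
    moreover have "\<forall>x\<in>set rest. x \<in> set st" by (simp add: rest_def)
    moreover have "good_table h e (fst (snd c)) Tc" unfolding Tc_def by (rule good_table_cl')
    ultimately show ?thesis using st c(1) w unfolding e wf_st_def by auto
  qed
qed

lemma wf_size:
  assumes "wf_st h e b L W st"
  shows "size (eList eEntry st) \<le> L * (2 * b + table_bound h e W + 3)"
proof -
  have "size (eEntry x) \<le> 2 * b + table_bound h e W + 2" if x: "x \<in> set st" for x
  proof -
    have "max_mass (snd (snd x)) \<le> total st" using x by (induction st) auto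
    then have "\<forall>S\<in>set (snd (snd x)). mass S \<le> W" using assms unfolding max_mass[symmetric] wf_st_def by linarith
    then have "size (eTab (snd (snd x))) \<le> table_bound h e W" using assms x by (intro size_good_table) (auto simp: wf_st_def)
    then show ?thesis using assms x by (auto simp: wf_st_def ePair_def)
  qed
  then have "size (eList eEntry st) \<le> length st * (2 * b + table_bound h e W + 2 + 1)" by (rule size_eList_bound)
  also have "\<dots> \<le> L * (2 * b + table_bound h e W + 2 + 1)" using assms by (intro mult_le_mono1) (simp add: wf_st_def)
  finally show ?thesis by (simp add: numeral_eq_Suc)
qed

lemma wf_inits:
  assumes b: "\<And>t. t \<in> set rs \<Longrightarrow> size (enc_nat (fst t)) \<le> b \<and> snd (snd (snd t)) \<le> b"
  shows "wf_st h e b (length rs) (length rs * ((b + 1) + 2 * (snd e * (b + 1)))) (inits h e cs rs)"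
proof -
  have "total (inits h e cs rs) \<le> length rs * ((b + 1) + 2 * (snd e * (b + 1)))"
    using b
  proof (induction rs)
    case (Cons t rs)
    let ?d = "snd (snd (snd t))"
    let ?T = "saturate h e ?d (starts e ?d (fst t) (saturate h e ?d (base cs (fst t))))"
    have "max_mass ?T \<le> max_mass (starts e ?d (fst t) (saturate h e ?d (base cs (fst t))))" by (rule max_mass_saturate)
    also have "\<dots> \<le> max_mass (saturate h e ?d (base cs (fst t))) + 2 * (snd e * (size (enc_nat (fst t)) + 1))" by (rule max_mass_starts)
    also have "\<dots> \<le> (size (enc_nat (fst t)) + 1) + 2 * (snd e * (size (enc_nat (fst t)) + 1))"
      using max_mass_saturate[of h e ?d "base cs (fst t)"] max_mass_base[of cs "fst t"] by linarith
    also have "\<dots> \<le> (b + 1) + 2 * (snd e * (b + 1))"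
      using Cons.prems[of t] by (intro add_mono mult_le_mono2) auto
    finally have "max_mass ?T \<le> (b + 1) + 2 * (snd e * (b + 1))" .
    moreover have "total (inits h e cs rs) \<le> length rs * ((b + 1) + 2 * (snd e * (b + 1)))"
      using Cons by simp
    ultimately show ?case by (simp add: inits_def)
  qed (simp add: inits_def)
  then show ?thesis using b good_table_cl' unfolding wf_st_def inits_def by auto
qed

lemma ptf_links0: "ptf (ePair eEnv (ePair eVs (eList eArc))) (eList eEntry) (\<lambda>z. links h (fst z) (fst (snd z)) (snd (snd z)))"
  unfolding links_def
proof (rule ptf_foldl)
  let ?E = "ePair eEnv (ePair eVs (eList eArc))"
  show "ptf ?E (eList eArc) (\<lambda>z. rev (tl (rev (snd (snd z)))))" by (rule ptf_rules)+
  show "ptf ?E (eList eEntry) (\<lambda>z. inits h (fst z) (fst (snd z)) (snd (snd z)))" by (rule ptf_inits0)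
  show "ptf (ePair (ePair ?E (eList eEntry)) eArc) (eList eEntry) (\<lambda>z. link h (fst (fst (fst z))) (snd z) (snd (fst z)))"
    by (rule ptf_link ptf_rules)+
  let ?b = "\<lambda>z. size (eList eArc (snd (snd z)))"
  let ?W = "\<lambda>z. ?b z * ((?b z + 1) + 2 * (snd (fst z) * (?b z + 1))) + ?b z * (4 * (snd (fst z) * (?b z + 1)))"
  let ?B = "\<lambda>z. ?b z * (2 * ?b z + table_bound h (fst z) (?W z) + 3)"
  show "size (eList eEntry (foldl (\<lambda>st t. link h (fst z) t st) (inits h (fst z) (fst (snd z)) (snd (snd z)))
      (take j (rev (tl (rev (snd (snd z))))))))  \<le> ?B z" if "j \<le> length (rev (tl (rev (snd (snd z)))))"
    for z :: "(nat \<times> nat) \<times> nat list \<times> arc list" and j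
  proof -
    obtain e cs rs where z: "z = (e, cs, rs)" by (metis prod.collapse)
    define b where "b = size (eList eArc rs)"
    have bt: "size (enc_nat (fst t)) \<le> b" "size (enc_nat (fst (snd t))) \<le> b" "snd (snd (snd t)) \<le> b" if "t \<in> set rs" for t
      using size_eList_mem[OF that, of eArc] by (auto simp: b_def ePair_def)
    have f: "wf_st h e b L (W + length ts * (4 * (snd e * (b + 1)))) (foldl (\<lambda>st t. link h e t st) st ts)"
      if "set ts \<subseteq> set rs" "wf_st h e b L W st" for ts L W st
      using that
    proof (induction ts arbitrary: W st)
      case (Cons t ts)
      have "wf_st h e b L (W + 4 * (snd e * (b + 1))) (link h e t st)"
        using Cons.prems by (intro wf_link bt) auto
      from Cons.IH[OF _ this] Cons.prems(1) show ?case by (simp add: add.assoc)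
    qed simp
    let ?ts = "take j (rev (tl (rev rs)))"
    have s: "set ?ts \<subseteq> set rs"
    proof
      fix t assume "t \<in> set ?ts"
      then have "t \<in> set (tl (rev rs))" by (auto dest: in_set_takeD)
      then have "t \<in> set (rev rs)" by (cases "rev rs") auto
      then show "t \<in> set rs" by simp
    qed
    have lr: "length rs \<le> b" unfolding b_def by (rule length_eList)
    moreover have "length ?ts \<le> length rs" by simp
    ultimately have lt: "length ?ts \<le> b" by linarith
    let ?w = "length rs * ((b + 1) + 2 * (snd e * (b + 1))) + length ?ts * (4 * (snd e * (b + 1)))"
    have w: "?w \<le> b * ((b + 1) + 2 * (snd e * (b + 1))) + b * (4 * (snd e * (b + 1)))"
      using lr lt by (intro add_mono mult_le_mono1)
    have F: "wf_st h e b (length rs) ?w (foldl (\<lambda>st t. link h e t st) (inits h e cs rs) ?ts)"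
      by (rule f[OF s wf_inits]) (use bt in blast)
    have "size (eList eEntry (foldl (\<lambda>st t. link h e t st) (inits h e cs rs) ?ts)) \<le> length rs * (2 * b + table_bound h e ?w + 3)"
      by (rule wf_size[OF F])
    also have "\<dots> \<le> b * (2 * b + table_bound h e (b * ((b + 1) + 2 * (snd e * (b + 1))) + b * (4 * (snd e * (b + 1)))) + 3)"
      using lr table_bound_mono[OF w] by (intro mult_le_mono add_mono le_refl) assumption+
    finally show ?thesis by (simp add: z b_def)
  qed
  have pb: "pbd ?E ?b" by (rule ptf_size) (rule ptf_rules)+
  have pe: "pbd ?E (\<lambda>z. snd (fst z))" by (rule pbd_un) (rule ptf_rules)+
  have pW: "pbd ?E ?W" using pb pe by (intro pbd_mult pbd_add pbd_const)
  have "pbd ?E (\<lambda>z. table_bound h (fst z) (?W z))" by (rule pbd_table_bound[OF _ pW]) (rule ptf_rules)+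
  then show "pbd ?E ?B" using pb by (intro pbd_mult pbd_add pbd_const)
qed

lemmas ptf_links = ptf3[where f = "links h" for h, OF ptf_links0]

text \<open>Any state of \<open>k\<close> ending tokens at the depot is a solution. The empty list
  answers inputs for which the table has none, so that the program halts with an output on all
  instances.\<close>

definition routes_of :: "nat \<Rightarrow> nat \<Rightarrow> entry list \<Rightarrow> nat list list" where
  "routes_of r k st = (case filter (\<lambda>S. length S \<le> k \<and> k \<le> length S \<and> (\<forall>t\<in>set S. fst t))
      (concat (map (\<lambda>x. if veq (fst x) r then snd (snd x) else []) st)) of [] \<Rightarrow> [] | S # Ss \<Rightarrow> map (\<lambda>t. snd (snd t)) S)"

lemma ptf_routes_of0: "ptf (ePair enc_nat (ePair un (eList eEntry))) (eList eVs) (\<lambda>z. routes_of (fst z) (fst (snd z)) (snd (snd z)))"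
  unfolding routes_of_def by (rule ptf_case_list ptf_veq ptf_rules)+

lemmas ptf_routes_of = ptf3[where f = routes_of, OF ptf_routes_of0]

type_synonym inst = "nat list \<times> edge list \<times> nat \<times> nat list \<times> nat \<times> nat"

abbreviation eInst :: "inst \<Rightarrow> btree" where
  "eInst \<equiv> ePair eVs (ePair (eList eEdge) (ePair enc_nat (ePair eVs eQ)))"

definition env :: "nat \<Rightarrow> inst \<times> nat \<Rightarrow> nat \<times> nat" where
  "env c z = (length (fst (fst z)), snd z * c)"

text \<open>\<open>K\<close>, \<open>h\<close> and \<open>c\<close> are constants of the program;
  \<open>c\<close> is the number of tokens allowed per bus.\<close>

definition solve :: "nat \<Rightarrow> nat \<Rightarrow> nat \<Rightarrow> inst \<times> nat \<Rightarrow> nat list list" where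
  "solve K h c z = routes_of (fst (snd (snd (fst z)))) (snd z) (links h (env c z) (fst (snd (snd (snd (fst z)))))
     (bfs K h (env c z) (snd (snd (snd (snd (fst z))))) (fst (snd (fst z))) (fst (snd (snd (fst z))))))"

lemma ptf_env: "ptf (ePair eInst un) eEnv (env c)"
  unfolding env_def by (rule ptf_rules)+

lemma ptf_solve: "ptf (ePair eInst un) (eList eVs) (solve K h c)"
  unfolding solve_def by (rule ptf_routes_of ptf_links ptf_bfs ptf_env ptf_rules)+

section \<open>Correctness of the tables\<close>

text \<open>With \<open>Suc H\<close> each token of admissible size contributes at least 1. So the
  sum falls under a merge, by which a token disappears, as well as under an increase.\<close>

definition mpot :: "nat \<Rightarrow> (bool \<times> nat) multiset \<Rightarrow> nat" where
  "mpot H M = (\<Sum>t\<in>#M. Suc H - snd t)"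

text \<open>The rules \<open>merge\<close> and \<open>inc\<close> of \<open>der\<close>, stripped of
  admissibility.\<close>

definition succM :: "(bool \<times> nat) multiset \<Rightarrow> (bool \<times> nat) multiset \<Rightarrow> bool" where
  "succM M M' \<longleftrightarrow> (\<exists>x y R. M = add_mset x (add_mset y R) \<and> \<not> fst y \<and> M' = add_mset (fst x, snd x + snd y) R) \<or>
     (\<exists>x R. M = add_mset x R \<and> M' = add_mset (fst x, Suc (snd x)) R)"

lemma mpot_le: "mpot H M \<le> size M * Suc H"
  unfolding mpot_def by (induction M) auto

lemma mpot_succM: "succM M M' \<Longrightarrow> \<forall>t\<in>#M'. snd t \<le> H \<Longrightarrow> mpot H M' < mpot H M"
  unfolding succM_def mpot_def by auto

lemma key_mrg: "key (mrg x y) = (fst (key x), snd (key x) + snd (key y))"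
  by (simp add: key_def mrg_def)

lemma key_grow: "key (grow x) = (fst (key x), Suc (snd (key x)))"
  by (simp add: key_def grow_def)

lemma keys_sel: "(x, R) \<in> set (sel S) \<Longrightarrow> keys S = add_mset (key x) (keys R)"
  using sel_mset[of x R S] by (simp add: keys_def)

lemma set_succs: "S' \<in> set (succs S) \<longleftrightarrow>
   (\<exists>x R y R'. (x, R) \<in> set (sel S) \<and> (y, R') \<in> set (sel R) \<and> \<not> fst y \<and> S' = mrg x y # R') \<or>
   (\<exists>x R. (x, R) \<in> set (sel S) \<and> S' = grow x # R)"
proof -
  have *: "S' \<in> set (succs S) \<longleftrightarrow> (\<exists>p\<in>set (sel S). \<exists>p'\<in>set (sel (snd p)). \<not> fst (fst p') \<and> S' = mrg (fst p) (fst p') # snd p')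
      \<or> (\<exists>p\<in>set (sel S). S' = grow (fst p) # snd p)"
    unfolding succs_def by (simp add: image_iff) (simp add: Bex_def)
  show ?thesis unfolding * Bex_def split_paired_Ex fst_conv snd_conv by blast
qed

lemma succs_succM: "S' \<in> set (succs S) \<Longrightarrow> succM (keys S) (keys S')"
proof -
  assume "S' \<in> set (succs S)"
  then consider x R y R' where "(x, R) \<in> set (sel S)" "(y, R') \<in> set (sel R)" "\<not> fst y" "S' = mrg x y # R'"
    | x R where "(x, R) \<in> set (sel S)" "S' = grow x # R" unfolding set_succs by blast
  then show ?thesis
  proof cases
    case 1
    have "keys S = add_mset (key x) (add_mset (key y) (keys R'))" using keys_sel[OF 1(1)] keys_sel[OF 1(2)] by simp
    moreover have "\<not> fst (key y)" using 1(3) by (simp add: key_def)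
    moreover have "keys S' = add_mset (fst (key x), snd (key x) + snd (key y)) (keys R')" by (simp add: 1(4) key_mrg)
    ultimately show ?thesis unfolding succM_def by blast
  next
    case 2
    have "keys S = add_mset (key x) (keys R)" by (rule keys_sel[OF 2(1)])
    moreover have "keys S' = add_mset (fst (key x), Suc (snd (key x))) (keys R)" by (simp add: 2(2) key_grow)
    ultimately show ?thesis unfolding succM_def by blast
  qed
qed

lemma keys_split: "keys S = add_mset k M \<Longrightarrow> \<exists>x R. (x, R) \<in> set (sel S) \<and> key x = k \<and> keys R = M"
proof -
  assume k: "keys S = add_mset k M"
  then have "k \<in># keys S" by simp
  then obtain x where x: "x \<in> set S" "key x = k" by (auto simp: keys_def)
  obtain R where R: "(x, R) \<in> set (sel S)" using sel_ex[OF x(1)] by blast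
  then show ?thesis using keys_sel[OF R] k x(2) by (intro exI[of _ x] exI[of _ R]) simp
qed

lemma succM_succs: "succM (keys S) M' \<Longrightarrow> \<exists>S'\<in>set (succs S). keys S' = M'"
proof -
  assume "succM (keys S) M'"
  then consider x y R where "keys S = add_mset x (add_mset y R)" "\<not> fst y" "M' = add_mset (fst x, snd x + snd y) R"
    | x R where "keys S = add_mset x R" "M' = add_mset (fst x, Suc (snd x)) R" unfolding succM_def by blast
  then show ?thesis
  proof cases
    case 1
    obtain tx S1 where a: "(tx, S1) \<in> set (sel S)" "key tx = x" "keys S1 = add_mset y R" using keys_split[OF 1(1)] by blast
    obtain ty S2 where b: "(ty, S2) \<in> set (sel S1)" "key ty = y" "keys S2 = R" using keys_split[OF a(3)] by blast
    have "\<not> fst ty" using 1(2) b(2) by (auto simp: key_def)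
    then have "mrg tx ty # S2 \<in> set (succs S)" unfolding set_succs using a(1) b(1) by blast
    moreover have "keys (mrg tx ty # S2) = M'" using a b by (simp add: 1(3) key_mrg)
    ultimately show ?thesis by blast
  next
    case 2
    obtain tx S1 where a: "(tx, S1) \<in> set (sel S)" "key tx = x" "keys S1 = R" using keys_split[OF 2(1)] by blast
    then have "grow tx # S1 \<in> set (succs S)" unfolding set_succs by blast
    moreover have "keys (grow tx # S1) = M'" using a by (simp add: 2(2) key_grow)
    ultimately show ?thesis by blast
  qed
qed

definition admissible_mset :: "nat \<Rightarrow> nat \<times> nat \<Rightarrow> nat \<Rightarrow> (bool \<times> nat) multiset \<Rightarrow> bool" where
  "admissible_mset h e d M \<longleftrightarrow> size M \<le> snd e \<and> (\<forall>t\<in>#M. snd t \<le> hmax h e) \<and>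
     size (filter_mset (\<lambda>t. (snd t + (if fst t then 0 else d)) mod grid e \<noteq> 0) M) \<le> 6"

lemma admissible_admissible_mset: "admissible h e d S \<longleftrightarrow> admissible_mset h e d (keys S)"
proof -
  have "size (filter_mset (\<lambda>t. (snd t + (if fst t then 0 else d)) mod grid e \<noteq> 0) (keys S)) = length (filter (\<lambda>t. \<not> lattice e d t) S)"
    by (induction S) (auto simp: lattice_def key_def)
  moreover have "size (keys S) = length S" by (simp add: keys_def)
  moreover have "(\<forall>t\<in>#keys S. snd t \<le> hmax h e) \<longleftrightarrow> (\<forall>t\<in>set S. fst (snd t) \<le> hmax h e)"
    by (auto simp: keys_def key_def)
  ultimately show ?thesis by (simp add: admissible_def admissible_mset_def)
qed

section \<open>Saturated tables are closed under the steps\<close>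

context
  fixes h :: nat and e :: "nat \<times> nat" and d :: nat and T :: "token list list"
begin

definition rounds :: "nat \<Rightarrow> (bool \<times> nat) multiset set" where
  "rounds j = keys ` set ((step h e d ^^ j) (norm h e d T))"

lemma rounds_adm: "M \<in> rounds j \<Longrightarrow> admissible_mset h e d M"
  using good_table_saturate[of h e d j T] unfolding rounds_def good_table_def admissible_admissible_mset by auto

lemma rounds_mono: "i \<le> j \<Longrightarrow> rounds i \<subseteq> rounds j"
proof (induction rule: dec_induct)
  case (step j)
  have "rounds j \<subseteq> rounds (Suc j)"
  proof
    fix M assume M: "M \<in> rounds j"
    then obtain S where S: "S \<in> set ((step h e d ^^ j) (norm h e d T))" "M = keys S" by (auto simp: rounds_def)
    have "admissible h e d S" using rounds_adm[OF M] S(2) by (simp add: admissible_admissible_mset)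
    then show "M \<in> rounds (Suc j)"
      unfolding rounds_def S(2) funpow.simps comp_def step_def[of h e d "(step h e d ^^ j) (norm h e d T)"]
      using S(1) by (intro keys_norm) auto
  qed
  then show ?case using step by blast
qed simp

lemma rounds_succ: "M \<in> rounds j \<Longrightarrow> succM M M' \<Longrightarrow> admissible_mset h e d M' \<Longrightarrow> M' \<in> rounds (Suc j)"
proof -
  assume M: "M \<in> rounds j" "succM M M'" "admissible_mset h e d M'"
  then obtain S where S: "S \<in> set ((step h e d ^^ j) (norm h e d T))" "M = keys S" by (auto simp: rounds_def)
  obtain S' where S': "S' \<in> set (succs S)" "keys S' = M'" using succM_succs M(2) S(2) by blast
  then have "admissible h e d S'" using M(3) by (simp add: admissible_admissible_mset)
  then show ?thesis
    unfolding rounds_def S'(2)[symmetric] funpow.simps comp_def step_def[of h e d "(step h e d ^^ j) (norm h e d T)"]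
    using S(1) S'(1) by (intro keys_norm) auto
qed

text \<open>Every step lowers the potential, so that a multiset first reached in round \<open>i\<close> still has
  enough rounds left for all its descendants.\<close>

lemma rounds_time: "M \<in> rounds j \<Longrightarrow> \<exists>i\<le>j. M \<in> rounds i \<and> i + mpot (hmax h e) M \<le> snd e * Suc (hmax h e)"
proof (induction j arbitrary: M)
  case 0
  have "size M \<le> snd e" using rounds_adm[OF 0] by (simp add: admissible_mset_def)
  then have "size M * Suc (hmax h e) \<le> snd e * Suc (hmax h e)" by (rule mult_le_mono1)
  then show ?case using 0 mpot_le[of "hmax h e" M] by auto
next
  case (Suc j)
  then obtain S where S: "S \<in> set (step h e d ((step h e d ^^ j) (norm h e d T)))" "M = keys S" by (auto simp: rounds_def)
  then have "S \<in> set ((step h e d ^^ j) (norm h e d T) @ concat (map (\<lambda>S. succs S) ((step h e d ^^ j) (norm h e d T))))"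
    unfolding step_def[of h e d "(step h e d ^^ j) (norm h e d T)"] using set_norm by blast
  then consider "M \<in> rounds j" | S0 where "S0 \<in> set ((step h e d ^^ j) (norm h e d T))" "S \<in> set (succs S0)"
    using S(2) by (auto simp: rounds_def)
  then show ?case
  proof cases
    case 1
    then show ?thesis using Suc.IH[of M] le_SucI by blast
  next
    case 2
    then have "keys S0 \<in> rounds j" by (simp add: rounds_def)
    from Suc.IH[OF this] obtain i where i: "i \<le> j" "keys S0 \<in> rounds i"
      "i + mpot (hmax h e) (keys S0) \<le> snd e * Suc (hmax h e)" by blast
    have s: "succM (keys S0) M" using succs_succM[OF 2(2)] S(2) by simp
    have a: "admissible_mset h e d M" by (rule rounds_adm[OF Suc.prems])
    have "mpot (hmax h e) M < mpot (hmax h e) (keys S0)" using mpot_succM[OF s] a by (simp add: admissible_mset_def)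
    then show ?thesis using rounds_succ[OF i(2) s a] i(1,3) by (intro exI[of _ "Suc i"]) auto
  qed
qed

lemma saturate_closed:
  assumes "M \<in> keys ` set (saturate h e d T)" "succM M M'" "admissible_mset h e d M'"
  shows "M' \<in> keys ` set (saturate h e d T)"
proof -
  let ?F = "snd e * Suc (hmax h e)"
  obtain i where i: "M \<in> rounds i" "i + mpot (hmax h e) M \<le> ?F"
    using rounds_time[of M ?F] assms(1) by (auto simp: saturate_def rounds_def)
  have "mpot (hmax h e) M' < mpot (hmax h e) M" using mpot_succM[OF assms(2)] assms(3) by (simp add: admissible_mset_def)
  then have "Suc i \<le> ?F" using i(2) by linarith
  then have "M' \<in> rounds ?F" using rounds_succ[OF i(1) assms(2,3)] rounds_mono by blast
  then show ?thesis by (simp add: saturate_def rounds_def)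
qed

lemma saturate_base: "S \<in> set T \<Longrightarrow> admissible_mset h e d (keys S) \<Longrightarrow> keys S \<in> keys ` set (saturate h e d T)"
  using rounds_mono[of 0 "snd e * Suc (hmax h e)"] keys_norm[of S T h e d] by (auto simp: saturate_def rounds_def admissible_admissible_mset)

lemma saturate_inv:
  assumes "\<And>S. S \<in> set T \<Longrightarrow> I S" "\<And>S S'. I S \<Longrightarrow> S' \<in> set (succs S) \<Longrightarrow> I S'" "S \<in> set (saturate h e d T)"
  shows "I S"
proof -
  have "\<forall>S\<in>set ((step h e d ^^ j) (norm h e d T)). I S" for j
  proof (induction j)
    case 0
    then show ?case using assms(1) set_norm[of h e d T] by auto
  next
    case (Suc j)
    have "set (step h e d ((step h e d ^^ j) (norm h e d T))) \<subseteq>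
        set ((step h e d ^^ j) (norm h e d T) @ concat (map (\<lambda>S. succs S) ((step h e d ^^ j) (norm h e d T))))"
      unfolding step_def[of h e d "(step h e d ^^ j) (norm h e d T)"] by (rule set_norm)
    then show ?case using Suc assms(2) by auto
  qed
  then show ?thesis using assms(3) by (simp add: saturate_def)
qed

lemma saturate_adm: "S \<in> set (saturate h e d T) \<Longrightarrow> admissible_mset h e d (keys S)"
  using good_table_cl'[of h e d T] by (simp add: good_table_def admissible_admissible_mset)

end

locale tables =
  fixes h :: nat and e :: "nat \<times> nat" and dep :: "nat \<Rightarrow> nat" and cs :: "nat list"
  assumes Nm0: "snd e > 0"

sublocale tables \<subseteq> dp "grid e" "snd e" "hmax h e" dep "set cs"
  by unfold_locales (simp_all add: Nm0)

context tables begin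

text \<open>The tables of the program, indexed by terms. They connect the program, which contains no
  terms, with the derivations.\<close>

primrec tbl :: "dp_term \<Rightarrow> token list list" where
  "tbl (Base v) = saturate h e (dep v) (base cs v)"
| "tbl (Start t) = saturate h e (dep (troot t)) (starts e (dep (troot t)) (troot t) (tbl t))"
| "tbl (Up u l t) = saturate h e (dep u) (ups u l (tbl t))"
| "tbl (Join t t') = saturate h e (dep (troot t)) (joins (tbl t) (tbl t'))"

lemma adm_M: "adm d M \<longleftrightarrow> admissible_mset h e d M"
  by (simp add: adm_def admissible_mset_def off_lattice_def on_lattice_def)

lemma tbl_closed: "M \<in> keys ` set (tbl t) \<Longrightarrow> succM M M' \<Longrightarrow> adm (dep (troot t)) M' \<Longrightarrow> M' \<in> keys ` set (tbl t)"
  unfolding adm_M by (cases t) (auto intro: saturate_closed)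

lemma keys_replicate: "keys (replicate p t) = replicate_mset p (key t)"
  by (induction p) auto

text \<open>The rules for the constructors match the table operations one by one;
  \<open>merge\<close> and \<open>inc\<close> hold because a saturated table is closed under
  \<open>succM\<close>.\<close>

lemma der_tbl: "der t M \<Longrightarrow> M \<in> keys ` set (tbl t)"
proof (induction rule: der.induct)
  case (Base v)
  let ?S = "if v \<in> set cs then [(False, 0, [v])] else []"
  have k: "(if v \<in> set cs then {#(False, 0)#} else {#}) = keys ?S" by (simp add: key_def)
  have "?S \<in> set (base cs v)" by (auto simp: base_def)
  moreover have "admissible_mset h e (dep v) (keys ?S)" using der_adm[OF der.Base[of v]] unfolding k adm_M by simp
  ultimately show ?case unfolding k tbl.simps by (rule saturate_base)
next
  case (Start t M p q)
  then obtain S where S: "S \<in> set (tbl t)" "M = keys S" by blast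
  let ?d = "dep (troot t)"
  let ?S = "S @ replicate p (True, 0, [troot t]) @ replicate q (False, idle e ?d, [troot t])"
  have k: "M + replicate_mset p (True, 0) + replicate_mset q (False, idl ?d) = keys ?S"
    by (simp add: S(2) keys_replicate key_def idle_def idl_def)
  have a: "admissible_mset h e ?d (keys ?S)" using Start.hyps(2) unfolding k adm_M .
  then have "p \<le> snd e" "q \<le> snd e" by (auto simp: admissible_mset_def keys_def)
  then have "?S \<in> set (starts e ?d (troot t) (tbl t))" unfolding mem_starts using S(1) by blast
  then show ?case unfolding k tbl.simps using a by (rule saturate_base)
next
  case (Up t M u l)
  then obtain S where S: "S \<in> set (tbl t)" "M = keys S" by blast
  let ?S = "map (\<lambda>t. if fst t then (fst t, fst (snd t), u # snd (snd t))
      else (fst t, fst (snd t) + l, u # snd (snd t) @ [u])) S"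
  have k: "image_mset (lift l) M = keys ?S"
    unfolding S(2) by (induction S) (auto simp: lift_def key_def)
  have "?S \<in> set (ups u l (tbl t))" using S(1) by (auto simp: ups_def)
  then show ?case unfolding k tbl.simps using Up.hyps(2) unfolding k adm_M by (rule saturate_base)
next
  case (Join t M t' M')
  then obtain S S' where S: "S \<in> set (tbl t)" "M = keys S" "S' \<in> set (tbl t')" "M' = keys S'" by blast
  have k: "M + M' = keys (S @ S')" using S by simp
  have "S @ S' \<in> set (joins (tbl t) (tbl t'))" using S by (auto simp: joins_def)
  then show ?case unfolding k tbl.simps using Join.hyps(3) unfolding k adm_M by (rule saturate_base)
next
  case (merge t x y M)
  have "succM (add_mset x (add_mset y M)) (add_mset (fst x, snd x + snd y) M)" unfolding succM_def using merge.hyps(2) by blast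
  from tbl_closed[OF merge.IH this merge.hyps(3)] show ?case .
next
  case (inc t x M)
  have "succM (add_mset x M) (add_mset (fst x, Suc (snd x)) M)" unfolding succM_def by blast
  from tbl_closed[OF inc.IH this inc.hyps(2)] show ?case .
qed

end

section \<open>Elimination of the vertices\<close>

text \<open>The head is the next leaf to be removed. Its parent occurs in the rest, at a depth
  smaller by the length of the edge; the root comes last.\<close>

fun elim_order :: "nat \<Rightarrow> arc list \<Rightarrow> bool" where
  "elim_order r [] = False"
| "elim_order r (t # rs) = (if rs = [] then t = (r, r, 0, 0) else elim_order r rs \<and> fst t \<notin> fst ` set rs \<and>
    (\<exists>s\<in>set rs. fst s = fst (snd t) \<and> snd (snd (snd t)) = snd (snd (snd s)) + fst (snd (snd t))))"

text \<open>The term of a vertex describes the part of its subtree that has been eliminated so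
  far.\<close>

definition relink :: "arc \<Rightarrow> (nat \<Rightarrow> dp_term) \<Rightarrow> nat \<Rightarrow> dp_term" where
  "relink t f = f(fst (snd t) := Join (f (fst (snd t))) (Up (fst (snd t)) (fst (snd (snd t))) (Start (f (fst t)))))"

primrec elim :: "arc list \<Rightarrow> (nat \<Rightarrow> dp_term) \<Rightarrow> dp_term" where
  "elim [] f = Base 0"
| "elim (t # rs) f = (if rs = [] then f (fst t) else elim rs (relink t f))"

lemma elim_order_Cons:
  assumes "elim_order r (t # rs)" "rs \<noteq> []"
  shows "elim_order r rs" "fst t \<notin> fst ` set rs" "fst (snd t) \<in> fst ` set rs" "fst (snd t) \<noteq> fst t"
    "(fst t, c) \<notin> set rs"
proof -
  have "elim_order r rs \<and> fst t \<notin> fst ` set rs \<and> (\<exists>s\<in>set rs. fst s = fst (snd t) \<and> snd (snd (snd t)) = snd (snd (snd s)) + fst (snd (snd t)))"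
    using assms by simp
  then obtain s where s: "elim_order r rs" "fst t \<notin> fst ` set rs" "s \<in> set rs" "fst s = fst (snd t)" by blast
  then show "elim_order r rs" "fst t \<notin> fst ` set rs" "fst (snd t) \<in> fst ` set rs" "fst (snd t) \<noteq> fst t" "(fst t, c) \<notin> set rs"
    by (metis image_eqI fst_conv)+
qed

lemma elim_order_root: "elim_order r rs \<Longrightarrow> r \<in> fst ` set rs"
  by (induction rs) (auto split: if_splits)

lemma elim_order_distinct: "elim_order r rs \<Longrightarrow> distinct (map fst rs)"
  by (induction rs) (auto split: if_splits)

lemma elim_order_neq: "elim_order r (t # rs) \<Longrightarrow> rs \<noteq> [] \<Longrightarrow> fst t \<noteq> r"
  using elim_order_Cons(1,2) elim_order_root by metis

primrec root_path :: "arc list \<Rightarrow> nat \<Rightarrow> nat set" where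
  "root_path [] y = {}"
| "root_path (t # rs) y = (if rs = [] then {} else if fst t = y then insert y (root_path rs (fst (snd t))) else root_path rs y)"

lemma root_path_sub: "elim_order r rs \<Longrightarrow> root_path rs y \<subseteq> fst ` set rs - {r}"
proof (induction rs arbitrary: y)
  case (Cons t rs)
  show ?case
  proof (cases "rs = []")
    case False
    then show ?thesis using Cons.IH[OF elim_order_Cons(1)[OF Cons.prems False]] elim_order_neq[OF Cons.prems False] by auto
  qed simp
qed simp

lemma root_path_root: "elim_order r rs \<Longrightarrow> root_path rs r = {}"
proof (induction rs)
  case (Cons t rs)
  then show ?case using elim_order_Cons(1)[of r t rs] elim_order_neq[of r t rs] by auto
qed simp

lemma root_path_step:
  assumes "elim_order r rs" "t \<in> set rs" "fst t \<noteq> r"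
  shows "root_path rs (fst t) = insert (fst t) (root_path rs (fst (snd t))) \<and> fst t \<notin> root_path rs (fst (snd t)) \<and>
    fst (snd t) \<in> fst ` set rs"
  using assms
proof (induction rs)
  case (Cons s rs)
  have ne: "rs \<noteq> []" using Cons.prems by auto
  note w = elim_order_Cons[OF Cons.prems(1) ne]
  show ?case
  proof (cases "t = s")
    case True
    then show ?thesis using w ne root_path_sub[OF w(1), of "fst (snd t)"] by auto
  next
    case False
    then have t: "t \<in> set rs" using Cons.prems by simp
    then have "fst t \<noteq> fst s" using w(2) by (metis image_eqI)
    moreover have "fst (snd t) \<noteq> fst s" using conjunct2[OF conjunct2[OF Cons.IH[OF w(1) t Cons.prems(3)]]] w(2) by metis
    ultimately show ?thesis using Cons.IH[OF w(1) t Cons.prems(3)] ne by auto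
  qed
qed simp

text \<open>\<open>y\<close> is the current vertex of the end of the route. When \<open>y\<close> is
  eliminated, the end passes to its parent free of charge; every other vertex of \<open>S\<close>
  pays for its edge.\<close>

primrec offcost :: "nat set \<Rightarrow> arc list \<Rightarrow> nat \<Rightarrow> nat" where
  "offcost S [] y = 0"
| "offcost S (t # rs) y = (if rs = [] then 0 else if fst t = y then offcost S rs (fst (snd t))
     else (if fst t \<in> S then fst (snd (snd t)) else 0) + offcost S rs y)"

lemma offcost_sum:
  assumes "elim_order r rs" "\<And>t. t \<in> set rs \<Longrightarrow> len (fst t) = fst (snd (snd t))"
  shows "offcost S rs y = (\<Sum>z\<in>S \<inter> fst ` set rs - {r} - root_path rs y. len z)"
  using assms
proof (induction rs arbitrary: y)
  case (Cons t rs)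
  show ?case
  proof (cases "rs = []")
    case True
    then show ?thesis using Cons.prems by auto
  next
    case False
    note w = elim_order_Cons[OF Cons.prems(1) False]
    have IH: "offcost S rs y = (\<Sum>z\<in>S \<inter> fst ` set rs - {r} - root_path rs y. len z)" for y
      using Cons.IH[OF w(1)] Cons.prems(2) by auto
    have tr: "fst t \<noteq> r" by (rule elim_order_neq[OF Cons.prems(1) False])
    have nt: "fst t \<notin> root_path rs z" for z using root_path_sub[OF w(1), of z] w(2) by auto
    show ?thesis
    proof (cases "fst t = y")
      case True
      have "S \<inter> fst ` set (t # rs) - {r} - root_path (t # rs) y = S \<inter> fst ` set rs - {r} - root_path rs (fst (snd t))"
        using True False w(2,5) by auto
      then show ?thesis using True False IH by simp
    next
      case ny: False
      show ?thesis
      proof (cases "fst t \<in> S")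
        case True
        have "S \<inter> fst ` set (t # rs) - {r} - root_path (t # rs) y = insert (fst t) (S \<inter> fst ` set rs - {r} - root_path rs y)"
          using True False ny tr nt by auto
        moreover have "fst t \<notin> S \<inter> fst ` set rs - {r} - root_path rs y" using w(2) by auto
        ultimately show ?thesis using True False ny IH Cons.prems(2) by simp
      next
        case nS: False
        have "S \<inter> fst ` set (t # rs) - {r} - root_path (t # rs) y = S \<inter> fst ` set rs - {r} - root_path rs y"
          using nS False ny by auto
        then show ?thesis using nS False ny IH by simp
      qed
    qed
  qed
qed simp

lemma elim_induct:
  assumes "elim_order r rs" "I rs f"
    and "\<And>t rs f. elim_order r (t # rs) \<Longrightarrow> rs \<noteq> [] \<Longrightarrow> I (t # rs) f \<Longrightarrow> I rs (relink t f)"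
  shows "\<exists>f'. I [(r, r, 0, 0)] f' \<and> elim rs f = f' r"
  using assms(1,2)
proof (induction rs arbitrary: f)
  case (Cons t rs)
  show ?case
  proof (cases "rs = []")
    case True
    then show ?thesis using Cons.prems by auto
  next
    case False
    then show ?thesis using Cons.IH[OF elim_order_Cons(1)[OF Cons.prems(1) False] assms(3)[OF Cons.prems(1) False Cons.prems(2)]] by simp
  qed
qed simp

lemma elim_bases:
  assumes "elim_order r rs"
  shows "bases (elim rs f) = (\<Union>v\<in>fst ` set rs. bases (f v))"
  using assms
proof (induction rs arbitrary: f)
  case (Cons t rs)
  show ?case
  proof (cases "rs = []")
    case False
    note w = elim_order_Cons[OF Cons.prems False]
    have b: "bases (relink t f v) = bases (f v) \<union> (if v = fst (snd t) then bases (f (fst t)) else {})" for v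
      by (simp add: relink_def)
    have u: "(\<Union>v\<in>A. g v \<union> (if v = u then X else {})) = (\<Union>v\<in>A. g v) \<union> X" if "u \<in> A"
      for A :: "nat set" and g u and X :: "nat set" using that by (auto split: if_splits)
    show ?thesis using Cons.IH[OF w(1), of "relink t f"] False unfolding b u[OF w(3)] by (simp add: Un_commute)
  qed simp
qed simp

text \<open>For the induction the end of the route is allowed to lie inside the term of another
  vertex \<open>z\<close>. Costs already incurred are inside the terms; those still to come are
  \<open>offcost\<close>. As \<open>S\<close> is closed under parents, a term contains visited
  vertices exactly if its own vertex is visited.\<close>

lemma elim_tcost:
  assumes "elim_order r rs" "y \<in> S" "\<And>t. t \<in> set rs \<Longrightarrow> fst t \<noteq> r \<Longrightarrow> fst t \<in> S \<Longrightarrow> fst (snd t) \<in> S"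
    "\<And>v. v \<in> fst ` set rs \<Longrightarrow> bases (f v) \<inter> S \<noteq> {} \<longleftrightarrow> v \<in> S"
    "z \<in> fst ` set rs" "\<And>v. v \<in> fst ` set rs \<Longrightarrow> y \<in> bases (f v) \<longleftrightarrow> v = z"
  shows "tcost S y (elim rs f) = (\<Sum>v\<in>fst ` set rs. tcost S y (f v)) + offcost S rs z"
  using assms
proof (induction rs arbitrary: f z)
  case (Cons t rs)
  show ?case
  proof (cases "rs = []")
    case True
    then show ?thesis by simp
  next
    case False
    note w = elim_order_Cons[OF Cons.prems(1) False]
    let ?v = "fst t" and ?u = "fst (snd t)" and ?l = "fst (snd (snd t))"
    let ?z = "if ?v = z then ?u else z"
    have vr: "?v \<noteq> r" by (rule elim_order_neq[OF Cons.prems(1) False])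
    have f': "relink t f ?u = Join (f ?u) (Up ?u ?l (Start (f ?v)))" "\<And>x. x \<noteq> ?u \<Longrightarrow> relink t f x = f x"
      by (simp_all add: relink_def)
    have vS: "bases (f ?v) \<inter> S \<noteq> {} \<longleftrightarrow> ?v \<in> S" using Cons.prems(4)[of ?v] by simp
    have vy: "y \<in> bases (f ?v) \<longleftrightarrow> ?v = z" using Cons.prems(6)[of ?v] by simp
    have up: "?v \<in> S \<Longrightarrow> ?u \<in> S" using Cons.prems(3)[of t] vr by simp
    have "tcost S y (elim rs (relink t f)) = (\<Sum>v\<in>fst ` set rs. tcost S y (relink t f v)) + offcost S rs ?z"
    proof (rule Cons.IH[OF w(1) Cons.prems(2)])
      show "\<And>t. t \<in> set rs \<Longrightarrow> fst t \<noteq> r \<Longrightarrow> fst t \<in> S \<Longrightarrow> fst (snd t) \<in> S" using Cons.prems(3) by simp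
      show "bases (relink t f x) \<inter> S \<noteq> {} \<longleftrightarrow> x \<in> S" if x: "x \<in> fst ` set rs" for x
      proof (cases "x = ?u")
        case True
        have "bases (f ?u) \<inter> S \<noteq> {} \<longleftrightarrow> ?u \<in> S" using Cons.prems(4)[of ?u] x True by simp
        then show ?thesis using True f'(1) vS up by auto
      next
        case False
        then show ?thesis using f'(2)[OF False] Cons.prems(4)[of x] x by simp
      qed
      show "?z \<in> fst ` set rs" using w(3) Cons.prems(5) by auto
      show "y \<in> bases (relink t f x) \<longleftrightarrow> x = ?z" if x: "x \<in> fst ` set rs" for x
      proof -
        have xv: "x \<noteq> ?v" using x w(2) by blast
        have bx: "y \<in> bases (f x) \<longleftrightarrow> x = z" using Cons.prems(6)[of x] x by simp
        show ?thesis
        proof (cases "x = ?u")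
          case True
          then show ?thesis using f'(1) bx vy xv by auto
        next
          case False
          then show ?thesis using f'(2)[OF False] bx xv by auto
        qed
      qed
    qed
    moreover have "(\<Sum>v\<in>fst ` set rs. tcost S y (relink t f v)) =
      (\<Sum>v\<in>fst ` set rs. tcost S y (f v)) + tcost S y (f ?v) + (if ?v \<in> S \<and> ?v \<noteq> z then ?l else 0)"
    proof -
      let ?A = "fst ` set rs - {?u}"
      have A: "fst ` set rs = insert ?u ?A" "finite ?A" "?u \<notin> ?A" using w(3) by auto
      have "(\<Sum>v\<in>?A. tcost S y (relink t f v)) = (\<Sum>v\<in>?A. tcost S y (f v))"
        by (intro sum.cong refl) (simp add: f'(2))
      moreover have "tcost S y (relink t f ?u) = tcost S y (f ?u) + tcost S y (f ?v) + (if ?v \<in> S \<and> ?v \<noteq> z then ?l else 0)"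
        unfolding f'(1) using vS vy by (auto simp: Int_commute)
      ultimately show ?thesis
        by (subst (1 2) A(1)) (simp add: sum.insert[OF A(2,3)] del: insert_Diff_single insert_Diff)
    qed
    moreover have "(\<Sum>v\<in>fst ` set (t # rs). tcost S y (f v)) = tcost S y (f ?v) + (\<Sum>v\<in>fst ` set rs. tcost S y (f v))"
      using w(2) by simp
    ultimately show ?thesis using False by auto
  qed
qed simp

lemma distinct_filter: "distinct (map fst st) \<Longrightarrow> x \<in> set st \<Longrightarrow> filter (\<lambda>z. fst z = fst x) st = [x]"
proof (induction st)
  case (Cons a st)
  show ?case
  proof (cases "a = x")
    case True
    then have "fst x \<notin> fst ` set st" using Cons.prems(1) by simp
    then have "filter (\<lambda>z. fst z = fst x) st = []" unfolding filter_empty_conv by (metis image_eqI)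
    then show ?thesis using True by simp
  next
    case False
    then have "x \<in> set st" using Cons.prems by simp
    moreover from this have "fst a \<noteq> fst x" using Cons.prems(1) by auto
    ultimately show ?thesis using Cons by simp
  qed
qed simp

context tables begin

definition repr :: "arc list \<Rightarrow> (nat \<Rightarrow> dp_term) \<Rightarrow> entry list \<Rightarrow> bool" where
  "repr rs f st \<longleftrightarrow> distinct (map fst st) \<and> set st = (\<lambda>v. (v, dep v, tbl (f v))) ` fst ` set rs"

lemma repr_link:
  assumes w: "elim_order r (t # rs)" "rs \<noteq> []" and R: "repr (t # rs) f st" and tr: "\<And>v. v \<in> fst ` set (t # rs) \<Longrightarrow> troot (f v) = v"
  shows "repr rs (relink t f) (link h e t st)"
proof -
  note w' = elim_order_Cons[OF w]
  let ?v = "fst t" and ?u = "fst (snd t)" and ?l = "fst (snd (snd t))"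
  let ?e = "\<lambda>v. (v, dep v, tbl (f v))"
  have d: "distinct (map fst st)" and s: "set st = ?e ` fst ` set (t # rs)" using R by (auto simp: repr_def)
  have "?e ?v \<in> set st" "?e ?u \<in> set st" using w'(3) unfolding s by auto
  then have F: "filter (\<lambda>x. veq (fst x) ?v) st = [?e ?v]" "filter (\<lambda>x. veq (fst x) ?u) st = [?e ?u]"
    using distinct_filter[OF d] by fastforce+
  have "filter (\<lambda>x. veq (fst x) ?u \<and> \<not> veq (fst x) ?v) st = filter (\<lambda>x. veq (fst x) ?u) st"
    using w'(4) by (intro filter_cong) auto
  then have F2: "filter (\<lambda>x. veq (fst x) ?u \<and> \<not> veq (fst x) ?v) st = [?e ?u]" using F(2) by simp
  let ?rest = "filter (\<lambda>x. \<not> veq (fst x) ?v \<and> \<not> veq (fst x) ?u) st"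
  have tv: "troot (f ?v) = ?v" "troot (f ?u) = ?u" using tr w'(3) by auto
  have L: "link h e t st = (?u, dep ?u, tbl (relink t f ?u)) # ?rest"
    unfolding link_def F(1) F2 list.case by (simp add: relink_def tv)
  have sr: "set ?rest = ?e ` (fst ` set rs - {?u})"
    unfolding set_filter s using w'(2,4,5) by auto
  have "set (link h e t st) = (\<lambda>v. (v, dep v, tbl (relink t f v))) ` fst ` set rs"
  proof -
    have "?e ` (fst ` set rs - {?u}) = (\<lambda>v. (v, dep v, tbl (relink t f v))) ` (fst ` set rs - {?u})"
      by (intro image_cong refl) (simp add: relink_def)
    then have "set (link h e t st) = (\<lambda>v. (v, dep v, tbl (relink t f v))) ` insert ?u (fst ` set rs - {?u})"
      unfolding L list.set sr image_insert by (simp only:)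
    moreover have "insert ?u (fst ` set rs - {?u}) = fst ` set rs" using w'(3) by blast
    ultimately show ?thesis by (simp only:)
  qed
  moreover have "distinct (map fst (link h e t st))"
    unfolding L using d by (auto simp: distinct_map_filter)
  ultimately show ?thesis by (simp add: repr_def)
qed

lemma foldl_link:
  assumes "elim_order r rs" "repr rs f st" "\<And>v. v \<in> fst ` set rs \<Longrightarrow> troot (f v) = v"
  shows "foldl (\<lambda>st t. link h e t st) st (butlast rs) = [(r, dep r, tbl (elim rs f))]"
  using assms
proof (induction rs arbitrary: f st)
  case (Cons t rs)
  show ?case
  proof (cases "rs = []")
    case True
    then have t: "t = (r, r, 0, 0)" using Cons.prems(1) by simp
    have "set st = {(r, dep r, tbl (f r))}" "distinct st"
      using Cons.prems(2) True t by (auto simp: repr_def distinct_map)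
    then have "st = [(r, dep r, tbl (f r))]"
    proof (cases st)
      case (Cons x xs)
      then show ?thesis using \<open>set st = _\<close> \<open>distinct st\<close> by (cases xs) auto
    qed simp
    then show ?thesis using True t by simp
  next
    case False
    have "foldl (\<lambda>st t. link h e t st) (link h e t st) (butlast rs) = [(r, dep r, tbl (elim rs (relink t f)))]"
    proof (rule Cons.IH[OF elim_order_Cons(1)[OF Cons.prems(1) False]])
      show "repr rs (relink t f) (link h e t st)" using Cons.prems by (intro repr_link[OF _ False]) auto
      show "troot (relink t f v) = v" if "v \<in> fst ` set rs" for v
        using Cons.prems(3)[of v] that by (auto simp: relink_def)
    qed
    then show ?thesis using False by simp
  qed
qed simp

text \<open>The sweep of the program evaluates exactly the term that \<open>elim\<close> builds from
  the same list.\<close>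

lemma links_eq:
  assumes "elim_order r rs" "\<And>t. t \<in> set rs \<Longrightarrow> dep (fst t) = snd (snd (snd t))"
  shows "links h e cs rs = [(r, dep r, tbl (elim rs (\<lambda>v. Start (Base v))))]"
proof -
  have "rev (tl (rev rs)) = butlast rs" by (cases rs rule: rev_cases) auto
  moreover have "repr rs (\<lambda>v. Start (Base v)) (inits h e cs rs)"
    unfolding repr_def inits_def using elim_order_distinct[OF assms(1)] assms(2) by (auto simp: comp_def image_image)
  ultimately show ?thesis unfolding links_def using foldl_link[OF assms(1)] by simp
qed

end

section \<open>Soundness and completeness on a rooted tree\<close>

text \<open>\<open>lenu\<close> is the length in units of \<open>R / X\<close>, rounded up. Products
  replace quotients so that \<open>R = 0\<close> is included, and \<open>up\<close> is restricted to
  lengths below the cut-off of \<open>ulen\<close>.\<close>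

locale routing = tables h e dep cs + rtree G w r par D P
  for h e dep cs G w r par D P +
  fixes rs :: "arc list" and lenu :: "nat \<Rightarrow> nat" and X R :: real
  assumes rs: "elim_order r rs" "fst ` set rs = pverts G"
    and arc: "\<And>t. t \<in> set rs \<Longrightarrow> dep (fst t) = snd (snd (snd t)) \<and> lenu (fst t) = fst (snd (snd t)) \<and>
      (fst t \<noteq> r \<longrightarrow> par (fst t) = fst (snd t))"
    and P_root_path: "P = root_path rs" and X: "X > 0" and R: "R \<ge> 0"
    and up: "\<And>y. y \<in> pverts G \<Longrightarrow> y \<noteq> r \<Longrightarrow> lenu y \<le> hmax h e \<Longrightarrow> X * w (par y, y) \<le> lenu y * R"
    and lo: "\<And>y j. y \<in> pverts G \<Longrightarrow> y \<noteq> r \<Longrightarrow> j < lenu y \<Longrightarrow> j * R < X * w (par y, y)"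
    and clients_sub: "set cs \<subseteq> pverts G"
begin

text \<open>The detour is traversed there and back, hence the factor 2. Beyond
  \<open>hmax h e\<close> nothing is claimed about lengths, because an edge may have been cut
  off.\<close>

definition token_ok :: "nat \<Rightarrow> token \<Rightarrow> bool" where
  "token_ok v t \<longleftrightarrow> vwalk (snd (snd t)) (with_proj G) \<and> hd (snd (snd t)) = v \<and> (\<not> fst t \<longrightarrow> last (snd (snd t)) = v) \<and>
    (fst (snd t) \<le> hmax h e \<longrightarrow>
      X * (walk_length w (snd (snd t)) - (D (last (snd (snd t))) - D v)) \<le> 2 * real (fst (snd t)) * R)"

definition state_ok :: "nat \<Rightarrow> nat set \<Rightarrow> token list \<Rightarrow> bool" where
  "state_ok v B S \<longleftrightarrow> (\<forall>t\<in>set S. token_ok v t) \<and> (\<forall>c\<in>B \<inter> set cs. \<exists>t\<in>set S. c \<in> set (snd (snd t)))"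

lemma token_ok_single: "v \<in> pverts G \<Longrightarrow> token_ok v (p, a, [v])"
  using R by (simp add: token_ok_def vw walk_length_simps)

lemma token_ok_mrg:
  assumes x: "token_ok v x" and y: "token_ok v y" and ny: "\<not> fst y"
  shows "token_ok v (mrg x y)" "set (snd (snd (mrg x y))) = set (snd (snd x)) \<union> set (snd (snd y))"
proof -
  obtain p a W where xe: "x = (p, a, W)" by (cases x)
  obtain q b U where ye: "y = (q, b, U)" by (cases y)
  have W: "W \<noteq> []" "set W \<subseteq> pverts G" "set (vwalk_arcs W) \<subseteq> parcs G" "hd W = v" "\<not> p \<longrightarrow> last W = v"
    "a \<le> hmax h e \<longrightarrow> X * (walk_length w W - (D (last W) - D v)) \<le> 2 * a * R"
    using x by (auto simp: token_ok_def xe vw)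
  have U: "U \<noteq> []" "set U \<subseteq> pverts G" "set (vwalk_arcs U) \<subseteq> parcs G" "hd U = v" "last U = v"
    "b \<le> hmax h e \<longrightarrow> X * walk_length w U \<le> 2 * b * R"
    using y ny by (auto simp: token_ok_def ye vw)
  have m: "mrg x y = (p, a + b, U @ tl W)" by (simp add: mrg_def xe ye)
  have eq: "last U = hd W" using U W by simp
  have Wv: "W = v # tl W" using W(1,4) by (metis list.collapse)
  have la: "last (U @ tl W) = last W"
    by (metis Wv U(1,5) append.right_neutral last.simps last_append)
  have st: "set (U @ tl W) = set W \<union> set U"
  proof -
    have "v \<in> set U" using U(1,4) by (metis list.set_sel(1))
    then have "set (U @ tl W) = set (v # tl W) \<union> set U" by auto
    then show ?thesis using Wv by simp
  qed
  have arcs: "vwalk_arcs (U @ tl W) = vwalk_arcs U @ vwalk_arcs W" by (rule vwalk_arcs_glue[OF U(1) W(1) eq])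
  have len: "walk_length w (U @ tl W) = walk_length w U + walk_length w W" by (rule walk_length_simps(4)[OF U(1) W(1) eq])
  show "set (snd (snd (mrg x y))) = set (snd (snd x)) \<union> set (snd (snd y))" unfolding m using st by (simp add: xe ye)
  show "token_ok v (mrg x y)"
    unfolding token_ok_def m fst_conv snd_conv la len vw
  proof (intro conjI impI)
    show "U @ tl W \<noteq> []" "hd (U @ tl W) = v" using U by auto
    show "set (U @ tl W) \<subseteq> pverts G" unfolding st using U W by blast
    show "set (vwalk_arcs (U @ tl W)) \<subseteq> parcs G" unfolding arcs using U W by auto
    show "last W = v" if "\<not> p" using W that by simp
    assume "a + b \<le> hmax h e"
    then have "X * (walk_length w W - (D (last W) - D v)) \<le> 2 * a * R" "X * walk_length w U \<le> 2 * b * R" using U W by auto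
    then show "X * (walk_length w U + walk_length w W - (D (last W) - D v)) \<le> 2 * real (a + b) * R"
      by (simp add: algebra_simps)
  qed
qed

lemma token_ok_grow:
  assumes "token_ok v x"
  shows "token_ok v (grow x)"
proof -
  have "2 * real (fst (snd x)) * R \<le> 2 * real (Suc (fst (snd x))) * R" using R by (intro mult_right_mono) auto
  then show ?thesis using assms by (auto simp: token_ok_def grow_def)
qed

lemma state_ok_succs:
  assumes S: "state_ok v B S" and S': "S' \<in> set (succs S)"
  shows "state_ok v B S'"
  using S' unfolding set_succs
proof (elim disjE exE conjE)
  fix x T y T' assume a: "(x, T) \<in> set (sel S)" "(y, T') \<in> set (sel T)" "\<not> fst y" "S' = mrg x y # T'"
  have "mset S = add_mset x (add_mset y (mset T'))" using sel_mset[OF a(1)] sel_mset[OF a(2)] by simp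
  then have s: "set S = insert x (insert y (set T'))" by (metis set_mset_add_mset_insert set_mset_mset)
  then have t: "token_ok v x" "token_ok v y" using S by (auto simp: state_ok_def)
  show ?thesis using S token_ok_mrg[OF t a(3)] unfolding state_ok_def s a(4) by auto
next
  fix x T assume a: "(x, T) \<in> set (sel S)" "S' = grow x # T"
  have s: "set S = insert x (set T)" using sel_mset[OF a(1)] by (metis set_mset_add_mset_insert set_mset_mset)
  then have t: "token_ok v x" using S by (auto simp: state_ok_def)
  have "snd (snd (grow x)) = snd (snd x)" by (simp add: grow_def)
  then show ?thesis using S token_ok_grow[OF t] unfolding state_ok_def s a(2) by auto
qed

lemma state_ok_saturate: "(\<And>S. S \<in> set T \<Longrightarrow> state_ok v B S) \<Longrightarrow> S \<in> set (saturate h e d T) \<Longrightarrow> state_ok v B S"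
  by (rule saturate_inv[where I = "state_ok v B"]) (use state_ok_succs in blast)+

primrec sound_term :: "dp_term \<Rightarrow> bool" where
  "sound_term (Base v) \<longleftrightarrow> v \<in> pverts G"
| "sound_term (Start t) \<longleftrightarrow> sound_term t"
| "sound_term (Up u l t) \<longleftrightarrow> sound_term t \<and> troot t \<noteq> r \<and> par (troot t) = u \<and> l = lenu (troot t)"
| "sound_term (Join t t') \<longleftrightarrow> sound_term t \<and> sound_term t' \<and> troot t' = troot t"

lemma sound_term_root: "sound_term t \<Longrightarrow> troot t \<in> pverts G"
proof (induction t)
  case (Up u l t)
  then show ?case using par[of "troot t"] arc_verts[of "par (troot t)" "troot t"] by auto
qed auto

text \<open>For an ending fragment the new edge is offset by the larger distance to its last vertex.
  A closed one uses the edge twice, which \<open>up\<close> bounds by \<open>2 * lenu v\<close>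
  units.\<close>

lemma token_ok_up:
  assumes t: "token_ok v t" and v: "v \<in> pverts G" "v \<noteq> r"
  shows "token_ok (par v) (if fst t then (fst t, fst (snd t), par v # snd (snd t))
      else (fst t, fst (snd t) + lenu v, par v # snd (snd t) @ [par v]))"
proof -
  obtain p a W where te: "t = (p, a, W)" by (cases t)
  have W: "W \<noteq> []" "set W \<subseteq> pverts G" "set (vwalk_arcs W) \<subseteq> parcs G" "hd W = v" "\<not> p \<longrightarrow> last W = v"
    "a \<le> hmax h e \<longrightarrow> X * (walk_length w W - (D (last W) - D v)) \<le> 2 * a * R"
    using t by (auto simp: token_ok_def te vw)
  have a: "(par v, v) \<in> parcs G" by (rule par[OF v])
  have pv: "par v \<in> pverts G" using arc_verts[OF a] by simp
  have Dv: "D v = D (par v) + w (par v, v)" by (rule D[OF v])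
  have l1: "walk_length w (par v # W) = w (par v, v) + walk_length w W" using W by (simp add: walk_length_simps)
  show ?thesis
  proof (cases p)
    case True
    then show ?thesis using W a pv Dv l1 by (simp add: token_ok_def te vw vwalk_arcs_Cons algebra_simps)
  next
    case False
    have "walk_length w ((par v # W) @ [par v]) = walk_length w (par v # W) + w (last (par v # W), par v)"
      by (rule walk_length_simps(2)) simp
    then have l2: "walk_length w (par v # W @ [par v]) = 2 * w (par v, v) + walk_length w W"
      using l1 W(1,5) False w_sym[of v "par v"] by simp
    have "vwalk_arcs ((par v # W) @ [par v]) = vwalk_arcs (par v # W) @ [(last (par v # W), par v)]"
      by (rule vwalk_arcs_snoc) simp
    then have ar: "set (vwalk_arcs (par v # W @ [par v])) \<subseteq> parcs G"
      using W False a sym[OF a] by (auto simp: vwalk_arcs_Cons)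
    have "X * (2 * w (par v, v) + walk_length w W) \<le> 2 * real (a + lenu v) * R" if h: "a + lenu v \<le> hmax h e"
    proof -
      have "X * w (par v, v) \<le> lenu v * R" using h by (intro up v) simp
      moreover have "X * walk_length w W \<le> 2 * a * R" using W(5,6) False h by simp
      ultimately show ?thesis by (simp add: algebra_simps)
    qed
    then show ?thesis using W pv ar l2 False by (simp add: token_ok_def te vw)
  qed
qed

lemma tbl_sound: "sound_term t \<Longrightarrow> S \<in> set (tbl t) \<Longrightarrow> state_ok (troot t) (bases t) S"
proof (induction t arbitrary: S)
  case (Base v)
  have "state_ok v {v} S" if "S \<in> set (base cs v)" for S
    using that token_ok_single[of v] Base.prems(1) by (auto simp: base_def state_ok_def split: if_splits)
  from state_ok_saturate[where S = S, OF this] Base.prems(2) show ?case by simp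
next
  case (Start t)
  have tr: "troot t \<in> pverts G" using Start.prems(1) sound_term_root by simp
  have "state_ok (troot t) (bases t) S" if S: "S \<in> set (starts e (dep (troot t)) (troot t) (tbl t))" for S
  proof -
    obtain S0 p q where S0: "S0 \<in> set (tbl t)"
      "S = S0 @ replicate p (True, 0, [troot t]) @ replicate q (False, idle e (dep (troot t)), [troot t])"
      using S unfolding mem_starts by blast
    have "state_ok (troot t) (bases t) S0" using Start.IH[OF _ S0(1)] Start.prems(1) by simp
    then show ?thesis using token_ok_single[OF tr] unfolding state_ok_def S0(2) by (auto simp: set_replicate_conv_if)
  qed
  from state_ok_saturate[where S = S, OF this] Start.prems(2) show ?case by simp
next
  case (Up u l t)
  have s: "sound_term t" "troot t \<noteq> r" "u = par (troot t)" "l = lenu (troot t)" using Up.prems(1) by auto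
  have tr: "troot t \<in> pverts G" by (rule sound_term_root[OF s(1)])
  have "state_ok u (bases t) S" if S: "S \<in> set (ups u l (tbl t))" for S
  proof -
    let ?f = "\<lambda>t. if fst t then (fst t, fst (snd t), u # snd (snd t))
      else (fst t, fst (snd t) + l, u # snd (snd t) @ [u])"
    obtain S0 where S0: "S0 \<in> set (tbl t)" "S = map ?f S0" using S by (auto simp: ups_def)
    have o: "state_ok (troot t) (bases t) S0" by (rule Up.IH[OF s(1) S0(1)])
    have f: "token_ok u (?f x)" "set (snd (snd x)) \<subseteq> set (snd (snd (?f x)))" if "x \<in> set S0" for x
    proof -
      have "token_ok (troot t) x" using o that by (simp add: state_ok_def)
      from token_ok_up[OF this tr s(2)] show "token_ok u (?f x)" unfolding s(3,4) .
      show "set (snd (snd x)) \<subseteq> set (snd (snd (?f x)))" by auto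
    qed
    show ?thesis
      unfolding state_ok_def S0(2)
    proof (intro conjI ballI)
      fix c assume "c \<in> bases t \<inter> set cs"
      moreover have "\<forall>c\<in>bases t \<inter> set cs. \<exists>t\<in>set S0. c \<in> set (snd (snd t))"
        using o unfolding state_ok_def by (rule conjunct2)
      ultimately obtain x where "x \<in> set S0" "c \<in> set (snd (snd x))" by blast
      then show "\<exists>x\<in>set (map ?f S0). c \<in> set (snd (snd x))" using f(2)[of x] by (intro bexI[of _ "?f x"]) auto
    next
      fix y assume "y \<in> set (map ?f S0)"
      then obtain x where x: "x \<in> set S0" "y = ?f x" unfolding set_map by blast
      show "token_ok u y" using f(1)[OF x(1)] unfolding x(2) .
    qed
  qed
  from state_ok_saturate[where S = S, OF this] Up.prems(2) show ?case by simp
next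
  case (Join t t')
  have "state_ok (troot t) (bases t \<union> bases t') S" if S: "S \<in> set (joins (tbl t) (tbl t'))" for S
  proof -
    obtain S1 S2 where "S1 \<in> set (tbl t)" "S2 \<in> set (tbl t')" "S = S1 @ S2" using S by (auto simp: joins_def)
    moreover from this have "state_ok (troot t) (bases t) S1" "state_ok (troot t') (bases t') S2" using Join by auto
    ultimately show ?thesis using Join.prems(1) by (auto simp: state_ok_def)
  qed
  from state_ok_saturate[where S = S, OF this] Join.prems(2) show ?case by simp
qed

definition root_term :: dp_term where "root_term = elim rs (\<lambda>v. Start (Base v))"

lemma arc_dep:
  assumes "elim_order r (t # ts)" "ts \<noteq> []" "set (t # ts) \<subseteq> set rs"
  shows "dep (fst t) = dep (fst (snd t)) + fst (snd (snd t))"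
proof -
  obtain s where s: "s \<in> set ts" "fst s = fst (snd t)" "snd (snd (snd t)) = snd (snd (snd s)) + fst (snd (snd t))"
    using assms by auto
  then show ?thesis using arc[of t] arc[of s] assms(3) by auto
qed

lemma root_sound_term: "sound_term root_term \<and> troot root_term = r"
proof -
  let ?I = "\<lambda>ts f. set ts \<subseteq> set rs \<union> {(r, r, 0, 0)} \<and> (\<forall>v\<in>fst ` set ts. sound_term (f v) \<and> troot (f v) = v)"
  have last: "(r, r, 0, 0) \<in> set rs" using rs(1) by (induction rs) (auto split: if_splits)
  have "\<exists>f. ?I [(r, r, 0, 0)] f \<and> elim rs (\<lambda>v. Start (Base v)) = f r"
  proof (rule elim_induct[OF rs(1)])
    show "?I rs (\<lambda>v. Start (Base v))" using rs(2) by auto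
    fix t ts f assume a: "elim_order r (t # ts)" "ts \<noteq> []" "?I (t # ts) f"
    note w = elim_order_Cons[OF a(1,2)]
    have "t \<in> set rs" using a(3) last by auto
    then have "par (fst t) = fst (snd t)" "lenu (fst t) = fst (snd (snd t))" "fst t \<noteq> r"
      using arc elim_order_neq[OF a(1,2)] by auto
    then show "?I ts (relink t f)" using a(3) w(3) by (auto simp: relink_def)
  qed
  then show ?thesis unfolding root_term_def by auto
qed

lemma root_bases: "bases root_term = pverts G"
  unfolding root_term_def elim_bases[OF rs(1)] rs(2) by simp

lemma root_tcost:
  assumes "S \<subseteq> pverts G" "\<forall>y\<in>S - {r}. par y \<in> S" "y \<in> S"
  shows "tcost S y root_term = (\<Sum>z\<in>S - {r} - P y. lenu z)"
proof -
  have "tcost S y root_term = (\<Sum>v\<in>fst ` set rs. tcost S y (Start (Base v))) + offcost S rs y"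
    unfolding root_term_def
  proof (rule elim_tcost[OF rs(1) assms(3)])
    fix t assume "t \<in> set rs" "fst t \<noteq> r" "fst t \<in> S"
    then show "fst (snd t) \<in> S" using assms(2) arc[of t] by (metis Diff_iff singletonD)
  qed (use assms rs(2) in auto)
  also have "\<dots> = offcost S rs y" by simp
  also have "\<dots> = (\<Sum>z\<in>S \<inter> fst ` set rs - {r} - root_path rs y. lenu z)"
    by (rule offcost_sum[OF rs(1)]) (use arc in auto)
  also have "S \<inter> fst ` set rs = S" using assms(1) rs(2) by auto
  finally show ?thesis by (simp add: P_root_path)
qed

text \<open>Each rounded length exceeds the true one by at most one unit, and there are fewer than
  \<open>grid e\<close> edges.\<close>

lemma units_bound:
  assumes A: "A \<subseteq> pverts G - {r}" and c: "card (pverts G) \<le> grid e" and XK: "X = 2 * (grid e * K)"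
    and b: "2 * (\<Sum>y\<in>A. w (par y, y)) \<le> R"
  shows "(\<Sum>y\<in>A. lenu y) \<le> grid e * (K + 1)"
proof -
  have fA: "finite A" using A fin finite_subset by blast
  have y: "y \<in> pverts G" "y \<noteq> r" "w (par y, y) \<ge> 0" if "y \<in> A" for y
    using A that w_nonneg[OF par] by auto
  show ?thesis
  proof (cases "R = 0")
    \<comment> \<open>With \<open>R = 0\<close> all edges of a detour have length 0, and
      \<open>lo\<close> then forces their rounded lengths to be 0 too.\<close>
    case True
    have "w (par y, y) = 0" if "y \<in> A" for y
    proof -
      have "w (par y, y) \<le> (\<Sum>y\<in>A. w (par y, y))" using fA y(3) that by (intro member_le_sum) auto
      then show ?thesis using y(3)[OF that] b True by simp
    qed
    then have "lenu y = 0" if "y \<in> A" for y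
      using lo[OF y(1,2), OF that that, of 0] that True by fastforce
    then show ?thesis by simp
  next
    case False
    then have R0: "R > 0" using R by simp
    have "lenu y * R \<le> X * w (par y, y) + R" if "y \<in> A" for y
    proof (cases "lenu y")
      case 0
      then show ?thesis using X y(3)[OF that] R by simp
    next
      case (Suc j)
      then have "j * R < X * w (par y, y)" using lo[OF y(1,2), OF that that, of j] by simp
      then show ?thesis using Suc by (simp add: algebra_simps)
    qed
    then have "(\<Sum>y\<in>A. lenu y * R) \<le> (\<Sum>y\<in>A. X * w (par y, y) + R)" by (intro sum_mono)
    also have "\<dots> = X * (\<Sum>y\<in>A. w (par y, y)) + card A * R" by (simp add: sum.distrib sum_distrib_left)
    also have "\<dots> \<le> (grid e * K) * R + grid e * R"
    proof (intro add_mono mult_right_mono)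
      have "X * (\<Sum>y\<in>A. w (par y, y)) = (grid e * K) * (2 * (\<Sum>y\<in>A. w (par y, y)))" by (simp add: XK)
      also have "\<dots> \<le> (grid e * K) * R" using b by (intro mult_left_mono) auto
      finally show "X * (\<Sum>y\<in>A. w (par y, y)) \<le> (grid e * K) * R" .
      have "card A \<le> card (pverts G)" using A fin by (intro card_mono) auto
      then show "real (card A) \<le> real (grid e)" using c by simp
    qed (rule R)
    also have "\<dots> = real (grid e * (K + 1)) * R" by (simp add: algebra_simps)
    finally have "real (\<Sum>y\<in>A. lenu y) * R \<le> real (grid e * (K + 1)) * R" by (simp add: sum_distrib_right)
    then have "real (\<Sum>y\<in>A. lenu y) \<le> real (grid e * (K + 1))" using R0 by (rule mult_right_le_imp_le)
    then show ?thesis by (simp only: of_nat_le_iff)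
  qed
qed

lemma state_routes:
  assumes S: "S \<in> set (tbl root_term)" and f: "\<forall>t\<in>set S. fst t"
  shows "bus_routes G w r (set cs) (2 * hmax h e / X * R) (map (\<lambda>t. snd (snd t)) S)"
proof -
  have o: "state_ok r (pverts G) S" using tbl_sound[OF _ S] root_sound_term root_bases by simp
  have "\<exists>d T. tbl root_term = saturate h e d T" by (cases root_term) auto
  then have a: "fst (snd t) \<le> hmax h e" if "t \<in> set S" for t
    using saturate_adm[of S h e] S that by (fastforce simp: admissible_admissible_mset[symmetric] admissible_def)
  have "regret G w (snd (snd t)) \<le> 2 * hmax h e / X * R" if t: "t \<in> set S" for t
  proof -
    have "token_ok r t" using o t by (simp add: state_ok_def)
    then have k: "vwalk (snd (snd t)) (with_proj G)" "hd (snd (snd t)) = r"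
      "X * (walk_length w (snd (snd t)) - D (last (snd (snd t)))) \<le> 2 * real (fst (snd t)) * R"
      using a[OF t] Dr by (auto simp: token_ok_def)
    have "2 * real (fst (snd t)) * R \<le> 2 * hmax h e * R" using a[OF t] R by (intro mult_right_mono) auto
    then have "X * regret G w (snd (snd t)) \<le> 2 * hmax h e * R" using k regret_D[OF k(1,2)] by simp
    then show ?thesis using X by (simp add: field_simps)
  qed
  then show ?thesis using o clients_sub unfolding bus_routes_def by (auto simp: state_ok_def token_ok_def)
qed

theorem exists_state:
  assumes Ps: "length Ps = k" "bus_routes G w r (set cs) R Ps" and k: "k > 0" and m: "m > 0"
    and h: "h = m ^ 4 + 100 * m ^ 3" and Nm: "k * (21 * m ^ 3 + 10) \<le> snd e"
    and c: "card (pverts G) \<le> grid e" and XK: "X = 2 * (grid e * m ^ 4)"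
  shows "\<exists>S\<in>set (tbl root_term). length S = k \<and> (\<forall>t\<in>set S. fst t)"
proof -
  have W: "vwalk (Ps ! i) (with_proj G)" "hd (Ps ! i) = r" "regret G w (Ps ! i) \<le> R" if "i < k" for i
    using Ps that by (auto simp: bus_routes_def)
  have db: "2 * (\<Sum>y\<in>set (Ps ! i) - {r} - P (last (Ps ! i)). w (par y, y)) \<le> R"
    "\<forall>y\<in>set (Ps ! i) - {r}. par y \<in> set (Ps ! i)" "last (Ps ! i) \<in> set (Ps ! i)" "r \<in> set (Ps ! i)"
    "set (Ps ! i) \<subseteq> pverts G" if "i < k" for i
    using detour_bound[OF W[OF that]] by blast+
  have nm: "grid e * m ^ 2 \<le> grid e * m ^ 3" "grid e * m \<le> grid e * m ^ 3" "grid e * m ^ 3 > 0"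
    using m by (auto simp: power_increasing eval_nat_numeral simp del: mult_Suc)
  interpret covering "grid e" "snd e" "hmax h e" dep "set cs" k "grid e * m ^ 3" "grid e * m ^ 2" "grid e * m"
    "\<lambda>i. set (Ps ! i)" "\<lambda>i. last (Ps ! i)"
  proof unfold_locales
    fix v assume "v \<in> set cs"
    then obtain p where "p \<in> set Ps" "v \<in> set p" using Ps(2) unfolding bus_routes_def by blast
    then show "\<exists>i<k. v \<in> set (Ps ! i)" using Ps(1) unfolding in_set_conv_nth by blast
  qed (rule nm db(3) | assumption)+
  have ok: "Ok root_term"
  proof -
    \<comment> \<open>Disjointness of the bases belongs to the invariant because
      \<open>Ok_join\<close> needs it.\<close>
    let ?I = "\<lambda>ts f. set ts \<subseteq> set rs \<union> {(r, r, 0, 0)} \<and> (\<forall>v\<in>fst ` set ts. Ok (f v) \<and> troot (f v) = v) \<and>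
      (\<forall>u\<in>fst ` set ts. \<forall>v\<in>fst ` set ts. u \<noteq> v \<longrightarrow> bases (f u) \<inter> bases (f v) = {})"
    have last: "(r, r, 0, 0) \<in> set rs" using rs(1) by (induction rs) (auto split: if_splits)
    have "\<exists>f. ?I [(r, r, 0, 0)] f \<and> elim rs (\<lambda>v. Start (Base v)) = f r"
    proof (rule elim_induct[OF rs(1)])
      show "?I rs (\<lambda>v. Start (Base v))" using Ok_base by auto
      fix t ts f assume a: "elim_order r (t # ts)" "ts \<noteq> []" "?I (t # ts) f"
      note w = elim_order_Cons[OF a(1,2)]
      let ?v = "fst t" and ?u = "fst (snd t)" and ?l = "fst (snd (snd t))"
      have ts: "set (t # ts) \<subseteq> set rs" using a(3) last by auto
      have I: "\<And>x. x \<in> fst ` set (t # ts) \<Longrightarrow> Ok (f x) \<and> troot (f x) = x"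
        "\<And>x y. x \<in> fst ` set (t # ts) \<Longrightarrow> y \<in> fst ` set (t # ts) \<Longrightarrow> x \<noteq> y \<Longrightarrow> bases (f x) \<inter> bases (f y) = {}"
        using a(3) by blast+
      have v: "?v \<in> fst ` set (t # ts)" "?u \<in> fst ` set (t # ts)" using w(3) by auto
      have "Ok (Up ?u ?l (Start (f ?v)))"
        by (rule Ok_up) (use I(1)[OF v(1)] arc_dep[OF a(1,2) ts] in auto)
      then have j: "Ok (Join (f ?u) (Up ?u ?l (Start (f ?v))))"
        by (intro Ok_join) (use I(1)[OF v(1)] I(1)[OF v(2)] I(2)[OF v(2,1) w(4)] in auto)
      have b: "bases (relink t f x) = bases (f x) \<union> (if x = ?u then bases (f ?v) else {})" for x
        by (simp add: relink_def)
      show "?I ts (relink t f)"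
      proof (intro conjI ballI impI)
        show "set ts \<subseteq> set rs \<union> {(r, r, 0, 0)}" using ts by auto
        fix x assume x: "x \<in> fst ` set ts"
        then have x': "x \<in> fst ` set (t # ts)" by auto
        show "Ok (relink t f x)" "troot (relink t f x) = x"
          using j I(1)[OF x'] I(1)[OF v(2)] by (auto simp: relink_def)
        fix y assume y: "y \<in> fst ` set ts" and xy: "x \<noteq> y"
        then have y': "y \<in> fst ` set (t # ts)" by auto
        have "x \<noteq> ?v" "y \<noteq> ?v" using x y w(2) by blast+
        then show "bases (relink t f x) \<inter> bases (relink t f y) = {}"
          unfolding b using I(2)[OF x' y' xy] I(2)[OF x' v(1)] I(2)[OF y' v(1)] xy by (auto split: if_splits)
      qed
    qed
    then show ?thesis unfolding root_term_def by auto
  qed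
  have "\<exists>M. der root_term M \<and> size M = k \<and> (\<forall>y\<in>#M. fst y)"
  proof (rule complete[OF ok k _ _ m refl refl refl _ Nm])
    fix i assume i: "i < k"
    show "last (Ps ! i) \<in> bases root_term" unfolding root_bases using db(3,5)[OF i] by blast
    have "tcost (set (Ps ! i)) (last (Ps ! i)) root_term = (\<Sum>z\<in>set (Ps ! i) - {r} - P (last (Ps ! i)). lenu z)"
      by (rule root_tcost[OF db(5,2,3)[OF i]])
    also have "\<dots> \<le> grid e * (m ^ 4 + 1)"
      by (rule units_bound[OF _ c XK db(1)[OF i]]) (use db(5)[OF i] in auto)
    finally show "tcost (set (Ps ! i)) (last (Ps ! i)) root_term \<le> grid e * (m ^ 4 + 1)" .
  qed (simp_all add: hmax_def h)
  then obtain M where M: "der root_term M" "size M = k" "\<forall>y\<in>#M. fst y" by blast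
  then obtain S where S: "S \<in> set (tbl root_term)" "M = keys S" using der_tbl by blast
  then have "length S = k" "\<forall>t\<in>set S. fst t" using M by (auto simp: keys_def key_def)
  then show ?thesis using S(1) by blast
qed

end

section \<open>Breadth-first search\<close>

text \<open>An initial segment is determined by its number of elements; this turns the count in
  \<open>ulen\<close> into a threshold.\<close>

lemma filter_upt_length:
  assumes "\<And>i j. i \<le> j \<Longrightarrow> Q j \<Longrightarrow> Q i" "i < c"
  shows "Q i \<longleftrightarrow> i < length (filter Q [0..<c])"
  using assms(2)
proof (induction c)
  case (Suc c)
  show ?case
  proof (cases "Q c")
    case True
    have "Q x" if "x \<le> c" for x by (rule assms(1)[OF that True])
    then have "filter Q [0..<Suc c] = [0..<Suc c]" by (intro filter_True) auto
    moreover have "Q i" using assms(1)[of i c] True Suc.prems by simp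
    ultimately show ?thesis using Suc.prems by (simp del: upt_Suc)
  next
    case False
    then have f: "filter Q [0..<Suc c] = filter Q [0..<c]" by simp
    have "length (filter Q [0..<c]) \<le> c" using length_filter_le[of Q "[0..<c]"] by simp
    then show ?thesis unfolding f using Suc False by (cases "i = c") auto
  qed
qed simp

lemma ulen_iff:
  assumes "j < Suc (hmax h e)"
  shows "j < ulen K h e R q \<longleftrightarrow> j * (fst R * snd q) < 2 * (grid e * K) * (fst q * snd R)"
proof -
  let ?Q = "\<lambda>j. \<not> val (bmulu (2 * (grid e * K)) (bmul (bits (fst q)) (bits (snd R))))
     \<le> val (bmulu j (bmul (bits (fst R)) (bits (snd q))))"
  have Q: "?Q j \<longleftrightarrow> j * (fst R * snd q) < 2 * (grid e * K) * (fst q * snd R)" for j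
    by (simp only: val_bmulu val_bmul val_bits not_le)
  have "?Q i" if "i \<le> j" "?Q j" for i j
    using that mult_le_mono1[OF that(1), of "fst R * snd q"] unfolding Q by linarith
  from filter_upt_length[of ?Q, OF this assms] show ?thesis unfolding Q ulen_def by simp
qed

lemma ulen_real:
  assumes q: "snd q > 0" and R: "snd R > 0"
  shows "ulen K h e R q \<le> hmax h e \<Longrightarrow> real (2 * (grid e * K)) * (real (fst q) / real (snd q)) \<le> ulen K h e R q * (real (fst R) / real (snd R))"
    and "j < ulen K h e R q \<Longrightarrow> j * (real (fst R) / real (snd R)) < real (2 * (grid e * K)) * (real (fst q) / real (snd q))"
proof -
  let ?X = "2 * (grid e * K)"
  have conv: "j * (fst R * snd q) < ?X * (fst q * snd R) \<longleftrightarrow>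
      j * (real (fst R) / real (snd R)) < real ?X * (real (fst q) / real (snd q))" for j
  proof -
    have "j * (fst R * snd q) < ?X * (fst q * snd R) \<longleftrightarrow> real (j * (fst R * snd q)) < real (?X * (fst q * snd R))"
      by (simp only: of_nat_less_iff)
    also have "\<dots> \<longleftrightarrow> (real j * real (fst R)) * real (snd q) < (real ?X * real (fst q)) * real (snd R)"
      by (simp only: of_nat_mult mult.assoc)
    also have "\<dots> \<longleftrightarrow> (real j * real (fst R)) / real (snd R) < (real ?X * real (fst q)) / real (snd q)"
      using q R by (simp add: divide_less_eq less_divide_eq field_simps)
    finally show ?thesis by simp
  qed
  show "real ?X * (real (fst q) / real (snd q)) \<le> ulen K h e R q * (real (fst R) / real (snd R))" if "ulen K h e R q \<le> hmax h e"
    using ulen_iff[of "ulen K h e R q" h e K R q] that conv[of "ulen K h e R q"] by (simp add: not_less)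
  show "j * (real (fst R) / real (snd R)) < real ?X * (real (fst q) / real (snd q))" if "j < ulen K h e R q"
    using ulen_iff[of j h e K R q] ulen_le[of K h e R q] that conv[of j] by simp
qed

locale search =
  fixes K h :: nat and e R :: "nat \<times> nat" and es :: "edge list" and r :: nat and V :: "nat set" and E :: "(nat \<times> nat) set"
  assumes V: "finite V" "card V \<le> fst e" "r \<in> V"
    and E: "E = {(u, v). \<exists>q. (u, v, q) \<in> set es \<or> (v, u, q) \<in> set es}" "E \<subseteq> V \<times> V"
    and conn: "\<And>v. v \<in> V \<Longrightarrow> (r, v) \<in> E\<^sup>*"
begin

definition partial_tree :: "arc list \<Rightarrow> bool" where
  "partial_tree rs \<longleftrightarrow> elim_order r rs \<and> fst ` set rs \<subseteq> V \<and> (\<forall>t\<in>set rs. fst t \<noteq> r \<longrightarrow>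
    (\<exists>q. ((fst (snd t), fst t, q) \<in> set es \<or> (fst t, fst (snd t), q) \<in> set es) \<and> fst (snd (snd t)) = ulen K h e R q))"

abbreviation bfs_rounds :: "nat \<Rightarrow> arc list" where "bfs_rounds j \<equiv> (bfs_step K h e R es ^^ j) [(r, r, 0, 0)]"

lemma reached: "reached rs v \<longleftrightarrow> v \<in> fst ` set rs"
  by (auto simp: reached_def image_iff)

lemma partial_tree_step:
  assumes "partial_tree rs"
  shows "partial_tree (bfs_step K h e R es rs)"
proof (cases "cands K h e R es rs")
  case Nil
  then show ?thesis using assms by (simp add: bfs_step_def)
next
  case (Cons c cs)
  then have b: "bfs_step K h e R es rs = c # rs" by (simp add: bfs_step_def)
  have "c \<in> set (cands K h e R es rs)" using Cons by simp
  then obtain u v q s where c: "(u, v, q) \<in> set es \<or> (v, u, q) \<in> set es" "s \<in> set rs" "fst s = u" "v \<notin> fst ` set rs"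
    "c = (v, u, ulen K h e R q, snd (snd (snd s)) + ulen K h e R q)" unfolding mem_cands reached by blast
  have "v \<in> V" using c(1) E by blast
  moreover have "rs \<noteq> []" using c(2) by auto
  moreover have "\<exists>q'. ((u, v, q') \<in> set es \<or> (v, u, q') \<in> set es) \<and> ulen K h e R q = ulen K h e R q'"
    using c(1) by blast
  moreover have "elim_order r (c # rs)" using assms c \<open>rs \<noteq> []\<close> by (auto simp: partial_tree_def)
  ultimately show ?thesis using assms unfolding b partial_tree_def c(5) by simp
qed

lemma partial_tree_rounds: "partial_tree (bfs_rounds j)"
proof (induction j)
  case (Suc j)
  then show ?case using partial_tree_step by simp
qed (use V in \<open>simp add: partial_tree_def\<close>)

text \<open>Candidates that exist now have existed in all earlier rounds, each of which added a
  vertex. As there are no more vertices than rounds, none can be left after the last round.\<close>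

lemma length_rounds: "cands K h e R es (bfs_rounds j) \<noteq> [] \<Longrightarrow> length (bfs_rounds j) = Suc j"
proof (induction j)
  case (Suc j)
  show ?case
  proof (cases "cands K h e R es (bfs_rounds j)")
    case Nil
    then have "bfs_step K h e R es (bfs_rounds j) = bfs_rounds j" unfolding bfs_step_def[of K h e R es "bfs_rounds j"] by simp
    then have "bfs_rounds (Suc j) = bfs_rounds j" by simp
    then show ?thesis using Suc.prems Nil by simp
  next
    case (Cons c cs)
    then have "bfs_step K h e R es (bfs_rounds j) = c # bfs_rounds j" unfolding bfs_step_def[of K h e R es "bfs_rounds j"] by simp
    then show ?thesis using Suc.IH Cons by simp
  qed
qed simp

lemma bfs_partial_tree: "partial_tree (bfs K h e R es r)" and bfs_V: "fst ` set (bfs K h e R es r) = V"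
proof -
  define rs where "rs = bfs K h e R es r"
  have rs: "rs = bfs_rounds (fst e)" by (simp add: rs_def bfs_def)
  have p: "partial_tree rs" unfolding rs by (rule partial_tree_rounds)
  then show "partial_tree (bfs K h e R es r)" by (simp add: rs_def)
  have w: "elim_order r rs" "fst ` set rs \<subseteq> V" using p by (auto simp: partial_tree_def)
  have nil: "cands K h e R es rs = []"
  proof (rule ccontr)
    assume "cands K h e R es rs \<noteq> []"
    then have "length rs = Suc (fst e)" unfolding rs by (rule length_rounds)
    moreover have "length rs = card (fst ` set rs)" using elim_order_distinct[OF w(1)] by (metis distinct_card length_map list.set_map)
    moreover have "card (fst ` set rs) \<le> card V" using w(2) V(1) by (intro card_mono)
    ultimately show False using V(2) by simp
  qed
  have "v \<in> fst ` set rs" if "(r, v) \<in> E\<^sup>*" for v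
    using that
  proof (induction rule: rtrancl_induct)
    case base
    show ?case by (rule elim_order_root[OF w(1)])
  next
    case (step u v)
    show ?case
    proof (rule ccontr)
      assume v: "v \<notin> fst ` set rs"
      obtain q where q: "(u, v, q) \<in> set es \<or> (v, u, q) \<in> set es" using step(2) E by blast
      obtain s where "s \<in> set rs" "fst s = u" using step(3) by auto
      then have "(v, u, ulen K h e R q, snd (snd (snd s)) + ulen K h e R q) \<in> set (cands K h e R es rs)"
        unfolding mem_cands reached using q v by blast
      then show False using nil by simp
    qed
  qed
  then show "fst ` set (bfs K h e R es r) = V" using w(2) conn unfolding rs_def[symmetric] by blast
qed

end

text \<open>An arc outside the search tree would close a cycle with a tree path between its ends.
  That path is not empty, since there are no loops, and not a single arc, since the arc is outside;
  so the cycle has length at least 3.\<close>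

lemma tree_arcs:
  assumes ut: "undirected_tree G" and w: "elim_order r rs" and V: "fst ` set rs = pverts G"
    and arcs: "\<And>t. t \<in> set rs \<Longrightarrow> fst t \<noteq> r \<Longrightarrow> (fst (snd t), fst t) \<in> parcs G \<and> par (fst t) = fst (snd t)"
    and uv: "(u, v) \<in> parcs G"
  shows "v \<noteq> r \<and> par v = u \<or> u \<noteq> r \<and> par u = v"
proof (rule ccontr)
  assume neg: "\<not> ?thesis"
  interpret pair_graph G using ut by (simp add: undirected_tree_def)
  define T where "T = {a \<in> parcs G. snd a \<noteq> r \<and> par (snd a) = fst a \<or> fst a \<noteq> r \<and> par (fst a) = snd a}"
  have A: "\<forall>y\<in>fst ` set ts. \<exists>p q. awalk r p y \<and> set p \<subseteq> T \<and> awalk y q r \<and> set q \<subseteq> T"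
    if "elim_order r ts" "set ts \<subseteq> set rs \<union> {(r, r, 0, 0)}" for ts
    using that
  proof (induction ts)
    case (Cons t ts)
    have rV: "r \<in> pverts G" using elim_order_root[OF w] V by simp
    show ?case
    proof (cases "ts = []")
      case True
      have "awalk r [] r" using rV by (simp add: awalk_Nil_iff)
      then show ?thesis using True Cons.prems(1) by (auto intro!: exI[of _ "[]"])
    next
      case False
      note w' = elim_order_Cons[OF Cons.prems(1) False]
      have tr: "fst t \<noteq> r" by (rule elim_order_neq[OF Cons.prems(1) False])
      then have "t \<in> set rs" using Cons.prems(2) by auto
      then have a: "(fst (snd t), fst t) \<in> parcs G" "par (fst t) = fst (snd t)" using arcs tr by auto
      have a': "(fst t, fst (snd t)) \<in> parcs G" using a(1) by (rule arcs_symmetric)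
      have IH: "\<forall>y\<in>fst ` set ts. \<exists>p q. awalk r p y \<and> set p \<subseteq> T \<and> awalk y q r \<and> set q \<subseteq> T"
        using Cons.IH[OF w'(1)] Cons.prems(2) by auto
      then obtain p q where pq: "awalk r p (fst (snd t))" "set p \<subseteq> T" "awalk (fst (snd t)) q r" "set q \<subseteq> T"
        using w'(3) by blast
      have "awalk (fst (snd t)) [(fst (snd t), fst t)] (fst t)" "awalk (fst t) [(fst t, fst (snd t))] (fst (snd t))"
        using a(1) a' by (auto simp: awalk_Cons_iff awalk_Nil_iff dest: in_arcsD1 in_arcsD2)
      then have n: "awalk r (p @ [(fst (snd t), fst t)]) (fst t)" "awalk (fst t) ([(fst t, fst (snd t))] @ q) r"
        using awalk_appendI[OF pq(1)] awalk_appendI[OF _ pq(3)] by blast+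
      have "(fst (snd t), fst t) \<in> T" "(fst t, fst (snd t)) \<in> T" using a a' tr by (simp_all add: T_def)
      then have "set (p @ [(fst (snd t), fst t)]) \<subseteq> T" "set ([(fst t, fst (snd t))] @ q) \<subseteq> T"
        using pq(2,4) by simp_all
      then have x: "\<exists>p q. awalk r p (fst t) \<and> set p \<subseteq> T \<and> awalk (fst t) q r \<and> set q \<subseteq> T"
        using n by blast
      have "fst ` set (t # ts) = insert (fst t) (fst ` set ts)" by simp
      then show ?thesis using x IH by (simp only: ball_simps) 
    qed
  qed simp
  have uvV: "u \<in> fst ` set rs" "v \<in> fst ` set rs" using uv V by (auto dest: in_arcsD1 in_arcsD2)
  have all: "\<forall>y\<in>fst ` set rs. \<exists>p q. awalk r p y \<and> set p \<subseteq> T \<and> awalk y q r \<and> set q \<subseteq> T"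
    by (rule A[OF w]) auto
  obtain q where q: "awalk u q r" "set q \<subseteq> T" using bspec[OF all uvV(1)] by blast
  obtain p where p: "awalk r p v" "set p \<subseteq> T" using bspec[OF all uvV(2)] by blast
  have qp: "awalk u (q @ p) v" using q(1) p(1) by (rule awalk_appendI)
  define c where "c = awalk_to_apath (q @ p)"
  have c: "apath u c v" unfolding c_def by (rule apath_awalk_to_apath[OF qp])
  have "set c \<subseteq> set (q @ p)" unfolding c_def by (rule awalk_to_apath_subset[OF qp])
  then have cT: "set c \<subseteq> T" using q(2) p(2) by auto
  have ca: "awalk u c v" "distinct (pawalk_verts u c)" using c by (auto simp: apath_def)
  have "u \<noteq> v" using pair_no_loops[OF uv] by simp
  then have c0: "c \<noteq> []" using ca(1) by (auto simp: awalk_Nil_iff)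
  have c1: "length c \<noteq> 1"
  proof
    assume "length c = 1"
    then obtain a where a: "c = [a]" by (auto simp: length_Suc_conv)
    then have "a = (u, v)" using ca(1) by (cases a) (auto simp: awalk_Cons_iff awalk_Nil_iff)
    then have "(u, v) \<in> T" using cT a by simp
    then show False using neg by (auto simp: T_def)
  qed
  have vu: "(v, u) \<in> parcs G" using uv by (rule arcs_symmetric)
  have "awalk v [(v, u)] u" using vu by (auto simp: awalk_Cons_iff awalk_Nil_iff dest: in_arcsD1 in_arcsD2)
  with ca(1) have cyc: "awalk u (c @ [(v, u)]) u" by (rule awalk_appendI)
  have ends: "last (pawalk_verts u c) = v" "hd (pawalk_verts u c) = u" using iffD1[OF awalk_conv ca(1)] by blast+
  have "pawalk_verts u (c @ [(v, u)]) = pawalk_verts u c @ [u]"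
    unfolding awalk_verts_append[OF cyc] ends(1) by simp
  moreover obtain l where l: "pawalk_verts u c = u # l" using ends(2) awalk_verts_non_Nil by (metis list.collapse)
  ultimately have "distinct (tl (pawalk_verts u (c @ [(v, u)])))" using ca(2) by simp
  then have "cycle (c @ [(v, u)])" unfolding cycle_def using cyc by blast
  moreover have "3 \<le> length (c @ [(v, u)])" using c0 c1 by (cases c) (auto simp: Suc_le_eq)
  ultimately show False using ut unfolding undirected_tree_def by blast
qed

text \<open>Connectedness is defined through the symmetric closure, which adds no arcs to a
  symmetric graph.\<close>

lemma connected_rtrancl:
  assumes "pair_graph G" "Digraph_Component.connected (with_proj G)" "u \<in> pverts G" "v \<in> pverts G"
  shows "(u, v) \<in> (parcs G)\<^sup>*"
proof -
  interpret pair_graph G by (rule assms(1))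
  have "u \<rightarrow>\<^sup>*\<^bsub>with_proj (mk_symmetric (with_proj G))\<^esub> v"
    using assms(2-4) by (auto simp: connected_def strongly_connected_def mk_symmetric_def)
  then have "(u, v) \<in> (arcs_ends (with_proj (mk_symmetric (with_proj G))))\<^sup>*" by (rule reachable_rtranclI)
  moreover have "arcs_ends (with_proj (mk_symmetric (with_proj G))) \<subseteq> parcs G"
    by (auto simp: arcs_ends_def arc_to_ends_def mk_symmetric_def intro: arcs_symmetric)
  ultimately show ?thesis using rtrancl_mono by blast
qed

section \<open>Instances\<close>

definition rat_parts :: "rat \<Rightarrow> nat \<times> nat" where
  "rat_parts q = (nat (fst (quotient_of q)), nat (snd (quotient_of q)))"

lemma rat_parts: "0 \<le> q \<Longrightarrow> snd (rat_parts q) > 0 \<and> real_of_rat q = real (fst (rat_parts q)) / real (snd (rat_parts q))"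
proof -
  assume q: "0 \<le> q"
  obtain a b where ab: "quotient_of q = (a, b)" by (cases "quotient_of q")
  have b: "b > 0" by (rule quotient_of_denom_pos[OF ab])
  have e: "q = of_int a / of_int b" by (rule quotient_of_div[OF ab])
  have a: "a \<ge> 0"
  proof (rule ccontr)
    assume "\<not> a \<ge> 0"
    then have "(of_int a :: rat) / of_int b < 0" using b by (simp add: divide_neg_pos)
    then show False using q e by simp
  qed
  have "real_of_rat q = real_of_int a / real_of_int b" unfolding e by (simp add: of_rat_divide)
  then show ?thesis using a b by (simp add: rat_parts_def ab)
qed

definition inst :: "sbr \<Rightarrow> inst" where
  "inst I = (vertex_list I, map (\<lambda>x. (fst x, fst (snd x), rat_parts (snd (snd x)))) (edge_list I), depot I, client_list I, rat_parts (regret_bound I))"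

lemma enc_list_map: "enc_list f (map g xs) = enc_list (\<lambda>x. f (g x)) xs"
  by (induction xs) auto

text \<open>The prescribed encoding of inputs coincides literally with the product encoding of
  \<open>inst\<close>, so that no program for conversion has to be composed with
  \<open>solve\<close>.\<close>

lemma enc_inst: "enc_input I k = ePair eInst un (inst I, k)"
proof -
  have q: "enc_rat q = eQ (rat_parts q)" for q by (simp add: enc_rat_def ePair_def rat_parts_def split: prod.split)
  have "enc_edge = (\<lambda>x. eEdge (fst x, fst (snd x), rat_parts (snd (snd x))))"
    by (rule ext) (simp add: enc_edge_def ePair_def q split: prod.split)
  then show ?thesis
    by (simp add: enc_input_def enc_sbr_def inst_def ePair_def q enc_list_map un_def)
qed

text \<open>Distinctness of the edges as unordered pairs makes the definite description
  unique.\<close>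

lemma edge_length_eq:
  assumes "valid_sbr I" "(u, v, l) \<in> set (edge_list I) \<or> (v, u, l) \<in> set (edge_list I)"
  shows "edge_length I (u, v) = of_rat l"
proof -
  have d: "inj_on (\<lambda>(u, v, l). {u, v}) (set (edge_list I))" using assms(1) by (auto simp: valid_sbr_def distinct_map)
  have "(THE l. (u, v, l) \<in> set (edge_list I) \<or> (v, u, l) \<in> set (edge_list I)) = l"
  proof (rule the_equality)
    fix l' assume "(u, v, l') \<in> set (edge_list I) \<or> (v, u, l') \<in> set (edge_list I)"
    then obtain a b a' b' where ab: "(a, b, l) \<in> set (edge_list I)" "(a', b', l') \<in> set (edge_list I)" "{a, b} = {a', b'}"
      using assms(2) by blast
    from inj_onD[OF d _ ab(1,2)] ab(3) show "l' = l" by simp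
  qed (rule assms(2))
  then show ?thesis by (simp add: edge_length_def)
qed

lemma solve_correct:
  assumes I: "valid_sbr I" and k: "k > 0" and m: "m > 0"
    and Ps: "length Ps = k" "sbr_routes I (of_rat (regret_bound I)) Ps"
  defines "Qs \<equiv> solve (m ^ 4) (m ^ 4 + 100 * m ^ 3) (21 * m ^ 3 + 10) (inst I, k)"
  shows "length Qs = k \<and> sbr_routes I ((1 + 100 / m) * of_rat (regret_bound I)) Qs"
proof -
  define K where "K = m ^ 4"
  define h where "h = m ^ 4 + 100 * m ^ 3"
  define e where "e = env (21 * m ^ 3 + 10) (inst I, k)"
  define es where "es = map (\<lambda>x. (fst x, fst (snd x), rat_parts (snd (snd x)))) (edge_list I)"
  define Q where "Q = rat_parts (regret_bound I)"
  define r where "r = depot I"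
  define G where "G = sbr_tree I"
  define w where "w = edge_length I"
  define rs where "rs = bfs K h e Q es r"
  define R where "R = real_of_rat (regret_bound I)"
  have e: "fst e = length (vertex_list I)" "snd e = k * (21 * m ^ 3 + 10)" by (simp_all add: e_def env_def inst_def)
  have ut: "undirected_tree G" and rV: "r \<in> pverts G" and cV: "set (client_list I) \<subseteq> pverts G"
    and dV: "distinct (vertex_list I)" and nn: "\<And>u v l. (u, v, l) \<in> set (edge_list I) \<Longrightarrow> 0 \<le> l" and R0: "0 \<le> regret_bound I"
    using I by (auto simp: valid_sbr_def G_def r_def sbr_tree_def)
  have pg: "pair_graph G" using ut by (simp add: undirected_tree_def)
  interpret g: pair_graph G by (rule pg)
  have es_iff: "(u, v, q) \<in> set es \<longleftrightarrow> (\<exists>l. (u, v, l) \<in> set (edge_list I) \<and> q = rat_parts l)" for u v q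
    unfolding es_def set_map image_iff Bex_def split_paired_Ex by auto
  have E: "parcs G = {(u, v). \<exists>q. (u, v, q) \<in> set es \<or> (v, u, q) \<in> set es}"
  proof -
    have "(\<exists>q. (u, v, q) \<in> set es \<or> (v, u, q) \<in> set es) \<longleftrightarrow>
        (\<exists>l. (u, v, l) \<in> set (edge_list I) \<or> (v, u, l) \<in> set (edge_list I))" for u v
      unfolding es_iff by blast
    then show ?thesis by (simp add: G_def sbr_tree_def)
  qed
  have eq: "w (u, v) = real (fst q) / real (snd q)" "snd q > 0"
    if uv: "(u, v, q) \<in> set es \<or> (v, u, q) \<in> set es" for u v q
  proof -
    obtain l where l: "(u, v, l) \<in> set (edge_list I) \<or> (v, u, l) \<in> set (edge_list I)" "q = rat_parts l"
      using uv unfolding es_iff by blast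
    have "0 \<le> l" using l(1) nn by blast
    from rat_parts[OF this] show "w (u, v) = real (fst q) / real (snd q)" "snd q > 0"
      using edge_length_eq[OF I l(1)] l(2) by (simp_all add: w_def)
  qed
  have cardV: "card (pverts G) = fst e" using dV by (simp add: G_def sbr_tree_def e distinct_card)
  interpret s: search K h e Q es r "pverts G" "parcs G"
  proof
    show "finite (pverts G)" by (rule g.pair_finite_verts)
    show "card (pverts G) \<le> fst e" using cardV by simp
    show "parcs G \<subseteq> pverts G \<times> pverts G" by (auto dest: g.in_arcsD1 g.in_arcsD2)
    show "(r, v) \<in> (parcs G)\<^sup>*" if "v \<in> pverts G" for v
      using connected_rtrancl[OF pg _ rV that] ut by (simp add: undirected_tree_def)
  qed (rule rV E)+
  have wf: "elim_order r rs" and Vrs: "fst ` set rs = pverts G"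
    using s.bfs_partial_tree s.bfs_V by (auto simp: rs_def s.partial_tree_def)
  have edge: "\<exists>q. ((fst (snd t), fst t, q) \<in> set es \<or> (fst t, fst (snd t), q) \<in> set es) \<and> fst (snd (snd t)) = ulen K h e Q q"
    if "t \<in> set rs" "fst t \<noteq> r" for t
    using s.bfs_partial_tree that by (simp add: rs_def s.partial_tree_def)
  define par where "par y = fst (the (map_of rs y))" for y
  define lenu where "lenu y = fst (snd (the (map_of rs y)))" for y
  define dep where "dep y = snd (snd (the (map_of rs y)))" for y
  have map_of: "map_of rs (fst t) = Some (snd t)" if "t \<in> set rs" for t
    using elim_order_distinct[OF wf] that by (simp add: map_of_eq_Some_iff)
  have sel: "par (fst t) = fst (snd t)" "lenu (fst t) = fst (snd (snd t))" "dep (fst t) = snd (snd (snd t))"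
    if "t \<in> set rs" for t using map_of[OF that] by (simp_all add: par_def lenu_def dep_def)
  have obt: "\<exists>t\<in>set rs. fst t = y" if "y \<in> pverts G" for y using that unfolding Vrs[symmetric] by auto
  have edge': "\<exists>q. ((par y, y, q) \<in> set es \<or> (y, par y, q) \<in> set es) \<and> lenu y = ulen K h e Q q"
    if "y \<in> pverts G" "y \<noteq> r" for y using obt[OF that(1)] edge sel that(2) by metis
  define D where "D y = (\<Sum>z\<in>root_path rs y. w (par z, z))" for y
  have pstep: "root_path rs y = insert y (root_path rs (par y)) \<and> y \<notin> root_path rs (par y)" if "y \<in> pverts G" "y \<noteq> r" for y
    using obt[OF that(1)] root_path_step[OF wf] sel that(2) by metis
  have Q2: "snd Q > 0" "R = real (fst Q) / real (snd Q)" using rat_parts[OF R0] by (auto simp: Q_def R_def)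
  let ?X = "real (2 * (grid e * K))"
  have "0 < 2 * (grid e * K)" using m by (simp add: K_def)
  then have X0: "?X > 0" by (simp only: of_nat_0_less_iff)
  interpret routing h e dep "client_list I" G w r par D "root_path rs" rs lenu ?X R
  proof
    show "0 < snd e" using k by (simp add: e)
    show "(par y, y) \<in> parcs G" if "y \<in> pverts G" "y \<noteq> r" for y using edge'[OF that] E by blast
    show "D r = 0" by (simp add: D_def root_path_root[OF wf])
    show "D y = D (par y) + w (par y, y)" if "y \<in> pverts G" "y \<noteq> r" for y
    proof -
      have "finite (root_path rs (par y))" using root_path_sub[OF wf] finite_subset by (metis finite_Diff finite_imageI finite_set)
      then show ?thesis using pstep[OF that] by (simp add: D_def)
    qed
    show "0 \<le> w a" if arc: "a \<in> parcs G" for a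
    proof -
      obtain u v where a: "a = (u, v)" by (cases a)
      then obtain q where "(u, v, q) \<in> set es \<or> (v, u, q) \<in> set es" using arc E by auto
      then show ?thesis using eq(1) a by simp
    qed
    show "w (u, v) = w (v, u)" for u v unfolding w_def edge_length_def by (simp add: disj_commute)
    show "v \<noteq> r \<and> par v = u \<or> u \<noteq> r \<and> par u = v" if "(u, v) \<in> parcs G" for u v
    proof (rule tree_arcs[OF ut wf Vrs _ that])
      fix t assume t: "t \<in> set rs" "fst t \<noteq> r"
      then have "fst t \<in> pverts G" unfolding Vrs[symmetric] by auto
      then show "(fst (snd t), fst t) \<in> parcs G \<and> par (fst t) = fst (snd t)" using edge'[of "fst t"] t sel(1) E by auto
    qed
    show "root_path rs r = {}" by (rule root_path_root[OF wf])
    show "root_path rs y = insert y (root_path rs (par y)) \<and> y \<notin> root_path rs (par y)" if "y \<in> pverts G" "y \<noteq> r" for y by (rule pstep[OF that])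
    show "root_path rs y \<subseteq> pverts G - {r}" for y using root_path_sub[OF wf] Vrs by simp
    show "0 \<le> R" using Q2 by simp
    show "?X * w (par y, y) \<le> lenu y * R" if "y \<in> pverts G" "y \<noteq> r" "lenu y \<le> hmax h e" for y
      using edge'[OF that(1,2)] eq ulen_real(1)[OF _ Q2(1)] that(3) unfolding Q2(2) by metis
    show "j * R < ?X * w (par y, y)" if "y \<in> pverts G" "y \<noteq> r" "j < lenu y" for y j
      using edge'[OF that(1,2)] eq ulen_real(2)[OF _ Q2(1)] that(3) unfolding Q2(2) by metis
  qed (use pg rV wf Vrs sel X0 cV in auto)
  have "links h e (client_list I) rs = [(r, dep r, tbl root_term)]"
    unfolding root_term_def by (rule links_eq[OF wf]) (simp add: sel(3))
  then have Qs: "Qs = routes_of r k [(r, dep r, tbl root_term)]"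
    by (simp add: Qs_def solve_def inst_def e_def rs_def r_def Q_def es_def K_def h_def)
  let ?good = "\<lambda>S. length S \<le> k \<and> k \<le> length S \<and> (\<forall>t\<in>set S. fst t)"
  have "bus_routes G w r (set (client_list I)) R Ps"
    using Ps(2) by (simp add: sbr_routes_def G_def w_def r_def R_def)
  from exists_state[OF Ps(1) this k m h_def] have "\<exists>S\<in>set (tbl root_term). length S = k \<and> (\<forall>t\<in>set S. fst t)"
    using e cardV by (simp add: K_def)
  then have "filter ?good (tbl root_term) \<noteq> []" by (auto simp: filter_empty_conv)
  then obtain S Ss where S: "filter ?good (tbl root_term) = S # Ss" by (meson neq_Nil_conv)
  then have "S \<in> set (filter ?good (tbl root_term))" by simp
  then have St: "S \<in> set (tbl root_term)" "length S = k" "\<forall>t\<in>set S. fst t" by auto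
  have Q': "Qs = map (\<lambda>t. snd (snd t)) S" unfolding Qs routes_of_def using S by simp
  have "bus_routes G w r (set (client_list I)) (2 * hmax h e / ?X * R) Qs" unfolding Q' by (rule state_routes[OF St(1,3)])
  moreover have "2 * hmax h e / ?X = 1 + 100 / m"
  proof -
    have f: "2 * (g * (q * M + 100 * q)) / (2 * (g * (q * M))) = 1 + 100 / M" if "g > 0" "q > 0" "M > 0" for g q M :: real
      using that by (simp add: field_simps)
    have "real m ^ 4 = real m ^ 3 * real m" by (simp add: eval_nat_numeral)
    then have x: "real (2 * hmax h e) = 2 * (real (grid e) * (real m ^ 3 * real m + 100 * real m ^ 3))"
      "?X = 2 * (real (grid e) * (real m ^ 3 * real m))"
      by (simp_all only: hmax_def h_def K_def of_nat_mult of_nat_add of_nat_power of_nat_numeral)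
    have "real (grid e) > 0" "real m ^ 3 > 0" "real m > 0" using m by simp_all
    from f[OF this] show ?thesis unfolding x .
  qed
  ultimately have "sbr_routes I ((1 + 100 / m) * of_rat (regret_bound I)) Qs"
    unfolding sbr_routes_def G_def w_def r_def R_def by (simp only:)
  then show ?thesis using St(2) Q' by simp
qed

theorem theorem7:
  fixes \<epsilon> :: real
  assumes "\<epsilon> > 0"
  shows "\<exists>A :: program.
    polynomial_time_on A {enc_input I k | I k. valid_sbr I \<and> k > 0} \<and>
    (\<forall>I k. valid_sbr I \<and> k > 0 \<and>
        (\<exists>Ps. length Ps = k \<and> sbr_routes I (of_rat (regret_bound I)) Ps) \<longrightarrow>
        (\<exists>Qs. outputs A (enc_input I k) (enc_routes Qs) \<and> length Qs = k \<and>
           sbr_routes I ((1 + \<epsilon>) * of_rat (regret_bound I)) Qs))"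
proof -
  \<comment> \<open>The relative loss is \<open>100 / m\<close>; the successor keeps
    \<open>m\<close> positive.\<close>
  define m where "m = Suc (nat \<lceil>100 / \<epsilon>\<rceil>)"
  have m: "m > 0" by (simp add: m_def)
  have "100 / \<epsilon> \<le> m" unfolding m_def by linarith
  then have me: "100 / m \<le> \<epsilon>" using assms m by (simp add: field_simps)
  let ?f = "solve (m ^ 4) (m ^ 4 + 100 * m ^ 3) (21 * m ^ 3 + 10)"
  obtain p d where p: "\<And>x. \<exists>t. exec p (ePair eInst un x) (eList eVs (?f x)) t \<and> t \<le> (size (ePair eInst un x) + 2) ^ d"
    using ptf_solve[of "m ^ 4" "m ^ 4 + 100 * m ^ 3" "21 * m ^ 3 + 10"] unfolding ptf_def by blast
  show ?thesis
  proof (rule exI[of _ p], intro conjI allI impI)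
    \<comment> \<open>The bound \<open>(s + 2) ^ d\<close> in \<open>ptf\<close> as a polynomial in
      \<open>s\<close>.\<close>
    have "poly ([:2, 1:] ^ d) s = (s + 2) ^ d" for s :: nat by (simp add: poly_power add.commute)
    then have "\<exists>y t. exec p x y t \<and> t \<le> poly ([:2, 1:] ^ d) (size x)" if x: "x \<in> {enc_input I k | I k. valid_sbr I \<and> k > 0}" for x
    proof -
      obtain I k where "x = enc_input I k" using x by blast
      then have "x = ePair eInst un (inst I, k)" by (simp only: enc_inst)
      then show ?thesis using p[of "(inst I, k)"] \<open>\<And>s. poly ([:2, 1:] ^ d) s = (s + 2) ^ d\<close> by auto
    qed
    then show "polynomial_time_on p {enc_input I k | I k. valid_sbr I \<and> k > 0}"
      unfolding polynomial_time_on_def by blast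
  next
    fix I k
    assume "valid_sbr I \<and> k > 0 \<and> (\<exists>Ps. length Ps = k \<and> sbr_routes I (of_rat (regret_bound I)) Ps)"
    then obtain Ps where I: "valid_sbr I" "k > 0" and Ps: "length Ps = k" "sbr_routes I (of_rat (regret_bound I)) Ps" by blast
    have s: "length (?f (inst I, k)) = k" "sbr_routes I ((1 + 100 / m) * of_rat (regret_bound I)) (?f (inst I, k))"
      using solve_correct[OF I m Ps] by auto
    show "\<exists>Qs. outputs p (enc_input I k) (enc_routes Qs) \<and> length Qs = k \<and> sbr_routes I ((1 + \<epsilon>) * of_rat (regret_bound I)) Qs"
    proof (intro exI conjI)
      show "outputs p (enc_input I k) (enc_routes (?f (inst I, k)))"
        unfolding outputs_def enc_inst enc_routes_def using p[of "(inst I, k)"] by blast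
      have "0 \<le> real_of_rat (regret_bound I)" using I(1) by (simp add: valid_sbr_def)
      then have "(1 + 100 / m) * real_of_rat (regret_bound I) \<le> (1 + \<epsilon>) * real_of_rat (regret_bound I)"
        using me by (intro mult_right_mono) auto
      then show "sbr_routes I ((1 + \<epsilon>) * of_rat (regret_bound I)) (?f (inst I, k))"
        using s(2) unfolding sbr_routes_def bus_routes_def by force
    qed (rule s(1))
  qed
qed

end
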